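(* Let $X\in\mathbb R^p$ and $Y\in\mathbb R^q$ be random vectors with $\mathbb E[X]=0$ and $\mathbb E[Y]=0$. Assume that $\mathbb E[\|X\|^{4+4\tau}]+\mathbb E[\|Y\|^{4+4\tau}]<\infty$ for some constant $0<\tau\le 1/2$ and that, as $n\to\infty$ and $p+q\to\infty$, $$\frac{n^{-\tau}L_{x,\tau}L_{y,\tau}}{\big(\mathbb E[(X_1^TX_2)^2]\,\mathbb E[(Y_1^TY_2)^2]\big)^{1+\tau}}\to 0 .$$ In addition, assume that $E_x\to0$ if $p\to\infty$, and $E_y\to 0$ if $q\to\infty$. Then under the independence of $X$ and $Y$, $T_n$ converges in distribution to $N(0,1)$.
   Context: $\|\cdot\|$ is the Euclidean norm, $n$ is the sample size, and $(X_1,Y_1),(X_2,Y_2),\dots$ are i.i.d. copies of $(X,Y)$. $\Sigma_x=\mathbb E[XX^T]$, $\Sigma_y=\mathbb E[YY^T]$. $B_X=\mathbb E[\|X_1-X_2\|^2]=2\,\mathbb E[\|X\|^2]$, $B_Y=\mathbb E[\|Y_1-Y_2\|^2]=2\,\mathbb E[\|Y\|^2]$; $L_{x,\tau}=\mathbb E\big(\big|\|X\|^2-\mathbb E\|X\|^2\big|^{2+2\tau}\big)+\mathbb E\big(|X_1^TX_2|^{2+2\tau}\big)$, $L_{y,\tau}=\mathbb E\big(\big|\|Y\|^2-\mathbb E\|Y\|^2\big|^{2+2\tau}\big)+\mathbb E\big(|Y_1^TY_2|^{2+2\tau}\big)$; $$E_x=\frac{\mathbb E[(X_1^T\Sigma_xX_2)^2]+B_X^{-2\tau}L_{x,\tau}^{(2+\tau)/(1+\tau)}}{(\mathbb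 E[(X_1^TX_2)^2])^2},\qquad E_y=\frac{\mathbb E[(Y_1^T\Sigma_yY_2)^2]+B_Y^{-2\tau}L_{y,\tau}^{(2+\tau)/(1+\tau)}}{(\mathbb E[(Y_1^TY_2)^2])^2}.$$ Sample quantities, computed from $(X_1,Y_1),\dots,(X_n,Y_n)$: with $a_{k,l}=\|X_k-X_l\|$, $b_{k,l}=\|Y_k-Y_l\|$, put $A^*_{k,l}=a_{k,l}-\frac1{n-2}\sum_{i=1}^n a_{i,l}-\frac1{n-2}\sum_{j=1}^n a_{k,j}+\frac{1}{(n-1)(n-2)}\sum_{i,j=1}^n a_{i,j}$, and $B^*_{k,l}$ in the same way from $b_{k,l}$. Set $\mathcal V_n^*(X,Y)=\frac1{n(n-3)}\sum_{k\ne l}A^*_{k,l}B^*_{k,l}$, $\mathcal V_n^*(X)=\mathcal V_n^*(X,X)$, $\mathcal V_n^*(Y)=\mathcal V_n^*(Y,Y)$. $\mathcal R_n^*(X,Y)=\mathcal V_n^*(X,Y)/\sqrt{\mathcal V_n^*(X)\mathcal V_n^*(Y)}$ if $\mathcal V_n^*(X)\mathcal V_n^*(Y)>0$ and $0$ otherwise. The rescaled (bias-corrected) distance correlation statistic is $T_n=\sqrt{n(n-1)/2}\;\mathcal R_n^*(X,Y)$. *)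

theory Defs
  imports "HOL-Probability.Probability"
begin

(* The dimensions vary along the asymptotic regime, so a vector of R^d is a function
   nat => real of which only the coordinates i < d matter, and R^d with its Borel
   sigma-algebra is the finite product space over {..<d}. *)
abbreviation euclid :: "nat \<Rightarrow> (nat \<Rightarrow> real) measure" where
  "euclid d \<equiv> \<Pi>\<^sub>M i\<in>{..<d}. borel"

definition vnorm :: "nat \<Rightarrow> (nat \<Rightarrow> real) \<Rightarrow> real" where
  "vnorm d x = L2_set x {..<d}"

definition vinner :: "nat \<Rightarrow> (nat \<Rightarrow> real) \<Rightarrow> (nat \<Rightarrow> real) \<Rightarrow> real" where
  "vinner d x y = (\<Sum>i<d. x i * y i)"

definition vdist :: "nat \<Rightarrow> (nat \<Rightarrow> real) \<Rightarrow> (nat \<Rightarrow> real) \<Rightarrow> real" where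
  "vdist d x y = vnorm d (\<lambda>i. x i - y i)"

(* Samples are numbered from 1: Zs 1, Zs 2, ... are i.i.d. copies of Z. *)
definition iid_copies ::
  "'a measure \<Rightarrow> 'b measure \<Rightarrow> ('a \<Rightarrow> 'b) \<Rightarrow> (nat \<Rightarrow> 'a \<Rightarrow> 'b) \<Rightarrow> bool" where
  "iid_copies M N Z Zs \<longleftrightarrow>
     prob_space.indep_vars M (\<lambda>_. N) Zs {1..} \<and>
     (\<forall>i\<ge>1. distr M N (Zs i) = distr M N Z)"

(* In the population quantities X1 and X2 stand for two independent copies of X. *)

definition Sigma_mat :: "'a measure \<Rightarrow> ('a \<Rightarrow> nat \<Rightarrow> real) \<Rightarrow> nat \<Rightarrow> nat \<Rightarrow> real" where
  "Sigma_mat M X i j = (\<integral>\<omega>. X \<omega> i * X \<omega> j \<partial>M)"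

definition B_dist ::
  "'a measure \<Rightarrow> nat \<Rightarrow> ('a \<Rightarrow> nat \<Rightarrow> real) \<Rightarrow> ('a \<Rightarrow> nat \<Rightarrow> real) \<Rightarrow> real" where
  "B_dist M d X1 X2 = (\<integral>\<omega>. (vdist d (X1 \<omega>) (X2 \<omega>))\<^sup>2 \<partial>M)"

definition L_moment ::
  "'a measure \<Rightarrow> nat \<Rightarrow> real \<Rightarrow> ('a \<Rightarrow> nat \<Rightarrow> real) \<Rightarrow>
     ('a \<Rightarrow> nat \<Rightarrow> real) \<Rightarrow> ('a \<Rightarrow> nat \<Rightarrow> real) \<Rightarrow> real" where
  "L_moment M d \<tau> X X1 X2 =
     (\<integral>\<omega>. \<bar>(vnorm d (X \<omega>))\<^sup>2 - (\<integral>\<omega>'. (vnorm d (X \<omega>'))\<^sup>2 \<partial>M)\<bar> powr (2 + 2 * \<tau>) \<partial>M)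
     + (\<integral>\<omega>. \<bar>vinner d (X1 \<omega>) (X2 \<omega>)\<bar> powr (2 + 2 * \<tau>) \<partial>M)"

definition inner_sq_moment ::
  "'a measure \<Rightarrow> nat \<Rightarrow> ('a \<Rightarrow> nat \<Rightarrow> real) \<Rightarrow> ('a \<Rightarrow> nat \<Rightarrow> real) \<Rightarrow> real" where
  "inner_sq_moment M d X1 X2 = (\<integral>\<omega>. (vinner d (X1 \<omega>) (X2 \<omega>))\<^sup>2 \<partial>M)"

definition Sigma_sq_moment ::
  "'a measure \<Rightarrow> nat \<Rightarrow> ('a \<Rightarrow> nat \<Rightarrow> real) \<Rightarrow>
     ('a \<Rightarrow> nat \<Rightarrow> real) \<Rightarrow> ('a \<Rightarrow> nat \<Rightarrow> real) \<Rightarrow> real" where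
  "Sigma_sq_moment M d X X1 X2 =
     (\<integral>\<omega>. (\<Sum>i<d. \<Sum>j<d. X1 \<omega> i * Sigma_mat M X i j * X2 \<omega> j)\<^sup>2 \<partial>M)"

definition E_ratio ::
  "'a measure \<Rightarrow> nat \<Rightarrow> real \<Rightarrow> ('a \<Rightarrow> nat \<Rightarrow> real) \<Rightarrow>
     ('a \<Rightarrow> nat \<Rightarrow> real) \<Rightarrow> ('a \<Rightarrow> nat \<Rightarrow> real) \<Rightarrow> real" where
  "E_ratio M d \<tau> X X1 X2 =
     (Sigma_sq_moment M d X X1 X2
       + B_dist M d X1 X2 powr (- 2 * \<tau>)
         * L_moment M d \<tau> X X1 X2 powr ((2 + \<tau>) / (1 + \<tau>)))
     / (inner_sq_moment M d X1 X2)\<^sup>2"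

definition U_center :: "nat \<Rightarrow> (nat \<Rightarrow> nat \<Rightarrow> real) \<Rightarrow> nat \<Rightarrow> nat \<Rightarrow> real" where
  "U_center n a k l =
     a k l
     - (\<Sum>i=1..n. a i l) / (real n - 2)
     - (\<Sum>j=1..n. a k j) / (real n - 2)
     + (\<Sum>i=1..n. \<Sum>j=1..n. a i j) / ((real n - 1) * (real n - 2))"

definition V_star ::
  "nat \<Rightarrow> (nat \<Rightarrow> nat \<Rightarrow> real) \<Rightarrow> (nat \<Rightarrow> nat \<Rightarrow> real) \<Rightarrow> real" where
  "V_star n a b =
     (\<Sum>k=1..n. \<Sum>l\<in>{1..n} - {k}. U_center n a k l * U_center n b k l)
     / (real n * (real n - 3))"

definition R_star ::
  "nat \<Rightarrow> (nat \<Rightarrow> nat \<Rightarrow> real) \<Rightarrow> (nat \<Rightarrow> nat \<Rightarrow> real) \<Rightarrow> real" where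
  "R_star n a b =
     (if V_star n a a * V_star n b b > 0
      then V_star n a b / sqrt (V_star n a a * V_star n b b) else 0)"

definition T_stat ::
  "nat \<Rightarrow> nat \<Rightarrow> nat \<Rightarrow> (nat \<Rightarrow> nat \<Rightarrow> real) \<Rightarrow> (nat \<Rightarrow> nat \<Rightarrow> real) \<Rightarrow> real" where
  "T_stat n p q x y =
     sqrt (real n * (real n - 1) / 2)
     * R_star n (\<lambda>k l. vdist p (x k) (x l)) (\<lambda>k l. vdist q (y k) (y l))"

end

(* The U-centred statistic does not change when each distance matrix is replaced by the matrix of the
   doubly centred kernel K, which is degenerate. Up to an O(1/sqrt n) remainder the numerator is then a
   sum over k > l of products KX * KY, a martingale in the larger index; its characteristic function is
   compared with the Gaussian one through the conditional variances, which are controlled by the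
   squared norm of the kernel composed with itself, and the conditional moments of order 2 + 2 tau.
   The denominator concentrates by a truncated weak law. All errors depend only on the moment ratios
   E|K|^(2+2tau) / (E K^2)^(1+tau) of X and Y and on the ratios of the composed kernels.
   These ratios are related to the hypotheses through a lower bound for E K^2: writing |z| as an
   average of Gaussian kernels and expanding exp (2 l <x, y>) into positive semidefinite kernels gives
   - E |X1 - X2| <X1, X2> >= c E <X1, X2>^2 / R, up to truncation of the norms. In high dimension
   K is close to - <x, y> / sqrt B, so the composed kernel is governed by Sigma and the ratio E; in
   bounded dimension all quantities are comparable. Passing to subsequences covers the general case. *)

theory Submission
  imports Defs
begin

section \<open>Moment inequalities\<close>

text \<open>The hypotheses speak of moments of <x, y>, while every error is relative to E K^2, which
  centring might make much smaller than E <x, y>^2 / B. Testing K against - <x, y> rules this out: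
  the terms removed by centring integrate to zero against <x, y>, and all terms of the Gaussian
  expansion have the same sign, so nothing cancels. If a dimension stays bounded, there is no
  hypothesis on its E and the law may still vary with the index. The truncation level is then built
  from the moment of order 4 + 4 \<tau>, in such a way that it drops out of the final ratio, and the
  constants depend on d and \<tau> alone. This suffices because the composed-kernel ratio of the
  product kernel is the product of the two ratios, each at most 1: one diverging dimension makes it
  small. K has moments of order 2 + 2 \<tau> only, so its conditional variances need not have a
  second moment; they are truncated before a variance is computed. Conditioning is expressed by
  resampling one coordinate of a product space.\<close>

lemma power2_eq_abs_powr: "x\<^sup>2 = \<bar>x\<bar> powr 2" for x :: real
  by simp

lemma powr_power2_eq: "(x\<^sup>2) powr a = \<bar>x\<bar> powr (2 * a)" for x a :: real
  by (metis power2_eq_abs_powr powr_powr)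

lemma abs_powr_2_plus: "\<bar>x\<bar> powr (2 + a) = \<bar>x\<bar> powr a * x\<^sup>2" for x a :: real
  by (cases "x = 0") (simp_all add: powr_add)

text \<open>Weighted arithmetic-geometric mean with weights \<open>a\<close> and
  \<open>1 - a\<close> at the points \<open>1 + x\<close> and \<open>1\<close>. Young's inequality
  is used at positive points, hence the separate case \<open>x = -1\<close>.\<close>

lemma powr_le_tangent:
  fixes x a :: real
  assumes "0 \<le> a" "a \<le> 1" "-1 \<le> x"
  shows "(1 + x) powr a \<le> 1 + a * x"
proof (cases "x = -1")
  case True
  then show ?thesis using assms by simp
next
  case False
  then show ?thesis
    using Youngs_inequality_0[of a "1 - a" "1 + x" 1] assms by (simp add: algebra_simps)
qed

text \<open>Bernoulli's inequality for the inverse exponent \<open>1 / a\<close> at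
  \<open>y = (x / c) powr a\<close>, solved for \<open>y\<close>. Integrated with \<open>c\<close>
  the mean of \<open>x\<close>, it becomes Jensen's inequality.\<close>

lemma powr_ge_tangent:
  fixes x c a :: real
  assumes "1 \<le> a" "0 \<le> x" "0 < c"
  shows "c powr a + a * c powr (a - 1) * (x - c) \<le> x powr a"
proof -
  define y where "y = (x / c) powr a"
  have "(1 + (y - 1)) powr (1 / a) \<le> 1 + (1 / a) * (y - 1)"
    using assms by (intro powr_le_tangent) (auto simp: y_def)
  moreover have "y powr (1 / a) = x / c"
    using assms by (auto simp: y_def powr_powr)
  ultimately have "x / c \<le> 1 + (y - 1) / a" by simp
  then have "a * (x / c - 1) \<le> y - 1"
    using assms by (simp add: field_simps)
  then have "c powr a * (1 + a * (x / c - 1)) \<le> c powr a * y"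
    by (intro mult_left_mono) auto
  moreover have "c powr a * y = x powr a"
    using assms by (simp add: y_def powr_divide)
  moreover have "c powr a * (1 + a * (x / c - 1)) = c powr a + a * c powr (a - 1) * (x - c)"
    using assms by (simp add: powr_diff field_simps)
  ultimately show ?thesis by simp
qed

lemma (in prob_space) powr_expectation_le:
  fixes f :: "'a \<Rightarrow> real"
  assumes "1 \<le> a" "\<And>x. x \<in> space M \<Longrightarrow> 0 \<le> f x"
    and "integrable M f" "integrable M (\<lambda>x. f x powr a)"
  shows "(\<integral>x. f x \<partial>M) powr a \<le> (\<integral>x. f x powr a \<partial>M)"
proof -
  define c where "c = (\<integral>x. f x \<partial>M)"
  have "0 \<le> c" unfolding c_def using assms by (intro Bochner_Integration.integral_nonneg) auto
  show ?thesis
  proof (cases "c = 0")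
    case True
    then show ?thesis by (simp add: c_def)
  next
    case False
    then have c: "0 < c" using \<open>0 \<le> c\<close> by simp
    have "c powr a = (\<integral>x. c powr a + a * c powr (a - 1) * (f x - c) \<partial>M)"
      using assms by (simp add: prob_space c_def)
    also have "\<dots> \<le> (\<integral>x. f x powr a \<partial>M)"
      using assms c by (intro integral_mono powr_ge_tangent) auto
    finally show ?thesis by (simp add: c_def)
  qed
qed

text \<open>Two remainder bounds are available, a cubic and a quadratic one. The cubic one lies
  below every power of order up to 3 when \<open>\<bar>x\<bar> \<le> 1\<close>, the quadratic one
  below every power of order at least 2 otherwise.\<close>

lemma iexp_taylor2_powr:
  fixes x r :: real
  assumes "2 \<le> r" "r \<le> 3"
  shows "cmod (iexp x - (1 + \<i> * x - x\<^sup>2 / 2)) \<le> \<bar>x\<bar> powr r"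
proof -
  have eq: "(\<Sum>k\<le>2. (\<i> * complex_of_real x) ^ k / fact k) = 1 + \<i> * x - x\<^sup>2 / 2"
  proof -
    have "\<i> * complex_of_real x * (\<i> * x) = (\<i> * \<i>) * (complex_of_real x * x)" by (simp only: mult_ac)
    then show ?thesis by (simp add: numeral_2_eq_2 power2_eq_square)
  qed
  show ?thesis
  proof (cases "\<bar>x\<bar> \<le> 1")
    case True
    show ?thesis
    proof (cases "x = 0")
      case False
      have "\<bar>x\<bar> ^ 3 / 6 \<le> \<bar>x\<bar> powr 3"
        using False by (simp add: powr_realpow[of "\<bar>x\<bar>" 3, simplified])
      also have "\<dots> \<le> \<bar>x\<bar> powr r" using True assms False by (intro powr_mono') auto
      finally show ?thesis
        using iexp_approx1[of x 2] unfolding eq by (simp add: fact_numeral)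
    qed simp
  next
    case False
    have "\<bar>x\<bar> ^ 2 \<le> \<bar>x\<bar> powr r"
      using False assms powr_mono[of 2 r "\<bar>x\<bar>"] by (simp add: powr_realpow[of "\<bar>x\<bar>" 2, simplified])
    then show ?thesis
      using iexp_approx2[of x 2] unfolding eq by simp
  qed
qed

text \<open>For \<open>u \<le> 1\<close> the identity
  \<open>(1 + u) * (1 - u + u^2) = 1 + u^3\<close> gives \<open>exp (- u) \<le> 1 - u + u^2\<close>;
  beyond 1 the trivial bound \<open>u\<close> is enough.\<close>

lemma exp_neg_taylor1_powr:
  fixes u a :: real
  assumes "0 \<le> u" "1 \<le> a" "a \<le> 2"
  shows "\<bar>exp (- u) - 1 + u\<bar> \<le> u powr a"
proof (cases "u = 0")
  case False
  then have u: "0 < u" using assms by simp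
  have ge: "0 \<le> exp (- u) - 1 + u" using exp_ge_add_one_self[of "-u"] by simp
  have le1: "exp (- u) - 1 + u \<le> u" using u by simp
  show ?thesis
  proof (cases "u \<le> 1")
    case True
    have "exp u * (1 - u + u\<^sup>2) \<ge> (1 + u) * (1 - u + u\<^sup>2)"
    proof (rule mult_right_mono)
      show "1 + u \<le> exp u" by (rule exp_ge_add_one_self)
      show "0 \<le> 1 - u + u\<^sup>2" using True by simp
    qed
    moreover have "(1 + u) * (1 - u + u\<^sup>2) \<ge> 1" using u by (simp add: algebra_simps power2_eq_square)
    ultimately have "exp (- u) \<le> 1 - u + u\<^sup>2" by (simp add: exp_minus field_simps)
    moreover have "u\<^sup>2 \<le> u powr a"
      using powr_mono'[of a 2 u] u True assms by (simp add: powr_realpow[of u 2, simplified])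
    ultimately show ?thesis using ge by linarith
  next
    case False
    then have "u \<le> u powr a" using powr_mono[of 1 a u] assms by simp
    then show ?thesis using ge le1 by linarith
  qed
qed simp

text \<open>Young's inequality with a free parameter: one of the two terms on the right dominates,
  according to which of \<open>b^2\<close> and \<open>e * s^2\<close> is larger. Later
  \<open>e\<close> is tuned to the number of summands.\<close>

lemma powr_mult_sq_le:
  fixes s b e \<tau> :: real
  assumes "0 \<le> \<tau>" "0 < e"
  shows "\<bar>s\<bar> powr (2 * \<tau>) * b\<^sup>2 \<le> e * \<bar>s\<bar> powr (2 + 2 * \<tau>) + e powr (- \<tau>) * \<bar>b\<bar> powr (2 + 2 * \<tau>)"
proof -
  note sq = abs_powr_2_plus[of _ "2 * \<tau>"]
  show ?thesis
  proof (cases "b\<^sup>2 \<le> e * s\<^sup>2")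
    case True
    then have "\<bar>s\<bar> powr (2 * \<tau>) * b\<^sup>2 \<le> \<bar>s\<bar> powr (2 * \<tau>) * (e * s\<^sup>2)"
      by (intro mult_left_mono) auto
    also have "\<dots> \<le> e * \<bar>s\<bar> powr (2 + 2 * \<tau>) + e powr (- \<tau>) * \<bar>b\<bar> powr (2 + 2 * \<tau>)"
      unfolding sq using assms by (simp add: mult.left_commute)
    finally show ?thesis .
  next
    case False
    then have "s\<^sup>2 \<le> b\<^sup>2 / e" using assms by (simp add: field_simps)
    then have "(s\<^sup>2) powr \<tau> \<le> (b\<^sup>2 / e) powr \<tau>" using assms by (intro powr_mono2) auto
    then have "\<bar>s\<bar> powr (2 * \<tau>) \<le> e powr (- \<tau>) * \<bar>b\<bar> powr (2 * \<tau>)"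
      using assms by (simp add: powr_power2_eq powr_divide powr_minus field_simps)
    then have "\<bar>s\<bar> powr (2 * \<tau>) * b\<^sup>2 \<le> e powr (- \<tau>) * \<bar>b\<bar> powr (2 * \<tau>) * b\<^sup>2"
      by (intro mult_right_mono) auto
    also have "\<dots> \<le> e * \<bar>s\<bar> powr (2 + 2 * \<tau>) + e powr (- \<tau>) * \<bar>b\<bar> powr (2 + 2 * \<tau>)"
      unfolding sq using assms by (simp add: mult.assoc)
    finally show ?thesis .
  qed
qed

text \<open>A one-step expansion whose linear term has mean zero as soon as \<open>b\<close> is
  centred given \<open>a\<close>; this is what makes the moments of row sums grow at the martingale
  rate. The constant 12 covers both regimes: \<open>3/2 + 9/2\<close> if \<open>b\<close> is the
  smaller one, \<open>8 + 3\<close> otherwise.\<close>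

lemma abs_add_powr_le:
  fixes a b \<tau> :: real
  assumes \<tau>: "0 < \<tau>" "\<tau> \<le> 1 / 2"
  shows "\<bar>a + b\<bar> powr (2 + 2 * \<tau>)
    \<le> \<bar>a\<bar> powr (2 + 2 * \<tau>) + 2 * (1 + \<tau>) * (\<bar>a\<bar> powr (2 * \<tau>) * a * b)
      + 12 * (\<bar>a\<bar> powr (2 * \<tau>) * b\<^sup>2 + \<bar>b\<bar> powr (2 + 2 * \<tau>))"
proof -
  note sq = abs_powr_2_plus[of _ "2 * \<tau>"]
  note sq' = powr_power2_eq[of _ \<tau>]
  show ?thesis
  proof (cases "\<bar>b\<bar> \<le> \<bar>a\<bar> \<and> a \<noteq> 0")
    case True
    define x where "x = b / a"
    have x: "\<bar>x\<bar> \<le> 1" using True by (simp add: x_def abs_divide divide_le_eq_1)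
    have ab: "a + b = a * (1 + x)" "b = a * x" using True by (auto simp: x_def field_simps)
    \<comment> \<open>With \<open>1 + y\<close> equal to the square of \<open>1 + x\<close>, the
      power of order \<open>2 * \<tau>\<close> becomes \<open>(1 + y) powr \<tau>\<close>, to which
      Bernoulli's inequality applies.\<close>
    define y where "y = 2 * x + x\<^sup>2"
    have y1: "1 + y = (1 + x)\<^sup>2" by (simp add: y_def power2_eq_square algebra_simps)
    have "\<bar>1 + x\<bar> powr (2 * \<tau>) = (1 + y) powr \<tau>" by (simp add: y1 sq')
    moreover have "-1 \<le> y" using y1 zero_le_power2[of "1 + x"] by linarith
    ultimately have "\<bar>1 + x\<bar> powr (2 * \<tau>) \<le> 1 + \<tau> * y"
      using \<tau> powr_le_tangent[of \<tau> y] by simp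
    from mult_right_mono[OF this zero_le_power2[of "1 + x"]]
    have "\<bar>1 + x\<bar> powr (2 * \<tau>) * (1 + x)\<^sup>2 \<le> (1 + \<tau> * y) * (1 + y)"
      unfolding y1 .
    also have "\<dots> = 1 + 2 * (1 + \<tau>) * x + (1 + \<tau>) * x\<^sup>2 + \<tau> * y\<^sup>2"
      by (simp add: y_def power2_eq_square algebra_simps)
    also have "\<dots> \<le> 1 + 2 * (1 + \<tau>) * x + 12 * x\<^sup>2"
    proof -
      have "\<bar>2 + x\<bar> \<le> 3" using x by linarith
      then have "(2 + x)\<^sup>2 \<le> 3\<^sup>2" by (intro power2_le_iff_abs_le[THEN iffD2]) auto
      then have "y\<^sup>2 \<le> 9 * x\<^sup>2"
        using mult_right_mono[of "(2 + x)\<^sup>2" 9 "x\<^sup>2"] by (simp add: y_def power2_eq_square algebra_simps)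
      then have "\<tau> * y\<^sup>2 \<le> (1/2) * (9 * x\<^sup>2)" using \<tau> by (intro mult_mono) auto
      moreover have "(1 + \<tau>) * x\<^sup>2 \<le> (3/2) * x\<^sup>2" using \<tau> by (intro mult_right_mono) auto
      ultimately show ?thesis using zero_le_power2[of x] by linarith
    qed
    finally have le: "\<bar>a\<bar> powr (2 * \<tau>) * a\<^sup>2 * (\<bar>1 + x\<bar> powr (2 * \<tau>) * (1 + x)\<^sup>2)
       \<le> \<bar>a\<bar> powr (2 * \<tau>) * a\<^sup>2 * (1 + 2 * (1 + \<tau>) * x + 12 * x\<^sup>2)"
      by (intro mult_left_mono) auto
    have "\<bar>a + b\<bar> powr (2 + 2 * \<tau>) = \<bar>a\<bar> powr (2 * \<tau>) * a\<^sup>2 * (\<bar>1 + x\<bar> powr (2 * \<tau>) * (1 + x)\<^sup>2)"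
      unfolding sq ab(1) abs_mult powr_mult power_mult_distrib by (simp add: mult_ac)
    also note le
    also have "\<bar>a\<bar> powr (2 * \<tau>) * a\<^sup>2 * (1 + 2 * (1 + \<tau>) * x + 12 * x\<^sup>2)
      = \<bar>a\<bar> powr (2 + 2 * \<tau>) + 2 * (1 + \<tau>) * (\<bar>a\<bar> powr (2 * \<tau>) * a * b) + 12 * (\<bar>a\<bar> powr (2 * \<tau>) * b\<^sup>2)"
      unfolding sq ab(2) by algebra
    also have "\<dots> \<le> \<bar>a\<bar> powr (2 + 2 * \<tau>) + 2 * (1 + \<tau>) * (\<bar>a\<bar> powr (2 * \<tau>) * a * b)
      + 12 * (\<bar>a\<bar> powr (2 * \<tau>) * b\<^sup>2 + \<bar>b\<bar> powr (2 + 2 * \<tau>))"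
      by (intro add_left_mono mult_left_mono) auto
    finally show ?thesis .
  next
    case False
    then have ab: "\<bar>a\<bar> \<le> \<bar>b\<bar>" by auto
    define B where "B = \<bar>b\<bar> powr (2 + 2 * \<tau>)"
    have B0: "0 \<le> B" by (simp add: B_def)
    have "\<bar>a + b\<bar> \<le> 2 * \<bar>b\<bar>" using ab by linarith
    then have "\<bar>a + b\<bar> powr (2 + 2 * \<tau>) \<le> (2 * \<bar>b\<bar>) powr (2 + 2 * \<tau>)"
      using \<tau> by (intro powr_mono2) auto
    also have "\<dots> = 2 powr (2 + 2 * \<tau>) * B" by (simp add: powr_mult B_def)
    also have "\<dots> \<le> 2 powr 3 * B" using \<tau> B0 by (intro mult_right_mono powr_mono) auto
    finally have 1: "\<bar>a + b\<bar> powr (2 + 2 * \<tau>) \<le> 8 * B" by simp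
    have "\<bar>a\<bar> powr (2 * \<tau>) * \<bar>a\<bar> * \<bar>b\<bar> \<le> \<bar>b\<bar> powr (2 * \<tau>) * \<bar>b\<bar> * \<bar>b\<bar>"
      using ab \<tau> by (intro mult_mono powr_mono2) auto
    also have "\<dots> = B" unfolding B_def sq by (simp add: power2_eq_square)
    finally have "\<bar>\<bar>a\<bar> powr (2 * \<tau>) * a * b\<bar> \<le> B" by (simp add: abs_mult)
    then have "- B \<le> \<bar>a\<bar> powr (2 * \<tau>) * a * b" by linarith
    then have "2 * (1 + \<tau>) * - B \<le> 2 * (1 + \<tau>) * (\<bar>a\<bar> powr (2 * \<tau>) * a * b)"
      using \<tau> by (intro mult_left_mono) auto
    moreover have "2 * (1 + \<tau>) * B \<le> 3 * B" using \<tau> B0 by (intro mult_right_mono) auto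
    moreover have "0 \<le> \<bar>a\<bar> powr (2 + 2 * \<tau>)" "0 \<le> \<bar>a\<bar> powr (2 * \<tau>) * b\<^sup>2" by auto
    ultimately show ?thesis using 1 B0 unfolding B_def[symmetric] by argo
  qed
qed

lemma abs_add_powr_le_sum:
  fixes a b r :: real
  assumes "0 \<le> r"
  shows "\<bar>a + b\<bar> powr r \<le> 2 powr r * (\<bar>a\<bar> powr r + \<bar>b\<bar> powr r)"
proof -
  define m where "m = max \<bar>a\<bar> \<bar>b\<bar>"
  have "\<bar>a + b\<bar> powr r \<le> (2 * m) powr r"
    using assms by (intro powr_mono2) (auto simp: m_def)
  also have "\<dots> = 2 powr r * m powr r" by (simp add: powr_mult m_def)
  also have "m powr r \<le> \<bar>a\<bar> powr r + \<bar>b\<bar> powr r" by (auto simp: m_def max_def)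
  finally show ?thesis by simp
qed

section \<open>Integrability across exponents and the Cauchy-Schwarz inequality\<close>

lemma integrable_powr_add:
  fixes f g :: "'a \<Rightarrow> real"
  assumes "0 \<le> r" "f \<in> borel_measurable M" "g \<in> borel_measurable M"
    and "integrable M (\<lambda>x. \<bar>f x\<bar> powr r)" "integrable M (\<lambda>x. \<bar>g x\<bar> powr r)"
  shows "integrable M (\<lambda>x. \<bar>f x + g x\<bar> powr r)"
proof (rule Bochner_Integration.integrable_bound)
  show "integrable M (\<lambda>x. 2 powr r * (\<bar>f x\<bar> powr r + \<bar>g x\<bar> powr r))"
    using assms by auto
  show "AE x in M. norm (\<bar>f x + g x\<bar> powr r) \<le> norm (2 powr r * (\<bar>f x\<bar> powr r + \<bar>g x\<bar> powr r))"
    using abs_add_powr_le_sum[OF \<open>0 \<le> r\<close>] by auto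
qed (use assms in measurable)

lemma (in finite_measure) integrable_powr_le:
  fixes f :: "'a \<Rightarrow> real"
  assumes "0 \<le> s" "s \<le> r" "f \<in> borel_measurable M" "integrable M (\<lambda>x. \<bar>f x\<bar> powr r)"
  shows "integrable M (\<lambda>x. \<bar>f x\<bar> powr s)"
proof (rule Bochner_Integration.integrable_bound)
  show "integrable M (\<lambda>x. 1 + \<bar>f x\<bar> powr r)" using assms by auto
  have "y powr s \<le> 1 + y powr r" if "0 \<le> y" for y :: real
  proof (cases "y \<le> 1")
    case True
    then have "y powr s \<le> 1 powr s" using assms that by (intro powr_mono2) auto
    then show ?thesis using powr_ge_zero[of y r] by (simp del: powr_ge_zero)
  next
    case False
    then show ?thesis using powr_mono[of s r y] assms by linarith
  qed
  then show "AE x in M. norm (\<bar>f x\<bar> powr s) \<le> norm (1 + \<bar>f x\<bar> powr r)"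
    by (auto simp: abs_of_nonneg)
qed (use assms in measurable)

lemma (in finite_measure) integrable_square_of_powr:
  fixes f :: "'a \<Rightarrow> real"
  assumes "2 \<le> r" "f \<in> borel_measurable M" "integrable M (\<lambda>x. \<bar>f x\<bar> powr r)"
  shows "integrable M (\<lambda>x. (f x)\<^sup>2)"
  using integrable_powr_le[of 2 r f] assms by simp

lemma (in finite_measure) integrable_of_square:
  fixes f :: "'a \<Rightarrow> real"
  assumes "f \<in> borel_measurable M" "integrable M (\<lambda>x. (f x)\<^sup>2)"
  shows "integrable M f"
proof -
  have "integrable M (\<lambda>x. \<bar>f x\<bar> powr 1)"
    using integrable_powr_le[of 1 2 f] assms by simp
  then have "integrable M (\<lambda>x. \<bar>f x\<bar>)" by simp
  then show ?thesis using assms(1) by (rule integrable_abs_cancel)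
qed

lemma integrable_mult_of_squares:
  fixes f g :: "'a \<Rightarrow> real"
  assumes "f \<in> borel_measurable M" "g \<in> borel_measurable M"
    and "integrable M (\<lambda>x. (f x)\<^sup>2)" "integrable M (\<lambda>x. (g x)\<^sup>2)"
  shows "integrable M (\<lambda>x. f x * g x)"
proof (rule Bochner_Integration.integrable_bound)
  show "integrable M (\<lambda>x. (f x)\<^sup>2 + (g x)\<^sup>2)" using assms by auto
  have "\<bar>a * b\<bar> \<le> a\<^sup>2 + b\<^sup>2" for a b :: real
  proof -
    have "2 * \<bar>a * b\<bar> \<le> a\<^sup>2 + b\<^sup>2"
      using sum_squares_bound[of "\<bar>a\<bar>" "\<bar>b\<bar>"] by (simp add: abs_mult)
    then show ?thesis using abs_ge_zero[of "a * b"] by linarith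
  qed
  then show "AE x in M. norm (f x * g x) \<le> norm ((f x)\<^sup>2 + (g x)\<^sup>2)" by auto
qed (use assms in measurable)

lemma integral_Cauchy_Schwarz:
  fixes f g :: "'a \<Rightarrow> real"
  assumes "f \<in> borel_measurable M" "g \<in> borel_measurable M"
    and "integrable M (\<lambda>x. (f x)\<^sup>2)" "integrable M (\<lambda>x. (g x)\<^sup>2)"
  shows "(\<integral>x. f x * g x \<partial>M)\<^sup>2 \<le> (\<integral>x. (f x)\<^sup>2 \<partial>M) * (\<integral>x. (g x)\<^sup>2 \<partial>M)"
proof -
  note fg = integrable_mult_of_squares[OF assms]
  define A B C where "A = (\<integral>x. (f x)\<^sup>2 \<partial>M)" and "B = (\<integral>x. f x * g x \<partial>M)"
    and "C = (\<integral>x. (g x)\<^sup>2 \<partial>M)"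
  have *: "0 \<le> t\<^sup>2 * A + 2 * t * s * B + s\<^sup>2 * C" for t s
  proof -
    have "0 \<le> (\<integral>x. (t * f x + s * g x)\<^sup>2 \<partial>M)" by (rule integral_nonneg_AE) auto
    also have "(\<lambda>x. (t * f x + s * g x)\<^sup>2)
      = (\<lambda>x. t\<^sup>2 * (f x)\<^sup>2 + 2 * t * s * (f x * g x) + s\<^sup>2 * (g x)\<^sup>2)"
      by (auto simp: power2_eq_square algebra_simps)
    also have "(\<integral>x. \<dots> x \<partial>M) = t\<^sup>2 * A + 2 * t * s * B + s\<^sup>2 * C"
      using assms fg unfolding A_def B_def C_def by simp
    finally show ?thesis .
  qed
  have A0: "0 \<le> A" and C0: "0 \<le> C" unfolding A_def C_def by simp_all
  have "B\<^sup>2 \<le> A * C"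
  proof (cases "A = 0")
    case True
    have "B = 0"
    proof (rule ccontr)
      assume "B \<noteq> 0"
      \<comment> \<open>With \<open>A = 0\<close> the quadratic form is linear in \<open>t\<close>;
        this \<open>t\<close>, with \<open>s = 1\<close>, makes it \<open>- C - 2\<close>.\<close>
      have "2 * (- (C + 1) / B) * 1 * B = - 2 * (C + 1)" using \<open>B \<noteq> 0\<close> by simp
      then show False using *[of "- (C + 1) / B" 1] True C0 by simp
    qed
    then show ?thesis using True by simp
  next
    case False
    have "0 \<le> A * (A * C - B\<^sup>2)"
      using *[of "- B" A] by (simp add: power2_eq_square algebra_simps)
    then show ?thesis using False A0 by (simp add: zero_le_mult_iff)
  qed
  then show ?thesis unfolding A_def B_def C_def .
qed

lemma (in prob_space) square_expectation_le:
  fixes f :: "'a \<Rightarrow> real"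
  assumes "f \<in> borel_measurable M" "integrable M (\<lambda>x. (f x)\<^sup>2)"
  shows "(\<integral>x. f x \<partial>M)\<^sup>2 \<le> (\<integral>x. (f x)\<^sup>2 \<partial>M)"
  using integral_Cauchy_Schwarz[of f M "\<lambda>_. 1"] assms by (simp add: prob_space)

lemma (in prob_space) abs_expectation_le_sqrt:
  fixes f :: "'a \<Rightarrow> real"
  assumes "f \<in> borel_measurable M" "integrable M (\<lambda>x. (f x)\<^sup>2)"
  shows "(\<integral>x. \<bar>f x\<bar> \<partial>M) \<le> sqrt (\<integral>x. (f x)\<^sup>2 \<partial>M)"
  using square_expectation_le[of "\<lambda>x. \<bar>f x\<bar>"] assms by (intro real_le_rsqrt) simp

section \<open>Degenerate kernels\<close>

abbreviation iid_space :: "'b measure \<Rightarrow> nat set \<Rightarrow> (nat \<Rightarrow> 'b) measure" where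
  "iid_space P I \<equiv> PiM I (\<lambda>_. P)"

definition offdiag :: "nat set \<Rightarrow> (nat \<times> nat) set" where
  "offdiag I = {(i, j). i \<in> I \<and> j \<in> I \<and> i \<noteq> j}"

lemma finite_offdiag [simp]: "finite I \<Longrightarrow> finite (offdiag I)"
  by (rule finite_subset[of _ "I \<times> I"]) (auto simp: offdiag_def)

lemma sum_offdiag:
  fixes f :: "nat \<Rightarrow> nat \<Rightarrow> 'a::comm_monoid_add"
  assumes "finite I"
  shows "(\<Sum>(i, j)\<in>offdiag I. f i j) = (\<Sum>i\<in>I. \<Sum>j\<in>I - {i}. f i j)"
proof -
  have "offdiag I = Sigma I (\<lambda>i. I - {i})" by (auto simp: offdiag_def)
  then show ?thesis using assms by (simp add: sum.Sigma)
qed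

section \<open>Product spaces and resampling of one coordinate\<close>

context prob_space
begin

abbreviation M2 :: "('a \<times> 'a) measure" where
  "M2 \<equiv> M \<Otimes>\<^sub>M M"

lemma prob_space_iid: "prob_space (iid_space M I)"
  by (intro prob_space_PiM prob_space_axioms)

lemma product_sigma_finite_const: "product_sigma_finite (\<lambda>_::nat. M)"
  by (simp add: product_sigma_finite_def sigma_finite_measure_axioms)

lemma pair_sigma_finite_iid: "pair_sigma_finite (iid_space M I) M"
  by (intro pair_sigma_finite.intro prob_space_imp_sigma_finite prob_space_iid sigma_finite_measure_axioms)

lemma measurable_upd [measurable]:
  "i \<in> I \<Longrightarrow> (\<lambda>(w, x). w(i := x)) \<in> iid_space M I \<Otimes>\<^sub>M M \<rightarrow>\<^sub>M iid_space M I"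
  unfolding split_beta by (rule measurable_fun_upd[where J = I]) auto

lemma upd_in_space:
  "i \<in> I \<Longrightarrow> w \<in> space (iid_space M I) \<Longrightarrow> x \<in> space M \<Longrightarrow> w(i := x) \<in> space (iid_space M I)"
  by (auto simp: space_PiM PiE_iff extensional_def)

lemma coord_in_space: "i \<in> I \<Longrightarrow> w \<in> space (iid_space M I) \<Longrightarrow> w i \<in> space M"
  by (auto simp: space_PiM PiE_iff)

text \<open>The conditioning device: with Fubini it makes
  \<open>\<integral>x. f (w(i := x)) \<partial>M\<close> the conditional expectation given all
  coordinates but \<open>i\<close>, so that no sub-sigma-algebra occurs. On boxes it holds because
  overwriting frees the old coordinate \<open>i\<close>, whose factor becomes 1.\<close>

lemma distr_upd:
  assumes "finite I" "i \<in> I"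
  shows "distr (iid_space M I \<Otimes>\<^sub>M M) (iid_space M I) (\<lambda>(w, x). w(i := x)) = iid_space M I"
proof -
  interpret product_sigma_finite "\<lambda>_::nat. M" by (rule product_sigma_finite_const)
  interpret Q: pair_sigma_finite "iid_space M I" M by (rule pair_sigma_finite_iid)
  show ?thesis
  proof (rule PiM_eqI[OF assms(1)])
    fix A :: "nat \<Rightarrow> 'a set"
    assume A: "\<And>k. k \<in> I \<Longrightarrow> A k \<in> sets M"
    have sub: "A k \<subseteq> space M" if "k \<in> I" for k using A[OF that] by (rule sets.sets_into_space)
    have eq: "(\<lambda>(w, x). w(i := x)) -` (Pi\<^sub>E I A) \<inter> space (iid_space M I \<Otimes>\<^sub>M M)
      = (Pi\<^sub>E I (A(i := space M))) \<times> A i" (is "?L = ?R")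
    proof (intro set_eqI, clarify)
      fix w x
      show "(w, x) \<in> ?L \<longleftrightarrow> (w, x) \<in> ?R"
        using sub assms(2) by (auto simp: space_pair_measure space_PiM PiE_iff extensional_def)
    qed
    have "emeasure (distr (iid_space M I \<Otimes>\<^sub>M M) (iid_space M I) (\<lambda>(w, x). w(i := x))) (Pi\<^sub>E I A)
      = emeasure (iid_space M I \<Otimes>\<^sub>M M) ((Pi\<^sub>E I (A(i := space M))) \<times> A i)"
      unfolding eq[symmetric] using assms A
      by (intro emeasure_distr measurable_upd sets_PiM_I_finite)
    also have "\<dots> = emeasure (iid_space M I) (Pi\<^sub>E I (A(i := space M))) * emeasure M (A i)"
      using A assms by (intro emeasure_pair_measure_Times sets_PiM_I_finite) simp_all
    also have "\<dots> = (\<Prod>k\<in>I. emeasure M ((A(i := space M)) k)) * emeasure M (A i)"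
      using A assms by (subst emeasure_PiM) auto
    also have "\<dots> = (\<Prod>k\<in>I. emeasure M (A k))"
    proof -
      have "(\<Prod>k\<in>I - {i}. emeasure M ((A(i := space M)) k)) = (\<Prod>k\<in>I - {i}. emeasure M (A k))"
        by (intro prod.cong) auto
      then show ?thesis
        using assms by (simp add: prod.remove[of I i] emeasure_space_1 mult.commute del: fun_upd_apply)
          (simp add: emeasure_space_1)
    qed
    finally show "emeasure (distr (iid_space M I \<Otimes>\<^sub>M M) (iid_space M I) (\<lambda>(w, x). w(i := x))) (Pi\<^sub>E I A)
      = (\<Prod>k\<in>I. emeasure M (A k))" .
  qed simp
qed

lemma integrable_upd:
  fixes f :: "_ \<Rightarrow> _ :: {banach, second_countable_topology}"
  assumes "finite I" "i \<in> I" "integrable (iid_space M I) f"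
  shows "integrable (iid_space M I \<Otimes>\<^sub>M M) (\<lambda>(w, x). f (w(i := x)))"
proof -
  have "integrable (distr (iid_space M I \<Otimes>\<^sub>M M) (iid_space M I) (\<lambda>(w, x). w(i := x))) f"
    using assms by (simp add: distr_upd)
  from integrable_distr[OF measurable_upd[OF assms(2)] this]
  show ?thesis by (simp add: split_beta')
qed

lemma integrable_integral_upd:
  fixes f :: "_ \<Rightarrow> _ :: {banach, second_countable_topology}"
  assumes "finite I" "i \<in> I" "integrable (iid_space M I) f"
  shows "integrable (iid_space M I) (\<lambda>w. \<integral>x. f (w(i := x)) \<partial>M)"
  using pair_sigma_finite.integrable_fst'[OF pair_sigma_finite_iid integrable_upd[OF assms]] by simp

lemma integral_upd:
  fixes f :: "_ \<Rightarrow> _ :: {banach, second_countable_topology}"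
  assumes "finite I" "i \<in> I" "integrable (iid_space M I) f"
  shows "(\<integral>w. f w \<partial>iid_space M I) = (\<integral>w. (\<integral>x. f (w(i := x)) \<partial>M) \<partial>iid_space M I)"
proof -
  have "(\<integral>w. f w \<partial>iid_space M I)
    = (\<integral>w. f w \<partial>distr (iid_space M I \<Otimes>\<^sub>M M) (iid_space M I) (\<lambda>(w, x). w(i := x)))"
    using assms by (simp add: distr_upd)
  also have "\<dots> = (\<integral>z. (\<lambda>(w, x). f (w(i := x))) z \<partial>(iid_space M I \<Otimes>\<^sub>M M))"
    using assms by (subst integral_distr[OF measurable_upd]) (auto simp: split_beta')
  also have "\<dots> = (\<integral>w. (\<integral>x. f (w(i := x)) \<partial>M) \<partial>iid_space M I)"
    using pair_sigma_finite.integral_fst'[OF pair_sigma_finite_iid integrable_upd[OF assms]] by simp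
  finally show ?thesis .
qed

text \<open>Taking out what is known: \<open>F\<close> does not see coordinate \<open>i\<close>, so
  only the factor \<open>k\<close> is averaged over it.\<close>

lemma integral_pull_out:
  fixes F :: "_ \<Rightarrow> _ :: {banach, second_countable_topology}" and k :: "_ \<Rightarrow> real"
  assumes "finite I" "i \<in> I" "integrable (iid_space M I) (\<lambda>w. k w *\<^sub>R F w)"
    and F: "\<And>w x. w \<in> space (iid_space M I) \<Longrightarrow> x \<in> space M \<Longrightarrow> F (w(i := x)) = F w"
    and k: "\<And>w. w \<in> space (iid_space M I) \<Longrightarrow> integrable M (\<lambda>x. k (w(i := x)))"
    and k': "\<And>w. w \<in> space (iid_space M I) \<Longrightarrow> (\<integral>x. k (w(i := x)) \<partial>M) = k' w"
  shows "(\<integral>w. k w *\<^sub>R F w \<partial>iid_space M I) = (\<integral>w. k' w *\<^sub>R F w \<partial>iid_space M I)"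
    and "integrable (iid_space M I) (\<lambda>w. k' w *\<^sub>R F w)"
proof -
  have *: "(\<integral>x. k (w(i := x)) *\<^sub>R F (w(i := x)) \<partial>M) = k' w *\<^sub>R F w"
    if w: "w \<in> space (iid_space M I)" for w
  proof -
    have "(\<integral>x. k (w(i := x)) *\<^sub>R F (w(i := x)) \<partial>M) = (\<integral>x. k (w(i := x)) *\<^sub>R F w \<partial>M)"
      using w by (intro Bochner_Integration.integral_cong) (auto simp: F)
    then show ?thesis using k[OF w] k'[OF w] by simp
  qed
  show "(\<integral>w. k w *\<^sub>R F w \<partial>iid_space M I) = (\<integral>w. k' w *\<^sub>R F w \<partial>iid_space M I)"
    unfolding integral_upd[OF assms(1-3)]
    by (intro Bochner_Integration.integral_cong refl *)
  show "integrable (iid_space M I) (\<lambda>w. k' w *\<^sub>R F w)"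
    using integrable_integral_upd[OF assms(1-3)] *
    by (subst (asm) Bochner_Integration.integrable_cong[OF refl]) auto
qed

lemma integral_pull_out_zero:
  fixes F :: "_ \<Rightarrow> _ :: {banach, second_countable_topology}" and k :: "_ \<Rightarrow> real"
  assumes "finite I" "i \<in> I" "integrable (iid_space M I) (\<lambda>w. k w *\<^sub>R F w)"
    and "\<And>w x. w \<in> space (iid_space M I) \<Longrightarrow> x \<in> space M \<Longrightarrow> F (w(i := x)) = F w"
    and "\<And>w. w \<in> space (iid_space M I) \<Longrightarrow> integrable M (\<lambda>x. k (w(i := x)))"
    and "\<And>w. w \<in> space (iid_space M I) \<Longrightarrow> (\<integral>x. k (w(i := x)) \<partial>M) = 0"
  shows "(\<integral>w. k w *\<^sub>R F w \<partial>iid_space M I) = 0"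
  using integral_pull_out(1)[OF assms(1-3), of "\<lambda>_. 0"] assms(4-) by simp

lemma distr_coord:
  assumes "i \<in> I"
  shows "distr (iid_space M I) M (\<lambda>w. w i) = M"
  using distr_PiM_component[of I "\<lambda>_. M" i] assms prob_space_axioms by simp

lemma distr_two_coords:
  assumes "finite I" "i \<in> I" "j \<in> I" "i \<noteq> j"
  shows "distr (iid_space M I) M2 (\<lambda>w. (w i, w j)) = M2"
proof (rule pair_measure_eqI[symmetric])
  interpret product_sigma_finite "\<lambda>_::nat. M" by (rule product_sigma_finite_const)
  fix A B assume AB: "A \<in> sets M" "B \<in> sets M"
  define C where "C k = (if k = i then A else if k = j then B else space M)" for k
  have meas: "(\<lambda>w. (w i, w j)) \<in> iid_space M I \<rightarrow>\<^sub>M M2"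
    using assms by measurable
  have sub: "A \<subseteq> space M" "B \<subseteq> space M" using AB by (auto dest: sets.sets_into_space)
  have "(\<lambda>w. (w i, w j)) -` (A \<times> B) \<inter> space (iid_space M I) = Pi\<^sub>E I C"
  proof -
    have "x \<in> space M" if "x \<in> A \<or> x \<in> B" for x using that sub by auto
    then show ?thesis using assms by (auto simp: space_PiM PiE_iff C_def split: if_splits) (metis+)?
  qed
  with emeasure_distr[OF meas pair_measureI[OF AB]]
  have "emeasure (distr (iid_space M I) M2 (\<lambda>w. (w i, w j))) (A \<times> B)
    = emeasure (iid_space M I) (Pi\<^sub>E I C)" by simp
  also have "\<dots> = (\<Prod>k\<in>I. emeasure M (C k))"
    using AB assms by (intro emeasure_PiM) (auto simp: C_def)
  also have "\<dots> = emeasure M A * (emeasure M B * (\<Prod>k\<in>I - {i} - {j}. emeasure M (C k)))"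
    using assms by (simp add: prod.remove[of I i] prod.remove[of "I - {i}" j] C_def)
  also have "(\<Prod>k\<in>I - {i} - {j}. emeasure M (C k)) = 1"
    by (intro prod.neutral) (auto simp: C_def emeasure_space_1)
  finally show "emeasure M A * emeasure M B
    = emeasure (distr (iid_space M I) M2 (\<lambda>w. (w i, w j))) (A \<times> B)" by simp
qed (auto intro: sigma_finite_measure_axioms)

lemma measurable_two_coords [measurable]:
  "i \<in> I \<Longrightarrow> j \<in> I \<Longrightarrow> (\<lambda>w. (w i, w j)) \<in> iid_space M I \<rightarrow>\<^sub>M M2"
  by measurable

lemma integrable_coord:
  fixes f :: "_ \<Rightarrow> _ :: {banach, second_countable_topology}"
  assumes "i \<in> I" "integrable M f"
  shows "integrable (iid_space M I) (\<lambda>w. f (w i))"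
  using integrable_distr[of "\<lambda>w. w i" "iid_space M I" M f] assms distr_coord by simp

lemma integral_coord:
  fixes f :: "_ \<Rightarrow> _ :: {banach, second_countable_topology}"
  assumes "i \<in> I" "f \<in> borel_measurable M"
  shows "(\<integral>w. f (w i) \<partial>iid_space M I) = (\<integral>x. f x \<partial>M)"
  using integral_distr[of "\<lambda>w. w i" "iid_space M I" M f] assms distr_coord by simp

lemma integrable_two_coords:
  fixes f :: "_ \<Rightarrow> _ \<Rightarrow> _ :: {banach, second_countable_topology}"
  assumes "finite I" "i \<in> I" "j \<in> I" "i \<noteq> j" "integrable M2 (\<lambda>(x, y). f x y)"
  shows "integrable (iid_space M I) (\<lambda>w. f (w i) (w j))"
  using integrable_distr[OF measurable_two_coords[of i I j], of "\<lambda>(x, y). f x y"] assms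
  by (simp add: distr_two_coords)

lemma integral_two_coords:
  fixes f :: "_ \<Rightarrow> _ \<Rightarrow> _ :: {banach, second_countable_topology}"
  assumes "finite I" "i \<in> I" "j \<in> I" "i \<noteq> j" "(\<lambda>(x, y). f x y) \<in> borel_measurable M2"
  shows "(\<integral>w. f (w i) (w j) \<partial>iid_space M I) = (\<integral>(x, y). f x y \<partial>M2)"
  using integral_distr[OF measurable_two_coords[of i I j] assms(5)] assms
  by (simp add: distr_two_coords)

end

text \<open>Sections are square integrable at every point, not only at almost every one, so that
  composed kernels and conditional variances are defined everywhere and their identities have no
  exceptional sets. In operator terms, \<open>K\<close> is a symmetric Hilbert-Schmidt operator that
  annihilates constants.\<close>

locale degenerate_kernel = prob_space +
  fixes K :: "'a \<Rightarrow> 'a \<Rightarrow> real"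
  assumes K_meas [measurable]: "(\<lambda>(x, y). K x y) \<in> borel_measurable M2"
    and K_sym: "\<And>x y. x \<in> space M \<Longrightarrow> y \<in> space M \<Longrightarrow> K x y = K y x"
    and K_section: "\<And>x. x \<in> space M \<Longrightarrow> integrable M (\<lambda>y. (K x y)\<^sup>2)"
    and K_degenerate: "\<And>x. x \<in> space M \<Longrightarrow> (\<integral>y. K x y \<partial>M) = 0"
    and K_square: "integrable M2 (\<lambda>(x, y). (K x y)\<^sup>2)"
begin

definition variance_K :: real where "variance_K = (\<integral>(x, y). (K x y)\<^sup>2 \<partial>M2)"

lemma K_meas':
  "f \<in> N \<rightarrow>\<^sub>M M \<Longrightarrow> g \<in> N \<rightarrow>\<^sub>M M \<Longrightarrow> (\<lambda>x. K (f x) (g x)) \<in> borel_measurable N"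
  using measurable_compose[OF measurable_Pair K_meas, of f N g] by simp

lemma K_section_integrable: "x \<in> space M \<Longrightarrow> integrable M (\<lambda>y. K x y)"
  by (rule integrable_of_square[OF _ K_section])
    (rule K_meas'[OF measurable_const measurable_ident_sets[OF refl]])

lemma K_section_integrable': 
  assumes "y \<in> space M"
  shows "integrable M (\<lambda>x. K x y)"
proof -
  have "integrable M (\<lambda>x. K x y) \<longleftrightarrow> integrable M (\<lambda>x. K y x)"
    by (intro Bochner_Integration.integrable_cong refl K_sym assms)
  then show ?thesis using K_section_integrable[OF assms] by simp
qed

lemma K_degenerate':
  assumes "y \<in> space M"
  shows "(\<integral>x. K x y \<partial>M) = 0"
proof -
  have "(\<integral>x. K x y \<partial>M) = (\<integral>x. K y x \<partial>M)"
    by (intro Bochner_Integration.integral_cong refl K_sym assms)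
  then show ?thesis using K_degenerate[OF assms] by simp
qed

lemma K_coords_square_integrable:
  "finite I \<Longrightarrow> (i, j) \<in> offdiag I \<Longrightarrow> integrable (iid_space M I) (\<lambda>w. (K (w i) (w j))\<^sup>2)"
  using integrable_two_coords[of I i j "\<lambda>x y. (K x y)\<^sup>2"] K_square by (simp add: offdiag_def)

lemma K_coords_meas [measurable]:
  assumes "(i, j) \<in> offdiag I"
  shows "(\<lambda>w. K (w i) (w j)) \<in> borel_measurable (iid_space M I)"
proof -
  have "i \<in> I" "j \<in> I" using assms unfolding offdiag_def by simp_all
  then show ?thesis by (intro K_meas' measurable_component_singleton)
qed

lemma K_coords_mult_integrable:
  assumes "finite I" "(i, j) \<in> offdiag I" "(k, l) \<in> offdiag I"
  shows "integrable (iid_space M I) (\<lambda>w. K (w i) (w j) * K (w k) (w l))"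
  using assms by (intro integrable_mult_of_squares K_coords_square_integrable K_coords_meas)

text \<open>The index \<open>i\<close> occurs in the first factor only, so resampling it averages
  that factor to zero by degeneracy.\<close>

lemma integral_K_mult_zero:
  assumes I: "finite I" "(i, j) \<in> offdiag I" "(k, l) \<in> offdiag I" and "i \<noteq> k" "i \<noteq> l"
  shows "(\<integral>w. K (w i) (w j) * K (w k) (w l) \<partial>iid_space M I) = 0"
proof -
  have ij: "i \<in> I" "j \<in> I" "i \<noteq> j" "k \<in> I" "l \<in> I" using I unfolding offdiag_def by simp_all
  show ?thesis
    using integral_pull_out_zero[of I i "\<lambda>w. K (w i) (w j)" "\<lambda>w. K (w k) (w l)"]
      K_coords_mult_integrable[OF I] assms ij K_section_integrable' K_degenerate' coord_in_space
    by simp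
qed

lemma integral_K_mult:
  assumes I: "finite I" "(i, j) \<in> offdiag I" "(k, l) \<in> offdiag I"
  shows "(\<integral>w. K (w i) (w j) * K (w k) (w l) \<partial>iid_space M I)
    = variance_K * (of_bool ((k, l) = (i, j)) + of_bool ((k, l) = (j, i)))"
proof -
  have ij: "i \<in> I" "j \<in> I" "i \<noteq> j" "k \<in> I" "l \<in> I" "k \<noteq> l" using I unfolding offdiag_def by simp_all
  have sq: "(\<integral>w. (K (w i) (w j))\<^sup>2 \<partial>iid_space M I) = variance_K"
    using ij I(1) unfolding variance_K_def by (subst integral_two_coords[of I i j "\<lambda>x y. (K x y)\<^sup>2"]) auto
  have sym: "K (w a) (w b) = K (w b) (w a)" if "w \<in> space (iid_space M I)" "a \<in> I" "b \<in> I" for w a b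
    using that by (intro K_sym coord_in_space)
  \<comment> \<open>Either some end of the first pair is absent from the second, and then that index
    occurs only once, or the pairs coincide up to order.\<close>
  consider "i \<noteq> k" "i \<noteq> l" | "j \<noteq> k" "j \<noteq> l" | "k = i" "l = j" | "k = j" "l = i" using ij by auto
  then show ?thesis
  proof cases
    case 1
    then show ?thesis using integral_K_mult_zero[OF I] by auto
  next
    case 2
    have "(\<integral>w. K (w i) (w j) * K (w k) (w l) \<partial>iid_space M I)
      = (\<integral>w. K (w j) (w i) * K (w k) (w l) \<partial>iid_space M I)"
      using ij by (intro Bochner_Integration.integral_cong) (auto simp: sym)
    then show ?thesis using integral_K_mult_zero[of I j i k l] 2 ij I by (auto simp: offdiag_def)
  next
    case 3
    then show ?thesis using sq ij by (simp add: power2_eq_square)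
  next
    case 4
    have "(\<integral>w. K (w i) (w j) * K (w k) (w l) \<partial>iid_space M I)
      = (\<integral>w. (K (w i) (w j))\<^sup>2 \<partial>iid_space M I)"
      using ij 4 by (intro Bochner_Integration.integral_cong) (auto simp: sym[of _ j i] power2_eq_square)
    then show ?thesis using sq ij 4 by simp
  qed
qed

text \<open>Row sums, their total, the U-statistic and the off-diagonal part of the conditional
  variance are all of this form, so a single covariance formula serves them all. Both orders of a
  pair occur and \<open>c\<close> need not be symmetric, hence the symmetrised coefficient in that
  formula.\<close>

definition pair_sum :: "nat set \<Rightarrow> (nat \<Rightarrow> nat \<Rightarrow> real) \<Rightarrow> (nat \<Rightarrow> 'a) \<Rightarrow> real" where
  "pair_sum I c w = (\<Sum>p\<in>offdiag I. c (fst p) (snd p) * K (w (fst p)) (w (snd p)))"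

lemma pair_sum_meas [measurable]: "pair_sum I c \<in> borel_measurable (iid_space M I)"
  unfolding pair_sum_def
proof (rule borel_measurable_sum)
  fix p assume "p \<in> offdiag I"
  then have "(fst p, snd p) \<in> offdiag I" by simp
  from K_coords_meas[OF this]
  show "(\<lambda>w. c (fst p) (snd p) * K (w (fst p)) (w (snd p))) \<in> borel_measurable (iid_space M I)"
    by (rule borel_measurable_times[OF borel_measurable_const])
qed

lemma pair_sum_product:
  "pair_sum I c w * pair_sum I c' w = (\<Sum>p\<in>offdiag I. \<Sum>q\<in>offdiag I.
    c (fst p) (snd p) * c' (fst q) (snd q) * (K (w (fst p)) (w (snd p)) * K (w (fst q)) (w (snd q))))"
  unfolding pair_sum_def sum_product by (intro sum.cong refl) (simp add: mult_ac)

lemma K_pairs_integrable: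
  assumes "finite I" "p \<in> offdiag I" "q \<in> offdiag I"
  shows "integrable (iid_space M I) (\<lambda>w. b * (K (w (fst p)) (w (snd p)) * K (w (fst q)) (w (snd q))))"
  using K_coords_mult_integrable[OF assms(1), of "fst p" "snd p" "fst q" "snd q"] assms by simp

lemma pair_sum_mult_integrable:
  assumes "finite I"
  shows "integrable (iid_space M I) (\<lambda>w. pair_sum I c w * pair_sum I c' w)"
  unfolding pair_sum_product
  by (rule Bochner_Integration.integrable_sum, rule Bochner_Integration.integrable_sum,
      rule K_pairs_integrable[OF assms])

lemma sum_select_pair:
  fixes f :: "nat \<times> nat \<Rightarrow> real"
  assumes "finite S" "r \<in> S"
  shows "(\<Sum>q\<in>S. f q * of_bool (q = r)) = f r"
proof -
  have "(\<Sum>q\<in>S. f q * of_bool (q = r)) = (\<Sum>q\<in>S. if q = r then f q else 0)"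
    by (intro sum.cong) auto
  then show ?thesis using assms by simp
qed

lemma integral_pair_sum_mult:
  assumes I: "finite I"
  shows "(\<integral>w. pair_sum I c w * pair_sum I c' w \<partial>iid_space M I)
    = variance_K * (\<Sum>(i, j)\<in>offdiag I. c i j * (c' i j + c' j i))"
proof -
  have "(\<integral>w. pair_sum I c w * pair_sum I c' w \<partial>iid_space M I)
    = (\<Sum>p\<in>offdiag I. \<Sum>q\<in>offdiag I. c (fst p) (snd p) * c' (fst q) (snd q) *
        (\<integral>w. K (w (fst p)) (w (snd p)) * K (w (fst q)) (w (snd q)) \<partial>iid_space M I))"
  proof -
    have int: "integrable (iid_space M I) (\<lambda>w. \<Sum>q\<in>offdiag I. c (fst p) (snd p) * c' (fst q) (snd q) *
        (K (w (fst p)) (w (snd p)) * K (w (fst q)) (w (snd q))))" if "p \<in> offdiag I" for p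
      by (rule Bochner_Integration.integrable_sum, rule K_pairs_integrable[OF I that])
    show ?thesis
      unfolding pair_sum_product
      by (subst Bochner_Integration.integral_sum[OF int], assumption, intro sum.cong refl,
          subst Bochner_Integration.integral_sum[OF K_pairs_integrable[OF I]], assumption, assumption,
          simp)
  qed
  also have "\<dots> = (\<Sum>p\<in>offdiag I. variance_K * (c (fst p) (snd p) * (c' (fst p) (snd p) + c' (snd p) (fst p))))"
  proof (intro sum.cong refl)
    fix p assume p: "p \<in> offdiag I"
    define g where "g q = c (fst p) (snd p) * c' (fst q) (snd q) * variance_K" for q
    have "c (fst p) (snd p) * c' (fst q) (snd q) *
        (\<integral>w. K (w (fst p)) (w (snd p)) * K (w (fst q)) (w (snd q)) \<partial>iid_space M I)
      = g q * of_bool (q = p) + g q * of_bool (q = (snd p, fst p))" if "q \<in> offdiag I" for q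
    proof -
      have "(\<integral>w. K (w (fst p)) (w (snd p)) * K (w (fst q)) (w (snd q)) \<partial>iid_space M I)
        = variance_K * (of_bool (q = p) + of_bool (q = (snd p, fst p)))"
        using integral_K_mult[OF I, of "fst p" "snd p" "fst q" "snd q"] p that
        unfolding prod.collapse by blast
      then show ?thesis by (simp only: g_def distrib_left mult.assoc)
    qed
    then have "(\<Sum>q\<in>offdiag I. c (fst p) (snd p) * c' (fst q) (snd q) *
        (\<integral>w. K (w (fst p)) (w (snd p)) * K (w (fst q)) (w (snd q)) \<partial>iid_space M I))
      = (\<Sum>q\<in>offdiag I. g q * of_bool (q = p)) + (\<Sum>q\<in>offdiag I. g q * of_bool (q = (snd p, fst p)))"
      unfolding sum.distrib[symmetric] by (intro sum.cong refl)
    also have "\<dots> = g p + g (snd p, fst p)"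
      using finite_offdiag[OF I] p
      by (intro arg_cong2[where f = "(+)"] sum_select_pair) (auto simp: offdiag_def)
    finally show "(\<Sum>q\<in>offdiag I. c (fst p) (snd p) * c' (fst q) (snd q) *
        (\<integral>w. K (w (fst p)) (w (snd p)) * K (w (fst q)) (w (snd q)) \<partial>iid_space M I))
      = variance_K * (c (fst p) (snd p) * (c' (fst p) (snd p) + c' (snd p) (fst p)))"
      by (simp add: g_def algebra_simps)
  qed
  also have "\<dots> = variance_K * (\<Sum>(i, j)\<in>offdiag I. c i j * (c' i j + c' j i))"
    by (simp add: sum_distrib_left split_beta')
  finally show ?thesis .
qed

end

text \<open>Moments of order \<open>1 + \<tau>\<close> give no variance, so the variables are cut at
  level \<open>c\<close>: the part cut off has mean at most \<open>B * c powr (- \<tau>)\<close>,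
  the truncated part second moment at most \<open>B * c powr (1 - \<tau>)\<close>. Outside
  \<open>D\<close> the truncated variables are uncorrelated, and \<open>\<delta>\<close> bounds the
  weight of \<open>D\<close> in the variance of the sum.\<close>

lemma (in prob_space) truncated_weak_law:
  fixes \<xi> :: "'i \<Rightarrow> 'a \<Rightarrow> real"
  assumes I: "finite I" and \<tau>: "0 < \<tau>" "\<tau> \<le> 1" and c: "0 < c"
    and meas: "\<And>a. a \<in> I \<Longrightarrow> \<xi> a \<in> borel_measurable M"
    and nonneg: "\<And>a x. a \<in> I \<Longrightarrow> x \<in> space M \<Longrightarrow> 0 \<le> \<xi> a x"
    and int: "\<And>a. a \<in> I \<Longrightarrow> integrable M (\<lambda>x. \<xi> a x powr (1 + \<tau>))"
    and mean: "\<And>a. a \<in> I \<Longrightarrow> (\<integral>x. \<xi> a x \<partial>M) = 1"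
    and B: "\<And>a. a \<in> I \<Longrightarrow> (\<integral>x. \<xi> a x powr (1 + \<tau>) \<partial>M) \<le> B"
    and w: "\<And>a. a \<in> I \<Longrightarrow> 0 \<le> w a" "(\<Sum>a\<in>I. w a) = 1"
    and indep: "\<And>a b. a \<in> I \<Longrightarrow> b \<in> I \<Longrightarrow> (a, b) \<notin> D \<Longrightarrow>
      (\<integral>x. min (\<xi> a x) c * min (\<xi> b x) c \<partial>M) = (\<integral>x. min (\<xi> a x) c \<partial>M) * (\<integral>x. min (\<xi> b x) c \<partial>M)"
    and D: "(\<Sum>a\<in>I. \<Sum>b\<in>I. w a * w b * of_bool ((a, b) \<in> D)) \<le> \<delta>"
  shows "(\<integral>x. \<bar>(\<Sum>a\<in>I. w a * \<xi> a x) - 1\<bar> \<partial>M) \<le> 2 * B * c powr (- \<tau>) + sqrt (\<delta> * (c powr (1 - \<tau>) * B))"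
proof -
  define \<eta> where "\<eta> a x = min (\<xi> a x) c" for a x
  define m where "m a = (\<integral>x. \<eta> a x \<partial>M)" for a
  have \<xi>_int: "integrable M (\<xi> a)" if "a \<in> I" for a
  proof -
    have "integrable M (\<lambda>x. \<bar>\<xi> a x\<bar> powr (1 + \<tau>))"
      using int[OF that] nonneg[OF that] by (subst Bochner_Integration.integrable_cong[OF refl]) auto
    then have "integrable M (\<lambda>x. \<bar>\<xi> a x\<bar> powr 1)"
      using \<tau> by (intro integrable_powr_le[of 1 "1 + \<tau>"] meas[OF that]) auto
    then have "integrable M (\<lambda>x. \<bar>\<xi> a x\<bar>)" by simp
    then show ?thesis by (rule integrable_abs_cancel) (rule meas[OF that])
  qed
  have \<eta>_meas: "\<eta> a \<in> borel_measurable M" if "a \<in> I" for a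
    unfolding \<eta>_def using meas[OF that] by simp
  have \<eta>_bound: "0 \<le> \<eta> a x" "\<eta> a x \<le> c" "\<eta> a x \<le> \<xi> a x" if "a \<in> I" "x \<in> space M" for a x
    using nonneg[OF that] c by (auto simp: \<eta>_def)
  have \<eta>_int: "integrable M (\<eta> a)" if "a \<in> I" for a
    using \<eta>_bound[OF that] by (intro integrable_const_bound[of _ c] \<eta>_meas[OF that]) auto
  have \<eta>\<eta>_int: "integrable M (\<lambda>x. \<eta> a x * \<eta> b x)" if "a \<in> I" "b \<in> I" for a b
    using \<eta>_bound[OF that(1)] \<eta>_bound[OF that(2)] c
    by (intro integrable_const_bound[of _ "c * c"] borel_measurable_times \<eta>_meas that AE_I2)
       (auto simp: abs_mult intro!: mult_mono)
  have tail: "\<xi> a x - \<eta> a x \<le> c powr (- \<tau>) * \<xi> a x powr (1 + \<tau>)" if "a \<in> I" "x \<in> space M" for a x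
  proof (cases "\<xi> a x \<le> c")
    case False
    then have "1 \<le> (\<xi> a x / c) powr \<tau>" using c \<tau> by (intro ge_one_powr_ge_zero) auto
    then have "\<xi> a x \<le> \<xi> a x * (\<xi> a x / c) powr \<tau>"
      using False c mult_left_mono[of 1 "(\<xi> a x / c) powr \<tau>" "\<xi> a x"] by simp
    also have "\<dots> = c powr (- \<tau>) * \<xi> a x powr (1 + \<tau>)"
      using False c by (simp add: powr_divide powr_add powr_minus field_simps)
    finally show ?thesis using False c by (simp add: \<eta>_def)
  qed (simp add: \<eta>_def)
  have tail_int: "1 - m a \<le> c powr (- \<tau>) * B" if "a \<in> I" for a
  proof -
    have "1 - m a = (\<integral>x. \<xi> a x - \<eta> a x \<partial>M)"
      using that \<xi>_int \<eta>_int by (simp add: mean m_def)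
    also have "\<dots> \<le> (\<integral>x. c powr (- \<tau>) * \<xi> a x powr (1 + \<tau>) \<partial>M)"
      using that \<xi>_int \<eta>_int int tail by (intro integral_mono) auto
    also have "\<dots> \<le> c powr (- \<tau>) * B"
      using B[OF that] by (simp add: mult_left_mono)
    finally show ?thesis .
  qed
  have sq: "(\<integral>x. (\<eta> a x)\<^sup>2 \<partial>M) \<le> c powr (1 - \<tau>) * B" if "a \<in> I" for a
  proof -
    have "(\<eta> a x)\<^sup>2 \<le> c powr (1 - \<tau>) * \<xi> a x powr (1 + \<tau>)" if x: "x \<in> space M" for x
    proof -
      have "(\<eta> a x)\<^sup>2 = \<eta> a x powr ((1 - \<tau>) + (1 + \<tau>))"
        using \<eta>_bound(1)[OF \<open>a \<in> I\<close> x] by simp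
      also have "\<dots> = \<eta> a x powr (1 - \<tau>) * \<eta> a x powr (1 + \<tau>)" by (rule powr_add)
      also have "\<dots> \<le> c powr (1 - \<tau>) * \<xi> a x powr (1 + \<tau>)"
        using \<eta>_bound[OF \<open>a \<in> I\<close> x] \<tau> by (intro mult_mono powr_mono2) auto
      finally show ?thesis .
    qed
    then have "(\<integral>x. (\<eta> a x)\<^sup>2 \<partial>M) \<le> (\<integral>x. c powr (1 - \<tau>) * \<xi> a x powr (1 + \<tau>) \<partial>M)"
      using \<eta>\<eta>_int[OF that that] int[OF that] by (intro integral_mono) (auto simp: power2_eq_square)
    also have "\<dots> \<le> c powr (1 - \<tau>) * B"
      using B[OF that] by (simp add: mult_left_mono)
    finally show ?thesis .
  qed
  have cov: "(\<integral>x. (\<eta> a x - m a) * (\<eta> b x - m b) \<partial>M) \<le> of_bool ((a, b) \<in> D) * (c powr (1 - \<tau>) * B)"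
    if ab: "a \<in> I" "b \<in> I" for a b
  proof -
    have "(\<integral>x. (\<eta> a x - m a) * (\<eta> b x - m b) \<partial>M)
      = (\<integral>x. \<eta> a x * \<eta> b x - m a * \<eta> b x - m b * \<eta> a x + m a * m b \<partial>M)"
      by (simp add: algebra_simps)
    also have "\<dots> = (\<integral>x. \<eta> a x * \<eta> b x \<partial>M) - m a * m b"
      using ab \<eta>\<eta>_int \<eta>_int by (simp add: prob_space m_def)
    also have "\<dots> \<le> of_bool ((a, b) \<in> D) * (c powr (1 - \<tau>) * B)"
    proof (cases "(a, b) \<in> D")
      case True
      have "0 \<le> m a * m b"
        using ab \<eta>_bound unfolding m_def by (intro mult_nonneg_nonneg Bochner_Integration.integral_nonneg)
      moreover have "(\<integral>x. \<eta> a x * \<eta> b x \<partial>M) \<le> (\<integral>x. ((\<eta> a x)\<^sup>2 + (\<eta> b x)\<^sup>2) / 2 \<partial>M)"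
      proof (rule integral_mono[OF \<eta>\<eta>_int[OF ab]])
        show "integrable M (\<lambda>x. ((\<eta> a x)\<^sup>2 + (\<eta> b x)\<^sup>2) / 2)"
          using ab \<eta>\<eta>_int[of a a] \<eta>\<eta>_int[of b b] by (simp add: power2_eq_square)
        show "\<eta> a x * \<eta> b x \<le> ((\<eta> a x)\<^sup>2 + (\<eta> b x)\<^sup>2) / 2" for x
          using sum_squares_bound[of "\<eta> a x" "\<eta> b x"] by simp
      qed
      moreover have "(\<integral>x. ((\<eta> a x)\<^sup>2 + (\<eta> b x)\<^sup>2) / 2 \<partial>M)
        = ((\<integral>x. (\<eta> a x)\<^sup>2 \<partial>M) + (\<integral>x. (\<eta> b x)\<^sup>2 \<partial>M)) / 2"
        using ab \<eta>\<eta>_int[of a a] \<eta>\<eta>_int[of b b] by (simp add: power2_eq_square)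
      ultimately show ?thesis using True sq[OF ab(1)] sq[OF ab(2)] by simp
    next
      case False
      then show ?thesis using indep[OF ab False] by (simp add: \<eta>_def m_def)
    qed
    finally show ?thesis .
  qed
  define U where "U x = (\<Sum>a\<in>I. w a * (\<eta> a x - m a))" for x
  have UU: "(U x)\<^sup>2 = (\<Sum>a\<in>I. \<Sum>b\<in>I. w a * w b * ((\<eta> a x - m a) * (\<eta> b x - m b)))" for x
    unfolding U_def power2_eq_square sum_product by (intro sum.cong refl) (simp add: mult_ac)
  have cov_int: "integrable M (\<lambda>x. w a * w b * ((\<eta> a x - m a) * (\<eta> b x - m b)))"
    if ab: "a \<in> I" "b \<in> I" for a b
  proof -
    have "integrable M (\<lambda>x. w a * w b * (\<eta> a x * \<eta> b x - m a * \<eta> b x - m b * \<eta> a x + m a * m b))"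
      using ab \<eta>\<eta>_int \<eta>_int by simp
    then show ?thesis by (simp add: algebra_simps)
  qed
  have U_int: "integrable M (\<lambda>x. (U x)\<^sup>2)"
    unfolding UU by (rule Bochner_Integration.integrable_sum, rule Bochner_Integration.integrable_sum, rule cov_int)
  have U_meas: "U \<in> borel_measurable M"
  proof -
    have "U = (\<lambda>x. \<Sum>a\<in>I. w a * (\<eta> a x - m a))" by (simp add: U_def fun_eq_iff)
    then show ?thesis using \<eta>_meas by simp
  qed
  have "(\<integral>x. (U x)\<^sup>2 \<partial>M) = (\<Sum>a\<in>I. \<Sum>b\<in>I. w a * w b * (\<integral>x. (\<eta> a x - m a) * (\<eta> b x - m b) \<partial>M))"
  proof -
    have "(\<integral>x. (U x)\<^sup>2 \<partial>M) = (\<Sum>a\<in>I. \<integral>x. (\<Sum>b\<in>I. w a * w b * ((\<eta> a x - m a) * (\<eta> b x - m b))) \<partial>M)"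
      unfolding UU by (rule Bochner_Integration.integral_sum, rule Bochner_Integration.integrable_sum, rule cov_int)
    also have "\<dots> = (\<Sum>a\<in>I. \<Sum>b\<in>I. \<integral>x. w a * w b * ((\<eta> a x - m a) * (\<eta> b x - m b)) \<partial>M)"
      by (rule sum.cong[OF refl], rule Bochner_Integration.integral_sum, rule cov_int)
    finally show ?thesis by simp
  qed
  also have "\<dots> \<le> (\<Sum>a\<in>I. \<Sum>b\<in>I. w a * w b * (of_bool ((a, b) \<in> D) * (c powr (1 - \<tau>) * B)))"
    using w(1) cov by (intro sum_mono mult_left_mono) auto
  also have "\<dots> = (\<Sum>a\<in>I. \<Sum>b\<in>I. w a * w b * of_bool ((a, b) \<in> D)) * (c powr (1 - \<tau>) * B)"
    by (simp add: sum_distrib_right mult.assoc)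
  also have "\<dots> \<le> \<delta> * (c powr (1 - \<tau>) * B)"
  proof (rule mult_right_mono[OF D])
    have "I \<noteq> {}" using w(2) by auto
    then obtain a where "a \<in> I" by auto
    moreover have "0 \<le> (\<integral>x. \<xi> a x powr (1 + \<tau>) \<partial>M)" by simp
    ultimately have "0 \<le> B" using B[of a] by linarith
    then show "0 \<le> c powr (1 - \<tau>) * B" by simp
  qed
  finally have var: "(\<integral>x. (U x)\<^sup>2 \<partial>M) \<le> \<delta> * (c powr (1 - \<tau>) * B)" .
  have "(\<integral>x. \<bar>U x\<bar> \<partial>M) \<le> sqrt (\<delta> * (c powr (1 - \<tau>) * B))"
    using abs_expectation_le_sqrt[OF U_meas U_int] real_sqrt_le_mono[OF var] by linarith
  \<comment> \<open>Pointwise the error consists of the fluctuation of the truncated sum, the mass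
    cut off and the mean cut off. The last two have the same integral, hence the factor 2.\<close>
  moreover have "(\<integral>x. \<bar>(\<Sum>a\<in>I. w a * \<xi> a x) - 1\<bar> \<partial>M)
    \<le> (\<integral>x. \<bar>U x\<bar> + ((\<Sum>a\<in>I. w a * (\<xi> a x - \<eta> a x)) + (\<Sum>a\<in>I. w a * (1 - m a))) \<partial>M)"
  proof (rule integral_mono)
    show "integrable M (\<lambda>x. \<bar>(\<Sum>a\<in>I. w a * \<xi> a x) - 1\<bar>)"
      using \<xi>_int by (intro integrable_abs Bochner_Integration.integrable_diff Bochner_Integration.integrable_sum) auto
    show "integrable M (\<lambda>x. \<bar>U x\<bar> + ((\<Sum>a\<in>I. w a * (\<xi> a x - \<eta> a x)) + (\<Sum>a\<in>I. w a * (1 - m a))))"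
      using integrable_of_square[OF U_meas U_int] \<xi>_int \<eta>_int by simp
    fix x assume x: "x \<in> space M"
    have "(\<Sum>a\<in>I. w a * \<xi> a x) - 1 = (\<Sum>a\<in>I. w a * \<xi> a x) - (\<Sum>a\<in>I. w a)" using w by simp
    also have "\<dots> = U x + (\<Sum>a\<in>I. w a * (\<xi> a x - \<eta> a x)) - (\<Sum>a\<in>I. w a * (1 - m a))"
      unfolding U_def by (simp add: algebra_simps sum.distrib sum_subtractf)
    finally have eq: "(\<Sum>a\<in>I. w a * \<xi> a x) - 1 = U x + (\<Sum>a\<in>I. w a * (\<xi> a x - \<eta> a x)) - (\<Sum>a\<in>I. w a * (1 - m a))" .
    have "0 \<le> (\<Sum>a\<in>I. w a * (\<xi> a x - \<eta> a x))"
      using w \<eta>_bound[OF _ x] by (intro sum_nonneg mult_nonneg_nonneg) auto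
    moreover have "0 \<le> (\<Sum>a\<in>I. w a * (1 - m a))"
    proof (intro sum_nonneg mult_nonneg_nonneg w)
      fix a assume a: "a \<in> I"
      have "m a \<le> (\<integral>x. \<xi> a x \<partial>M)"
        unfolding m_def using a \<eta>_bound by (intro integral_mono \<eta>_int \<xi>_int) auto
      then show "0 \<le> 1 - m a" using mean[OF a] by simp
    qed
    ultimately show "\<bar>(\<Sum>a\<in>I. w a * \<xi> a x) - 1\<bar>
      \<le> \<bar>U x\<bar> + ((\<Sum>a\<in>I. w a * (\<xi> a x - \<eta> a x)) + (\<Sum>a\<in>I. w a * (1 - m a)))"
      unfolding eq by linarith
  qed
  moreover have "(\<integral>x. \<bar>U x\<bar> + ((\<Sum>a\<in>I. w a * (\<xi> a x - \<eta> a x)) + (\<Sum>a\<in>I. w a * (1 - m a))) \<partial>M)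
    = (\<integral>x. \<bar>U x\<bar> \<partial>M) + 2 * (\<Sum>a\<in>I. w a * (1 - m a))"
    using integrable_of_square[OF U_meas U_int] \<xi>_int \<eta>_int
    by (simp add: m_def mean prob_space)
  moreover have "(\<Sum>a\<in>I. w a * (1 - m a)) \<le> (\<Sum>a\<in>I. w a * (c powr (- \<tau>) * B))"
    using w tail_int by (intro sum_mono mult_left_mono) auto
  moreover have "(\<Sum>a\<in>I. w a * (c powr (- \<tau>) * B)) = c powr (- \<tau>) * B"
    using w by (simp flip: sum_distrib_right)
  ultimately show ?thesis by (simp add: mult_ac)
qed

section \<open>Moments of row sums\<close>

context degenerate_kernel
begin

definition moment_K :: "real \<Rightarrow> real" where
  "moment_K r = (\<integral>(x, y). \<bar>K x y\<bar> powr r \<partial>M2)"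

lemma moment_K_nonneg: "0 \<le> moment_K r"
  unfolding moment_K_def by (rule Bochner_Integration.integral_nonneg) auto

text \<open>Given \<open>w k\<close> the summands are independent and centred, so the moment should
  grow like \<open>m powr (1 + \<tau>)\<close> in their number \<open>m\<close>. Adding one summand
  costs a factor \<open>1 + 12 * e\<close> and a term of order \<open>e powr (- \<tau>)\<close>; for
  \<open>e\<close> of order \<open>1 / m\<close> both fit into the increment of
  \<open>m powr (1 + \<tau>)\<close>.\<close>

lemma row_sum_moment_le:
  assumes \<tau>: "0 < \<tau>" "\<tau> \<le> 1 / 2"
    and K_int: "integrable M2 (\<lambda>(x, y). \<bar>K x y\<bar> powr (2 + 2 * \<tau>))"
    and I: "finite I" "k \<in> I" and J: "J \<subseteq> I - {k}"
  shows "integrable (iid_space M I) (\<lambda>w. \<bar>\<Sum>l\<in>J. K (w k) (w l)\<bar> powr (2 + 2 * \<tau>)) \<and>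
    (\<integral>w. \<bar>\<Sum>l\<in>J. K (w k) (w l)\<bar> powr (2 + 2 * \<tau>) \<partial>iid_space M I)
      \<le> 144 * real (card J) powr (1 + \<tau>) * moment_K (2 + 2 * \<tau>)"
proof -
  have "finite J" using I J finite_subset by blast
  from this J show ?thesis
  proof (induction J rule: finite_induct)
    case empty
    then show ?case by simp
  next
    case (insert j J)
    define r where "r = 2 + 2 * \<tau>"
    define T where "T w = (\<Sum>l\<in>J. K (w k) (w l))" for w :: "nat \<Rightarrow> 'a"
    define b where "b w = K (w k) (w j)" for w :: "nat \<Rightarrow> 'a"
    have j: "j \<in> I" "j \<noteq> k" "j \<notin> J" and JI: "J \<subseteq> I - {k}" using insert by auto
    have IH: "integrable (iid_space M I) (\<lambda>w. \<bar>T w\<bar> powr r)"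
      "(\<integral>w. \<bar>T w\<bar> powr r \<partial>iid_space M I) \<le> 144 * real (card J) powr (1 + \<tau>) * moment_K r"
      using insert.IH[OF JI] by (auto simp: T_def r_def)
    have T_meas [measurable]: "T \<in> borel_measurable (iid_space M I)"
      unfolding T_def using JI I
      by (intro borel_measurable_sum K_coords_meas) (auto simp: offdiag_def)
    have b_meas [measurable]: "b \<in> borel_measurable (iid_space M I)"
      unfolding b_def using j I by (intro K_coords_meas) (auto simp: offdiag_def)
    have b_int: "integrable (iid_space M I) (\<lambda>w. \<bar>b w\<bar> powr r)"
      unfolding b_def r_def using j I K_int by (intro integrable_two_coords) auto
    have b_mom: "(\<integral>w. \<bar>b w\<bar> powr r \<partial>iid_space M I) = moment_K r"
      unfolding b_def moment_K_def using j I by (intro integral_two_coords) auto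
    have sum_eq: "(\<Sum>l\<in>insert j J. K (w k) (w l)) = T w + b w" for w
      using insert by (simp add: T_def b_def)
    have int: "integrable (iid_space M I) (\<lambda>w. \<bar>T w + b w\<bar> powr r)"
      using \<tau> IH(1) b_int by (intro integrable_powr_add) (auto simp: r_def)
    \<comment> \<open>Chosen so that \<open>12 * e = 1 / (2 * (card J + 1))\<close>: the factor
      \<open>1 + 12 * e\<close> then uses up half of the available increment.\<close>
    define e where "e = 1 / (24 * real (card J + 1))"
    have e: "0 < e" by (simp add: e_def)
    define F where "F w = \<bar>T w\<bar> powr (2 * \<tau>) * T w" for w
    have F_meas [measurable]: "F \<in> borel_measurable (iid_space M I)" unfolding F_def by measurable
    have Fb_int: "integrable (iid_space M I) (\<lambda>w. b w *\<^sub>R F w)"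
    proof (rule Bochner_Integration.integrable_bound)
      show "integrable (iid_space M I) (\<lambda>w. \<bar>T w\<bar> powr r + \<bar>b w\<bar> powr r)" using IH b_int by simp
      have "\<bar>x\<bar> * (\<bar>y\<bar> powr (2 * \<tau>) * \<bar>y\<bar>) \<le> \<bar>y\<bar> powr r + \<bar>x\<bar> powr r" for x y :: real
      proof (cases "\<bar>x\<bar> \<le> \<bar>y\<bar>")
        case True
        then have "\<bar>x\<bar> * (\<bar>y\<bar> powr (2 * \<tau>) * \<bar>y\<bar>) \<le> \<bar>y\<bar> * (\<bar>y\<bar> powr (2 * \<tau>) * \<bar>y\<bar>)"
          by (intro mult_right_mono) auto
        also have "\<dots> = \<bar>y\<bar> powr r" unfolding r_def abs_powr_2_plus by (simp add: power2_eq_square)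
        finally show ?thesis by (smt (verit) powr_ge_zero)
      next
        case False
        then have "\<bar>y\<bar> powr (2 * \<tau>) \<le> \<bar>x\<bar> powr (2 * \<tau>)" using \<tau> by (intro powr_mono2) auto
        then have "\<bar>x\<bar> * (\<bar>y\<bar> powr (2 * \<tau>) * \<bar>y\<bar>) \<le> \<bar>x\<bar> * (\<bar>x\<bar> powr (2 * \<tau>) * \<bar>x\<bar>)"
          using False by (intro mult_left_mono mult_mono) auto
        also have "\<dots> = \<bar>x\<bar> powr r" unfolding r_def abs_powr_2_plus by (simp add: power2_eq_square)
        finally show ?thesis by (smt (verit) powr_ge_zero)
      qed
      then show "AE w in iid_space M I. norm (b w *\<^sub>R F w) \<le> norm (\<bar>T w\<bar> powr r + \<bar>b w\<bar> powr r)"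
        unfolding F_def by (intro AE_I2) (simp add: abs_mult)
    qed measurable
    \<comment> \<open>\<open>F\<close> involves the earlier summands only, so resampling
      \<open>j\<close> integrates \<open>K (w k) (w j)\<close> to zero while \<open>w k\<close>
      stays fixed.\<close>
    have zero: "(\<integral>w. b w *\<^sub>R F w \<partial>iid_space M I) = 0"
    proof (rule integral_pull_out_zero[OF I(1) j(1) Fb_int])
      fix w x
      have "T (w(j := x)) = T w" unfolding T_def using j JI by (intro sum.cong) auto
      then show "F (w(j := x)) = F w" by (simp add: F_def)
    next
      fix w assume w: "w \<in> space (iid_space M I)"
      then have "w k \<in> space M" using I by (intro coord_in_space)
      then show "integrable M (\<lambda>x. b (w(j := x)))" "(\<integral>x. b (w(j := x)) \<partial>M) = 0"
        using j K_section_integrable K_degenerate by (auto simp: b_def)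
    qed
    have "(\<integral>w. \<bar>T w + b w\<bar> powr r \<partial>iid_space M I)
      \<le> (\<integral>w. \<bar>T w\<bar> powr r + 2 * (1 + \<tau>) * (b w *\<^sub>R F w)
          + 12 * (e * \<bar>T w\<bar> powr r + (e powr (- \<tau>) + 1) * \<bar>b w\<bar> powr r) \<partial>iid_space M I)"
    proof (rule integral_mono[OF int])
      show "integrable (iid_space M I) (\<lambda>w. \<bar>T w\<bar> powr r + 2 * (1 + \<tau>) * (b w *\<^sub>R F w)
          + 12 * (e * \<bar>T w\<bar> powr r + (e powr (- \<tau>) + 1) * \<bar>b w\<bar> powr r))"
        using IH(1) b_int Fb_int by simp
      fix w
      have "\<bar>T w + b w\<bar> powr r \<le> \<bar>T w\<bar> powr r + 2 * (1 + \<tau>) * (b w *\<^sub>R F w)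
        + 12 * (\<bar>T w\<bar> powr (2 * \<tau>) * (b w)\<^sup>2 + \<bar>b w\<bar> powr r)"
        using abs_add_powr_le[OF \<tau>, of "T w" "b w"] by (simp add: r_def F_def mult_ac)
      moreover have "\<bar>T w\<bar> powr (2 * \<tau>) * (b w)\<^sup>2 \<le> e * \<bar>T w\<bar> powr r + e powr (- \<tau>) * \<bar>b w\<bar> powr r"
        using powr_mult_sq_le[of \<tau> e "T w" "b w"] \<tau> e by (simp add: r_def)
      ultimately show "\<bar>T w + b w\<bar> powr r \<le> \<bar>T w\<bar> powr r + 2 * (1 + \<tau>) * (b w *\<^sub>R F w)
          + 12 * (e * \<bar>T w\<bar> powr r + (e powr (- \<tau>) + 1) * \<bar>b w\<bar> powr r)"
        by (simp add: distrib_right)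
    qed
    also have "\<dots> = (1 + 12 * e) * (\<integral>w. \<bar>T w\<bar> powr r \<partial>iid_space M I) + 12 * (e powr (- \<tau>) + 1) * moment_K r"
      using IH(1) b_int Fb_int zero b_mom by simp (simp add: algebra_simps)
    also have "\<dots> \<le> (1 + 12 * e) * (144 * real (card J) powr (1 + \<tau>) * moment_K r)
        + 12 * (e powr (- \<tau>) + 1) * moment_K r"
      using IH(2) e by (intro add_right_mono mult_left_mono) auto
    also have "\<dots> = ((1 + 12 * e) * (144 * real (card J) powr (1 + \<tau>)) + 12 * (e powr (- \<tau>) + 1)) * moment_K r"
      by (simp add: algebra_simps)
    also have "\<dots> \<le> (144 * real (card J + 1) powr (1 + \<tau>)) * moment_K r"
    proof (rule mult_right_mono[OF _ moment_K_nonneg])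
      define n where "n = real (card J + 1)"
      have n: "1 \<le> n" by (simp add: n_def)
      define m where "m = real (card J)"
      have m: "0 \<le> m" "n = m + 1" by (auto simp: m_def n_def)
      have e1: "e powr (- \<tau>) \<le> 5 * n powr \<tau>"
      proof -
        have "e powr (- \<tau>) = (24 * n) powr \<tau>"
          using n by (simp add: e_def n_def powr_divide powr_minus)
        also have "\<dots> = 24 powr \<tau> * n powr \<tau>" using n by (simp add: powr_mult)
        also have "24 powr \<tau> \<le> 25 powr (1 / 2)" using \<tau> by (intro order_trans[OF powr_mono powr_mono2]) auto
        also have "25 powr (1 / 2) = sqrt (5\<^sup>2)" by (simp add: powr_half_sqrt)
        also have "\<dots> = 5" by simp
        finally show ?thesis using n by (simp add: mult_right_mono)
      qed
      have e2: "12 * e * m powr (1 + \<tau>) \<le> (1 / 2) * n powr \<tau>"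
      proof -
        have "12 * e * m powr (1 + \<tau>) = (1 / 2) * (m / n) * m powr \<tau>"
        proof -
          have "e = 1 / (24 * n)" by (simp add: e_def n_def)
          then show ?thesis using n m(1) by (cases "m = 0") (simp_all add: powr_add)
        qed
        also have "\<dots> \<le> (1 / 2) * 1 * n powr \<tau>"
          using n m \<tau> by (intro mult_mono powr_mono2) auto
        finally show ?thesis by simp
      qed
      have e3: "m powr (1 + \<tau>) + n powr \<tau> \<le> n powr (1 + \<tau>)"
      proof -
        have "m powr (1 + \<tau>) = m * m powr \<tau>" using m by (cases "m = 0") (auto simp: powr_add)
        also have "\<dots> \<le> m * n powr \<tau>" using m \<tau> by (intro mult_left_mono powr_mono2) auto
        finally have "m powr (1 + \<tau>) + n powr \<tau> \<le> n * n powr \<tau>" by (simp add: m algebra_simps)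
        also have "\<dots> = n powr (1 + \<tau>)" using n by (simp add: powr_add)
        finally show ?thesis .
      qed
      have e4: "1 \<le> n powr \<tau>" using n \<tau> by (intro ge_one_powr_ge_zero) auto
      \<comment> \<open>The budget that fixes the constant:
        \<open>144 / 2 + 12 * 5 + 12 = 144\<close> copies of \<open>n powr \<tau>\<close>, paid by
        \<open>m powr (1 + \<tau>) + n powr \<tau> \<le> n powr (1 + \<tau>)\<close>.\<close>
      have "(1 + 12 * e) * (144 * m powr (1 + \<tau>)) + 12 * (e powr (- \<tau>) + 1)
        = 144 * m powr (1 + \<tau>) + 144 * (12 * e * m powr (1 + \<tau>)) + 12 * e powr (- \<tau>) + 12"
        by (simp add: algebra_simps)
      also have "\<dots> \<le> 144 * n powr (1 + \<tau>)" using e1 e2 e3 e4 by linarith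
      finally show "(1 + 12 * e) * (144 * real (card J) powr (1 + \<tau>)) + 12 * (e powr (- \<tau>) + 1)
        \<le> 144 * real (card J + 1) powr (1 + \<tau>)"
        by (simp add: m_def n_def)
    qed
    finally show ?case using int insert.hyps unfolding sum_eq r_def by simp
  qed
qed

end

section \<open>Characteristic functions of martingale sums\<close>

context prob_space
begin

text \<open>The factor \<open>exp (t^2 * q / 2)\<close> compensates the conditional variance. Put
  \<open>u = t^2 * q / 2\<close> and \<open>G = F * exp u\<close>. Since \<open>D\<close> has
  conditional mean zero and conditional variance \<open>q\<close>, expanding \<open>iexp\<close> to
  second order and conditioning leaves \<open>G * (1 - u)\<close>, which differs from
  \<open>F = G * exp (- u)\<close> by order \<open>u powr (1 + \<tau>)\<close>. The remainders of
  \<open>iexp\<close> and of \<open>exp (- u)\<close> have the same bound, hence the factor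
  2.\<close>

lemma martingale_step:
  fixes D :: "(nat \<Rightarrow> 'a) \<Rightarrow> real" and F :: "(nat \<Rightarrow> 'a) \<Rightarrow> complex"
  assumes \<tau>: "0 < \<tau>" "\<tau> \<le> 1 / 2" and I: "finite I" "k \<in> I"
    and D_meas: "D \<in> borel_measurable (iid_space M I)"
    and D_int: "integrable (iid_space M I) (\<lambda>w. \<bar>D w\<bar> powr (2 + 2 * \<tau>))"
    and D_sec: "\<And>w. w \<in> space (iid_space M I) \<Longrightarrow> integrable M (\<lambda>x. (D (w(k := x)))\<^sup>2)"
    and D_mean: "\<And>w. w \<in> space (iid_space M I) \<Longrightarrow> (\<integral>x. D (w(k := x)) \<partial>M) = 0"
    and q: "\<And>w. w \<in> space (iid_space M I) \<Longrightarrow> q w = (\<integral>x. (D (w(k := x)))\<^sup>2 \<partial>M)"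
    and F_meas: "F \<in> borel_measurable (iid_space M I)"
    and F_indep: "\<And>w x. w \<in> space (iid_space M I) \<Longrightarrow> x \<in> space M \<Longrightarrow> F (w(k := x)) = F w"
    and F_bound: "\<And>w. w \<in> space (iid_space M I) \<Longrightarrow> cmod (F w) * exp (t\<^sup>2 * q w / 2) \<le> C"
  shows "cmod ((\<integral>w. F w * exp (t\<^sup>2 * q w / 2) * iexp (t * D w) \<partial>iid_space M I) - (\<integral>w. F w \<partial>iid_space M I))
    \<le> 2 * C * \<bar>t\<bar> powr (2 + 2 * \<tau>) * (\<integral>w. \<bar>D w\<bar> powr (2 + 2 * \<tau>) \<partial>iid_space M I)"
proof -
  let ?P = "iid_space M I"
  define r where "r = 2 + 2 * \<tau>"
  have r: "2 \<le> r" "r \<le> 3" using \<tau> by (auto simp: r_def)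
  interpret P: prob_space ?P by (rule prob_space_iid)
  have D_r: "integrable ?P (\<lambda>w. \<bar>D w\<bar> powr r)" using D_int by (simp add: r_def)
  have D2: "integrable ?P (\<lambda>w. (D w)\<^sup>2)" by (rule P.integrable_square_of_powr[OF r(1) D_meas D_r])
  have D1: "integrable ?P D" by (rule P.integrable_of_square[OF D_meas D2])
  have sec: "integrable M (\<lambda>x. D (w(k := x)))" if "w \<in> space ?P" for w
  proof (rule integrable_of_square[OF _ D_sec[OF that]])
    show "(\<lambda>x. D (w(k := x))) \<in> borel_measurable M"
    proof (rule measurable_compose[OF _ D_meas])
      show "(\<lambda>x. w(k := x)) \<in> M \<rightarrow>\<^sub>M ?P"
        using measurable_compose[OF measurable_Pair1'[OF that] measurable_upd[OF I(2)]] by simp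
    qed
  qed
  have q_int: "integrable ?P q"
    using integrable_integral_upd[OF I D2] by (subst Bochner_Integration.integrable_cong[OF refl q]) auto
  have q_meas [measurable]: "q \<in> borel_measurable ?P" using q_int by simp
  have q_nonneg: "0 \<le> q w" if "w \<in> space ?P" for w
    using q[OF that] by simp
  have q_indep: "q (w(k := x)) = q w" if "w \<in> space ?P" "x \<in> space M" for w x
    using q[OF that(1)] q[OF upd_in_space[OF I(2) that]] by simp
  note [measurable] = D_meas F_meas
  define u where "u w = t\<^sup>2 * q w / 2" for w
  have u_meas [measurable]: "u \<in> borel_measurable ?P" unfolding u_def by measurable
  have u_nonneg: "0 \<le> u w" if "w \<in> space ?P" for w using q_nonneg[OF that] by (simp add: u_def)
  define G where "G w = F w * exp (u w)" for w
  have G_meas [measurable]: "G \<in> borel_measurable ?P" unfolding G_def by measurable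
  have G_indep: "G (w(k := x)) = G w" if "w \<in> space ?P" "x \<in> space M" for w x
    using F_indep[OF that] q_indep[OF that] by (simp add: G_def u_def)
  have G_bound: "cmod (G w) \<le> C" if "w \<in> space ?P" for w
    using F_bound[OF that] by (simp add: G_def u_def norm_mult)
  have C: "0 \<le> C" using P.not_empty G_bound norm_ge_zero order_trans by blast
  have F_bound': "cmod (F w) \<le> C" if "w \<in> space ?P" for w
  proof -
    have "cmod (F w) * 1 \<le> cmod (F w) * exp (u w)"
      using u_nonneg[OF that] by (intro mult_left_mono) auto
    then show ?thesis using F_bound[OF that] by (simp add: u_def)
  qed
  have bounded_mult: "integrable ?P (\<lambda>w. f w *\<^sub>R G w)" if "integrable ?P f" for f :: "_ \<Rightarrow> real"
  proof (rule Bochner_Integration.integrable_bound)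
    show "integrable ?P (\<lambda>w. C * f w)" using that by simp
    show "(\<lambda>w. f w *\<^sub>R G w) \<in> borel_measurable ?P" using that by simp
    show "AE w in ?P. norm (f w *\<^sub>R G w) \<le> norm (C * f w)"
    proof (rule AE_I2)
      fix w assume "w \<in> space ?P"
      from mult_left_mono[OF G_bound[OF this], of "\<bar>f w\<bar>"]
      show "norm (f w *\<^sub>R G w) \<le> norm (C * f w)" using C by (simp add: abs_mult mult.commute)
    qed
  qed
  have G_int: "integrable ?P G" using bounded_mult[of "\<lambda>_. 1"] by simp
  have F_int: "integrable ?P F"
    using F_bound' by (intro P.integrable_const_bound[of _ C] AE_I2) auto
  have DG: "(\<integral>w. D w *\<^sub>R G w \<partial>?P) = 0"
    by (rule integral_pull_out_zero[OF I bounded_mult[OF D1] G_indep sec D_mean])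
  have D2G: "(\<integral>w. (D w)\<^sup>2 *\<^sub>R G w \<partial>?P) = (\<integral>w. q w *\<^sub>R G w \<partial>?P)"
    by (rule integral_pull_out(1)[OF I bounded_mult[OF D2] G_indep D_sec q[symmetric]])
  define R where "R w = iexp (t * D w) - (1 + \<i> * (t * D w) - (t * D w)\<^sup>2 / 2)" for w
  have R_meas [measurable]: "R \<in> borel_measurable ?P" unfolding R_def by measurable
  have R_bound: "cmod (G w * R w) \<le> C * \<bar>t\<bar> powr r * \<bar>D w\<bar> powr r" if "w \<in> space ?P" for w
  proof -
    have "cmod (R w) \<le> \<bar>t * D w\<bar> powr r"
      unfolding R_def using iexp_taylor2_powr[OF r, of "t * D w"] by simp
    then have "cmod (G w) * cmod (R w) \<le> C * \<bar>t * D w\<bar> powr r"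
      using G_bound[OF that] C by (intro mult_mono) auto
    then show ?thesis by (simp add: norm_mult abs_mult powr_mult mult.assoc)
  qed
  have GR_int: "integrable ?P (\<lambda>w. G w * R w)"
  proof (rule Bochner_Integration.integrable_bound)
    show "integrable ?P (\<lambda>w. C * \<bar>t\<bar> powr r * \<bar>D w\<bar> powr r)" using D_r by simp
    show "AE w in ?P. norm (G w * R w) \<le> norm (C * \<bar>t\<bar> powr r * \<bar>D w\<bar> powr r)"
      using R_bound C by (intro AE_I2) (simp add: abs_mult)
  qed measurable
  have GR: "cmod (\<integral>w. G w * R w \<partial>?P) \<le> C * \<bar>t\<bar> powr r * (\<integral>w. \<bar>D w\<bar> powr r \<partial>?P)"
  proof -
    have "cmod (\<integral>w. G w * R w \<partial>?P) \<le> (\<integral>w. cmod (G w * R w) \<partial>?P)" by (rule integral_norm_bound)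
    also have "\<dots> \<le> (\<integral>w. C * \<bar>t\<bar> powr r * \<bar>D w\<bar> powr r \<partial>?P)"
      using D_r GR_int R_bound by (intro integral_mono integrable_norm) auto
    finally show ?thesis by simp
  qed
  define S where "S w = G w * (1 - u w) - F w" for w
  \<comment> \<open>Conditional Jensen inequality. The sections of the power of \<open>D\<close> are
    integrable only almost everywhere, so the bound is an almost sure one.\<close>
  have q_jensen: "AE w in ?P. q w powr (1 + \<tau>) \<le> (\<integral>x. \<bar>D (w(k := x))\<bar> powr r \<partial>M)"
  proof -
    have "AE w in ?P. integrable M (\<lambda>x. \<bar>D (w(k := x))\<bar> powr r)"
      using pair_sigma_finite.AE_integrable_fst'[OF pair_sigma_finite_iid integrable_upd[OF I D_r]] by simp
    then show ?thesis
    proof (rule AE_mp, intro AE_I2 impI)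
      fix w assume w: "w \<in> space ?P" and int: "integrable M (\<lambda>x. \<bar>D (w(k := x))\<bar> powr r)"
      have "((D (w(k := x)))\<^sup>2) powr (1 + \<tau>) = \<bar>D (w(k := x))\<bar> powr r" for x
        by (simp add: powr_power2_eq r_def)
      then show "q w powr (1 + \<tau>) \<le> (\<integral>x. \<bar>D (w(k := x))\<bar> powr r \<partial>M)"
        using powr_expectation_le[of "1 + \<tau>" "\<lambda>x. (D (w(k := x)))\<^sup>2"] \<tau> D_sec[OF w] int q[OF w] by simp
    qed
  qed
  have q_pow_int: "integrable ?P (\<lambda>w. q w powr (1 + \<tau>))"
  proof (rule Bochner_Integration.integrable_bound)
    show "integrable ?P (\<lambda>w. \<integral>x. \<bar>D (w(k := x))\<bar> powr r \<partial>M)"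
      using integrable_integral_upd[OF I D_r] .
    show "AE w in ?P. norm (q w powr (1 + \<tau>)) \<le> norm (\<integral>x. \<bar>D (w(k := x))\<bar> powr r \<partial>M)"
      using q_jensen by eventually_elim (simp add: abs_of_nonneg)
  qed measurable
  have q_pow: "(\<integral>w. q w powr (1 + \<tau>) \<partial>?P) \<le> (\<integral>w. \<bar>D w\<bar> powr r \<partial>?P)"
    unfolding integral_upd[OF I D_r]
    by (rule integral_mono_AE[OF q_pow_int integrable_integral_upd[OF I D_r] q_jensen])
  have S_bound: "cmod (S w) \<le> C * \<bar>t\<bar> powr r * q w powr (1 + \<tau>)" if w: "w \<in> space ?P" for w
  proof -
    have "S w = - G w * (exp (- u w) - 1 + u w)"
      by (simp add: S_def G_def exp_of_real[symmetric] exp_minus algebra_simps)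
    then have "cmod (S w) = cmod (G w) * \<bar>exp (- u w) - 1 + u w\<bar>"
      by (simp only: norm_mult norm_minus_cancel) (metis of_real_1 of_real_add of_real_diff norm_of_real)
    also have "\<dots> \<le> C * (u w) powr (1 + \<tau>)"
      using G_bound[OF w] C \<tau> u_nonneg[OF w] by (intro mult_mono exp_neg_taylor1_powr) auto
    also have "\<dots> \<le> C * (t\<^sup>2 * q w) powr (1 + \<tau>)"
      using C \<tau> q_nonneg[OF w] by (intro mult_left_mono powr_mono2) (auto simp: u_def)
    also have "\<dots> = C * \<bar>t\<bar> powr r * q w powr (1 + \<tau>)"
      using q_nonneg[OF w] by (simp add: powr_mult powr_power2_eq r_def)
    finally show ?thesis .
  qed
  have S_int: "integrable ?P S"
  proof -
    have "integrable ?P (\<lambda>w. G w - (t\<^sup>2 / 2) *\<^sub>R (q w *\<^sub>R G w) - F w)"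
      by (intro Bochner_Integration.integrable_diff integrable_scaleR_right bounded_mult q_int G_int F_int)
    moreover have "S w = G w - (t\<^sup>2 / 2) *\<^sub>R (q w *\<^sub>R G w) - F w" for w
      by (simp add: S_def u_def scaleR_conv_of_real algebra_simps)
    ultimately show ?thesis by presburger
  qed
  have S: "cmod (\<integral>w. S w \<partial>?P) \<le> C * \<bar>t\<bar> powr r * (\<integral>w. \<bar>D w\<bar> powr r \<partial>?P)"
  proof -
    have "cmod (\<integral>w. S w \<partial>?P) \<le> (\<integral>w. cmod (S w) \<partial>?P)" by (rule integral_norm_bound)
    also have "\<dots> \<le> (\<integral>w. C * \<bar>t\<bar> powr r * q w powr (1 + \<tau>) \<partial>?P)"
      using q_pow_int S_int S_bound by (intro integral_mono integrable_norm) auto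
    also have "\<dots> = C * \<bar>t\<bar> powr r * (\<integral>w. q w powr (1 + \<tau>) \<partial>?P)" by simp
    also have "\<dots> \<le> C * \<bar>t\<bar> powr r * (\<integral>w. \<bar>D w\<bar> powr r \<partial>?P)"
      using q_pow C by (intro mult_left_mono) auto
    finally show ?thesis .
  qed
  define c\<^sub>1 c\<^sub>2 where "c\<^sub>1 = \<i> * t" and "c\<^sub>2 = complex_of_real (t\<^sup>2 / 2)"
  have "F w * exp (t\<^sup>2 * q w / 2) * iexp (t * D w)
    = G w * R w + S w + F w + c\<^sub>1 * (D w *\<^sub>R G w) - c\<^sub>2 * ((D w)\<^sup>2 *\<^sub>R G w) + c\<^sub>2 * (q w *\<^sub>R G w)" for w
    unfolding R_def S_def u_def[symmetric] G_def[symmetric] c\<^sub>1_def c\<^sub>2_def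
    by (simp add: u_def scaleR_conv_of_real power_mult_distrib algebra_simps)
  then have "(\<integral>w. F w * exp (t\<^sup>2 * q w / 2) * iexp (t * D w) \<partial>?P)
    = (\<integral>w. G w * R w + S w + F w + c\<^sub>1 * (D w *\<^sub>R G w) - c\<^sub>2 * ((D w)\<^sup>2 *\<^sub>R G w)
        + c\<^sub>2 * (q w *\<^sub>R G w) \<partial>?P)"
    by presburger
  also have "\<dots> = (\<integral>w. G w * R w \<partial>?P) + (\<integral>w. S w \<partial>?P) + (\<integral>w. F w \<partial>?P) + c\<^sub>1 * (\<integral>w. D w *\<^sub>R G w \<partial>?P)
    - c\<^sub>2 * (\<integral>w. (D w)\<^sup>2 *\<^sub>R G w \<partial>?P) + c\<^sub>2 * (\<integral>w. q w *\<^sub>R G w \<partial>?P)"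
    using GR_int S_int F_int bounded_mult[OF D1] bounded_mult[OF D2] bounded_mult[OF q_int]
    by (simp del: mult_scaleR_right)
  finally have "(\<integral>w. F w * exp (t\<^sup>2 * q w / 2) * iexp (t * D w) \<partial>?P) - (\<integral>w. F w \<partial>?P)
    = (\<integral>w. G w * R w \<partial>?P) + (\<integral>w. S w \<partial>?P)"
    using DG D2G by simp
  then have "cmod ((\<integral>w. F w * exp (t\<^sup>2 * q w / 2) * iexp (t * D w) \<partial>?P) - (\<integral>w. F w \<partial>?P))
    \<le> cmod (\<integral>w. G w * R w \<partial>?P) + cmod (\<integral>w. S w \<partial>?P)"
    by (simp add: norm_triangle_ineq)
  then show ?thesis using GR S unfolding r_def by linarith
qed

text \<open>Telescoping the single steps shows that the compensated exponential keeps a mean close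
  to 1. To keep it bounded, the differences are switched off once the accumulated conditional
  variance exceeds 2; where that happens the variance misses its target 1 by more than 1, so the
  first error term pays for it.\<close>

theorem martingale_char_bound:
  fixes D :: "nat \<Rightarrow> (nat \<Rightarrow> 'a) \<Rightarrow> real" and n :: nat
  defines "I \<equiv> {1..n}"
  assumes \<tau>: "0 < \<tau>" "\<tau> \<le> 1 / 2"
    and D_meas: "\<And>k. k \<in> I \<Longrightarrow> D k \<in> borel_measurable (iid_space M I)"
    and D_int: "\<And>k. k \<in> I \<Longrightarrow> integrable (iid_space M I) (\<lambda>w. \<bar>D k w\<bar> powr (2 + 2 * \<tau>))"
    and D_sec: "\<And>k w. k \<in> I \<Longrightarrow> w \<in> space (iid_space M I) \<Longrightarrow> integrable M (\<lambda>x. (D k (w(k := x)))\<^sup>2)"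
    and D_mean: "\<And>k w. k \<in> I \<Longrightarrow> w \<in> space (iid_space M I) \<Longrightarrow> (\<integral>x. D k (w(k := x)) \<partial>M) = 0"
    and D_adapted: "\<And>k j w x. k \<in> I \<Longrightarrow> j \<in> I \<Longrightarrow> k < j \<Longrightarrow> D k (w(j := x)) = D k w"
  defines "q k w \<equiv> \<integral>x. (D k (w(k := x)))\<^sup>2 \<partial>M"
  shows "cmod ((\<integral>w. iexp (t * (\<Sum>k\<in>I. D k w)) \<partial>iid_space M I) - exp (- (t\<^sup>2) / 2))
    \<le> (2 + t\<^sup>2 * exp (t\<^sup>2)) * (\<integral>w. \<bar>(\<Sum>k\<in>I. q k w) - 1\<bar> \<partial>iid_space M I)
      + 2 * exp (t\<^sup>2) * \<bar>t\<bar> powr (2 + 2 * \<tau>) *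
        (\<Sum>k\<in>I. \<integral>w. \<bar>D k w\<bar> powr (2 + 2 * \<tau>) \<partial>iid_space M I)"
proof -
  let ?P = "iid_space M I"
  define r where "r = 2 + 2 * \<tau>"
  interpret P: prob_space ?P by (rule prob_space_iid)
  have finI: "finite I" by (simp add: I_def)
  have D2: "integrable ?P (\<lambda>w. (D k w)\<^sup>2)" if "k \<in> I" for k
    using \<tau> by (intro P.integrable_square_of_powr[OF _ D_meas D_int] that) auto
  have q_int: "integrable ?P (q k)" if "k \<in> I" for k
    unfolding q_def using integrable_integral_upd[OF finI that D2[OF that]] .
  have q_meas [measurable]: "q k \<in> borel_measurable ?P" if "k \<in> I" for k
    using q_int[OF that] by simp
  have q_nonneg: "0 \<le> q k w" for k w by (simp add: q_def)
  \<comment> \<open>The case \<open>k = j\<close> is included: \<open>q k\<close> is predictable, it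
    depends on coordinates below \<open>k\<close> only.\<close>
  have q_indep: "q k (w(j := x)) = q k w" if "k \<in> I" "j \<in> I" "k \<le> j" for k j w x
  proof (cases "k = j")
    case False
    then have "D k (w(j := x, k := y)) = D k (w(k := y))" for y
      using that D_adapted[of k j "w(k := y)" x] by (simp add: fun_upd_twist[of j k])
    then show ?thesis by (simp add: q_def)
  qed (simp add: q_def)
  define A where "A k w = (\<Sum>i\<in>{1..k}. q i w)" for k w
  \<comment> \<open>Predictable stopping: \<open>A k\<close> contains \<open>q k\<close> but does
    not depend on coordinate \<open>k\<close>, so the indicator may multiply \<open>D k\<close>
    without changing its conditional mean zero.\<close>
  define \<iota> where "\<iota> k w = (of_bool (A k w \<le> 2) :: real)" for k w
  define S where "S k w = (\<Sum>i\<in>{1..k}. D i w * \<iota> i w)" for k w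
  define V where "V k w = (\<Sum>i\<in>{1..k}. q i w * \<iota> i w)" for k w
  define W where "W k w = exp (t\<^sup>2 * V k w / 2) * iexp (t * S k w)" for k w
  have sub: "{1..k} \<subseteq> I" if "k \<le> n" for k using that by (auto simp: I_def)
  have A_meas [measurable]: "A k \<in> borel_measurable ?P" if "k \<le> n" for k
    unfolding A_def using sub[OF that] q_meas by (intro borel_measurable_sum) auto
  have \<iota>_meas: "\<iota> k \<in> borel_measurable ?P" if "k \<le> n" for k
    unfolding \<iota>_def using A_meas[OF that] by measurable
  have S_meas: "S k \<in> borel_measurable ?P" if "k \<le> n" for k
    unfolding S_def using sub[OF that] that
    by (intro borel_measurable_sum borel_measurable_times D_meas \<iota>_meas) auto
  have V_meas: "V k \<in> borel_measurable ?P" if "k \<le> n" for k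
    unfolding V_def using sub[OF that] that
    by (intro borel_measurable_sum borel_measurable_times q_meas \<iota>_meas) auto
  have A_indep: "A k (w(j := x)) = A k w" if "j \<in> I" "k \<le> j" for k j w x
    unfolding A_def using that by (intro sum.cong refl q_indep) (auto simp: I_def)
  have V_indep: "V k (w(j := x)) = V k w" if "j \<in> I" "k \<le> j" for k j w x
    unfolding V_def \<iota>_def using that by (intro sum.cong refl) (auto simp: I_def q_indep A_indep)
  have S_indep: "S k (w(j := x)) = S k w" if "j \<in> I" "k < j" for k j w x
    unfolding S_def \<iota>_def using that by (intro sum.cong refl) (auto simp: I_def D_adapted A_indep)
  have V_nonneg: "0 \<le> V k w" for k w
    unfolding V_def \<iota>_def by (intro sum_nonneg) (simp add: q_nonneg)
  have V_le_A: "V k w \<le> A k w" for k w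
    unfolding V_def A_def \<iota>_def by (intro sum_mono) (simp add: q_nonneg)
  have V_le_2: "V k w \<le> 2" for k w
  proof (induction k)
    case (Suc k)
    have "V (Suc k) w = V k w + q (Suc k) w * \<iota> (Suc k) w" by (simp add: V_def)
    then show ?case using Suc V_le_A[of "Suc k" w] by (cases "A (Suc k) w \<le> 2") (auto simp: \<iota>_def)
  qed (simp add: V_def)
  have exp_V: "exp (t\<^sup>2 * V k w / 2) \<le> exp (t\<^sup>2)" for k w
    using mult_left_mono[OF V_le_2[of k w], of "t\<^sup>2"] by simp
  have W_norm: "cmod (W k w) \<le> exp (t\<^sup>2)" for k w
    unfolding W_def norm_mult norm_of_real norm_exp_i_times using exp_V[of k w] by simp
  have W_meas: "W k \<in> borel_measurable ?P" if "k \<le> n" for k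
    unfolding W_def using S_meas[OF that] V_meas[OF that] by measurable
  have W_int: "integrable ?P (W k)" if "k \<le> n" for k
    using W_norm by (intro P.integrable_const_bound[of _ "exp (t\<^sup>2)"] W_meas that) auto
  define \<epsilon> where "\<epsilon> k = 2 * exp (t\<^sup>2) * \<bar>t\<bar> powr r * (\<integral>w. \<bar>D k w\<bar> powr r \<partial>?P)" for k
  have step: "cmod ((\<integral>w. W (Suc k) w \<partial>?P) - (\<integral>w. W k w \<partial>?P)) \<le> \<epsilon> (Suc k)" if "Suc k \<le> n" for k
  proof -
    let ?k = "Suc k"
    have k: "?k \<in> I" "k \<le> n" using that by (auto simp: I_def)
    define D' where "D' w = D ?k w * \<iota> ?k w" for w
    have \<iota>_indep: "\<iota> ?k (w(?k := x)) = \<iota> ?k w" for w x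
      using k by (simp add: \<iota>_def A_indep)
    have W_eq: "W ?k w = W k w * exp (t\<^sup>2 * (q ?k w * \<iota> ?k w) / 2) * iexp (t * D' w)" for w
      unfolding W_def V_def S_def D'_def
      by (simp add: distrib_left add_divide_distrib exp_add mult_ac)
    have D'_le: "\<bar>D' w\<bar> powr r \<le> \<bar>D ?k w\<bar> powr r" for w by (simp add: D'_def \<iota>_def)
    have D'_meas: "D' \<in> borel_measurable ?P"
      unfolding D'_def using D_meas[OF k(1)] \<iota>_meas[OF that] by simp
    have D'_int: "integrable ?P (\<lambda>w. \<bar>D' w\<bar> powr r)"
    proof (rule Bochner_Integration.integrable_bound)
      show "integrable ?P (\<lambda>w. \<bar>D ?k w\<bar> powr r)" using D_int[OF k(1)] by (simp add: r_def)
      show "AE w in ?P. norm (\<bar>D' w\<bar> powr r) \<le> norm (\<bar>D ?k w\<bar> powr r)" using D'_le by simp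
    qed (use D'_meas in measurable)
    have "cmod ((\<integral>w. W k w * exp (t\<^sup>2 * (q ?k w * \<iota> ?k w) / 2) * iexp (t * D' w) \<partial>?P) - (\<integral>w. W k w \<partial>?P))
      \<le> 2 * exp (t\<^sup>2) * \<bar>t\<bar> powr (2 + 2 * \<tau>) * (\<integral>w. \<bar>D' w\<bar> powr (2 + 2 * \<tau>) \<partial>?P)"
    proof (rule martingale_step[OF \<tau> finI k(1) D'_meas D'_int[unfolded r_def]])
      fix w assume w: "w \<in> space ?P"
      show "integrable M (\<lambda>x. (D' (w(?k := x)))\<^sup>2)"
        using D_sec[OF k(1) w] by (simp add: D'_def \<iota>_indep power_mult_distrib)
      show "(\<integral>x. D' (w(?k := x)) \<partial>M) = 0"
        using D_mean[OF k(1) w] by (simp add: D'_def \<iota>_indep)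
      show "q ?k w * \<iota> ?k w = (\<integral>x. (D' (w(?k := x)))\<^sup>2 \<partial>M)"
        by (simp add: D'_def \<iota>_indep power_mult_distrib q_def) (simp add: \<iota>_def)
      have "cmod (W k w) * exp (t\<^sup>2 * (q ?k w * \<iota> ?k w) / 2) = exp (t\<^sup>2 * V ?k w / 2)"
        unfolding W_def norm_mult norm_of_real norm_exp_i_times
        by (simp add: V_def distrib_left add_divide_distrib exp_add)
      then show "cmod (W k w) * exp (t\<^sup>2 * (q ?k w * \<iota> ?k w) / 2) \<le> exp (t\<^sup>2)"
        using exp_V by simp
      show "W k (w(?k := x)) = W k w" for x
        using k by (simp add: W_def V_indep S_indep)
    qed (rule W_meas[OF k(2)])
    also have "\<dots> \<le> \<epsilon> ?k"
      unfolding \<epsilon>_def r_def[symmetric] using D'_int D_int[OF k(1)] D'_le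
      by (intro mult_left_mono integral_mono) (auto simp: r_def)
    finally show ?thesis by (simp only: W_eq[symmetric])
  qed
  have "cmod ((\<integral>w. W k w \<partial>?P) - 1) \<le> (\<Sum>i\<in>{1..k}. \<epsilon> i)" if "k \<le> n" for k
    using that
  proof (induction k)
    case 0
    then show ?case by (simp add: W_def V_def S_def P.prob_space)
  next
    case (Suc k)
    have "cmod ((\<integral>w. W (Suc k) w \<partial>?P) - 1)
      \<le> cmod ((\<integral>w. W (Suc k) w \<partial>?P) - (\<integral>w. W k w \<partial>?P)) + cmod ((\<integral>w. W k w \<partial>?P) - 1)"
      using norm_triangle_ineq[of "(\<integral>w. W (Suc k) w \<partial>?P) - (\<integral>w. W k w \<partial>?P)" "(\<integral>w. W k w \<partial>?P) - 1"]
      by simp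
    then show ?case using Suc step[of k] by simp
  qed
  from this[of n] have W1: "cmod ((\<integral>w. W n w \<partial>?P) - 1) \<le> (\<Sum>i\<in>I. \<epsilon> i)" by (simp add: I_def)
  define T where "T w = (\<Sum>k\<in>I. D k w)" for w
  define d where "d w = \<bar>A n w - 1\<bar>" for w
  define b where "b = t\<^sup>2 * exp (t\<^sup>2)"
  have T_meas: "T \<in> borel_measurable ?P" unfolding T_def by (intro borel_measurable_sum D_meas)
  have d_int: "integrable ?P d"
    unfolding d_def A_def I_def[symmetric]
    by (intro integrable_abs Bochner_Integration.integrable_diff Bochner_Integration.integrable_sum
        q_int P.integrable_const)
  have T_int: "integrable ?P (\<lambda>w. iexp (t * T w))"
    using T_meas by (intro P.integrable_const_bound[of _ 1]) auto
  \<comment> \<open>If nothing was stopped, the two terms differ by the factor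
    \<open>exp (t^2 * (A n w - 1) / 2)\<close>; otherwise \<open>d w > 1\<close> and bounds on the
    absolute values suffice.\<close>
  have pointwise: "cmod (iexp (t * T w) - exp (- (t\<^sup>2) / 2) * W n w) \<le> (2 + b) * d w" for w
  proof (cases "A n w \<le> 2")
    case True
    have "A k w \<le> A n w" if "k \<in> I" for k
      unfolding A_def using that q_nonneg by (intro sum_mono2) (auto simp: I_def)
    then have "\<iota> k w = 1" if "k \<in> I" for k
      using True that by (force simp: \<iota>_def)
    then have "S n w = T w" "V n w = A n w"
      by (simp_all add: S_def T_def V_def A_def I_def)
    then have "iexp (t * T w) - exp (- (t\<^sup>2) / 2) * W n w
      = (1 - complex_of_real (exp (t\<^sup>2 * (A n w - 1) / 2))) * iexp (t * T w)"
    proof -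
      have "exp (- (t\<^sup>2) / 2) * exp (t\<^sup>2 * A n w / 2) = exp (t\<^sup>2 * (A n w - 1) / 2)"
        unfolding mult_exp_exp by (rule arg_cong[where f = exp]) (simp add: right_diff_distrib diff_divide_distrib)
      then show ?thesis
        unfolding W_def \<open>S n w = T w\<close> \<open>V n w = A n w\<close> mult.assoc[symmetric] of_real_mult[symmetric]
        by (simp only: left_diff_distrib mult_1_left)
    qed
    then have "cmod (iexp (t * T w) - exp (- (t\<^sup>2) / 2) * W n w) = \<bar>1 - exp (t\<^sup>2 * (A n w - 1) / 2)\<bar>"
      by (simp only: norm_mult norm_exp_i_times mult_1_right) (metis of_real_1 of_real_diff norm_of_real)
    also have "\<dots> \<le> b * d w"
    proof -
      define y where "y = t\<^sup>2 * (A n w - 1) / 2"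
      have y: "y \<le> t\<^sup>2" using True mult_left_mono[of "A n w - 1" 2 "t\<^sup>2"] by (simp add: y_def)
      have "\<bar>1 - exp y\<bar> \<le> exp (t\<^sup>2) * \<bar>y\<bar>"
      proof (cases "0 \<le> y")
        case True
        have "1 \<le> exp (- y) * exp y" by (simp add: exp_minus)
        moreover have "(1 - y) * exp y \<le> exp (- y) * exp y"
          using exp_ge_add_one_self[of "- y"] by (intro mult_right_mono) auto
        ultimately have "exp y - 1 \<le> exp y * y" by (simp add: exp_minus algebra_simps)
        also have "\<dots> \<le> exp (t\<^sup>2) * y" using True y by (intro mult_right_mono) auto
        finally show ?thesis using True by simp
      next
        case False
        have "1 - exp y \<le> 1 * \<bar>y\<bar>" using exp_ge_add_one_self[of y] False by linarith
        also have "\<dots> \<le> exp (t\<^sup>2) * \<bar>y\<bar>" by (intro mult_right_mono) auto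
        finally show ?thesis using False by simp
      qed
      also have "\<dots> \<le> exp (t\<^sup>2) * (t\<^sup>2 * d w)"
        by (intro mult_left_mono) (auto simp: y_def d_def abs_mult)
      finally show ?thesis by (simp add: y_def b_def mult_ac)
    qed
    also have "\<dots> \<le> (2 + b) * d w" by (intro mult_right_mono) (auto simp: d_def)
    finally show ?thesis .
  next
    case False
    have "cmod (exp (- (t\<^sup>2) / 2) * W n w) = exp (t\<^sup>2 * (V n w - 1) / 2)"
      unfolding W_def norm_mult norm_of_real norm_exp_i_times
      by (simp add: exp_add[symmetric] algebra_simps diff_divide_distrib)
    also have "\<dots> \<le> exp (t\<^sup>2 * 1 / 2)"
      using V_le_2[of n w] by (intro exp_le_cancel_iff[THEN iffD2] divide_right_mono mult_left_mono) auto
    also have "\<dots> \<le> 1 + b"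
    proof -
      have "1 - t\<^sup>2 / 2 \<le> exp (- (t\<^sup>2 / 2))" using exp_ge_add_one_self[of "- (t\<^sup>2 / 2)"] by simp
      then have "(1 - t\<^sup>2 / 2) * exp (t\<^sup>2 / 2) \<le> exp (- (t\<^sup>2 / 2)) * exp (t\<^sup>2 / 2)"
        by (intro mult_right_mono) auto
      then have "exp (t\<^sup>2 / 2) \<le> 1 + t\<^sup>2 / 2 * exp (t\<^sup>2 / 2)" by (simp add: exp_minus algebra_simps)
      also have "t\<^sup>2 / 2 * exp (t\<^sup>2 / 2) \<le> b"
        unfolding b_def by (intro mult_mono) auto
      finally show ?thesis by simp
    qed
    finally have "cmod (iexp (t * T w) - exp (- (t\<^sup>2) / 2) * W n w) \<le> 1 + (1 + b)"
      using norm_triangle_ineq4[of "iexp (t * T w)" "exp (- (t\<^sup>2) / 2) * W n w"]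
      unfolding norm_exp_i_times by linarith
    also have "\<dots> \<le> (2 + b) * d w"
      using False mult_left_mono[of 1 "d w" "2 + b"] by (simp add: d_def b_def)
    finally show ?thesis .
  qed
  have eW_int: "integrable ?P (\<lambda>w. exp (- (t\<^sup>2) / 2) * W n w)"
    using W_int[of n] by (intro integrable_mult_right) auto
  have "cmod ((\<integral>w. iexp (t * T w) \<partial>?P) - exp (- (t\<^sup>2) / 2) * (\<integral>w. W n w \<partial>?P))
    = cmod (\<integral>w. iexp (t * T w) - exp (- (t\<^sup>2) / 2) * W n w \<partial>?P)"
    by (subst Bochner_Integration.integral_diff[OF T_int eW_int]) simp
  also have "\<dots> \<le> (\<integral>w. cmod (iexp (t * T w) - exp (- (t\<^sup>2) / 2) * W n w) \<partial>?P)"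
    by (rule integral_norm_bound)
  also have "\<dots> \<le> (\<integral>w. (2 + b) * d w \<partial>?P)"
    using T_int eW_int d_int pointwise
    by (intro integral_mono integrable_norm Bochner_Integration.integrable_diff) auto
  finally have 1: "cmod ((\<integral>w. iexp (t * T w) \<partial>?P) - exp (- (t\<^sup>2) / 2) * (\<integral>w. W n w \<partial>?P))
    \<le> (2 + b) * (\<integral>w. d w \<partial>?P)" by simp
  have "cmod (exp (- (t\<^sup>2) / 2) * (\<integral>w. W n w \<partial>?P) - exp (- (t\<^sup>2) / 2))
    = exp (- (t\<^sup>2) / 2) * cmod ((\<integral>w. W n w \<partial>?P) - 1)"
  proof -
    have "exp (- (t\<^sup>2) / 2) * (\<integral>w. W n w \<partial>?P) - exp (- (t\<^sup>2) / 2)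
      = complex_of_real (exp (- (t\<^sup>2) / 2)) * ((\<integral>w. W n w \<partial>?P) - 1)"
      by (simp add: algebra_simps)
    then show ?thesis by (simp only: norm_mult norm_of_real) simp
  qed
  also have "\<dots> \<le> 1 * (\<Sum>i\<in>I. \<epsilon> i)"
    using W1 by (intro mult_mono) auto
  finally have 2: "cmod (exp (- (t\<^sup>2) / 2) * (\<integral>w. W n w \<partial>?P) - exp (- (t\<^sup>2) / 2)) \<le> (\<Sum>i\<in>I. \<epsilon> i)" by simp
  have "cmod ((\<integral>w. iexp (t * T w) \<partial>?P) - exp (- (t\<^sup>2) / 2)) \<le> (2 + b) * (\<integral>w. d w \<partial>?P) + (\<Sum>i\<in>I. \<epsilon> i)"
    using norm_triangle_mono[OF 1 2] by simp
  also have "(\<Sum>i\<in>I. \<epsilon> i) = 2 * exp (t\<^sup>2) * \<bar>t\<bar> powr r * (\<Sum>k\<in>I. \<integral>w. \<bar>D k w\<bar> powr r \<partial>?P)"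
    by (simp add: \<epsilon>_def sum_distrib_left)
  finally show ?thesis unfolding T_def d_def A_def b_def r_def I_def .
qed

end

lemma
  fixes f :: "'a \<Rightarrow> real" and g :: "'b \<Rightarrow> real"
  assumes "pair_sigma_finite M N" and f: "integrable M f" and g: "integrable N g"
  shows integrable_pair_mult: "integrable (M \<Otimes>\<^sub>M N) (\<lambda>(x, y). f x * g y)"
    and integral_pair_mult: "(\<integral>(x, y). f x * g y \<partial>(M \<Otimes>\<^sub>M N)) = (\<integral>x. f x \<partial>M) * (\<integral>y. g y \<partial>N)"
proof -
  interpret pair_sigma_finite M N by fact
  have [measurable]: "f \<in> borel_measurable M" "g \<in> borel_measurable N" using f g by auto
  show *: "integrable (M \<Otimes>\<^sub>M N) (\<lambda>(x, y). f x * g y)"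
    using f g by (intro Fubini_integrable) (auto simp: abs_mult)
  show "(\<integral>(x, y). f x * g y \<partial>(M \<Otimes>\<^sub>M N)) = (\<integral>x. f x \<partial>M) * (\<integral>y. g y \<partial>N)"
    using integral_fst'[OF *] by simp
qed

section \<open>Composition of kernels\<close>

context prob_space
begin

lemma pair_prob_space_self: "pair_prob_space M M"
  by (simp add: pair_prob_space_def pair_sigma_finite_def prob_space_axioms sigma_finite_measure_axioms)

lemma pair_sigma_finite_self: "pair_sigma_finite M M"
  by (simp add: pair_sigma_finite_def sigma_finite_measure_axioms)

lemma prob_space_pair_self: "prob_space M2"
proof -
  interpret pair_prob_space M M by (rule pair_prob_space_self)
  show ?thesis by unfold_locales
qed

text \<open>The kernel of the product of two integral operators; its square integral is a squared
  Hilbert-Schmidt norm.\<close>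

definition comp_kernel :: "('a \<Rightarrow> 'a \<Rightarrow> real) \<Rightarrow> ('a \<Rightarrow> 'a \<Rightarrow> real) \<Rightarrow> 'a \<Rightarrow> 'a \<Rightarrow> real" where
  "comp_kernel f g x y = (\<integral>z. f x z * g z y \<partial>M)"

lemma comp_kernel_meas [measurable]:
  assumes [measurable]: "(\<lambda>(x, y). f x y) \<in> borel_measurable M2" "(\<lambda>(x, y). g x y) \<in> borel_measurable M2"
  shows "(\<lambda>(x, y). comp_kernel f g x y) \<in> borel_measurable M2"
  unfolding comp_kernel_def by measurable

lemma section_meas:
  assumes "(\<lambda>(x, y). f x y) \<in> borel_measurable M2" "x \<in> space M"
  shows "(\<lambda>y. f x y) \<in> borel_measurable M" "(\<lambda>y. f y x) \<in> borel_measurable M"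
  using measurable_compose[OF measurable_Pair1'[OF assms(2)] assms(1)]
    measurable_compose[OF measurable_Pair2'[OF assms(2)] assms(1)] by auto

lemma comp_kernel_square_le:
  assumes f: "(\<lambda>(x, y). f x y) \<in> borel_measurable M2"
    and g: "(\<lambda>(x, y). g x y) \<in> borel_measurable M2"
    and f_sec: "\<And>x. x \<in> space M \<Longrightarrow> integrable M (\<lambda>y. (f x y)\<^sup>2)"
    and g_sec: "\<And>y. y \<in> space M \<Longrightarrow> integrable M (\<lambda>x. (g x y)\<^sup>2)"
    and xy: "x \<in> space M" "y \<in> space M"
  shows "(comp_kernel f g x y)\<^sup>2 \<le> (\<integral>z. (f x z)\<^sup>2 \<partial>M) * (\<integral>z. (g z y)\<^sup>2 \<partial>M)"
  unfolding comp_kernel_def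
  by (rule integral_Cauchy_Schwarz[OF section_meas(1)[OF f xy(1)] section_meas(2)[OF g xy(2)]
        f_sec[OF xy(1)] g_sec[OF xy(2)]])

text \<open>Cauchy-Schwarz in the middle variable bounds the square by a product of a function of
  \<open>x\<close> and a function of \<open>y\<close>: the Hilbert-Schmidt norm is
  submultiplicative.\<close>

lemma
  assumes f: "(\<lambda>(x, y). f x y) \<in> borel_measurable M2"
    and g: "(\<lambda>(x, y). g x y) \<in> borel_measurable M2"
    and f_sec: "\<And>x. x \<in> space M \<Longrightarrow> integrable M (\<lambda>y. (f x y)\<^sup>2)"
    and g_sec: "\<And>y. y \<in> space M \<Longrightarrow> integrable M (\<lambda>x. (g x y)\<^sup>2)"
    and f_sq: "integrable M2 (\<lambda>(x, y). (f x y)\<^sup>2)"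
    and g_sq: "integrable M2 (\<lambda>(x, y). (g x y)\<^sup>2)"
  shows comp_kernel_square_integrable: "integrable M2 (\<lambda>(x, y). (comp_kernel f g x y)\<^sup>2)"
    and comp_kernel_section_integrable: "\<And>x. x \<in> space M \<Longrightarrow> integrable M (\<lambda>y. (comp_kernel f g x y)\<^sup>2)"
    and integral_comp_kernel_square: "(\<integral>(x, y). (comp_kernel f g x y)\<^sup>2 \<partial>M2)
      \<le> (\<integral>(x, y). (f x y)\<^sup>2 \<partial>M2) * (\<integral>(x, y). (g x y)\<^sup>2 \<partial>M2)"
proof -
  interpret MM: pair_sigma_finite M M by (rule pair_sigma_finite_self)
  define a where "a x = (\<integral>z. (f x z)\<^sup>2 \<partial>M)" for x
  define b where "b y = (\<integral>z. (g z y)\<^sup>2 \<partial>M)" for y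
  have a: "integrable M a" unfolding a_def using MM.integrable_fst'[OF f_sq] by simp
  have b: "integrable M b" unfolding b_def using MM.integrable_snd[of "\<lambda>x y. (g x y)\<^sup>2"] g_sq by simp
  have nonneg: "0 \<le> a x" "0 \<le> b x" for x by (auto simp: a_def b_def)
  have le: "(comp_kernel f g x y)\<^sup>2 \<le> a x * b y" if "x \<in> space M" "y \<in> space M" for x y
    unfolding a_def b_def by (rule comp_kernel_square_le[OF f g f_sec g_sec that])
  note comp_meas = comp_kernel_meas[OF f g]
  have ab: "integrable M2 (\<lambda>(x, y). a x * b y)"
    by (rule integrable_pair_mult[OF MM.pair_sigma_finite_axioms a b])
  show int: "integrable M2 (\<lambda>(x, y). (comp_kernel f g x y)\<^sup>2)"
  proof (rule Bochner_Integration.integrable_bound[OF ab])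
    show "(\<lambda>(x, y). (comp_kernel f g x y)\<^sup>2) \<in> borel_measurable M2"
      using comp_meas by (simp add: split_beta')
    show "AE p in M2. norm (case p of (x, y) \<Rightarrow> (comp_kernel f g x y)\<^sup>2) \<le> norm (case p of (x, y) \<Rightarrow> a x * b y)"
      using le nonneg by (intro AE_I2) (auto simp: space_pair_measure)
  qed
  show "integrable M (\<lambda>y. (comp_kernel f g x y)\<^sup>2)" if x: "x \<in> space M" for x
  proof (rule Bochner_Integration.integrable_bound)
    show "integrable M (\<lambda>y. a x * b y)" using b by simp
    show "(\<lambda>y. (comp_kernel f g x y)\<^sup>2) \<in> borel_measurable M"
      using section_meas(1)[OF comp_meas x] by simp
    show "AE y in M. norm ((comp_kernel f g x y)\<^sup>2) \<le> norm (a x * b y)"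
      using le[OF x] nonneg by (intro AE_I2) auto
  qed
  have "(\<integral>(x, y). (comp_kernel f g x y)\<^sup>2 \<partial>M2) \<le> (\<integral>(x, y). a x * b y \<partial>M2)"
    using le by (intro integral_mono int ab) (auto simp: space_pair_measure)
  also have "\<dots> = (\<integral>x. a x \<partial>M) * (\<integral>y. b y \<partial>M)"
    by (rule integral_pair_mult[OF MM.pair_sigma_finite_axioms a b])
  also have "(\<integral>x. a x \<partial>M) = (\<integral>(x, y). (f x y)\<^sup>2 \<partial>M2)"
    unfolding a_def using MM.integral_fst'[OF f_sq] by simp
  also have "(\<integral>y. b y \<partial>M) = (\<integral>(x, y). (g x y)\<^sup>2 \<partial>M2)"
    unfolding b_def using MM.integral_snd[of "\<lambda>x y. (g x y)\<^sup>2"] g_sq by simp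
  finally show "(\<integral>(x, y). (comp_kernel f g x y)\<^sup>2 \<partial>M2)
      \<le> (\<integral>(x, y). (f x y)\<^sup>2 \<partial>M2) * (\<integral>(x, y). (g x y)\<^sup>2 \<partial>M2)" .
qed

lemma integral_mult_coords:
  fixes f g :: "'a \<Rightarrow> real"
  assumes "finite I" "i \<in> I" "j \<in> I" "i \<noteq> j" "integrable M f" "integrable M g"
  shows "(\<integral>w. f (w i) * g (w j) \<partial>iid_space M I) = (\<integral>x. f x \<partial>M) * (\<integral>x. g x \<partial>M)"
proof -
  note int = integrable_pair_mult[OF pair_sigma_finite_self assms(5,6)]
  have "(\<integral>w. f (w i) * g (w j) \<partial>iid_space M I) = (\<integral>(x, y). f x * g y \<partial>M2)"
    using int by (intro integral_two_coords assms(1-4) borel_measurable_integrable)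
  then show ?thesis using integral_pair_mult[OF pair_sigma_finite_self assms(5,6)] by simp
qed

end

context degenerate_kernel
begin

abbreviation "KK \<equiv> comp_kernel K K"

lemma K_section': "y \<in> space M \<Longrightarrow> integrable M (\<lambda>x. (K x y)\<^sup>2)"
  using K_section[of y] K_sym[of _ y] by (subst Bochner_Integration.integrable_cong[OF refl, where g = "\<lambda>x. (K y x)\<^sup>2"]) auto

lemma KK_sym: "x \<in> space M \<Longrightarrow> y \<in> space M \<Longrightarrow> KK x y = KK y x"
  unfolding comp_kernel_def by (intro Bochner_Integration.integral_cong refl) (simp add: K_sym mult.commute)

text \<open>Fubini moves the integral over \<open>y\<close> to the inner factor, where degeneracy of
  \<open>K\<close> applies.\<close>

lemma KK_degenerate:
  assumes x: "x \<in> space M"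
  shows "(\<integral>y. KK x y \<partial>M) = 0"
proof -
  interpret MM: pair_sigma_finite M M by (rule pair_sigma_finite_self)
  have Kx: "(\<lambda>y. K x y) \<in> borel_measurable M" by (rule section_meas[OF K_meas x])
  have int: "integrable M2 (\<lambda>(y, z). K x z * K z y)"
  proof (rule Bochner_Integration.integrable_bound)
    have "integrable M2 (\<lambda>(y, z). 1 * (K x z)\<^sup>2)"
      by (rule integrable_pair_mult[OF MM.pair_sigma_finite_axioms _ K_section[OF x]]) simp
    moreover have "integrable M2 (\<lambda>(y, z). (K z y)\<^sup>2)"
      using MM.integrable_product_swap[OF K_square] by (simp add: split_beta')
    ultimately show "integrable M2 (\<lambda>(y, z). (K x z)\<^sup>2 + (K z y)\<^sup>2)"
      by (simp add: split_beta')
    have 1: "(\<lambda>p. K x (snd p)) \<in> borel_measurable M2"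
      by (rule measurable_compose[OF measurable_snd Kx])
    have 2: "(\<lambda>p. K (snd p) (fst p)) \<in> borel_measurable M2"
      by (rule K_meas'[OF measurable_snd measurable_fst])
    show "(\<lambda>(y, z). K x z * K z y) \<in> borel_measurable M2"
      using 1 2 by (simp add: split_beta')
    have "\<bar>a * b\<bar> \<le> a\<^sup>2 + b\<^sup>2" for a b :: real
    proof -
      have "2 * \<bar>a * b\<bar> \<le> a\<^sup>2 + b\<^sup>2"
        using sum_squares_bound[of "\<bar>a\<bar>" "\<bar>b\<bar>"] by (simp add: abs_mult)
      then show ?thesis using abs_ge_zero[of "a * b"] by linarith
    qed
    then show "AE p in M2. norm (case p of (y, z) \<Rightarrow> K x z * K z y) \<le> norm (case p of (y, z) \<Rightarrow> (K x z)\<^sup>2 + (K z y)\<^sup>2)"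
      by (intro AE_I2) (simp add: split_beta')
  qed
  have "(\<integral>y. KK x y \<partial>M) = (\<integral>z. (\<integral>y. K x z * K z y \<partial>M) \<partial>M)"
    unfolding comp_kernel_def using MM.Fubini_integral[OF int] by simp
  also have "\<dots> = (\<integral>z. 0 \<partial>M)"
    by (intro Bochner_Integration.integral_cong refl) (simp add: K_degenerate)
  finally show ?thesis by simp
qed

text \<open>Makes the orthogonality relations available for the composed kernel, whose value at two
  sample points is the conditional covariance of their kernel values with a fresh third
  point.\<close>

lemma degenerate_KK: "degenerate_kernel M KK"
proof (unfold_locales)
  show "(\<lambda>(x, y). KK x y) \<in> borel_measurable M2" by (rule comp_kernel_meas[OF K_meas K_meas])
  show "integrable M2 (\<lambda>(x, y). (KK x y)\<^sup>2)"
    by (rule comp_kernel_square_integrable[OF K_meas K_meas K_section K_section' K_square K_square])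
  show "integrable M (\<lambda>y. (KK x y)\<^sup>2)" if "x \<in> space M" for x
    by (rule comp_kernel_section_integrable[OF K_meas K_meas K_section K_section' K_square K_square that])
qed (fact KK_sym KK_degenerate)+

text \<open>With eigenvalues \<lambda> of the operator \<open>K\<close> this is the sum of
  \<lambda>^4, while \<open>variance_K\<close> is the sum of \<lambda>^2. The ratio to the square of
  \<open>variance_K\<close> is small exactly when no single eigenvalue dominates, which separates a
  Gaussian limit from a weighted chi-square one.\<close>

definition variance_KK :: real where
  "variance_KK = (\<integral>(x, y). (KK x y)\<^sup>2 \<partial>M2)"

lemma variance_KK_nonneg: "0 \<le> variance_KK"
  unfolding variance_KK_def by (rule Bochner_Integration.integral_nonneg) auto

lemma variance_KK_le: "variance_KK \<le> variance_K\<^sup>2"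
  unfolding variance_KK_def variance_K_def power2_eq_square[of "integral\<^sup>L _ _"]
  by (rule integral_comp_kernel_square[OF K_meas K_meas K_section K_section' K_square K_square])

lemma KK_diag: "x \<in> space M \<Longrightarrow> KK x x = (\<integral>y. (K x y)\<^sup>2 \<partial>M)"
  unfolding comp_kernel_def by (intro Bochner_Integration.integral_cong refl) (simp add: K_sym[of _ x] power2_eq_square)

lemma KK_diag_nonneg: "x \<in> space M \<Longrightarrow> 0 \<le> KK x x"
  by (simp add: KK_diag)

lemma KK_diag_meas: "(\<lambda>x. KK x x) \<in> borel_measurable M"
  using measurable_compose[OF measurable_Pair[OF measurable_ident measurable_ident] comp_kernel_meas[OF K_meas K_meas]]
  by simp

lemma integral_KK_diag: "(\<integral>x. KK x x \<partial>M) = variance_K"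
proof -
  have "(\<integral>x. KK x x \<partial>M) = (\<integral>x. (\<integral>y. (K x y)\<^sup>2 \<partial>M) \<partial>M)"
    by (intro Bochner_Integration.integral_cong refl KK_diag)
  then show ?thesis
    using pair_sigma_finite.integral_fst'[OF pair_sigma_finite_self K_square] by (simp add: variance_K_def)
qed

text \<open>The diagonal of the composed kernel is a conditional second moment, so Jensen's
  inequality carries the moment of order \<open>2 + 2 * \<tau>\<close> of \<open>K\<close> over to
  it.\<close>

lemma
  assumes \<tau>: "0 < \<tau>"
    and K_int: "integrable M2 (\<lambda>(x, y). \<bar>K x y\<bar> powr (2 + 2 * \<tau>))"
  shows KK_diag_powr_integrable: "integrable M (\<lambda>x. KK x x powr (1 + \<tau>))"
    and KK_diag_powr_le: "(\<integral>x. KK x x powr (1 + \<tau>) \<partial>M) \<le> moment_K (2 + 2 * \<tau>)"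
proof -
  interpret MM: pair_sigma_finite M M by (rule pair_sigma_finite_self)
  define r where "r = 2 + 2 * \<tau>"
  have K_r: "integrable M2 (\<lambda>(x, y). \<bar>K x y\<bar> powr r)" using K_int by (simp add: r_def)
  have int: "integrable M (\<lambda>x. \<integral>y. \<bar>K x y\<bar> powr r \<partial>M)"
    using MM.integrable_fst'[OF K_r] by simp
  have jensen: "AE x in M. KK x x powr (1 + \<tau>) \<le> (\<integral>y. \<bar>K x y\<bar> powr r \<partial>M)"
    using MM.AE_integrable_fst'[OF K_r]
  proof (rule AE_mp, intro AE_I2 impI)
    fix x assume x: "x \<in> space M" and i: "integrable M (\<lambda>y. case (x, y) of (x, y) \<Rightarrow> \<bar>K x y\<bar> powr r)"
    have "((K x y)\<^sup>2) powr (1 + \<tau>) = \<bar>K x y\<bar> powr r" for y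
      by (simp add: powr_power2_eq r_def)
    then show "KK x x powr (1 + \<tau>) \<le> (\<integral>y. \<bar>K x y\<bar> powr r \<partial>M)"
      using powr_expectation_le[of "1 + \<tau>" "\<lambda>y. (K x y)\<^sup>2"] \<tau> K_section[OF x] i KK_diag[OF x] by simp
  qed
  show int': "integrable M (\<lambda>x. KK x x powr (1 + \<tau>))"
  proof (rule Bochner_Integration.integrable_bound[OF int])
    show "(\<lambda>x. KK x x powr (1 + \<tau>)) \<in> borel_measurable M" using KK_diag_meas by simp
    show "AE x in M. norm (KK x x powr (1 + \<tau>)) \<le> norm (\<integral>y. \<bar>K x y\<bar> powr r \<partial>M)"
      using jensen by eventually_elim (simp add: abs_of_nonneg)
  qed
  have "(\<integral>x. KK x x powr (1 + \<tau>) \<partial>M) \<le> (\<integral>x. (\<integral>y. \<bar>K x y\<bar> powr r \<partial>M) \<partial>M)"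
    by (rule integral_mono_AE[OF int' int jensen])
  also have "\<dots> = moment_K r"
    using MM.integral_fst'[OF K_r] by (simp add: moment_K_def)
  finally show "(\<integral>x. KK x x powr (1 + \<tau>) \<partial>M) \<le> moment_K (2 + 2 * \<tau>)" by (simp add: r_def)
qed

end

lemma card_offdiag: "finite I \<Longrightarrow> card (offdiag I) = card I * (card I - 1)"
proof -
  assume I: "finite I"
  have "offdiag I = Sigma I (\<lambda>i. I - {i})" by (auto simp: offdiag_def)
  then show ?thesis using I by simp
qed

lemma sum_square_split_diag:
  fixes f :: "nat \<Rightarrow> nat \<Rightarrow> 'a::comm_monoid_add"
  assumes "finite I"
  shows "(\<Sum>i\<in>I. \<Sum>j\<in>I. f i j) = (\<Sum>i\<in>I. f i i) + (\<Sum>p\<in>offdiag I. f (fst p) (snd p))"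
proof -
  have "(\<Sum>i\<in>I. \<Sum>j\<in>I. f i j) = (\<Sum>i\<in>I. f i i + (\<Sum>j\<in>I - {i}. f i j))"
    using assms by (intro sum.cong refl) (simp add: sum.remove)
  then show ?thesis using sum_offdiag[OF assms, of f] by (simp add: sum.distrib split_beta')
qed

text \<open>Exchanging the sums counts, for each \<open>l\<close> and \<open>m\<close>, the rows
  \<open>k\<close> above both; this count is the coefficient of the composed kernel in the total
  conditional variance.\<close>

lemma sum_below_swap:
  fixes f :: "nat \<Rightarrow> nat \<Rightarrow> real"
  shows "(\<Sum>k\<in>{1..n}. \<Sum>l\<in>{1..<k}. \<Sum>m\<in>{1..<k}. f l m)
    = (\<Sum>l\<in>{1..n}. \<Sum>m\<in>{1..n}. (\<Sum>k\<in>{1..n}. of_bool (l < k \<and> m < k)) * f l m)"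
proof -
  have below: "(\<Sum>l\<in>{1..<k}. g l) = (\<Sum>l\<in>{1..n}. of_bool (l < k) * g l)" if "k \<in> {1..n}" for k and g :: "nat \<Rightarrow> real"
  proof -
    have "(\<Sum>l\<in>{1..n}. of_bool (l < k) * g l) = (\<Sum>l\<in>{1..n}. if l < k then g l else 0)"
      by (intro sum.cong) auto
    also have "\<dots> = (\<Sum>l\<in>{l\<in>{1..n}. l < k}. g l)" by (rule sum.inter_filter[symmetric]) simp
    also have "{l\<in>{1..n}. l < k} = {1..<k}" using that by auto
    finally show ?thesis by simp
  qed
  have "(\<Sum>k\<in>{1..n}. \<Sum>l\<in>{1..<k}. \<Sum>m\<in>{1..<k}. f l m)
    = (\<Sum>k\<in>{1..n}. \<Sum>l\<in>{1..n}. \<Sum>m\<in>{1..n}. of_bool (l < k \<and> m < k) * f l m)"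
  proof (rule sum.cong[OF refl])
    fix k assume k: "k \<in> {1..n}"
    show "(\<Sum>l\<in>{1..<k}. \<Sum>m\<in>{1..<k}. f l m) = (\<Sum>l\<in>{1..n}. \<Sum>m\<in>{1..n}. of_bool (l < k \<and> m < k) * f l m)"
      unfolding below[OF k] by (simp only: sum_distrib_left of_bool_conj mult.assoc)
  qed
  also have "\<dots> = (\<Sum>l\<in>{1..n}. \<Sum>m\<in>{1..n}. \<Sum>k\<in>{1..n}. of_bool (l < k \<and> m < k) * f l m)"
    by (rule trans[OF sum.swap], rule sum.cong[OF refl], rule sum.swap)
  finally show ?thesis by (simp add: sum_distrib_right)
qed

lemma sum_pred_real: "(\<Sum>k\<in>{1..n}. real (k - 1)) = real n * (real n - 1) / 2"
  by (induction n) (auto simp: algebra_simps add_divide_distrib diff_divide_distrib)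

section \<open>Normal approximation of degenerate U-statistics\<close>

context degenerate_kernel
begin

definition ustat :: "nat \<Rightarrow> (nat \<Rightarrow> 'a) \<Rightarrow> real" where
  "ustat n w = (\<Sum>k\<in>{1..n}. \<Sum>l\<in>{1..<k}. K (w k) (w l)) / sqrt (real n * (real n - 1) / 2)"

text \<open>The row sums are martingale differences in the larger index. Their total conditional
  variance is a quadratic form in \<open>KK\<close>: the diagonal has mean 1 and obeys the truncated
  weak law, the off-diagonal part is centred with second moment governed by
  \<open>variance_KK\<close>.\<close>

theorem ustat_char_bound:
  assumes \<tau>: "0 < \<tau>" "\<tau> \<le> 1 / 2" and n: "2 \<le> n"
    and unit: "variance_K = 1"
    and K_int: "integrable M2 (\<lambda>(x, y). \<bar>K x y\<bar> powr (2 + 2 * \<tau>))"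
  defines "y \<equiv> real n powr (- \<tau>) * moment_K (2 + 2 * \<tau>)"
  shows "cmod ((\<integral>w. iexp (t * ustat n w) \<partial>iid_space M {1..n}) - exp (- (t\<^sup>2) / 2))
    \<le> (2 + t\<^sup>2 * exp (t\<^sup>2)) * (2 * y + 4 * sqrt y + 4 * sqrt (2 * variance_KK))
      + 2 * exp (t\<^sup>2) * \<bar>t\<bar> powr (2 + 2 * \<tau>) * (1152 * y)"
proof -
  define I where "I = {1..n}"
  let ?P = "iid_space M I"
  define r where "r = 2 + 2 * \<tau>"
  define \<kappa> where "\<kappa> = moment_K r"
  interpret P: prob_space ?P by (rule prob_space_iid)
  interpret G: degenerate_kernel M KK by (rule degenerate_KK)
  have finI: "finite I" by (simp add: I_def)
  have \<kappa>: "0 \<le> \<kappa>" unfolding \<kappa>_def by (rule moment_K_nonneg)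
  have n2: "2 \<le> real n" using n by simp
  define s where "s = real n * (real n - 1) / 2"
  have s_ge: "(real n)\<^sup>2 / 4 \<le> s"
    using mult_left_mono[of 2 "real n" "real n"] n2 by (simp add: s_def power2_eq_square right_diff_distrib)
  have s: "0 < s" using n2 by (simp add: s_def)
  define D where "D k w = (\<Sum>l\<in>{1..<k}. K (w k) (w l)) / sqrt s" for k and w :: "nat \<Rightarrow> 'a"
  define q where "q k w = (\<integral>x. (D k (w(k := x)))\<^sup>2 \<partial>M)" for k and w :: "nat \<Rightarrow> 'a"
  have below: "{1..<k} \<subseteq> I - {k}" if "k \<in> I" for k using that by (auto simp: I_def)
  have D_upd: "D k (w(k := x)) = (\<Sum>l\<in>{1..<k}. K x (w l)) / sqrt s" for k w x
    unfolding D_def by (intro arg_cong2[where f = "(/)"] sum.cong) auto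
  have sec: "(\<lambda>x. K x (w l)) \<in> borel_measurable M" "integrable M (\<lambda>x. (K x (w l))\<^sup>2)"
      "integrable M (\<lambda>x. K x (w l))" "(\<integral>x. K x (w l) \<partial>M) = 0"
    if "w \<in> space ?P" "l \<in> I" for w l
    using section_meas(2)[OF K_meas] K_section' K_section_integrable' K_degenerate' coord_in_space[OF that(2,1)]
    by auto
  have prod_int: "integrable M (\<lambda>x. K x (w l) * K x (w m))" if "w \<in> space ?P" "l \<in> I" "m \<in> I" for w l m
    using that by (intro integrable_mult_of_squares sec)
  have KK_eq: "(\<integral>x. K x (w l) * K x (w m) \<partial>M) = KK (w l) (w m)" if "w \<in> space ?P" "l \<in> I" "m \<in> I" for w l m
    unfolding comp_kernel_def using coord_in_space[OF that(2,1)]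
    by (intro Bochner_Integration.integral_cong refl) (simp add: K_sym)
  have D_sq: "(D k (w(k := x)))\<^sup>2 = (\<Sum>l\<in>{1..<k}. \<Sum>m\<in>{1..<k}. K x (w l) * K x (w m)) / s" for k w x
    unfolding D_upd power_divide using s by (simp add: power2_eq_square[of "sum _ _"] sum_product)
  have lin: "l \<in> I" if "k \<in> I" "l \<in> {1..<k}" for k l using that by (auto simp: I_def)
  have row: "integrable ?P (\<lambda>w. \<bar>\<Sum>l\<in>{1..<k}. K (w k) (w l)\<bar> powr r)"
      "(\<integral>w. \<bar>\<Sum>l\<in>{1..<k}. K (w k) (w l)\<bar> powr r \<partial>?P) \<le> 144 * real (card {1..<k}) powr (1 + \<tau>) * \<kappa>"
    if "k \<in> I" for k
    using row_sum_moment_le[OF \<tau> K_int finI that below[OF that]] by (auto simp: r_def \<kappa>_def)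
  have D_powr: "\<bar>D k w\<bar> powr r = \<bar>\<Sum>l\<in>{1..<k}. K (w k) (w l)\<bar> powr r / s powr (1 + \<tau>)" for k w
  proof -
    have "sqrt s powr r = s powr (1 + \<tau>)"
      using s powr_power2_eq[of "sqrt s" "1 + \<tau>"] by (simp add: r_def)
    then show ?thesis using s by (simp add: D_def abs_divide powr_divide)
  qed
  have CLT: "cmod ((\<integral>w. iexp (t * (\<Sum>k\<in>I. D k w)) \<partial>?P) - exp (- (t\<^sup>2) / 2))
    \<le> (2 + t\<^sup>2 * exp (t\<^sup>2)) * (\<integral>w. \<bar>(\<Sum>k\<in>I. q k w) - 1\<bar> \<partial>?P)
      + 2 * exp (t\<^sup>2) * \<bar>t\<bar> powr (2 + 2 * \<tau>) * (\<Sum>k\<in>I. \<integral>w. \<bar>D k w\<bar> powr (2 + 2 * \<tau>) \<partial>?P)"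
    unfolding q_def I_def
  proof (rule martingale_char_bound[OF \<tau>], unfold I_def[symmetric])
    fix k assume k: "k \<in> I"
    show "D k \<in> borel_measurable ?P"
    proof -
      have "(\<lambda>w. (\<Sum>l\<in>{1..<k}. K (w k) (w l))) \<in> borel_measurable ?P"
        using below[OF k] k by (intro borel_measurable_sum K_coords_meas) (auto simp: offdiag_def)
      then show ?thesis unfolding D_def by simp
    qed
    show "integrable ?P (\<lambda>w. \<bar>D k w\<bar> powr (2 + 2 * \<tau>))"
      unfolding r_def[symmetric] D_powr using row(1)[OF k] by simp
    fix w assume w: "w \<in> space ?P"
    show "integrable M (\<lambda>x. (D k (w(k := x)))\<^sup>2)"
      unfolding D_sq using prod_int[OF w] lin[OF k]
      by (intro integrable_divide Bochner_Integration.integrable_sum) auto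
    show "(\<integral>x. D k (w(k := x)) \<partial>M) = 0"
      unfolding D_upd using sec[OF w] lin[OF k] by (simp add: Bochner_Integration.integral_sum)
  next
    fix k j w x assume "k \<in> I" "j \<in> I" "k < j"
    then show "D k (w(j := x)) = D k w"
      unfolding D_def by (intro arg_cong2[where f = "(/)"] sum.cong) auto
  qed
  define c where "c l m = (\<Sum>k\<in>I. of_bool (l < k \<and> m < k) :: real)" for l m :: nat
  have c_bounds: "0 \<le> c l m" "c l m \<le> real n" for l m
  proof -
    show "0 \<le> c l m" unfolding c_def by (intro sum_nonneg) auto
    have "c l m \<le> (\<Sum>k\<in>I. 1)" unfolding c_def by (intro sum_mono) auto
    then show "c l m \<le> real n" by (simp add: I_def)
  qed
  have c_sum: "(\<Sum>l\<in>I. c l l) = s"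
  proof -
    have "(\<Sum>l\<in>I. c l l) = (\<Sum>k\<in>I. \<Sum>l\<in>I. of_bool (l < k))"
      unfolding c_def by (subst sum.swap) simp
    also have "\<dots> = (\<Sum>k\<in>I. real (k - 1))"
    proof (intro sum.cong refl)
      fix k assume "k \<in> I"
      then have "{l \<in> I. l < k} = {1..<k}" by (auto simp: I_def)
      then show "(\<Sum>l\<in>I. of_bool (l < k)) = real (k - 1)" using finI by (simp add: Int_def)
    qed
    also have "\<dots> = s" unfolding I_def s_def by (rule sum_pred_real)
    finally show ?thesis .
  qed
  have q_sum: "(\<Sum>k\<in>I. q k w) = (\<Sum>l\<in>I. c l l / s * KK (w l) (w l)) + G.pair_sum I c w / s"
    if w: "w \<in> space ?P" for w
  proof -
    have "q k w = (\<Sum>l\<in>{1..<k}. \<Sum>m\<in>{1..<k}. KK (w l) (w m)) / s" if k: "k \<in> I" for k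
    proof -
      have "(\<integral>x. (\<Sum>l\<in>{1..<k}. \<Sum>m\<in>{1..<k}. K x (w l) * K x (w m)) \<partial>M)
        = (\<Sum>l\<in>{1..<k}. \<Sum>m\<in>{1..<k}. \<integral>x. K x (w l) * K x (w m) \<partial>M)"
        using prod_int[OF w] lin[OF k]
        by (subst Bochner_Integration.integral_sum, intro Bochner_Integration.integrable_sum, force,
            intro sum.cong refl Bochner_Integration.integral_sum, force)
      then show ?thesis unfolding q_def D_sq using KK_eq[OF w] lin[OF k] by simp
    qed
    then have "(\<Sum>k\<in>I. q k w) = (\<Sum>k\<in>I. \<Sum>l\<in>{1..<k}. \<Sum>m\<in>{1..<k}. KK (w l) (w m)) / s"
      by (simp add: sum_divide_distrib)
    also have "\<dots> = (\<Sum>l\<in>I. \<Sum>m\<in>I. c l m * KK (w l) (w m)) / s"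
      unfolding I_def c_def sum_below_swap ..
    also have "\<dots> = ((\<Sum>l\<in>I. c l l * KK (w l) (w l)) + G.pair_sum I c w) / s"
      unfolding sum_square_split_diag[OF finI] G.pair_sum_def ..
    finally show ?thesis by (simp add: add_divide_distrib sum_divide_distrib)
  qed
  have y: "y = real n powr (- \<tau>) * \<kappa>" by (simp add: y_def \<kappa>_def r_def)
  have y0: "0 \<le> y" using \<kappa> by (simp add: y)
  \<comment> \<open>A function that is not integrable has integral 0 by convention, but here the
    integral is 1.\<close>
  have diag_int: "integrable M (\<lambda>x. KK x x)"
    using not_integrable_integral_eq[of M "\<lambda>x. KK x x"] integral_KK_diag unit by fastforce
  have diag: "(\<integral>w. \<bar>(\<Sum>l\<in>I. c l l / s * KK (w l) (w l)) - 1\<bar> \<partial>?P) \<le> 2 * y + 4 * sqrt y"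
  proof -
    have "(\<integral>w. \<bar>(\<Sum>l\<in>I. c l l / s * KK (w l) (w l)) - 1\<bar> \<partial>?P)
      \<le> 2 * \<kappa> * real n powr (- \<tau>) + sqrt (16 / real n * (real n powr (1 - \<tau>) * \<kappa>))"
    \<comment> \<open>The cut is at level \<open>n\<close>, and only equal indices are dependent.
      Each weight \<open>c l l / s\<close> is at most \<open>4 / n\<close>, so the sum of their
      squares is at most \<open>16 / n\<close>.\<close>
    proof (rule P.truncated_weak_law[where D = Id and \<xi> = "\<lambda>l w. KK (w l) (w l)"])
      fix l assume l: "l \<in> I"
      show "(\<lambda>w. KK (w l) (w l)) \<in> borel_measurable ?P"
        using measurable_compose[OF measurable_component_singleton[OF l] KK_diag_meas] .
      show "0 \<le> KK (w l) (w l)" if "w \<in> space ?P" for w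
        using that l by (intro KK_diag_nonneg coord_in_space)
      show "integrable ?P (\<lambda>w. KK (w l) (w l) powr (1 + \<tau>))"
        using KK_diag_powr_integrable[OF \<tau>(1) K_int] by (rule integrable_coord[OF l])
      show "(\<integral>w. KK (w l) (w l) \<partial>?P) = 1"
        using integral_coord[OF l KK_diag_meas] integral_KK_diag unit by simp
      show "(\<integral>w. KK (w l) (w l) powr (1 + \<tau>) \<partial>?P) \<le> \<kappa>"
        using integral_coord[OF l, of "\<lambda>x. KK x x powr (1 + \<tau>)"] KK_diag_powr_le[OF \<tau>(1) K_int] KK_diag_meas
        by (simp add: \<kappa>_def r_def)
      show "0 \<le> c l l / s" using c_bounds s by simp
      fix m assume m: "m \<in> I" and lm: "(l, m) \<notin> Id"
      have int: "integrable M (\<lambda>x. min (KK x x) (real n))" using diag_int by simp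
      have "(\<integral>w. min (KK (w l) (w l)) (real n) * min (KK (w m) (w m)) (real n) \<partial>?P)
        = (\<integral>x. min (KK x x) (real n) \<partial>M) * (\<integral>x. min (KK x x) (real n) \<partial>M)"
        using lm by (intro integral_mult_coords[OF finI l m _ int int]) auto
      then show "(\<integral>w. min (KK (w l) (w l)) (real n) * min (KK (w m) (w m)) (real n) \<partial>?P)
        = (\<integral>w. min (KK (w l) (w l)) (real n) \<partial>?P) * (\<integral>w. min (KK (w m) (w m)) (real n) \<partial>?P)"
        using integral_coord[OF l, of "\<lambda>x. min (KK x x) (real n)"]
          integral_coord[OF m, of "\<lambda>x. min (KK x x) (real n)"] int by simp
    next
      show "(\<Sum>l\<in>I. c l l / s) = 1" using c_sum s by (simp flip: sum_divide_distrib)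
      have "(\<Sum>l\<in>I. \<Sum>m\<in>I. c l l / s * (c m m / s) * of_bool ((l, m) \<in> Id)) = (\<Sum>l\<in>I. (c l l / s)\<^sup>2)"
      proof (intro sum.cong refl)
        fix l assume l: "l \<in> I"
        have "(\<Sum>m\<in>I. c l l / s * (c m m / s) * of_bool ((l, m) \<in> Id))
          = (\<Sum>m\<in>I. if m = l then c l l / s * (c m m / s) else 0)"
          by (intro sum.cong) auto
        then show "(\<Sum>m\<in>I. c l l / s * (c m m / s) * of_bool ((l, m) \<in> Id)) = (c l l / s)\<^sup>2"
          using l finI by (simp add: power2_eq_square)
      qed
      also have "\<dots> \<le> (\<Sum>l\<in>I. (4 / real n)\<^sup>2)"
      proof (intro sum_mono power_mono)
        fix l
        have "c l l * real n \<le> real n * real n" using c_bounds[of l l] by (intro mult_right_mono) auto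
        also have "\<dots> \<le> 4 * s" using s_ge by (simp add: power2_eq_square)
        finally show "c l l / s \<le> 4 / real n" using s n2 by (simp add: field_simps)
        show "0 \<le> c l l / s" using c_bounds s by simp
      qed
      also have "\<dots> = 16 / real n" using n2 by (simp add: I_def power2_eq_square)
      finally show "(\<Sum>l\<in>I. \<Sum>m\<in>I. c l l / s * (c m m / s) * of_bool ((l, m) \<in> Id)) \<le> 16 / real n" .
    qed (use \<tau> n2 finI in auto)
    also have "16 / real n * (real n powr (1 - \<tau>) * \<kappa>) = 4\<^sup>2 * y"
      using n2 by (simp add: y powr_diff powr_minus field_simps)
    also have "sqrt (4\<^sup>2 * y) = 4 * sqrt y" by (simp add: real_sqrt_mult)
    finally show ?thesis by (simp add: y mult_ac)
  qed
  have off_sq: "integrable ?P (\<lambda>w. (G.pair_sum I c w)\<^sup>2)"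
    using G.pair_sum_mult_integrable[OF finI, of c c] by (simp add: power2_eq_square)
  have off: "(\<integral>w. \<bar>G.pair_sum I c w\<bar> \<partial>?P) \<le> 4 * s * sqrt (2 * variance_KK)"
  proof -
    have card: "card (offdiag I) \<le> n * n"
      using card_offdiag[OF finI] by (simp add: I_def)
    have "(\<Sum>(i, j)\<in>offdiag I. c i j * (c i j + c j i)) \<le> (\<Sum>p\<in>offdiag I. real n * (real n + real n))"
      unfolding split_beta' using c_bounds by (intro sum_mono mult_mono add_mono) (auto intro: add_nonneg_nonneg)
    also have "\<dots> \<le> real (n * n) * (real n * (real n + real n))"
      using card by (simp del: of_nat_mult add: mult_right_mono)
    finally have *: "(\<Sum>(i, j)\<in>offdiag I. c i j * (c i j + c j i)) \<le> 2 * (real n)^4"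
      by (simp add: power4_eq_xxxx mult_ac)
    have "(\<integral>w. (G.pair_sum I c w)\<^sup>2 \<partial>?P) = variance_KK * (\<Sum>(i, j)\<in>offdiag I. c i j * (c i j + c j i))"
      using G.integral_pair_sum_mult[OF finI, of c c]
      by (simp add: power2_eq_square G.variance_K_def variance_KK_def)
    also have "\<dots> \<le> variance_KK * (2 * (real n)^4)"
      by (intro mult_left_mono * variance_KK_nonneg)
    finally have "sqrt (\<integral>w. (G.pair_sum I c w)\<^sup>2 \<partial>?P) \<le> sqrt (((real n)\<^sup>2)\<^sup>2 * (2 * variance_KK))"
      by (intro real_sqrt_le_mono) (simp add: mult_ac)
    also have "\<dots> = (real n)\<^sup>2 * sqrt (2 * variance_KK)"
      by (simp only: real_sqrt_mult real_sqrt_abs) simp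
    also have "\<dots> \<le> 4 * s * sqrt (2 * variance_KK)"
      using s_ge variance_KK_nonneg by (intro mult_right_mono) auto
    finally show ?thesis
      using P.abs_expectation_le_sqrt[OF G.pair_sum_meas off_sq] by linarith
  qed
  have "(\<integral>w. \<bar>(\<Sum>k\<in>I. q k w) - 1\<bar> \<partial>?P)
    \<le> (\<integral>w. \<bar>(\<Sum>l\<in>I. c l l / s * KK (w l) (w l)) - 1\<bar> + \<bar>G.pair_sum I c w\<bar> / s \<partial>?P)"
  proof (rule integral_mono)
    have 1: "integrable ?P (\<lambda>w. (\<Sum>l\<in>I. c l l / s * KK (w l) (w l)) - 1)"
      by (intro Bochner_Integration.integrable_diff Bochner_Integration.integrable_sum integrable_mult_right
          integrable_coord[OF _ diag_int] P.integrable_const)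
    have 2: "integrable ?P (G.pair_sum I c)" by (rule P.integrable_of_square[OF G.pair_sum_meas off_sq])
    show "integrable ?P (\<lambda>w. \<bar>(\<Sum>l\<in>I. c l l / s * KK (w l) (w l)) - 1\<bar> + \<bar>G.pair_sum I c w\<bar> / s)"
      using 1 2 by simp
    have "integrable ?P (\<lambda>w. \<bar>((\<Sum>l\<in>I. c l l / s * KK (w l) (w l)) - 1) + G.pair_sum I c w / s\<bar>)"
      using 1 2 by (intro integrable_abs Bochner_Integration.integrable_add integrable_divide)
    then show "integrable ?P (\<lambda>w. \<bar>(\<Sum>k\<in>I. q k w) - 1\<bar>)"
      using q_sum by (subst Bochner_Integration.integrable_cong[OF refl]) (auto simp: algebra_simps)
    fix w assume w: "w \<in> space ?P"
    have "\<bar>G.pair_sum I c w / s\<bar> = \<bar>G.pair_sum I c w\<bar> / s" using s by simp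
    then show "\<bar>(\<Sum>k\<in>I. q k w) - 1\<bar> \<le> \<bar>(\<Sum>l\<in>I. c l l / s * KK (w l) (w l)) - 1\<bar> + \<bar>G.pair_sum I c w\<bar> / s"
      unfolding q_sum[OF w] by linarith
  qed
  also have "\<dots> = (\<integral>w. \<bar>(\<Sum>l\<in>I. c l l / s * KK (w l) (w l)) - 1\<bar> \<partial>?P) + (\<integral>w. \<bar>G.pair_sum I c w\<bar> \<partial>?P) / s"
    using P.integrable_of_square[OF G.pair_sum_meas off_sq] integrable_coord[OF _ diag_int]
    by (simp add: Bochner_Integration.integrable_sum)
  also have "\<dots> \<le> (2 * y + 4 * sqrt y) + 4 * sqrt (2 * variance_KK)"
    using diag off s by (intro add_mono) (auto simp: field_simps)
  finally have A: "(\<integral>w. \<bar>(\<Sum>k\<in>I. q k w) - 1\<bar> \<partial>?P) \<le> 2 * y + 4 * sqrt y + 4 * sqrt (2 * variance_KK)" .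
  have L: "(\<Sum>k\<in>I. \<integral>w. \<bar>D k w\<bar> powr (2 + 2 * \<tau>) \<partial>?P) \<le> 1152 * y"
  proof -
    \<comment> \<open>The 8 is \<open>4 powr (3 / 2)\<close>, as \<open>\<tau> \<le> 1 / 2\<close>;
      with the 144 from the row sums it yields 1152.\<close>
    have s_pow: "real n powr (2 + 2 * \<tau>) / 8 \<le> s powr (1 + \<tau>)"
    proof -
      have "4 powr (1 + \<tau>) \<le> (4::real) powr (3 / 2)" using \<tau> by (intro powr_mono) auto
      also have "(4::real) powr (3 / 2) = (2 powr 2) powr (3 / 2)" by simp
      also have "\<dots> = 2 powr 3" by (simp only: powr_powr) simp
      finally have "4 powr (1 + \<tau>) \<le> (8::real)" by simp
      then have "real n powr (2 + 2 * \<tau>) / 8 \<le> real n powr (2 + 2 * \<tau>) / 4 powr (1 + \<tau>)"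
        by (intro divide_left_mono) auto
      also have "\<dots> = ((real n)\<^sup>2 / 4) powr (1 + \<tau>)" by (simp add: powr_divide powr_power2_eq)
      also have "\<dots> \<le> s powr (1 + \<tau>)" using s_ge \<tau> by (intro powr_mono2) auto
      finally show ?thesis .
    qed
    have "(\<Sum>k\<in>I. \<integral>w. \<bar>D k w\<bar> powr r \<partial>?P) \<le> (\<Sum>k\<in>I. 144 * real n powr (1 + \<tau>) * \<kappa> / s powr (1 + \<tau>))"
    proof (rule sum_mono)
      fix k assume k: "k \<in> I"
      have "real (card {1..<k}) powr (1 + \<tau>) \<le> real n powr (1 + \<tau>)"
        using k \<tau> by (intro powr_mono2) (auto simp: I_def)
      then have "144 * real (card {1..<k}) powr (1 + \<tau>) * \<kappa> \<le> 144 * real n powr (1 + \<tau>) * \<kappa>"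
        using \<kappa> by (intro mult_right_mono mult_left_mono) auto
      then show "(\<integral>w. \<bar>D k w\<bar> powr r \<partial>?P) \<le> 144 * real n powr (1 + \<tau>) * \<kappa> / s powr (1 + \<tau>)"
        unfolding D_powr using row(2)[OF k] by (simp add: divide_right_mono)
    qed
    also have "\<dots> = 144 * (real n * real n powr (1 + \<tau>)) * \<kappa> / s powr (1 + \<tau>)"
      by (simp add: I_def)
    also have "\<dots> = 144 * (real n powr (2 + \<tau>)) * \<kappa> / s powr (1 + \<tau>)"
      using n2 by (simp add: powr_add power2_eq_square mult_ac)
    also have "\<dots> \<le> 144 * (real n powr (2 + \<tau>)) * \<kappa> / (real n powr (2 + 2 * \<tau>) / 8)"
      using s_pow \<kappa> n2 s by (intro divide_left_mono) auto
    also have "\<dots> = 1152 * y"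
    proof -
      have "real n powr (2 + 2 * \<tau>) = real n powr (2 + \<tau>) * real n powr \<tau>"
        unfolding powr_add[symmetric] by (rule arg_cong[where f = "(powr) (real n)"]) simp
      then show ?thesis using n2 by (simp add: y powr_minus field_simps)
    qed
    finally show ?thesis by (simp add: r_def)
  qed
  have "(\<Sum>k\<in>I. D k w) = ustat n w" for w
    by (simp add: D_def ustat_def I_def s_def sum_divide_distrib)
  then have "cmod ((\<integral>w. iexp (t * ustat n w) \<partial>?P) - exp (- (t\<^sup>2) / 2))
    \<le> (2 + t\<^sup>2 * exp (t\<^sup>2)) * (\<integral>w. \<bar>(\<Sum>k\<in>I. q k w) - 1\<bar> \<partial>?P)
      + 2 * exp (t\<^sup>2) * \<bar>t\<bar> powr (2 + 2 * \<tau>) * (\<Sum>k\<in>I. \<integral>w. \<bar>D k w\<bar> powr (2 + 2 * \<tau>) \<partial>?P)"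
    using CLT by simp
  also have "\<dots> \<le> (2 + t\<^sup>2 * exp (t\<^sup>2)) * (2 * y + 4 * sqrt y + 4 * sqrt (2 * variance_KK))
      + 2 * exp (t\<^sup>2) * \<bar>t\<bar> powr (2 + 2 * \<tau>) * (1152 * y)"
    using A L by (intro add_mono mult_left_mono) auto
  finally show ?thesis unfolding I_def .
qed

end

section \<open>Bias-corrected statistics of centred kernels\<close>

text \<open>In row \<open>k\<close> of a matrix with zero diagonal, \<open>\<alpha> k\<close> occurs
  \<open>n - 1\<close> times and is missing once from the sum of the other
  \<open>\<alpha> j\<close>, a net count of \<open>n - 2\<close>. The divisors of the U-centring are
  made for this count, so all additive terms cancel.\<close>

lemma
  fixes d :: "nat \<Rightarrow> nat \<Rightarrow> real"
  assumes n: "4 \<le> n"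
    and sym: "\<And>k l. k \<in> {1..n} \<Longrightarrow> l \<in> {1..n} \<Longrightarrow> d k l = d l k"
    and a_diag: "\<And>k. k \<in> {1..n} \<Longrightarrow> a k k = 0"
    and a_off: "\<And>k l. k \<in> {1..n} \<Longrightarrow> l \<in> {1..n} \<Longrightarrow> k \<noteq> l \<Longrightarrow> a k l = d k l + \<alpha> k + \<alpha> l"
    and kl: "k \<in> {1..n}" "l \<in> {1..n}" "k \<noteq> l"
  defines "r \<equiv> \<lambda>k. \<Sum>l\<in>{1..n} - {k}. d k l"
  shows U_center_of_shifted: "U_center n a k l
    = d k l - r k / (real n - 2) - r l / (real n - 2) + (\<Sum>k\<in>{1..n}. r k) / ((real n - 1) * (real n - 2))"
proof -
  let ?I = "{1..n}"
  define A where "A = (\<Sum>k\<in>?I. \<alpha> k)"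
  have n4: "4 \<le> real n" using n by simp
  have row: "(\<Sum>j\<in>?I. a k j) = r k + (real n - 2) * \<alpha> k + A" if k: "k \<in> ?I" for k
  proof -
    have "(\<Sum>j\<in>?I. a k j) = (\<Sum>j\<in>?I - {k}. a k j)" using k a_diag by (simp add: sum.remove)
    also have "\<dots> = (\<Sum>j\<in>?I - {k}. d k j + \<alpha> k + \<alpha> j)" using k by (intro sum.cong refl a_off) auto
    also have "\<dots> = r k + (real n - 1) * \<alpha> k + (\<Sum>j\<in>?I - {k}. \<alpha> j)"
      using k n by (simp add: sum.distrib r_def of_nat_diff)
    also have "(\<Sum>j\<in>?I - {k}. \<alpha> j) = A - \<alpha> k" using k by (simp add: A_def sum_diff1)
    finally show ?thesis by (simp add: algebra_simps)
  qed
  have a_sym: "a i j = a j i" if "i \<in> ?I" "j \<in> ?I" for i j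
    using a_off[OF that] a_off[OF that(2,1)] sym[OF that] by (cases "i = j") auto
  have col: "(\<Sum>i\<in>?I. a i l) = r l + (real n - 2) * \<alpha> l + A" if l: "l \<in> ?I" for l
    using row[OF l] a_sym[OF _ l] by simp
  have tot: "(\<Sum>i\<in>?I. \<Sum>j\<in>?I. a i j) = (\<Sum>k\<in>?I. r k) + 2 * (real n - 1) * A"
  proof -
    have "(\<Sum>i\<in>?I. \<Sum>j\<in>?I. a i j) = (\<Sum>i\<in>?I. r i + (real n - 2) * \<alpha> i + A)"
      by (rule sum.cong[OF refl]) (rule row)
    also have "\<dots> = (\<Sum>k\<in>?I. r k) + (real n - 2) * A + real n * A"
      by (simp add: sum.distrib A_def flip: sum_distrib_left)
    finally show ?thesis by (simp add: algebra_simps)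
  qed
  have nz: "real n - 2 \<noteq> 0" "real n - 1 \<noteq> 0" using n4 by auto
  have 1: "(x + (real n - 2) * y + A) / (real n - 2) = x / (real n - 2) + y + A / (real n - 2)" for x y
    using nz by (simp add: add_divide_distrib)
  have 2: "(x + 2 * k * A) / (k * m) = x / (k * m) + (A / m + A / m)" if "m \<noteq> 0" "k \<noteq> 0" for x k m
    using that by (simp add: add_divide_distrib)
  show ?thesis
    unfolding U_center_def row[OF kl(1)] col[OF kl(2)] tot a_off[OF kl] 1 2[OF nz] by simp
qed

text \<open>Off the diagonal the U-centred matrix is symmetric with zero row sums, hence orthogonal
  to the additive terms of the other factor. So only one of the two centrings has to be
  expanded.\<close>

lemma V_star_of_shifted:
  fixes d e :: "nat \<Rightarrow> nat \<Rightarrow> real"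
  assumes n: "4 \<le> n"
    and d: "\<And>k l. k \<in> {1..n} \<Longrightarrow> l \<in> {1..n} \<Longrightarrow> d k l = d l k"
      "\<And>k. k \<in> {1..n} \<Longrightarrow> a k k = 0"
      "\<And>k l. k \<in> {1..n} \<Longrightarrow> l \<in> {1..n} \<Longrightarrow> k \<noteq> l \<Longrightarrow> a k l = d k l + \<alpha> k + \<alpha> l"
    and e: "\<And>k l. k \<in> {1..n} \<Longrightarrow> l \<in> {1..n} \<Longrightarrow> e k l = e l k"
      "\<And>k. k \<in> {1..n} \<Longrightarrow> b k k = 0"
      "\<And>k l. k \<in> {1..n} \<Longrightarrow> l \<in> {1..n} \<Longrightarrow> k \<noteq> l \<Longrightarrow> b k l = e k l + \<beta> k + \<beta> l"
  defines "r \<equiv> \<lambda>k. \<Sum>l\<in>{1..n} - {k}. d k l" and "s \<equiv> \<lambda>k. \<Sum>l\<in>{1..n} - {k}. e k l"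
  shows "V_star n a b = ((\<Sum>k\<in>{1..n}. \<Sum>l\<in>{1..n} - {k}. d k l * e k l)
    - 2 / (real n - 2) * (\<Sum>k\<in>{1..n}. r k * s k)
    + (\<Sum>k\<in>{1..n}. r k) * (\<Sum>k\<in>{1..n}. s k) / ((real n - 1) * (real n - 2))) / (real n * (real n - 3))"
proof -
  let ?I = "{1..n}"
  define N where "N = real n"
  have N: "4 \<le> N" using n by (simp add: N_def)
  define R where "R = (\<Sum>k\<in>?I. r k)"
  define S where "S = (\<Sum>k\<in>?I. s k)"
  define A where "A k l = d k l - r k / (N - 2) - r l / (N - 2) + R / ((N - 1) * (N - 2))" for k l
  define B where "B k l = e k l - s k / (N - 2) - s l / (N - 2) + S / ((N - 1) * (N - 2))" for k l
  have UA: "U_center n a k l = A k l" if "k \<in> ?I" "l \<in> ?I" "k \<noteq> l" for k l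
    using U_center_of_shifted[where d = d and \<alpha> = \<alpha> and a = a, OF n d that]
    by (simp add: A_def r_def R_def N_def)
  have UB: "U_center n b k l = B k l" if "k \<in> ?I" "l \<in> ?I" "k \<noteq> l" for k l
    using U_center_of_shifted[where d = e and \<alpha> = \<beta> and a = b, OF n e that]
    by (simp add: B_def s_def S_def N_def)
  have card: "real (card (?I - {k})) = N - 1" if "k \<in> ?I" for k
    using that n by (simp add: N_def of_nat_diff)
  have row_A: "(\<Sum>l\<in>?I - {k}. A k l) = 0" if k: "k \<in> ?I" for k
  proof -
    have "(\<Sum>l\<in>?I - {k}. A k l)
      = r k - (N - 1) * (r k / (N - 2)) - (\<Sum>l\<in>?I - {k}. r l) / (N - 2) + (N - 1) * (R / ((N - 1) * (N - 2)))"
      unfolding A_def using card[OF k]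
      by (simp add: sum.distrib sum_subtractf r_def sum_divide_distrib)
    also have "(\<Sum>l\<in>?I - {k}. r l) = R - r k" using k by (simp add: R_def sum_diff1)
    also have "r k - (N - 1) * (r k / (N - 2)) - (R - r k) / (N - 2) + (N - 1) * (R / ((N - 1) * (N - 2))) = 0"
    proof -
      have "N - 2 \<noteq> 0" "N - 1 \<noteq> 0" using N by auto
      then show ?thesis by (simp add: divide_simps) (simp add: algebra_simps)
    qed
    finally show ?thesis .
  qed
  have A_sym: "A k l = A l k" if "k \<in> ?I" "l \<in> ?I" for k l
    using d(1)[OF that] by (simp add: A_def)
  \<comment> \<open>Swapping the two indices turns these column sums into row sums, by symmetry of
    \<open>A\<close>.\<close>
  have col_A: "(\<Sum>k\<in>?I. \<Sum>l\<in>?I - {k}. A k l * s l) = 0"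
  proof -
    have "(\<Sum>k\<in>?I. \<Sum>l\<in>?I - {k}. A k l * s l) = (\<Sum>p\<in>offdiag ?I. A (fst p) (snd p) * s (snd p))"
      using sum_offdiag[of ?I "\<lambda>k l. A k l * s l"] by (simp add: split_beta')
    also have "\<dots> = (\<Sum>p\<in>offdiag ?I. A (snd p) (fst p) * s (fst p))"
      by (rule sum.reindex_bij_witness[of _ prod.swap prod.swap]) (auto simp: offdiag_def)
    also have "\<dots> = (\<Sum>p\<in>offdiag ?I. A (fst p) (snd p) * s (fst p))"
      by (intro sum.cong refl) (auto simp: offdiag_def A_sym)
    also have "\<dots> = (\<Sum>k\<in>?I. \<Sum>l\<in>?I - {k}. A k l * s k)"
      using sum_offdiag[of ?I "\<lambda>k l. A k l * s k"] by (simp add: split_beta')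
    also have "\<dots> = 0" using row_A by (simp flip: sum_distrib_right)
    finally show ?thesis .
  qed
  have "(\<Sum>k\<in>?I. \<Sum>l\<in>?I - {k}. A k l * B k l) = (\<Sum>k\<in>?I. \<Sum>l\<in>?I - {k}. A k l * e k l)"
  proof -
    have "(\<Sum>k\<in>?I. \<Sum>l\<in>?I - {k}. A k l * B k l)
      = (\<Sum>k\<in>?I. (\<Sum>l\<in>?I - {k}. A k l * e k l) - s k / (N - 2) * (\<Sum>l\<in>?I - {k}. A k l)
          - (\<Sum>l\<in>?I - {k}. A k l * s l) / (N - 2) + S / ((N - 1) * (N - 2)) * (\<Sum>l\<in>?I - {k}. A k l))"
      unfolding B_def
      by (intro sum.cong refl)
         (simp add: sum_distrib_left sum_divide_distrib sum.distrib sum_subtractf distrib_left right_diff_distrib mult_ac)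
    also have "\<dots> = (\<Sum>k\<in>?I. \<Sum>l\<in>?I - {k}. A k l * e k l) - (\<Sum>k\<in>?I. \<Sum>l\<in>?I - {k}. A k l * s l) / (N - 2)"
      using row_A by (simp add: sum_subtractf sum_divide_distrib)
    finally show ?thesis using col_A by simp
  qed
  also have "\<dots> = (\<Sum>k\<in>?I. \<Sum>l\<in>?I - {k}. d k l * e k l) - 2 / (N - 2) * (\<Sum>k\<in>?I. r k * s k)
    + R * S / ((N - 1) * (N - 2))"
  proof -
    have swap: "(\<Sum>k\<in>?I. \<Sum>l\<in>?I - {k}. r l * e k l) = (\<Sum>k\<in>?I. r k * s k)"
    proof -
      have "(\<Sum>k\<in>?I. \<Sum>l\<in>?I - {k}. r l * e k l) = (\<Sum>p\<in>offdiag ?I. r (snd p) * e (fst p) (snd p))"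
        using sum_offdiag[of ?I "\<lambda>k l. r l * e k l"] by (simp add: split_beta')
      also have "\<dots> = (\<Sum>p\<in>offdiag ?I. r (fst p) * e (snd p) (fst p))"
        by (rule sum.reindex_bij_witness[of _ prod.swap prod.swap]) (auto simp: offdiag_def)
      also have "\<dots> = (\<Sum>p\<in>offdiag ?I. r (fst p) * e (fst p) (snd p))"
        by (intro sum.cong refl) (auto simp: offdiag_def e(1))
      also have "\<dots> = (\<Sum>k\<in>?I. \<Sum>l\<in>?I - {k}. r k * e k l)"
        using sum_offdiag[of ?I "\<lambda>k l. r k * e k l"] by (simp add: split_beta')
      finally show ?thesis by (simp add: s_def sum_distrib_left)
    qed
    have "(\<Sum>k\<in>?I. \<Sum>l\<in>?I - {k}. A k l * e k l)
      = (\<Sum>k\<in>?I. (\<Sum>l\<in>?I - {k}. d k l * e k l) - r k * s k / (N - 2) - (\<Sum>l\<in>?I - {k}. r l * e k l) / (N - 2)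
          + R / ((N - 1) * (N - 2)) * s k)"
      unfolding A_def s_def
      by (intro sum.cong refl)
         (simp add: sum_distrib_left sum_divide_distrib sum.distrib sum_subtractf distrib_right left_diff_distrib)
    also have "\<dots> = (\<Sum>k\<in>?I. \<Sum>l\<in>?I - {k}. d k l * e k l) - (\<Sum>k\<in>?I. r k * s k) / (N - 2)
        - (\<Sum>k\<in>?I. \<Sum>l\<in>?I - {k}. r l * e k l) / (N - 2) + R / ((N - 1) * (N - 2)) * S"
      by (simp add: sum.distrib sum_subtractf sum_divide_distrib sum_distrib_left S_def)
    finally show ?thesis unfolding swap by simp
  qed
  finally have "(\<Sum>k\<in>?I. \<Sum>l\<in>?I - {k}. A k l * B k l) = (\<Sum>k\<in>?I. \<Sum>l\<in>?I - {k}. d k l * e k l)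
    - 2 / (N - 2) * (\<Sum>k\<in>?I. r k * s k) + R * S / ((N - 1) * (N - 2))" .
  moreover have "(\<Sum>k\<in>?I. \<Sum>l\<in>?I - {k}. U_center n a k l * U_center n b k l) = (\<Sum>k\<in>?I. \<Sum>l\<in>?I - {k}. A k l * B k l)"
    using UA UB by (intro sum.cong refl) auto
  ultimately show ?thesis unfolding V_star_def R_def S_def N_def by simp
qed

text \<open>Resampling \<open>k\<close> and then \<open>l\<close> replaces the second factor by its
  mean and leaves the first untouched. Boundedness takes care of integrability, as the application
  is to truncated squares.\<close>

lemma (in prob_space) integral_disjoint_pairs:
  fixes f g :: "'a \<Rightarrow> 'a \<Rightarrow> real"
  assumes I: "finite I" "i \<in> I" "j \<in> I" "k \<in> I" "l \<in> I"
    and distinct: "i \<noteq> j" "k \<noteq> l" "i \<noteq> k" "i \<noteq> l" "j \<noteq> k" "j \<noteq> l"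
    and f: "(\<lambda>(x, y). f x y) \<in> borel_measurable M2" "\<And>x y. \<bar>f x y\<bar> \<le> c"
    and g: "(\<lambda>(x, y). g x y) \<in> borel_measurable M2" "\<And>x y. \<bar>g x y\<bar> \<le> c"
  shows "(\<integral>w. f (w i) (w j) * g (w k) (w l) \<partial>iid_space M I)
    = (\<integral>w. f (w i) (w j) \<partial>iid_space M I) * (\<integral>w. g (w k) (w l) \<partial>iid_space M I)"
proof -
  let ?P = "iid_space M I"
  interpret P: prob_space ?P by (rule prob_space_iid)
  define h where "h y = (\<integral>x. g x y \<partial>M)" for y
  define m where "m = (\<integral>y. h y \<partial>M)"
  have f_coords: "(\<lambda>w. f (w i) (w j)) \<in> borel_measurable ?P"
    using measurable_compose[OF measurable_two_coords[OF I(2,3)] f(1)] by simp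
  have g_coords: "(\<lambda>w. g (w k) (w l)) \<in> borel_measurable ?P"
    using measurable_compose[OF measurable_two_coords[OF I(4,5)] g(1)] by simp
  have g_swap: "(\<lambda>(y, x). g x y) \<in> borel_measurable M2"
    using measurable_compose[OF measurable_pair_swap' g(1)] by (simp add: split_beta')
  have h_meas: "h \<in> borel_measurable M"
    unfolding h_def using borel_measurable_lebesgue_integral[OF g_swap] .
  have sec: "integrable M (\<lambda>x. g x y)" if "y \<in> space M" for y
    using g(2) by (intro integrable_const_bound[of _ c] section_meas(2)[OF g(1) that] AE_I2) auto
  have h_bound: "\<bar>h y\<bar> \<le> c" if "y \<in> space M" for y
  proof -
    have "\<bar>h y\<bar> \<le> (\<integral>x. \<bar>g x y\<bar> \<partial>M)" unfolding h_def using integral_norm_bound[of M "\<lambda>x. g x y"] by simp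
    also have "\<dots> \<le> (\<integral>x. c \<partial>M)" using g(2) sec[OF that] by (intro integral_mono) auto
    finally show ?thesis by (simp add: prob_space)
  qed
  have h_int: "integrable M h" using h_bound h_meas by (intro integrable_const_bound[of _ c] AE_I2) auto
  have c: "0 \<le> c" using f(2) abs_ge_zero order_trans by blast
  \<comment> \<open>The bound \<open>max c 1\<close> admits both choices of \<open>F\<close> below,
    the constant 1 and the first factor.\<close>
  have int1: "integrable ?P (\<lambda>w. g (w k) (w l) *\<^sub>R F w)" if "F \<in> borel_measurable ?P" "\<And>w. \<bar>F w\<bar> \<le> max c 1" for F
    using that g(2) c g_coords
    by (intro P.integrable_const_bound[of _ "c * max c 1"] AE_I2) (auto simp: abs_mult intro!: mult_mono)
  have key: "(\<integral>w. g (w k) (w l) *\<^sub>R F w \<partial>?P) = (\<integral>w. m *\<^sub>R F w \<partial>?P)"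
    if F: "F \<in> borel_measurable ?P" "\<And>w. \<bar>F w\<bar> \<le> max c 1"
      "\<And>w x. F (w(k := x)) = F w" "\<And>w x. F (w(l := x)) = F w" for F
  proof -
    note 1 = integral_pull_out[OF I(1,4) int1[OF F(1,2)], of "\<lambda>w. h (w l)"]
    have "(\<integral>w. g (w k) (w l) *\<^sub>R F w \<partial>?P) = (\<integral>w. h (w l) *\<^sub>R F w \<partial>?P)"
      and int2: "integrable ?P (\<lambda>w. h (w l) *\<^sub>R F w)"
      using distinct I sec coord_in_space F(3) by (intro 1; simp add: h_def)+
    note this(1)
    also have "(\<integral>w. h (w l) *\<^sub>R F w \<partial>?P) = (\<integral>w. m *\<^sub>R F w \<partial>?P)"
      using h_int F(4) by (intro integral_pull_out(1)[OF I(1,5) int2]) (auto simp: m_def)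
    finally show ?thesis .
  qed
  have "(\<integral>w. g (w k) (w l) \<partial>?P) = m"
    using key[of "\<lambda>_. 1"] by (simp add: P.prob_space)
  moreover have "(\<integral>w. f (w i) (w j) * g (w k) (w l) \<partial>?P) = m * (\<integral>w. f (w i) (w j) \<partial>?P)"
    using key[of "\<lambda>w. f (w i) (w j)"] f_coords f(2) distinct by (simp add: mult.commute le_max_iff_disj)
  ultimately show ?thesis by simp
qed

section \<open>Row sums and the weak law for squared kernel values\<close>

context degenerate_kernel
begin

definition row_sum :: "nat set \<Rightarrow> nat \<Rightarrow> (nat \<Rightarrow> 'a) \<Rightarrow> real" where
  "row_sum I k w = (\<Sum>l\<in>I - {k}. K (w k) (w l))"

lemma row_sum_eq_pair_sum:
  assumes "finite I" "k \<in> I"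
  shows "row_sum I k w = pair_sum I (\<lambda>i j. of_bool (i = k)) w"
proof -
  have "pair_sum I (\<lambda>i j. of_bool (i = k)) w = (\<Sum>i\<in>I. \<Sum>j\<in>I - {i}. of_bool (i = k) * K (w i) (w j))"
    using sum_offdiag[OF assms(1), of "\<lambda>i j. of_bool (i = k) * K (w i) (w j)"]
    by (simp add: pair_sum_def split_beta')
  also have "\<dots> = (\<Sum>i\<in>I. if i = k then row_sum I k w else 0)"
    by (intro sum.cong) (auto simp: row_sum_def)
  finally show ?thesis using assms by simp
qed

lemma sum_row_sum_eq_pair_sum:
  assumes "finite I"
  shows "(\<Sum>k\<in>I. row_sum I k w) = pair_sum I (\<lambda>i j. 1) w"
  using sum_offdiag[OF assms, of "\<lambda>i j. K (w i) (w j)"]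
  by (simp add: pair_sum_def split_beta' row_sum_def)

text \<open>Two different rows share exactly one unordered pair, while a row shares all of its
  \<open>card I - 1\<close> pairs with itself; all other products of kernel values have mean
  zero.\<close>

lemma integral_row_sum_mult:
  assumes I: "finite I" "k \<in> I" "m \<in> I"
  shows "(\<integral>w. row_sum I k w * row_sum I m w \<partial>iid_space M I)
    = variance_K * (if k = m then real (card I) - 1 else 1)"
proof -
  have "(\<Sum>(i, j)\<in>offdiag I. of_bool (i = k) * (of_bool (i = m) + of_bool (j = m)))
    = (\<Sum>i\<in>I. \<Sum>j\<in>I - {i}. of_bool (i = k) * (of_bool (i = m) + of_bool (j = m)) :: real)"
    by (rule sum_offdiag[OF I(1)])
  also have "\<dots> = (\<Sum>i\<in>I. if i = k then (\<Sum>j\<in>I - {k}. of_bool (k = m) + of_bool (j = m)) else 0)"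
    by (intro sum.cong) auto
  also have "\<dots> = (\<Sum>j\<in>I - {k}. of_bool (k = m)) + (\<Sum>j\<in>I - {k}. of_bool (j = m))"
    using I by (simp add: sum.distrib)
  also have "(\<Sum>j\<in>I - {k}. of_bool (j = m)) = (of_bool (m \<noteq> k) :: real)"
  proof -
    have "(\<Sum>j\<in>I - {k}. of_bool (j = m)) = (\<Sum>j\<in>I - {k}. if j = m then 1 else 0 :: real)"
      by (intro sum.cong) auto
    then show ?thesis using I by simp
  qed
  also have "(\<Sum>j\<in>I - {k}. of_bool (k = m)) = (real (card I) - 1) * of_bool (k = m)"
  proof -
    have "0 < card I" using I by (auto simp: card_gt_0_iff)
    then show ?thesis using I by (simp add: of_nat_diff)
  qed
  finally show ?thesis
    using integral_pair_sum_mult[OF I(1), of "\<lambda>i j. of_bool (i = k)" "\<lambda>i j. of_bool (i = m)"]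
      row_sum_eq_pair_sum I by simp
qed

lemma row_sum_mult_integrable:
  assumes "finite I" "k \<in> I" "m \<in> I"
  shows "integrable (iid_space M I) (\<lambda>w. row_sum I k w * row_sum I m w)"
  using pair_sum_mult_integrable[OF assms(1)] row_sum_eq_pair_sum assms by simp

lemma integral_total_square:
  assumes "finite I"
  shows "(\<integral>w. (\<Sum>k\<in>I. row_sum I k w)\<^sup>2 \<partial>iid_space M I) = 2 * variance_K * real (card (offdiag I))"
    and "integrable (iid_space M I) (\<lambda>w. (\<Sum>k\<in>I. row_sum I k w)\<^sup>2)"
  using integral_pair_sum_mult[OF assms, of "\<lambda>_ _. 1" "\<lambda>_ _. 1"]
    pair_sum_mult_integrable[OF assms, of "\<lambda>_ _. 1" "\<lambda>_ _. 1"]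
  by (simp_all add: sum_row_sum_eq_pair_sum[OF assms] power2_eq_square split_beta')

text \<open>Ordered pairs without a common index are independent. A given pair meets at most
  \<open>4 * n\<close> pairs out of at least \<open>n^2 / 2\<close>, so the dependent ones carry
  weight at most \<open>8 / n\<close>. The cut is at level \<open>n\<close>, and the square root of
  8 is rounded up to 3.\<close>

lemma square_law:
  assumes \<tau>: "0 < \<tau>" "\<tau> \<le> 1" and n: "2 \<le> n" and v: "0 < variance_K"
    and K_int: "integrable M2 (\<lambda>(x, y). \<bar>K x y\<bar> powr (2 + 2 * \<tau>))"
  defines "y \<equiv> real n powr (- \<tau>) * (moment_K (2 + 2 * \<tau>) / variance_K powr (1 + \<tau>))"
  shows "(\<integral>w. \<bar>(\<Sum>p\<in>offdiag {1..n}. 1 / (real n * (real n - 1)) * ((K (w (fst p)) (w (snd p)))\<^sup>2 / variance_K)) - 1\<bar>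
      \<partial>iid_space M {1..n}) \<le> 2 * y + 3 * sqrt y"
proof -
  define I where "I = {1..n}"
  let ?P = "iid_space M I"
  define N where "N = real n * (real n - 1)"
  define \<kappa> where "\<kappa> = moment_K (2 + 2 * \<tau>) / variance_K powr (1 + \<tau>)"
  have y: "y = real n powr (- \<tau>) * \<kappa>" by (simp add: y_def \<kappa>_def)
  interpret P: prob_space ?P by (rule prob_space_iid)
  have finI: "finite I" by (simp add: I_def)
  have n2: "2 \<le> real n" using n by simp
  have N: "(real n)\<^sup>2 / 2 \<le> N" "0 < N"
    using mult_left_mono[of 2 "real n" "real n"] n2 by (auto simp: N_def power2_eq_square right_diff_distrib)
  have cardN: "real (card (offdiag I)) = N"
    using n by (simp add: card_offdiag finI I_def N_def of_nat_diff)
  define \<xi> where "\<xi> p w = (K (w (fst p)) (w (snd p)))\<^sup>2 / variance_K" for p and w :: "nat \<Rightarrow> 'a"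
  define D where "D = {(p, q). {fst p, snd p} \<inter> {fst q, snd q} \<noteq> ({} :: nat set)}"
  have pow: "\<xi> p w powr (1 + \<tau>) = \<bar>K (w (fst p)) (w (snd p))\<bar> powr (2 + 2 * \<tau>) / variance_K powr (1 + \<tau>)" for p w
    using v by (simp add: \<xi>_def powr_divide powr_power2_eq)
  have "(\<integral>w. \<bar>(\<Sum>p\<in>offdiag I. 1 / N * \<xi> p w) - 1\<bar> \<partial>?P)
    \<le> 2 * \<kappa> * real n powr (- \<tau>) + sqrt (8 / real n * (real n powr (1 - \<tau>) * \<kappa>))"
  proof (rule P.truncated_weak_law[where D = D])
    fix p assume p: "p \<in> offdiag I"
    then have p': "fst p \<in> I" "snd p \<in> I" "fst p \<noteq> snd p" "(fst p, snd p) \<in> offdiag I" by (auto simp: offdiag_def)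
    show "\<xi> p \<in> borel_measurable ?P" unfolding \<xi>_def using K_coords_meas[OF p'(4)] by simp
    show "0 \<le> \<xi> p w" for w using v by (simp add: \<xi>_def)
    show "integrable ?P (\<lambda>w. \<xi> p w powr (1 + \<tau>))"
      unfolding pow using integrable_two_coords[OF finI p'(1-3) K_int] by simp
    show "(\<integral>w. \<xi> p w \<partial>?P) = 1"
    proof -
      have "p \<noteq> (snd p, fst p)" using p'(3) by (metis fst_conv)
      then show ?thesis
        using integral_K_mult[OF finI p'(4,4)] v by (simp add: \<xi>_def power2_eq_square)
    qed
    show "(\<integral>w. \<xi> p w powr (1 + \<tau>) \<partial>?P) \<le> \<kappa>"
      unfolding pow using integral_two_coords[OF finI p'(1-3), of "\<lambda>x y. \<bar>K x y\<bar> powr (2 + 2 * \<tau>)"]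
        borel_measurable_integrable[OF K_int] by (simp add: \<kappa>_def moment_K_def)
    show "0 \<le> 1 / N" using N by simp
    fix q assume q: "q \<in> offdiag I" and pq: "(p, q) \<notin> D"
    then have q': "fst q \<in> I" "snd q \<in> I" "fst q \<noteq> snd q" by (auto simp: offdiag_def)
    have dis: "fst p \<noteq> fst q" "fst p \<noteq> snd q" "snd p \<noteq> fst q" "snd p \<noteq> snd q" using pq by (auto simp: D_def)
    define f where "f x y = min ((K x y)\<^sup>2 / variance_K) (real n)" for x y
    have f: "(\<lambda>(x, y). f x y) \<in> borel_measurable M2" "\<bar>f x y\<bar> \<le> real n" for x y
      using K_meas v unfolding f_def by (auto simp: split_beta' abs_of_nonneg)
    show "(\<integral>w. min (\<xi> p w) (real n) * min (\<xi> q w) (real n) \<partial>?P)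
      = (\<integral>w. min (\<xi> p w) (real n) \<partial>?P) * (\<integral>w. min (\<xi> q w) (real n) \<partial>?P)"
      using integral_disjoint_pairs[OF finI p'(1,2) q'(1,2) p'(3) q'(3) dis f f]
      unfolding f_def \<xi>_def .
  next
    show "(\<Sum>p\<in>offdiag I. 1 / N) = 1" using cardN N by simp
    have "(\<Sum>p\<in>offdiag I. \<Sum>q\<in>offdiag I. 1 / N * (1 / N) * of_bool ((p, q) \<in> D))
      \<le> (\<Sum>p\<in>offdiag I. 1 / N * (1 / N) * (4 * real n))"
    proof (rule sum_mono)
      fix p :: "nat \<times> nat"
      let ?S = "{fst p, snd p}"
      have S: "finite ?S" "card ?S \<le> 2" by (auto simp: card_insert_if)
      have "(\<Sum>q\<in>offdiag I. of_bool ((p, q) \<in> D) :: real) = real (card {q \<in> offdiag I. (p, q) \<in> D})"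
        using finI by (simp add: Int_def)
      also have "card {q \<in> offdiag I. (p, q) \<in> D} \<le> card (?S \<times> I \<union> I \<times> ?S)"
        using finI by (intro card_mono) (auto simp: D_def offdiag_def)
      also have "\<dots> \<le> card (?S \<times> I) + card (I \<times> ?S)" by (rule card_Un_le)
      also have "\<dots> = card ?S * n + card ?S * n" by (simp add: card_cartesian_product I_def)
      also have "\<dots> \<le> 2 * n + 2 * n" using S(2) by (intro add_mono mult_le_mono1)
      also have "\<dots> = 4 * n" by simp
      finally have *: "(\<Sum>q\<in>offdiag I. of_bool ((p, q) \<in> D) :: real) \<le> 4 * real n" by simp
      show "(\<Sum>q\<in>offdiag I. 1 / N * (1 / N) * of_bool ((p, q) \<in> D)) \<le> 1 / N * (1 / N) * (4 * real n)"
        unfolding sum_distrib_left[symmetric] using N by (intro mult_left_mono *) auto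
    qed
    also have "\<dots> = 4 * real n / N" using cardN N by simp
    also have "\<dots> \<le> 4 * real n / ((real n)\<^sup>2 / 2)" using N n2 by (intro divide_left_mono) auto
    also have "\<dots> = 8 / real n" using n2 by (simp add: power2_eq_square)
    finally show "(\<Sum>p\<in>offdiag I. \<Sum>q\<in>offdiag I. 1 / N * (1 / N) * of_bool ((p, q) \<in> D)) \<le> 8 / real n" .
  qed (use \<tau> n2 finI in auto)
  also have "8 / real n * (real n powr (1 - \<tau>) * \<kappa>) = 8 * y"
    using n2 by (simp add: y powr_diff powr_minus field_simps)
  also have "sqrt (8 * y) \<le> sqrt (3\<^sup>2 * y)"
    using moment_K_nonneg by (intro real_sqrt_le_mono mult_right_mono) (auto simp: y_def)
  also have "sqrt (3\<^sup>2 * y) = 3 * sqrt y" by (simp add: real_sqrt_mult)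
  finally show ?thesis
    by (simp add: y I_def N_def \<xi>_def mult_ac)
qed

end

text \<open>\<open>a\<close> is the observed distance and \<open>\<alpha>\<close> collects what
  double centring removes from it. The diagonal of \<open>a\<close> vanishes although that of
  \<open>K\<close> need not, which is why all sums run over distinct indices.\<close>

locale centered_kernel = degenerate_kernel +
  fixes a :: "'a \<Rightarrow> 'a \<Rightarrow> real" and \<alpha> :: "'a \<Rightarrow> real"
  assumes a_diag: "\<And>x. x \<in> space M \<Longrightarrow> a x x = 0"
    and a_shift: "\<And>x y. x \<in> space M \<Longrightarrow> y \<in> space M \<Longrightarrow> a x y = K x y + \<alpha> x + \<alpha> y"
begin

lemma V_star_self:
  assumes n: "4 \<le> n" and w: "w \<in> space (iid_space M {1..n})"
  shows "V_star n (\<lambda>k l. a (w k) (w l)) (\<lambda>k l. a (w k) (w l)) =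
    ((\<Sum>p\<in>offdiag {1..n}. (K (w (fst p)) (w (snd p)))\<^sup>2)
     - 2 / (real n - 2) * (\<Sum>k\<in>{1..n}. (row_sum {1..n} k w)\<^sup>2)
     + (\<Sum>k\<in>{1..n}. row_sum {1..n} k w)\<^sup>2 / ((real n - 1) * (real n - 2))) / (real n * (real n - 3))"
proof -
  have s: "w k \<in> space M" if "k \<in> {1..n}" for k using w that by (intro coord_in_space)
  note eq = V_star_of_shifted[where d = "\<lambda>k l. K (w k) (w l)" and e = "\<lambda>k l. K (w k) (w l)"
      and \<alpha> = "\<lambda>k. \<alpha> (w k)" and \<beta> = "\<lambda>k. \<alpha> (w k)" and n = n
      and a = "\<lambda>k l. a (w k) (w l)" and b = "\<lambda>k l. a (w k) (w l)", OF n]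
  have "(\<Sum>p\<in>offdiag {1..n}. (K (w (fst p)) (w (snd p)))\<^sup>2)
    = (\<Sum>k\<in>{1..n}. \<Sum>l\<in>{1..n} - {k}. K (w k) (w l) * K (w k) (w l))"
    using sum_offdiag[of "{1..n}" "\<lambda>k l. K (w k) (w l) * K (w k) (w l)"]
    by (simp add: split_beta' power2_eq_square)
  then show ?thesis
    unfolding row_sum_def power2_eq_square
    using s by (simp only:) (rule eq; simp add: K_sym a_diag a_shift)
qed

text \<open>The divisor \<open>n * (n - 3)\<close> in place of \<open>n * (n - 1)\<close> multiplies
  the average of squares by \<open>c\<^sub>0\<close>, which differs from 1 by at most
  \<open>4 / n\<close> once \<open>n \<ge> 6\<close>. The quantities behind the two centring
  corrections are nonnegative, so the corrections are bounded by their means, together at most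
  \<open>8 / n\<close>.\<close>

lemma self_law:
  assumes \<tau>: "0 < \<tau>" "\<tau> \<le> 1" and n: "6 \<le> n" and v: "0 < variance_K"
    and K_int: "integrable M2 (\<lambda>(x, y). \<bar>K x y\<bar> powr (2 + 2 * \<tau>))"
  defines "y \<equiv> real n powr (- \<tau>) * (moment_K (2 + 2 * \<tau>) / variance_K powr (1 + \<tau>))"
    and "V \<equiv> \<lambda>w. V_star n (\<lambda>k l. a (w k) (w l)) (\<lambda>k l. a (w k) (w l))"
  shows "integrable (iid_space M {1..n}) V"
    and "(\<integral>w. \<bar>V w / variance_K - 1\<bar> \<partial>iid_space M {1..n}) \<le> 4 * y + 6 * sqrt y + 12 / real n"
proof -
  define I where "I = {1..n}"
  let ?P = "iid_space M I"
  define N where "N = real n"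
  have N: "6 \<le> N" using n by (simp add: N_def)
  interpret P: prob_space ?P by (rule prob_space_iid)
  have finI: "finite I" by (simp add: I_def)
  define U where "U w = (\<Sum>p\<in>offdiag I. 1 / (N * (N - 1)) * ((K (w (fst p)) (w (snd p)))\<^sup>2 / variance_K))" for w
  define R where "R w = (\<Sum>k\<in>I. (row_sum I k w)\<^sup>2)" for w
  define T where "T w = (\<Sum>k\<in>I. row_sum I k w)\<^sup>2" for w
  have U_int: "integrable ?P U"
    unfolding U_def using K_coords_square_integrable[OF finI] v
    by (intro Bochner_Integration.integrable_sum integrable_mult_right integrable_divide) auto
  have R_int: "integrable ?P R"
    unfolding R_def power2_eq_square by (intro Bochner_Integration.integrable_sum row_sum_mult_integrable finI)
  have T_int: "integrable ?P T" unfolding T_def by (rule integral_total_square(2)[OF finI])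
  have ER: "(\<integral>w. R w \<partial>?P) = N * ((N - 1) * variance_K)"
  proof -
    have "(\<integral>w. R w \<partial>?P) = (\<Sum>k\<in>I. \<integral>w. row_sum I k w * row_sum I k w \<partial>?P)"
      unfolding R_def power2_eq_square
      by (intro Bochner_Integration.integral_sum row_sum_mult_integrable finI)
    also have "\<dots> = (\<Sum>k\<in>I. variance_K * (real (card I) - 1))"
      by (intro sum.cong refl) (simp add: integral_row_sum_mult[OF finI])
    finally show ?thesis by (simp add: I_def N_def)
  qed
  have ET: "(\<integral>w. T w \<partial>?P) = 2 * variance_K * (N * (N - 1))"
    unfolding T_def integral_total_square(1)[OF finI] card_offdiag[OF finI]
    using n by (simp add: I_def N_def of_nat_diff)
  define c\<^sub>0 c\<^sub>1 c\<^sub>2 where "c\<^sub>0 = (N - 1) / (N - 3)" and "c\<^sub>1 = 2 / ((N - 2) * (N * (N - 3)) * variance_K)"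
    and "c\<^sub>2 = 1 / ((N - 1) * (N - 2) * (N * (N - 3)) * variance_K)"
  have c: "0 \<le> c\<^sub>1" "0 \<le> c\<^sub>2" "c\<^sub>0 \<le> 2" "0 \<le> c\<^sub>0 - 1" "c\<^sub>0 - 1 \<le> 4 / N"
  proof -
    show "0 \<le> c\<^sub>1" "0 \<le> c\<^sub>2"
      unfolding c\<^sub>1_def c\<^sub>2_def using N v by (intro divide_nonneg_nonneg mult_nonneg_nonneg; simp)+
    show "c\<^sub>0 \<le> 2" "0 \<le> c\<^sub>0 - 1" "c\<^sub>0 - 1 \<le> 4 / N"
      unfolding c\<^sub>0_def using N by (simp_all add: field_simps)
  qed
  have V_eq: "V w / variance_K = c\<^sub>0 * U w - c\<^sub>1 * R w + c\<^sub>2 * T w" if w: "w \<in> space ?P" for w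
  proof -
    define Q where "Q = (\<Sum>p\<in>offdiag I. (K (w (fst p)) (w (snd p)))\<^sup>2)"
    have Q: "c\<^sub>0 * U w = Q / (N * (N - 3)) / variance_K"
    proof -
      have "U w = 1 / (N * (N - 1)) * (Q / variance_K)"
        unfolding U_def Q_def sum_divide_distrib sum_distrib_left ..
      then show ?thesis using N v by (simp add: c\<^sub>0_def)
    qed
    have "V w = (Q - 2 / (N - 2) * R w + T w / ((N - 1) * (N - 2))) / (N * (N - 3))"
      unfolding V_def Q_def R_def T_def N_def I_def using n w by (intro V_star_self) (auto simp: I_def)
    also have "\<dots> / variance_K = Q / (N * (N - 3)) / variance_K
        - 2 / (N - 2) * R w / (N * (N - 3)) / variance_K + T w / ((N - 1) * (N - 2)) / (N * (N - 3)) / variance_K"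
      by (simp add: add_divide_distrib diff_divide_distrib)
    finally show ?thesis unfolding Q by (simp add: c\<^sub>1_def c\<^sub>2_def mult_ac)
  qed
  have int: "integrable ?P (\<lambda>w. c\<^sub>0 * U w - c\<^sub>1 * R w + c\<^sub>2 * T w)"
    using U_int R_int T_int by simp
  then have "integrable ?P (\<lambda>w. V w / variance_K)"
    by (subst Bochner_Integration.integrable_cong[OF refl V_eq])
  then have "integrable ?P (\<lambda>w. variance_K * (V w / variance_K))" by (rule integrable_mult_right)
  then have "integrable ?P V" using v by simp
  then show "integrable (iid_space M {1..n}) V" by (simp add: I_def)
  have "(\<integral>w. \<bar>V w / variance_K - 1\<bar> \<partial>?P)
    \<le> (\<integral>w. 2 * \<bar>U w - 1\<bar> + 4 / N + c\<^sub>1 * R w + c\<^sub>2 * T w \<partial>?P)"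
  proof (rule integral_mono)
    show "integrable ?P (\<lambda>w. \<bar>V w / variance_K - 1\<bar>)" using \<open>integrable ?P V\<close> by simp
    show "integrable ?P (\<lambda>w. 2 * \<bar>U w - 1\<bar> + 4 / N + c\<^sub>1 * R w + c\<^sub>2 * T w)"
      using U_int R_int T_int by simp
    fix w assume w: "w \<in> space ?P"
    have "V w / variance_K - 1 = c\<^sub>0 * (U w - 1) + (c\<^sub>0 - 1) - c\<^sub>1 * R w + c\<^sub>2 * T w"
      unfolding V_eq[OF w] by (simp add: algebra_simps)
    moreover have "\<bar>c\<^sub>0 * (U w - 1)\<bar> \<le> 2 * \<bar>U w - 1\<bar>"
      unfolding abs_mult using c by (intro mult_right_mono) auto
    moreover have "0 \<le> c\<^sub>1 * R w" "0 \<le> c\<^sub>2 * T w"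
      using c by (auto simp: R_def T_def intro!: mult_nonneg_nonneg sum_nonneg)
    ultimately show "\<bar>V w / variance_K - 1\<bar> \<le> 2 * \<bar>U w - 1\<bar> + 4 / N + c\<^sub>1 * R w + c\<^sub>2 * T w"
      using c by linarith
  qed
  also have "\<dots> = 2 * (\<integral>w. \<bar>U w - 1\<bar> \<partial>?P) + 4 / N + c\<^sub>1 * (N * ((N - 1) * variance_K)) + c\<^sub>2 * (2 * variance_K * (N * (N - 1)))"
    using U_int R_int T_int by (simp add: P.prob_space ER ET)
  also have "(\<integral>w. \<bar>U w - 1\<bar> \<partial>?P) \<le> 2 * y + 3 * sqrt y"
    unfolding U_def y_def I_def N_def using square_law[OF \<tau> _ v K_int, of n] n by simp
  also have "c\<^sub>1 * (N * ((N - 1) * variance_K)) = 2 * (N - 1) / ((N - 2) * (N - 3))"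
    using N v by (simp add: c\<^sub>1_def)
  also have "c\<^sub>2 * (2 * variance_K * (N * (N - 1))) = 2 / ((N - 2) * (N - 3))"
  proof -
    have "1 / (k * m * (N * h) * u) * (2 * u * (N * k)) = 2 / (m * h)"
      if "k \<noteq> 0" "m \<noteq> 0" "h \<noteq> 0" "u \<noteq> 0" for k m h u
      using that N by (simp add: field_simps)
    from this[of "N - 1" "N - 2" "N - 3" variance_K] show ?thesis using N v by (simp add: c\<^sub>2_def)
  qed
  also have "2 * (2 * y + 3 * sqrt y) + 4 / N + 2 * (N - 1) / ((N - 2) * (N - 3)) + 2 / ((N - 2) * (N - 3))
    = 4 * y + 6 * sqrt y + 4 / N + 2 * N / ((N - 2) * (N - 3))"
  proof -
    have "2 * (N - 1) / ((N - 2) * (N - 3)) + 2 / ((N - 2) * (N - 3)) = 2 * N / ((N - 2) * (N - 3))"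
      unfolding add_divide_distrib[symmetric] by simp
    moreover have "A + B = C \<Longrightarrow> 2 * (2 * y + 3 * sqrt y) + E + A + B = 4 * y + 6 * sqrt y + E + C"
      for A B C E by simp
    ultimately show ?thesis by blast
  qed
  also have "2 * N / ((N - 2) * (N - 3)) \<le> 8 / N"
  proof -
    have "N / (N - 2) \<le> 3 / 2" "N / (N - 3) \<le> 2" "0 \<le> N / (N - 2)" "0 \<le> N / (N - 3)" using N by (auto simp: field_simps)
    then have "N / (N - 2) * (N / (N - 3)) \<le> 3 / 2 * 2" by (intro mult_mono) auto
    then have "2 / N * (N / (N - 2) * (N / (N - 3))) \<le> 2 / N * 3" using N by (intro mult_left_mono) auto
    also have "2 / N * 3 \<le> 8 / N" using N by (simp add: divide_right_mono)
    also have "2 / N * (N / (N - 2) * (N / (N - 3))) = 2 * N / ((N - 2) * (N - 3))" using N by simp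
    finally show ?thesis .
  qed
  finally show "(\<integral>w. \<bar>V w / variance_K - 1\<bar> \<partial>iid_space M {1..n}) \<le> 4 * y + 6 * sqrt y + 12 / real n"
    by (simp add: I_def N_def)
qed

end

section \<open>Integration over products of two samples\<close>

lemma nn_integral_pair4:
  fixes F :: "'a \<Rightarrow> 'a \<Rightarrow> ennreal" and G :: "'b \<Rightarrow> 'b \<Rightarrow> ennreal"
  assumes P: "prob_space P" "prob_space Q"
    and F [measurable]: "(\<lambda>(x, y). F x y) \<in> borel_measurable (P \<Otimes>\<^sub>M P)"
    and G [measurable]: "(\<lambda>(x, y). G x y) \<in> borel_measurable (Q \<Otimes>\<^sub>M Q)"
  shows "(\<integral>\<^sup>+z. F (fst (fst z)) (fst (snd z)) * G (snd (fst z)) (snd (snd z)) \<partial>((P \<Otimes>\<^sub>M Q) \<Otimes>\<^sub>M (P \<Otimes>\<^sub>M Q)))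
    = (\<integral>\<^sup>+(x, y). F x y \<partial>(P \<Otimes>\<^sub>M P)) * (\<integral>\<^sup>+(x, y). G x y \<partial>(Q \<Otimes>\<^sub>M Q))"
proof -
  interpret P: prob_space P by fact
  interpret Q: prob_space Q by fact
  interpret PQ: pair_prob_space P Q ..
  define f where "f x = (\<integral>\<^sup>+x'. F x x' \<partial>P)" for x
  define g where "g y = (\<integral>\<^sup>+y'. G y y' \<partial>Q)" for y
  have f_meas [measurable]: "f \<in> borel_measurable P" unfolding f_def by measurable
  have g_meas [measurable]: "g \<in> borel_measurable Q" unfolding g_def by measurable
  have product: "(\<integral>\<^sup>+p. u (fst p) * v (snd p) \<partial>(P \<Otimes>\<^sub>M Q)) = (\<integral>\<^sup>+x. u x \<partial>P) * (\<integral>\<^sup>+y. v y \<partial>Q)"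
    if [measurable]: "u \<in> borel_measurable P" "v \<in> borel_measurable Q" for u :: "'a \<Rightarrow> ennreal" and v :: "'b \<Rightarrow> ennreal"
  proof -
    have "(\<integral>\<^sup>+p. u (fst p) * v (snd p) \<partial>(P \<Otimes>\<^sub>M Q)) = (\<integral>\<^sup>+x. (\<integral>\<^sup>+y. u x * v y \<partial>Q) \<partial>P)"
      by (subst Q.nn_integral_fst[symmetric]) auto
    then show ?thesis by (simp add: nn_integral_cmult nn_integral_multc)
  qed
  have F' [measurable]: "(\<lambda>z. F (fst (fst z)) (fst (snd z))) \<in> borel_measurable ((P \<Otimes>\<^sub>M Q) \<Otimes>\<^sub>M (P \<Otimes>\<^sub>M Q))"
    using measurable_compose[OF _ F, of "\<lambda>z. (fst (fst z), fst (snd z))"] by simp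
  have G' [measurable]: "(\<lambda>z. G (snd (fst z)) (snd (snd z))) \<in> borel_measurable ((P \<Otimes>\<^sub>M Q) \<Otimes>\<^sub>M (P \<Otimes>\<^sub>M Q))"
    using measurable_compose[OF _ G, of "\<lambda>z. (snd (fst z), snd (snd z))"] by simp
  have "(\<integral>\<^sup>+z. F (fst (fst z)) (fst (snd z)) * G (snd (fst z)) (snd (snd z)) \<partial>((P \<Otimes>\<^sub>M Q) \<Otimes>\<^sub>M (P \<Otimes>\<^sub>M Q)))
    = (\<integral>\<^sup>+p. (\<integral>\<^sup>+p'. F (fst p) (fst p') * G (snd p) (snd p') \<partial>(P \<Otimes>\<^sub>M Q)) \<partial>(P \<Otimes>\<^sub>M Q))"
    by (subst PQ.nn_integral_fst[symmetric]) auto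
  also have "\<dots> = (\<integral>\<^sup>+p. f (fst p) * g (snd p) \<partial>(P \<Otimes>\<^sub>M Q))"
  proof (intro nn_integral_cong)
    fix p assume "p \<in> space (P \<Otimes>\<^sub>M Q)"
    then have p: "fst p \<in> space P" "snd p \<in> space Q" by (auto simp: space_pair_measure)
    have "(\<lambda>x'. F (fst p) x') \<in> borel_measurable P" "(\<lambda>y'. G (snd p) y') \<in> borel_measurable Q"
      using measurable_compose[OF measurable_Pair1'[OF p(1)] F] measurable_compose[OF measurable_Pair1'[OF p(2)] G] by auto
    from product[OF this] show "(\<integral>\<^sup>+p'. F (fst p) (fst p') * G (snd p) (snd p') \<partial>(P \<Otimes>\<^sub>M Q)) = f (fst p) * g (snd p)"
      by (simp add: f_def g_def)
  qed
  also have "\<dots> = (\<integral>\<^sup>+x. f x \<partial>P) * (\<integral>\<^sup>+y. g y \<partial>Q)" by (rule product) measurable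
  also have "(\<integral>\<^sup>+x. f x \<partial>P) = (\<integral>\<^sup>+(x, y). F x y \<partial>(P \<Otimes>\<^sub>M P))"
    unfolding f_def using P.nn_integral_fst[OF F] by simp
  also have "(\<integral>\<^sup>+y. g y \<partial>Q) = (\<integral>\<^sup>+(x, y). G x y \<partial>(Q \<Otimes>\<^sub>M Q))"
    unfolding g_def using Q.nn_integral_fst[OF G] by simp
  finally show ?thesis .
qed

lemma
  fixes F :: "'a \<Rightarrow> 'a \<Rightarrow> real" and G :: "'b \<Rightarrow> 'b \<Rightarrow> real"
  assumes P: "prob_space P" "prob_space Q"
    and F: "integrable (P \<Otimes>\<^sub>M P) (\<lambda>(x, y). F x y)" "\<And>x y. 0 \<le> F x y"
    and G: "integrable (Q \<Otimes>\<^sub>M Q) (\<lambda>(x, y). G x y)" "\<And>x y. 0 \<le> G x y"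
  shows integrable_pair4: "integrable ((P \<Otimes>\<^sub>M Q) \<Otimes>\<^sub>M (P \<Otimes>\<^sub>M Q))
      (\<lambda>z. F (fst (fst z)) (fst (snd z)) * G (snd (fst z)) (snd (snd z)))" (is "integrable ?M ?f")
    and integral_pair4: "(\<integral>z. F (fst (fst z)) (fst (snd z)) * G (snd (fst z)) (snd (snd z)) \<partial>((P \<Otimes>\<^sub>M Q) \<Otimes>\<^sub>M (P \<Otimes>\<^sub>M Q)))
      = (\<integral>(x, y). F x y \<partial>(P \<Otimes>\<^sub>M P)) * (\<integral>(x, y). G x y \<partial>(Q \<Otimes>\<^sub>M Q))"
proof -
  define I where "I = (\<integral>(x, y). F x y \<partial>(P \<Otimes>\<^sub>M P))"
  define J where "J = (\<integral>(x, y). G x y \<partial>(Q \<Otimes>\<^sub>M Q))"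
  have IJ: "0 \<le> I" "0 \<le> J"
    unfolding I_def J_def using F(2) G(2) by (auto intro!: Bochner_Integration.integral_nonneg)
  have F_meas: "(\<lambda>(x, y). F x y) \<in> borel_measurable (P \<Otimes>\<^sub>M P)" using F(1) by simp
  have G_meas: "(\<lambda>(x, y). G x y) \<in> borel_measurable (Q \<Otimes>\<^sub>M Q)" using G(1) by simp
  have F_nn: "(\<integral>\<^sup>+(x, y). ennreal (F x y) \<partial>(P \<Otimes>\<^sub>M P)) = ennreal I"
    using nn_integral_eq_integral[OF F(1)] F(2) by (simp add: split_beta' I_def)
  have G_nn: "(\<integral>\<^sup>+(x, y). ennreal (G x y) \<partial>(Q \<Otimes>\<^sub>M Q)) = ennreal J"
    using nn_integral_eq_integral[OF G(1)] G(2) by (simp add: split_beta' J_def)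
  have f_meas: "?f \<in> borel_measurable ?M"
  proof (rule borel_measurable_times)
    have "(\<lambda>z. (fst (fst z), fst (snd z))) \<in> ?M \<rightarrow>\<^sub>M P \<Otimes>\<^sub>M P" by measurable
    from measurable_compose[OF this F_meas]
    show "(\<lambda>z. F (fst (fst z)) (fst (snd z))) \<in> borel_measurable ?M" by simp
    have "(\<lambda>z. (snd (fst z), snd (snd z))) \<in> ?M \<rightarrow>\<^sub>M Q \<Otimes>\<^sub>M Q" by measurable
    from measurable_compose[OF this G_meas]
    show "(\<lambda>z. G (snd (fst z)) (snd (snd z))) \<in> borel_measurable ?M" by simp
  qed
  have "(\<integral>\<^sup>+z. ennreal (?f z) \<partial>?M) = ennreal I * ennreal J"
    using nn_integral_pair4[OF P, of "\<lambda>x y. ennreal (F x y)" "\<lambda>x y. ennreal (G x y)"] F_meas G_meas F G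
    by (simp add: F_nn[simplified split_beta'] G_nn[simplified split_beta'] split_beta' ennreal_mult)
  also have "\<dots> = ennreal (I * J)" using IJ by (simp add: ennreal_mult)
  finally have "integrable ?M ?f \<and> integral\<^sup>L ?M ?f = I * J"
    using f_meas F(2) G(2) IJ by (subst (asm) nn_integral_eq_integrable) auto
  then show "integrable ?M ?f" "integral\<^sup>L ?M ?f = (\<integral>(x, y). F x y \<partial>(P \<Otimes>\<^sub>M P)) * (\<integral>(x, y). G x y \<partial>(Q \<Otimes>\<^sub>M Q))"
    by (auto simp: I_def J_def)
qed

text \<open>Connects two separate samples with one sample of pairs. On a box the integrand is a
  product over \<open>i\<close>; for a fixed first sample the inner integral factorises over the
  coordinates, and the result is again a product in the coordinates of the first sample.\<close>

lemma distr_zip: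
  assumes P: "prob_space P" "prob_space Q" and I: "finite I"
  shows "distr (iid_space P I \<Otimes>\<^sub>M iid_space Q I) (iid_space (P \<Otimes>\<^sub>M Q) I) (\<lambda>z. \<lambda>i\<in>I. (fst z i, snd z i))
    = iid_space (P \<Otimes>\<^sub>M Q) I"
proof -
  interpret P: prob_space P by fact
  interpret Q: prob_space Q by fact
  interpret PQ: pair_prob_space P Q ..
  interpret PP: product_sigma_finite "\<lambda>_::nat. P" by (rule P.product_sigma_finite_const)
  interpret QQ: product_sigma_finite "\<lambda>_::nat. Q" by (rule Q.product_sigma_finite_const)
  interpret RR: product_sigma_finite "\<lambda>_::nat. P \<Otimes>\<^sub>M Q" by (rule PQ.product_sigma_finite_const)
  interpret QI: sigma_finite_measure "iid_space Q I"
    by (intro prob_space_imp_sigma_finite Q.prob_space_iid)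
  let ?Z = "\<lambda>z. \<lambda>i\<in>I. (fst z i, snd z i)"
  have Z: "?Z \<in> iid_space P I \<Otimes>\<^sub>M iid_space Q I \<rightarrow>\<^sub>M iid_space (P \<Otimes>\<^sub>M Q) I" by measurable
  show ?thesis
  proof (rule RR.PiM_eqI[OF I])
    fix A assume A: "\<And>i. i \<in> I \<Longrightarrow> A i \<in> sets (P \<Otimes>\<^sub>M Q)"
    have A_ind: "(\<lambda>p. indicator (A i) p :: ennreal) \<in> borel_measurable (P \<Otimes>\<^sub>M Q)" if "i \<in> I" for i
      using A[OF that] by simp
    have "emeasure (distr (iid_space P I \<Otimes>\<^sub>M iid_space Q I) (iid_space (P \<Otimes>\<^sub>M Q) I) ?Z) (Pi\<^sub>E I A)
      = (\<integral>\<^sup>+z. indicator (Pi\<^sub>E I A) (?Z z) \<partial>(iid_space P I \<Otimes>\<^sub>M iid_space Q I))"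
      using A I Z by (subst nn_integral_indicator[symmetric], simp add: sets_PiM_I_finite, subst nn_integral_distr) (auto simp: sets_PiM_I_finite)
    also have "\<dots> = (\<integral>\<^sup>+z. (\<Prod>i\<in>I. indicator (A i) (fst z i, snd z i)) \<partial>(iid_space P I \<Otimes>\<^sub>M iid_space Q I))"
    proof (intro nn_integral_cong)
      fix z
      show "indicator (Pi\<^sub>E I A) (?Z z) = (\<Prod>i\<in>I. indicator (A i) (fst z i, snd z i) :: ennreal)"
      proof (cases "\<forall>i\<in>I. (fst z i, snd z i) \<in> A i")
        case True
        then show ?thesis by (auto simp: indicator_def PiE_iff)
      next
        case False
        then obtain i where "i \<in> I" "(fst z i, snd z i) \<notin> A i" by auto
        then show ?thesis using I by (auto simp: indicator_def PiE_iff)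
      qed
    qed
    also have "\<dots> = (\<integral>\<^sup>+w. (\<integral>\<^sup>+\<psi>. (\<Prod>i\<in>I. indicator (A i) (w i, \<psi> i)) \<partial>iid_space Q I) \<partial>iid_space P I)"
    proof (subst QI.nn_integral_fst[symmetric])
      show "(\<lambda>z. \<Prod>i\<in>I. indicator (A i) (fst z i, snd z i) :: ennreal) \<in> borel_measurable (iid_space P I \<Otimes>\<^sub>M iid_space Q I)"
      proof (rule borel_measurable_prod_ennreal)
        fix i assume i: "i \<in> I"
        then have "(\<lambda>z. (fst z i, snd z i)) \<in> iid_space P I \<Otimes>\<^sub>M iid_space Q I \<rightarrow>\<^sub>M P \<Otimes>\<^sub>M Q" by measurable
        from measurable_compose[OF this A_ind[OF i]]
        show "(\<lambda>z. indicator (A i) (fst z i, snd z i) :: ennreal) \<in> borel_measurable (iid_space P I \<Otimes>\<^sub>M iid_space Q I)" .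
      qed
    qed simp
    also have "\<dots> = (\<integral>\<^sup>+w. (\<Prod>i\<in>I. \<integral>\<^sup>+y. indicator (A i) (w i, y) \<partial>Q) \<partial>iid_space P I)"
    proof (intro nn_integral_cong)
      fix w assume w: "w \<in> space (iid_space P I)"
      show "(\<integral>\<^sup>+\<psi>. (\<Prod>i\<in>I. indicator (A i) (w i, \<psi> i)) \<partial>iid_space Q I) = (\<Prod>i\<in>I. \<integral>\<^sup>+y. indicator (A i) (w i, y) \<partial>Q)"
      proof (rule QQ.product_nn_integral_prod[OF I, of "\<lambda>i y. indicator (A i) (w i, y)"])
        fix i assume i: "i \<in> I"
        then have "w i \<in> space P" using w P.coord_in_space by blast
        from measurable_compose[OF measurable_Pair1'[OF this] A_ind[OF i]]
        show "(\<lambda>y. indicator (A i) (w i, y) :: ennreal) \<in> borel_measurable Q" .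
      qed
    qed
    also have "\<dots> = (\<Prod>i\<in>I. \<integral>\<^sup>+x. (\<integral>\<^sup>+y. indicator (A i) (x, y) \<partial>Q) \<partial>P)"
      by (rule PP.product_nn_integral_prod[OF I, of "\<lambda>i x. \<integral>\<^sup>+y. indicator (A i) (x, y) \<partial>Q"])
         (rule Q.borel_measurable_nn_integral_fst[OF A_ind])
    also have "\<dots> = (\<Prod>i\<in>I. emeasure (P \<Otimes>\<^sub>M Q) (A i))"
      by (intro prod.cong refl) (simp add: Q.nn_integral_fst[OF A_ind] A)
    finally show "emeasure (distr (iid_space P I \<Otimes>\<^sub>M iid_space Q I) (iid_space (P \<Otimes>\<^sub>M Q) I) ?Z) (Pi\<^sub>E I A)
      = (\<Prod>i\<in>I. emeasure (P \<Otimes>\<^sub>M Q) (A i))" .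
  qed simp
qed

lemma sum_symmetric_pairs:
  fixes f :: "nat \<Rightarrow> nat \<Rightarrow> real"
  assumes "\<And>k l. k \<in> {1..n} \<Longrightarrow> l \<in> {1..n} \<Longrightarrow> f k l = f l k"
  shows "(\<Sum>k\<in>{1..n}. \<Sum>l\<in>{1..n} - {k}. f k l) = 2 * (\<Sum>k\<in>{1..n}. \<Sum>l\<in>{1..<k}. f k l)"
  using assms
proof (induction n)
  case (Suc n)
  have IH: "(\<Sum>k\<in>{1..n}. \<Sum>l\<in>{1..n} - {k}. f k l) = 2 * (\<Sum>k\<in>{1..n}. \<Sum>l\<in>{1..<k}. f k l)"
    using Suc by simp
  have ins: "{1..Suc n} = insert (Suc n) {1..n}" by auto
  have "(\<Sum>l\<in>{1..Suc n} - {k}. f k l) = (\<Sum>l\<in>{1..n} - {k}. f k l) + f k (Suc n)" if "k \<in> {1..n}" for k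
  proof -
    have "{1..Suc n} - {k} = insert (Suc n) ({1..n} - {k})" using that by auto
    then show ?thesis by simp
  qed
  moreover have "{1..Suc n} - {Suc n} = {1..n}" by auto
  ultimately have "(\<Sum>k\<in>{1..Suc n}. \<Sum>l\<in>{1..Suc n} - {k}. f k l)
    = (\<Sum>l\<in>{1..n}. f (Suc n) l) + ((\<Sum>k\<in>{1..n}. \<Sum>l\<in>{1..n} - {k}. f k l) + (\<Sum>k\<in>{1..n}. f k (Suc n)))"
    unfolding ins by (simp add: sum.distrib)
  also have "(\<Sum>k\<in>{1..n}. f k (Suc n)) = (\<Sum>l\<in>{1..n}. f (Suc n) l)"
    using Suc.prems by (intro sum.cong) auto
  also note IH
  also have "(\<Sum>l\<in>{1..n}. f (Suc n) l) + (2 * (\<Sum>k\<in>{1..n}. \<Sum>l\<in>{1..<k}. f k l) + (\<Sum>l\<in>{1..n}. f (Suc n) l))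
    = 2 * (\<Sum>k\<in>{1..Suc n}. \<Sum>l\<in>{1..<k}. f k l)"
    unfolding ins by (simp add: atLeastLessThanSuc_atLeastAtMost)
  finally show ?case .
qed simp

section \<open>The product kernel of two independent samples\<close>

locale kernel_pair = X: centered_kernel MX KX aX \<alpha>X + Y: centered_kernel MY KY aY \<alpha>Y
  for MX :: "'x measure" and KX aX \<alpha>X and MY :: "'y measure" and KY aY \<alpha>Y +
  assumes vX: "0 < X.variance_K" and vY: "0 < Y.variance_K"
begin

sublocale XY: pair_prob_space MX MY ..

abbreviation "vw \<equiv> X.variance_K * Y.variance_K"

text \<open>Products of two degenerate kernels in independent variables form a degenerate kernel for
  the product law. The scaling gives it variance 1, so the normal approximation applies directly to
  the main term of the numerator.\<close>

definition H :: "'x \<times> 'y \<Rightarrow> 'x \<times> 'y \<Rightarrow> real" where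
  "H z z' = KX (fst z) (fst z') * KY (snd z) (snd z') / sqrt vw"

lemma vw_pos: "0 < vw" using vX vY by simp

lemma H_powr: "\<bar>H z z'\<bar> powr r = \<bar>KX (fst z) (fst z')\<bar> powr r * \<bar>KY (snd z) (snd z')\<bar> powr r / vw powr (r / 2)"
proof -
  have "sqrt vw powr r = vw powr (r / 2)"
    using vw_pos powr_power2_eq[of "sqrt vw" "r / 2"] by simp
  then show ?thesis using vw_pos by (simp add: H_def abs_mult powr_mult powr_divide)
qed

lemma H_square: "(H z z')\<^sup>2 = (KX (fst z) (fst z'))\<^sup>2 * (KY (snd z) (snd z'))\<^sup>2 / vw"
  using vw_pos by (simp add: H_def power_mult_distrib power_divide)

lemma H_meas: "(\<lambda>(z, z'). H z z') \<in> borel_measurable ((MX \<Otimes>\<^sub>M MY) \<Otimes>\<^sub>M (MX \<Otimes>\<^sub>M MY))"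
proof -
  let ?M = "(MX \<Otimes>\<^sub>M MY) \<Otimes>\<^sub>M (MX \<Otimes>\<^sub>M MY)"
  have "(\<lambda>p. (fst (fst p), fst (snd p))) \<in> ?M \<rightarrow>\<^sub>M MX \<Otimes>\<^sub>M MX" by measurable
  from measurable_compose[OF this X.K_meas]
  have 1: "(\<lambda>p. KX (fst (fst p)) (fst (snd p))) \<in> borel_measurable ?M" by simp
  have "(\<lambda>p. (snd (fst p), snd (snd p))) \<in> ?M \<rightarrow>\<^sub>M MY \<Otimes>\<^sub>M MY" by measurable
  from measurable_compose[OF this Y.K_meas]
  have 2: "(\<lambda>p. KY (snd (fst p)) (snd (snd p))) \<in> borel_measurable ?M" by simp
  show ?thesis unfolding H_def using 1 2 by (simp add: split_beta')
qed

lemma XY_integral_mult: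
  fixes f :: "'x \<Rightarrow> real" and g :: "'y \<Rightarrow> real"
  assumes "integrable MX f" "integrable MY g"
  shows "integrable (MX \<Otimes>\<^sub>M MY) (\<lambda>z. f (fst z) * g (snd z))"
    and "(\<integral>z. f (fst z) * g (snd z) \<partial>(MX \<Otimes>\<^sub>M MY)) = (\<integral>x. f x \<partial>MX) * (\<integral>y. g y \<partial>MY)"
  using integrable_pair_mult[OF XY.pair_sigma_finite_axioms assms]
    integral_pair_mult[OF XY.pair_sigma_finite_axioms assms]
  by (simp_all add: split_beta')

sublocale H: degenerate_kernel "MX \<Otimes>\<^sub>M MY" H
proof
  fix z assume z: "z \<in> space (MX \<Otimes>\<^sub>M MY)"
  then have z': "fst z \<in> space MX" "snd z \<in> space MY" by (auto simp: space_pair_measure)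
  show "integrable (MX \<Otimes>\<^sub>M MY) (\<lambda>y. (H z y)\<^sup>2)"
    unfolding H_square using XY_integral_mult(1)[OF X.K_section[OF z'(1)] Y.K_section[OF z'(2)]] by simp
  show "(\<integral>y. H z y \<partial>(MX \<Otimes>\<^sub>M MY)) = 0"
    unfolding H_def
    using XY_integral_mult(2)[OF X.K_section_integrable[OF z'(1)] Y.K_section_integrable[OF z'(2)]]
      X.K_degenerate[OF z'(1)] by simp
  fix w assume w: "w \<in> space (MX \<Otimes>\<^sub>M MY)"
  then have w': "fst w \<in> space MX" "snd w \<in> space MY" by (auto simp: space_pair_measure)
  show "H z w = H w z"
    using X.K_sym[OF z'(1) w'(1)] Y.K_sym[OF z'(2) w'(2)] by (simp add: H_def)
next
  show "integrable ((MX \<Otimes>\<^sub>M MY) \<Otimes>\<^sub>M (MX \<Otimes>\<^sub>M MY)) (\<lambda>(x, y). (H x y)\<^sup>2)"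
    unfolding H_square
    using integrable_pair4[OF X.prob_space_axioms Y.prob_space_axioms X.K_square _ Y.K_square]
    by (simp add: split_beta')
qed (rule H_meas)

lemma variance_H: "H.variance_K = 1"
  unfolding H.variance_K_def H_square
  using integral_pair4[OF X.prob_space_axioms Y.prob_space_axioms X.K_square _ Y.K_square] vX vY
  by (simp add: split_beta' X.variance_K_def Y.variance_K_def)

lemma
  assumes "integrable (MX \<Otimes>\<^sub>M MX) (\<lambda>(x, y). \<bar>KX x y\<bar> powr r)"
    and "integrable (MY \<Otimes>\<^sub>M MY) (\<lambda>(x, y). \<bar>KY x y\<bar> powr r)"
  shows H_powr_integrable: "integrable ((MX \<Otimes>\<^sub>M MY) \<Otimes>\<^sub>M (MX \<Otimes>\<^sub>M MY)) (\<lambda>(x, y). \<bar>H x y\<bar> powr r)"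
    and moment_H: "H.moment_K r = X.moment_K r * Y.moment_K r / vw powr (r / 2)"
  using integrable_pair4[OF X.prob_space_axioms Y.prob_space_axioms assms(1) _ assms(2)]
    integral_pair4[OF X.prob_space_axioms Y.prob_space_axioms assms(1) _ assms(2)]
  by (simp_all add: split_beta' H_powr H.moment_K_def X.moment_K_def Y.moment_K_def)

text \<open>Composition acts on the two factors separately, by independence, so the ratios of the
  composed kernels multiply. If one of them tends to zero, the product does, since the other is at
  most 1.\<close>

lemma variance_HH: "H.variance_KK = X.variance_KK * Y.variance_KK / vw\<^sup>2"
proof -
  have HH: "(XY.P.comp_kernel H H z z')\<^sup>2 = (X.KK (fst z) (fst z'))\<^sup>2 * (Y.KK (snd z) (snd z'))\<^sup>2 / vw\<^sup>2"
    if "z \<in> space (MX \<Otimes>\<^sub>M MY)" "z' \<in> space (MX \<Otimes>\<^sub>M MY)" for z z'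
  proof -
    have s: "fst z \<in> space MX" "snd z \<in> space MY" "fst z' \<in> space MX" "snd z' \<in> space MY"
      using that by (auto simp: space_pair_measure)
    have iX: "integrable MX (\<lambda>x. KX (fst z) x * KX x (fst z'))"
      using s by (intro integrable_mult_of_squares X.K_section X.K_section' X.section_meas[OF X.K_meas])
    have iY: "integrable MY (\<lambda>y. KY (snd z) y * KY y (snd z'))"
      using s by (intro integrable_mult_of_squares Y.K_section Y.K_section' Y.section_meas[OF Y.K_meas])
    have "XY.P.comp_kernel H H z z' = (\<integral>u. (KX (fst z) (fst u) * KX (fst u) (fst z')) * (KY (snd z) (snd u) * KY (snd u) (snd z')) / vw \<partial>(MX \<Otimes>\<^sub>M MY))"
      unfolding XY.P.comp_kernel_def H_def
      using vw_pos by (intro Bochner_Integration.integral_cong refl) (simp add: field_simps)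
    also have "\<dots> = X.KK (fst z) (fst z') * Y.KK (snd z) (snd z') / vw"
      using XY_integral_mult(2)[OF iX iY] by (simp add: X.comp_kernel_def Y.comp_kernel_def)
    finally show ?thesis by (simp add: power_mult_distrib power_divide)
  qed
  have "H.variance_KK = (\<integral>z. (X.KK (fst (fst z)) (fst (snd z)))\<^sup>2 * (Y.KK (snd (fst z)) (snd (snd z)))\<^sup>2 / vw\<^sup>2
      \<partial>((MX \<Otimes>\<^sub>M MY) \<Otimes>\<^sub>M (MX \<Otimes>\<^sub>M MY)))"
    unfolding H.variance_KK_def split_beta'
    by (intro Bochner_Integration.integral_cong refl HH) (auto simp: space_pair_measure)
  then show ?thesis
    using integral_pair4[OF X.prob_space_axioms Y.prob_space_axioms
        degenerate_kernel.K_square[OF X.degenerate_KK] _ degenerate_kernel.K_square[OF Y.degenerate_KK]]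
    by (simp add: X.variance_KK_def Y.variance_KK_def)
qed

lemma integral_ustat_square:
  assumes n: "2 \<le> n"
  shows "(\<integral>z. (H.ustat n z)\<^sup>2 \<partial>iid_space (MX \<Otimes>\<^sub>M MY) {1..n}) = 1"
    and "integrable (iid_space (MX \<Otimes>\<^sub>M MY) {1..n}) (\<lambda>z. (H.ustat n z)\<^sup>2)"
proof -
  let ?I = "{1..n}" and ?P = "iid_space (MX \<Otimes>\<^sub>M MY) {1..n}"
  define s where "s = real n * (real n - 1) / 2"
  have s: "0 < s" using n by (simp add: s_def)
  \<comment> \<open>The U-statistic counts each unordered pair once, so it is a pair sum with
    coefficients \<open>1 / 2\<close>.\<close>
  have eq: "(H.ustat n z)\<^sup>2 = H.pair_sum ?I (\<lambda>_ _. 1 / 2) z * H.pair_sum ?I (\<lambda>_ _. 1 / 2) z / s" if z: "z \<in> space ?P" for z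
  proof -
    have "H.pair_sum ?I (\<lambda>_ _. 1 / 2) z = (\<Sum>k\<in>?I. \<Sum>l\<in>?I - {k}. 1 / 2 * H (z k) (z l))"
      unfolding H.pair_sum_def using sum_offdiag[of ?I "\<lambda>k l. 1 / 2 * H (z k) (z l)"] by (simp add: split_beta')
    also have "\<dots> = 2 * (\<Sum>k\<in>?I. \<Sum>l\<in>{1..<k}. 1 / 2 * H (z k) (z l))"
    proof (rule sum_symmetric_pairs)
      fix k l assume "k \<in> ?I" "l \<in> ?I"
      then have "z k \<in> space (MX \<Otimes>\<^sub>M MY)" "z l \<in> space (MX \<Otimes>\<^sub>M MY)" using XY.P.coord_in_space[OF _ z] by blast+
      then show "1 / 2 * H (z k) (z l) = 1 / 2 * H (z l) (z k)" using H.K_sym by simp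
    qed
    also have "\<dots> = (\<Sum>k\<in>?I. \<Sum>l\<in>{1..<k}. H (z k) (z l))" by (simp flip: sum_divide_distrib)
    finally show ?thesis using s by (simp add: H.ustat_def s_def[symmetric] power_divide) (simp add: power2_eq_square)
  qed
  have "(\<integral>z. (H.ustat n z)\<^sup>2 \<partial>?P) = (\<integral>z. H.pair_sum ?I (\<lambda>_ _. 1 / 2) z * H.pair_sum ?I (\<lambda>_ _. 1 / 2) z / s \<partial>?P)"
    by (intro Bochner_Integration.integral_cong refl eq)
  also have "\<dots> = real (card (offdiag ?I)) / 2 / s"
    by (simp add: H.integral_pair_sum_mult variance_H split_beta')
  also have "real (card (offdiag ?I)) = 2 * s" using n by (simp add: card_offdiag s_def of_nat_diff)
  finally show "(\<integral>z. (H.ustat n z)\<^sup>2 \<partial>?P) = 1" using s by simp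
  show "integrable ?P (\<lambda>z. (H.ustat n z)\<^sup>2)"
    using H.pair_sum_mult_integrable[of ?I "\<lambda>_ _. 1 / 2" "\<lambda>_ _. 1 / 2"]
    by (subst Bochner_Integration.integrable_cong[OF refl eq]) auto
qed

abbreviation sample_space :: "nat \<Rightarrow> ((nat \<Rightarrow> 'x) \<times> (nat \<Rightarrow> 'y)) measure" where
  "sample_space n \<equiv> iid_space MX {1..n} \<Otimes>\<^sub>M iid_space MY {1..n}"

lemma pair_prob_samples: "pair_prob_space (iid_space MX I) (iid_space MY I)"
  by (simp add: pair_prob_space_def pair_sigma_finite_def X.prob_space_iid Y.prob_space_iid prob_space_imp_sigma_finite)

lemma sample_mult:
  fixes f :: "(nat \<Rightarrow> 'x) \<Rightarrow> real" and g :: "(nat \<Rightarrow> 'y) \<Rightarrow> real"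
  assumes "integrable (iid_space MX I) f" "integrable (iid_space MY I) g"
  shows "integrable (iid_space MX I \<Otimes>\<^sub>M iid_space MY I) (\<lambda>z. f (fst z) * g (snd z))"
    and "(\<integral>z. f (fst z) * g (snd z) \<partial>(iid_space MX I \<Otimes>\<^sub>M iid_space MY I))
      = (\<integral>x. f x \<partial>iid_space MX I) * (\<integral>y. g y \<partial>iid_space MY I)"
proof -
  interpret pair_prob_space "iid_space MX I" "iid_space MY I" by (rule pair_prob_samples)
  show "integrable (iid_space MX I \<Otimes>\<^sub>M iid_space MY I) (\<lambda>z. f (fst z) * g (snd z))"
    and "(\<integral>z. f (fst z) * g (snd z) \<partial>(iid_space MX I \<Otimes>\<^sub>M iid_space MY I))
      = (\<integral>x. f x \<partial>iid_space MX I) * (\<integral>y. g y \<partial>iid_space MY I)"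
    using integrable_pair_mult[OF pair_sigma_finite_axioms assms]
      integral_pair_mult[OF pair_sigma_finite_axioms assms]
    by (simp_all add: split_beta')
qed

text \<open>What U-centring adds to the plain double sum of kernel products in the
  numerator.\<close>

definition remainder :: "nat \<Rightarrow> (nat \<Rightarrow> 'x) \<times> (nat \<Rightarrow> 'y) \<Rightarrow> real" where
  "remainder n z = - 2 / (real n - 2) * (\<Sum>k\<in>{1..n}. X.row_sum {1..n} k (fst z) * Y.row_sum {1..n} k (snd z))
    + (\<Sum>k\<in>{1..n}. X.row_sum {1..n} k (fst z)) * (\<Sum>k\<in>{1..n}. Y.row_sum {1..n} k (snd z)) / ((real n - 1) * (real n - 2))"

text \<open>Products of an X row and a Y row are nearly orthogonal: in units of \<open>vw\<close>
  there are \<open>n\<close> diagonal terms of size \<open>(n - 1)^2\<close> and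
  \<open>n * (n - 1)\<close> terms of size 1, in all of order \<open>n^3\<close>. The factor
  \<open>2 / (n - 2)\<close> reduces this to order \<open>n\<close>, against a main term with second
  moment of order \<open>n^2\<close>.\<close>

lemma
  assumes n: "4 \<le> n"
  shows remainder_square_integrable: "integrable (sample_space n) (\<lambda>z. (remainder n z)\<^sup>2)"
    and remainder_meas: "remainder n \<in> borel_measurable (sample_space n)"
    and integral_remainder_square: "(\<integral>z. (remainder n z)\<^sup>2 \<partial>sample_space n) \<le> 32 * real n * vw"
proof -
  define I where "I = {1..n}"
  let ?P = "iid_space MX I \<Otimes>\<^sub>M iid_space MY I"
  define N where "N = real n"
  have N: "4 \<le> N" using n by (simp add: N_def)
  have finI: "finite I" by (simp add: I_def)
  define R where "R z = (\<Sum>k\<in>I. X.row_sum I k (fst z) * Y.row_sum I k (snd z))" for z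
  define T where "T z = (\<Sum>k\<in>I. X.row_sum I k (fst z)) * (\<Sum>k\<in>I. Y.row_sum I k (snd z))" for z
  have X_meas: "(\<lambda>z. X.row_sum I k (fst z)) \<in> borel_measurable ?P" if "k \<in> I" for k
    using measurable_compose[OF measurable_fst X.pair_sum_meas] X.row_sum_eq_pair_sum[OF finI that] by simp
  have Y_meas: "(\<lambda>z. Y.row_sum I k (snd z)) \<in> borel_measurable ?P" if "k \<in> I" for k
    using measurable_compose[OF measurable_snd Y.pair_sum_meas] Y.row_sum_eq_pair_sum[OF finI that] by simp
  have R_meas: "R \<in> borel_measurable ?P"
    unfolding R_def by (intro borel_measurable_sum borel_measurable_times X_meas Y_meas)
  have T_meas: "T \<in> borel_measurable ?P"
    unfolding T_def by (intro borel_measurable_sum borel_measurable_times X_meas Y_meas)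
  have rem: "remainder n z = - 2 / (N - 2) * R z + T z / ((N - 1) * (N - 2))" for z
    by (simp add: remainder_def R_def T_def I_def N_def)
  show "remainder n \<in> borel_measurable (sample_space n)"
    unfolding rem I_def[symmetric] using R_meas T_meas by simp
  note XY_rows = sample_mult[OF X.row_sum_mult_integrable[OF finI] Y.row_sum_mult_integrable[OF finI]]
  have R_sq: "(R z)\<^sup>2 = (\<Sum>k\<in>I. \<Sum>m\<in>I. (X.row_sum I k (fst z) * X.row_sum I m (fst z)) * (Y.row_sum I k (snd z) * Y.row_sum I m (snd z)))" for z
    unfolding R_def power2_eq_square sum_product by (intro sum.cong refl) (simp add: mult_ac)
  have R_int: "integrable ?P (\<lambda>z. (R z)\<^sup>2)"
    unfolding R_sq by (intro Bochner_Integration.integrable_sum XY_rows)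
  have ER: "(\<integral>z. (R z)\<^sup>2 \<partial>?P) = vw * (N\<^sup>2 * (N - 1))"
  proof -
    have "(\<integral>z. (R z)\<^sup>2 \<partial>?P) = (\<Sum>k\<in>I. \<integral>z. (\<Sum>m\<in>I. (X.row_sum I k (fst z) * X.row_sum I m (fst z)) * (Y.row_sum I k (snd z) * Y.row_sum I m (snd z))) \<partial>?P)"
      unfolding R_sq by (intro Bochner_Integration.integral_sum Bochner_Integration.integrable_sum XY_rows)
    also have "\<dots> = (\<Sum>k\<in>I. \<Sum>m\<in>I. \<integral>z. (X.row_sum I k (fst z) * X.row_sum I m (fst z)) * (Y.row_sum I k (snd z) * Y.row_sum I m (snd z)) \<partial>?P)"
      by (rule sum.cong[OF refl]) (intro Bochner_Integration.integral_sum XY_rows)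
    also have "\<dots> = (\<Sum>k\<in>I. \<Sum>m\<in>I. vw * (if k = m then (N - 1)\<^sup>2 else 1))"
    proof (intro sum.cong refl)
      fix k m assume km: "k \<in> I" "m \<in> I"
      show "(\<integral>z. (X.row_sum I k (fst z) * X.row_sum I m (fst z)) * (Y.row_sum I k (snd z) * Y.row_sum I m (snd z)) \<partial>?P)
        = vw * (if k = m then (N - 1)\<^sup>2 else 1)"
        unfolding XY_rows(2)[OF km km] X.integral_row_sum_mult[OF finI km] Y.integral_row_sum_mult[OF finI km]
        by (simp add: I_def N_def power2_eq_square)
    qed
    also have "\<dots> = (\<Sum>k\<in>I. vw * ((N - 1)\<^sup>2 + (N - 1)))"
    proof (intro sum.cong refl)
      fix k assume k: "k \<in> I"
      have "(\<Sum>m\<in>I. vw * (if k = m then (N - 1)\<^sup>2 else 1)) = vw * (\<Sum>m\<in>I. if k = m then (N - 1)\<^sup>2 else 1)"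
        by (simp add: sum_distrib_left)
      also have "(\<Sum>m\<in>I. if k = m then (N - 1)\<^sup>2 else 1) = (N - 1)\<^sup>2 + (\<Sum>m\<in>I - {k}. 1)"
        using k finI by (subst sum.remove[OF finI k]) simp
      also have "(\<Sum>m\<in>I - {k}. 1) = N - 1" using k n by (simp add: I_def N_def of_nat_diff)
      finally show "(\<Sum>m\<in>I. vw * (if k = m then (N - 1)\<^sup>2 else 1)) = vw * ((N - 1)\<^sup>2 + (N - 1))" .
    qed
    also have "\<dots> = N * (vw * ((N - 1)\<^sup>2 + (N - 1)))" by (simp add: I_def N_def)
    also have "\<dots> = vw * (N\<^sup>2 * (N - 1))" by (simp add: power2_eq_square algebra_simps)
    finally show ?thesis .
  qed
  have T_sq: "(T z)\<^sup>2 = (\<Sum>k\<in>I. X.row_sum I k (fst z))\<^sup>2 * (\<Sum>k\<in>I. Y.row_sum I k (snd z))\<^sup>2" for z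
    by (simp add: T_def power_mult_distrib)
  note T_prod = sample_mult[OF X.integral_total_square(2)[OF finI] Y.integral_total_square(2)[OF finI]]
  have T_int: "integrable ?P (\<lambda>z. (T z)\<^sup>2)" unfolding T_sq by (rule T_prod(1))
  have "real (card (offdiag I)) = N * (N - 1)" using n by (simp add: card_offdiag I_def N_def of_nat_diff)
  then have ET: "(\<integral>z. (T z)\<^sup>2 \<partial>?P) = vw * (4 * N\<^sup>2 * (N - 1)\<^sup>2)"
    unfolding T_sq T_prod(2) X.integral_total_square(1)[OF finI] Y.integral_total_square(1)[OF finI]
    by (simp add: power2_eq_square)
  define c\<^sub>1 c\<^sub>2 where "c\<^sub>1 = - 2 / (N - 2)" and "c\<^sub>2 = 1 / ((N - 1) * (N - 2))"
  have rem': "remainder n z = c\<^sub>1 * R z + c\<^sub>2 * T z" for z by (simp add: rem c\<^sub>1_def c\<^sub>2_def)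
  have bound: "(remainder n z)\<^sup>2 \<le> 2 * c\<^sub>1\<^sup>2 * (R z)\<^sup>2 + 2 * c\<^sub>2\<^sup>2 * (T z)\<^sup>2" for z
  proof -
    have "(x + y)\<^sup>2 \<le> 2 * x\<^sup>2 + 2 * y\<^sup>2" for x y :: real
      using sum_squares_bound[of x y] by (simp add: power2_sum)
    from this[of "c\<^sub>1 * R z" "c\<^sub>2 * T z"] show ?thesis by (simp add: rem' power_mult_distrib)
  qed
  have int_bound: "integrable ?P (\<lambda>z. 2 * c\<^sub>1\<^sup>2 * (R z)\<^sup>2 + 2 * c\<^sub>2\<^sup>2 * (T z)\<^sup>2)" using R_int T_int by simp
  have int: "integrable ?P (\<lambda>z. (remainder n z)\<^sup>2)"
  proof (rule Bochner_Integration.integrable_bound[OF int_bound])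
    show "(\<lambda>z. (remainder n z)\<^sup>2) \<in> borel_measurable ?P" unfolding rem using R_meas T_meas by simp
    show "AE z in ?P. norm ((remainder n z)\<^sup>2) \<le> norm (2 * c\<^sub>1\<^sup>2 * (R z)\<^sup>2 + 2 * c\<^sub>2\<^sup>2 * (T z)\<^sup>2)"
      using bound by (intro AE_I2) simp
  qed
  then show "integrable (sample_space n) (\<lambda>z. (remainder n z)\<^sup>2)" by (simp add: I_def)
  have "(\<integral>z. (remainder n z)\<^sup>2 \<partial>?P) \<le> (\<integral>z. 2 * c\<^sub>1\<^sup>2 * (R z)\<^sup>2 + 2 * c\<^sub>2\<^sup>2 * (T z)\<^sup>2 \<partial>?P)"
    using bound by (intro integral_mono int int_bound)
  also have "\<dots> = 2 * c\<^sub>1\<^sup>2 * (vw * (N\<^sup>2 * (N - 1))) + 2 * c\<^sub>2\<^sup>2 * (vw * (4 * N\<^sup>2 * (N - 1)\<^sup>2))"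
    using R_int T_int ER ET by simp
  also have "\<dots> = 8 * vw * N * (N / (N - 2))\<^sup>2"
  proof -
    have "2 * (- 2 / m)\<^sup>2 * (u * (N\<^sup>2 * k)) + 2 * (1 / (k * m))\<^sup>2 * (u * (4 * N\<^sup>2 * k\<^sup>2)) = 8 * u * N\<^sup>2 * (k + 1) / m\<^sup>2"
      if "m \<noteq> 0" "k \<noteq> 0" for m k u
      using that by (simp add: field_simps power2_eq_square)
    from this[of "N - 2" "N - 1" vw] show ?thesis
      using N by (simp add: c\<^sub>1_def c\<^sub>2_def power_divide power2_eq_square)
  qed
  also have "\<dots> \<le> 8 * vw * N * 2\<^sup>2"
  proof -
    have "N / (N - 2) \<le> 2" "0 \<le> N / (N - 2)" using N by (auto simp: field_simps)
    then have "(N / (N - 2))\<^sup>2 \<le> 2\<^sup>2" by (intro power_mono)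
    then show ?thesis using N vw_pos by (intro mult_left_mono) auto
  qed
  finally show "(\<integral>z. (remainder n z)\<^sup>2 \<partial>sample_space n) \<le> 32 * real n * vw"
    by (simp add: I_def N_def mult_ac)
qed

end

section \<open>Replacing the true variances by the empirical ones\<close>

lemma norm_iexp_diff_le: "cmod (iexp x - iexp y) \<le> \<bar>x - y\<bar>"
proof -
  have "iexp x - iexp y = iexp y * (iexp (x - y) - 1)"
    by (simp add: algebra_simps flip: exp_add)
  then have "cmod (iexp x - iexp y) = cmod (iexp (x - y) - 1)"
    by (simp only: norm_mult norm_exp_i_times mult_1_left)
  also have "\<dots> \<le> \<bar>x - y\<bar>" using iexp_approx1[of "x - y" 0] by simp
  finally show ?thesis .
qed

lemma norm_iexp_diff_le_2: "cmod (iexp x - iexp y) \<le> 2"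
  using norm_triangle_ineq4[of "iexp x" "iexp y"] by simp

text \<open>A difference of exponentials is at most \<open>x\<close> and at most 2, hence at most
  the square root of \<open>2 * x\<close>. The square root separates \<open>u\<close> from
  \<open>q - 1\<close>, so that Cauchy-Schwarz needs first moments only, although
  \<open>u * (q - 1)\<close> need not be integrable. For \<open>q < 1 / 2\<close>, which includes
  the default value 0, the bound 2 is paid by \<open>4 * \<bar>q - 1\<bar>\<close>.\<close>

lemma norm_iexp_studentize:
  fixes t u q :: real
  shows "cmod (iexp (t * (if 0 < q then u / sqrt q else 0)) - iexp (t * u))
    \<le> 2 * (sqrt (\<bar>t\<bar> * \<bar>u\<bar>) * sqrt \<bar>q - 1\<bar>) + 4 * \<bar>q - 1\<bar>" (is "?L \<le> _")
proof (cases "q < 1 / 2")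
  case True
  have "?L \<le> 2" by (rule norm_iexp_diff_le_2)
  also have "\<dots> \<le> 4 * \<bar>q - 1\<bar>" using True by simp
  also have "\<dots> \<le> 2 * (sqrt (\<bar>t\<bar> * \<bar>u\<bar>) * sqrt \<bar>q - 1\<bar>) + 4 * \<bar>q - 1\<bar>" by simp
  finally show ?thesis .
next
  case False
  then have q: "1 / 2 \<le> q" by simp
  define x where "x = \<bar>t\<bar> * \<bar>u\<bar> * (2 * \<bar>q - 1\<bar>)"
  have x0: "0 \<le> x" by (simp add: x_def)
  have half: "1 / 2 \<le> sqrt q" using q by (intro real_le_rsqrt) (simp add: power2_eq_square)
  have "\<bar>1 / sqrt q - 1\<bar> \<le> 2 * \<bar>q - 1\<bar>"
  proof -
    have sq: "sqrt q * sqrt q = q" using q by simp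
    have "\<bar>1 - sqrt q\<bar> \<le> \<bar>1 - sqrt q\<bar> * (1 + sqrt q)"
      using half mult_left_mono[of 1 "1 + sqrt q" "\<bar>1 - sqrt q\<bar>"] q by simp
    also have "\<dots> = \<bar>(1 - sqrt q) * (1 + sqrt q)\<bar>" using half by (simp add: abs_mult)
    also have "(1 - sqrt q) * (1 + sqrt q) = 1 - q" using sq by (simp add: algebra_simps)
    finally have 1: "\<bar>1 - sqrt q\<bar> \<le> \<bar>1 - q\<bar>" .
    have "\<bar>1 / sqrt q - 1\<bar> = \<bar>1 - sqrt q\<bar> / sqrt q"
    proof -
      have "\<bar>1 / p - 1\<bar> = \<bar>1 - p\<bar> / p" if "0 < p" for p :: real
      proof -
        have "1 / p - 1 = (1 - p) / p" using that by (simp add: diff_divide_distrib)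
        then show ?thesis using that by (simp add: abs_divide)
      qed
      then show ?thesis using half by (meson less_le_trans zero_less_divide_1_iff zero_less_numeral)
    qed
    also have "\<dots> \<le> \<bar>1 - q\<bar> / (1 / 2)" using 1 half by (intro frac_le) auto
    finally show ?thesis by (simp add: abs_minus_commute)
  qed
  then have "\<bar>t\<bar> * \<bar>u\<bar> * \<bar>1 / sqrt q - 1\<bar> \<le> x"
    unfolding x_def by (intro mult_left_mono) auto
  moreover have "\<bar>t * (u / sqrt q) - t * u\<bar> = \<bar>t\<bar> * \<bar>u\<bar> * \<bar>1 / sqrt q - 1\<bar>"
  proof -
    have "t * (u / sqrt q) - t * u = t * u * (1 / sqrt q - 1)" by (simp add: algebra_simps)
    then show ?thesis by (simp add: abs_mult)
  qed
  ultimately have "?L \<le> x"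
    using norm_iexp_diff_le[of "t * (u / sqrt q)" "t * u"] q by simp
  then have "?L * ?L \<le> 2 * x"
    by (intro mult_mono norm_iexp_diff_le_2) (auto simp: x0)
  then have "?L \<le> sqrt (2 * x)" by (intro real_le_rsqrt) (simp add: power2_eq_square)
  also have "2 * x = 2\<^sup>2 * (\<bar>t\<bar> * \<bar>u\<bar> * \<bar>q - 1\<bar>)" by (simp add: x_def)
  also have "sqrt \<dots> = 2 * (sqrt (\<bar>t\<bar> * \<bar>u\<bar>) * sqrt \<bar>q - 1\<bar>)"
    unfolding real_sqrt_mult real_sqrt_abs by simp
  finally show ?thesis by (rule add_increasing2[rotated]) simp
qed

lemma (in prob_space) integral_sqrt_mult_le:
  fixes f g :: "'a \<Rightarrow> real"
  assumes f: "integrable M f" "\<And>x. 0 \<le> f x" and g: "integrable M g" "\<And>x. 0 \<le> g x"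
  shows "integrable M (\<lambda>x. sqrt (f x) * sqrt (g x))"
    and "(\<integral>x. sqrt (f x) * sqrt (g x) \<partial>M) \<le> sqrt ((\<integral>x. f x \<partial>M) * (\<integral>x. g x \<partial>M))"
proof -
  have sq: "(\<lambda>x. (sqrt (f x))\<^sup>2) = f" "(\<lambda>x. (sqrt (g x))\<^sup>2) = g" using f(2) g(2) by auto
  have m: "(\<lambda>x. sqrt (f x)) \<in> borel_measurable M" "(\<lambda>x. sqrt (g x)) \<in> borel_measurable M"
    using f(1) g(1) by auto
  show "integrable M (\<lambda>x. sqrt (f x) * sqrt (g x))"
    using f g by (intro integrable_mult_of_squares m) (simp_all add: sq)
  show "(\<integral>x. sqrt (f x) * sqrt (g x) \<partial>M) \<le> sqrt ((\<integral>x. f x \<partial>M) * (\<integral>x. g x \<partial>M))"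
    using integral_Cauchy_Schwarz[OF m] f g by (intro real_le_rsqrt) (simp add: sq)
qed

section \<open>Characteristic function of the studentized statistic\<close>

context kernel_pair
begin

lemma V_star_cross:
  assumes n: "4 \<le> n" and z: "z \<in> space (sample_space n)"
  shows "V_star n (\<lambda>k l. aX (fst z k) (fst z l)) (\<lambda>k l. aY (snd z k) (snd z l))
    = (2 * (\<Sum>k\<in>{1..n}. \<Sum>l\<in>{1..<k}. KX (fst z k) (fst z l) * KY (snd z k) (snd z l)) + remainder n z)
      / (real n * (real n - 3))"
proof -
  have z': "fst z \<in> space (iid_space MX {1..n})" "snd z \<in> space (iid_space MY {1..n})"
    using z by (auto simp: space_pair_measure)
  have s: "fst z k \<in> space MX" "snd z k \<in> space MY" if "k \<in> {1..n}" for k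
    using X.coord_in_space[OF that z'(1)] Y.coord_in_space[OF that z'(2)] by auto
  have "V_star n (\<lambda>k l. aX (fst z k) (fst z l)) (\<lambda>k l. aY (snd z k) (snd z l))
    = ((\<Sum>k\<in>{1..n}. \<Sum>l\<in>{1..n} - {k}. KX (fst z k) (fst z l) * KY (snd z k) (snd z l))
      - 2 / (real n - 2) * (\<Sum>k\<in>{1..n}. X.row_sum {1..n} k (fst z) * Y.row_sum {1..n} k (snd z))
      + (\<Sum>k\<in>{1..n}. X.row_sum {1..n} k (fst z)) * (\<Sum>k\<in>{1..n}. Y.row_sum {1..n} k (snd z))
        / ((real n - 1) * (real n - 2))) / (real n * (real n - 3))"
    unfolding X.row_sum_def Y.row_sum_def
    by (rule V_star_of_shifted[where \<alpha> = "\<lambda>k. \<alpha>X (fst z k)" and \<beta> = "\<lambda>k. \<alpha>Y (snd z k)", OF n];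
        use s in \<open>simp add: X.K_sym Y.K_sym X.a_diag Y.a_diag X.a_shift Y.a_shift\<close>)
  also have "(\<Sum>k\<in>{1..n}. \<Sum>l\<in>{1..n} - {k}. KX (fst z k) (fst z l) * KY (snd z k) (snd z l))
    = 2 * (\<Sum>k\<in>{1..n}. \<Sum>l\<in>{1..<k}. KX (fst z k) (fst z l) * KY (snd z k) (snd z l))"
    by (rule sum_symmetric_pairs) (use s in \<open>simp add: X.K_sym Y.K_sym\<close>)
  finally show ?thesis by (simp add: remainder_def)
qed

definition dcor_stat :: "nat \<Rightarrow> (nat \<Rightarrow> 'x) \<times> (nat \<Rightarrow> 'y) \<Rightarrow> real" where
  "dcor_stat n z = sqrt (real n * (real n - 1) / 2)
    * R_star n (\<lambda>k l. aX (fst z k) (fst z l)) (\<lambda>k l. aY (snd z k) (snd z l))"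

text \<open>Three comparisons add up: the statistic with \<open>U\<close>, which is normalised by
  the true variances; \<open>U\<close> with the U-statistic \<open>S\<close> of the product kernel;
  \<open>S\<close> with the normal law. The two samples live on separate product spaces, where the
  empirical variances are studied, and are zipped into one sample of pairs for
  \<open>S\<close>.\<close>

theorem dcor_stat_char_bound:
  fixes t :: real
  assumes \<tau>: "0 < \<tau>" "\<tau> \<le> 1 / 2" and n: "6 \<le> n"
    and KX_int: "integrable (MX \<Otimes>\<^sub>M MX) (\<lambda>(x, y). \<bar>KX x y\<bar> powr (2 + 2 * \<tau>))"
    and KY_int: "integrable (MY \<Otimes>\<^sub>M MY) (\<lambda>(x, y). \<bar>KY x y\<bar> powr (2 + 2 * \<tau>))"
  defines "\<kappa>X \<equiv> X.moment_K (2 + 2 * \<tau>) / X.variance_K powr (1 + \<tau>)"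
    and "\<kappa>Y \<equiv> Y.moment_K (2 + 2 * \<tau>) / Y.variance_K powr (1 + \<tau>)"
  defines "y \<equiv> real n powr (- \<tau>) * (\<kappa>X * \<kappa>Y)"
    and "\<rho> \<equiv> (X.variance_KK / X.variance_K\<^sup>2) * (Y.variance_KK / Y.variance_K\<^sup>2)"
    and "\<beta>X \<equiv> 4 * (real n powr (- \<tau>) * \<kappa>X) + 6 * sqrt (real n powr (- \<tau>) * \<kappa>X) + 12 / real n"
    and "\<beta>Y \<equiv> 4 * (real n powr (- \<tau>) * \<kappa>Y) + 6 * sqrt (real n powr (- \<tau>) * \<kappa>Y) + 12 / real n"
  defines "\<beta> \<equiv> (1 + \<beta>X) * \<beta>Y + \<beta>X"
  shows "dcor_stat n \<in> borel_measurable (sample_space n)"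
    and "cmod ((\<integral>z. iexp (t * dcor_stat n z) \<partial>sample_space n) - exp (- (t\<^sup>2) / 2))
    \<le> (2 * sqrt (\<bar>t\<bar> * 13 * \<beta>) + 4 * \<beta>) + \<bar>t\<bar> * (12 / sqrt (real n))
      + ((2 + t\<^sup>2 * exp (t\<^sup>2)) * (2 * y + 4 * sqrt y + 4 * sqrt (2 * \<rho>))
        + 2 * exp (t\<^sup>2) * \<bar>t\<bar> powr (2 + 2 * \<tau>) * (1152 * y))"
proof -
  note One_nat_def [simp del]
  let ?P = "sample_space n"
  let ?Q = "iid_space (MX \<Otimes>\<^sub>M MY) {1..n}"
  define N where "N = real n"
  have N: "6 \<le> N" using n by (simp add: N_def)
  interpret P: pair_prob_space "iid_space MX {1..n}" "iid_space MY {1..n}" by (rule pair_prob_samples)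
  define \<sigma> where "\<sigma> = sqrt vw"
  have \<sigma>: "0 < \<sigma>" "\<sigma> * \<sigma> = vw" using vw_pos by (auto simp: \<sigma>_def)
  define s where "s = N * (N - 1) / 2"
  have s: "0 < s" using N by (simp add: s_def)
  define Z where "Z z = (\<lambda>i\<in>{1..n}. (fst z i, snd z i))" for z :: "(nat \<Rightarrow> 'x) \<times> (nat \<Rightarrow> 'y)"
  have Z_meas: "Z \<in> ?P \<rightarrow>\<^sub>M ?Q" unfolding Z_def by measurable
  have Z_distr: "distr ?P ?Q Z = ?Q"
    unfolding Z_def using distr_zip[OF X.prob_space_axioms Y.prob_space_axioms] by simp
  define S where "S z = H.ustat n (Z z)" for z
  have S_sum: "2 * (\<Sum>k\<in>{1..n}. \<Sum>l\<in>{1..<k}. KX (fst z k) (fst z l) * KY (snd z k) (snd z l)) = 2 * \<sigma> * sqrt s * S z" for z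
  proof -
    have "S z = (\<Sum>k\<in>{1..n}. \<Sum>l\<in>{1..<k}. KX (fst z k) (fst z l) * KY (snd z k) (snd z l) / \<sigma>) / sqrt s"
      unfolding S_def H.ustat_def s_def N_def
      by (intro arg_cong2[where f = "(/)"] sum.cong refl) (auto simp: Z_def H_def \<sigma>_def)
    then show ?thesis using s \<sigma> by (simp flip: sum_divide_distrib)
  qed
  have ustat_meas: "H.ustat n \<in> borel_measurable ?Q"
    unfolding H.ustat_def
    by (intro borel_measurable_divide borel_measurable_sum borel_measurable_const H.K_coords_meas)
       (auto simp: offdiag_def)
  have S_meas: "S \<in> borel_measurable ?P" unfolding S_def by (rule measurable_compose[OF Z_meas ustat_meas])
  have S_sq: "integrable ?P (\<lambda>z. (S z)\<^sup>2)" "(\<integral>z. (S z)\<^sup>2 \<partial>?P) = 1"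
  proof -
    have m: "(\<lambda>w. (H.ustat n w)\<^sup>2) \<in> borel_measurable ?Q" using ustat_meas by simp
    show "integrable ?P (\<lambda>z. (S z)\<^sup>2)"
      unfolding S_def using integral_ustat_square(2)[of n] n
      by (intro integrable_distr[OF Z_meas, unfolded Z_distr]) auto
    show "(\<integral>z. (S z)\<^sup>2 \<partial>?P) = 1"
      unfolding S_def using integral_distr[OF Z_meas m, unfolded Z_distr] integral_ustat_square(1)[of n] n by simp
  qed
  have S_int: "integrable ?P S" by (rule P.P.integrable_of_square[OF S_meas S_sq(1)])
  have ES: "(\<integral>z. \<bar>S z\<bar> \<partial>?P) \<le> 1"
    using P.P.abs_expectation_le_sqrt[OF S_meas S_sq(1)] S_sq(2) by simp
  define V where "V z = V_star n (\<lambda>k l. aX (fst z k) (fst z l)) (\<lambda>k l. aY (snd z k) (snd z l))"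
    for z :: "(nat \<Rightarrow> 'x) \<times> (nat \<Rightarrow> 'y)"
  define qX where "qX w = V_star n (\<lambda>k l. aX (w k) (w l)) (\<lambda>k l. aX (w k) (w l)) / X.variance_K" for w
  define qY where "qY w = V_star n (\<lambda>k l. aY (w k) (w l)) (\<lambda>k l. aY (w k) (w l)) / Y.variance_K" for w
  define q where "q z = qX (fst z) * qY (snd z)" for z
  define U where "U z = sqrt s * V z / \<sigma>" for z
  define c where "c = sqrt s / (N * (N - 3) * \<sigma>)"
  have c0: "0 \<le> c" using s N \<sigma> by (simp add: c_def)
  have U_eq: "U z = (N - 1) / (N - 3) * S z + c * remainder n z" if "z \<in> space ?P" for z
  proof -
    have "U z = sqrt s * ((2 * \<sigma> * sqrt s * S z + remainder n z) / (N * (N - 3))) / \<sigma>"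
      unfolding U_def V_def using V_star_cross[OF _ that] n unfolding S_sum by (simp add: N_def)
    also have "\<dots> = 2 * (sqrt s * sqrt s) / (N * (N - 3)) * S z + c * remainder n z"
    proof -
      have "r * ((2 * h * r * x + m) / D) / h = 2 * (r * r) / D * x + r / (D * h) * m"
        if "h \<noteq> 0" "D \<noteq> 0" for r h x m D :: real
        using that by (simp add: field_simps)
      from this[of \<sigma> "N * (N - 3)"] show ?thesis using \<sigma> N by (simp add: c_def)
    qed
    also have "2 * (sqrt s * sqrt s) / (N * (N - 3)) = (N - 1) / (N - 3)"
      using s N by (simp add: s_def)
    finally show ?thesis .
  qed
  have n4: "4 \<le> n" using n by simp
  note rem = remainder_meas[OF n4] remainder_square_integrable[OF n4] integral_remainder_square[OF n4]
  have rem_int: "integrable ?P (remainder n)" by (rule P.P.integrable_of_square[OF rem(1,2)])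
  have U_int: "integrable ?P U"
  proof -
    have "integrable ?P (\<lambda>z. (N - 1) / (N - 3) * S z + c * remainder n z)" using S_int rem_int by simp
    then show ?thesis by (subst Bochner_Integration.integrable_cong[OF refl U_eq])
  qed
  \<comment> \<open>The divisor \<open>N - 3\<close> costs \<open>4 / N\<close>, the remainder with
    second moment at most \<open>32 * N * vw\<close> costs \<open>8 / sqrt N\<close>.\<close>
  have US: "(\<integral>z. \<bar>U z - S z\<bar> \<partial>?P) \<le> 12 / sqrt N"
  proof -
    have "(\<integral>z. \<bar>U z - S z\<bar> \<partial>?P) \<le> (\<integral>z. 4 / N * \<bar>S z\<bar> + c * \<bar>remainder n z\<bar> \<partial>?P)"
    proof (rule integral_mono)
      show "integrable ?P (\<lambda>z. \<bar>U z - S z\<bar>)" using U_int S_int by simp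
      show "integrable ?P (\<lambda>z. 4 / N * \<bar>S z\<bar> + c * \<bar>remainder n z\<bar>)" using rem_int S_int by simp
      fix z assume z: "z \<in> space ?P"
      have "(N - 1) / (N - 3) - 1 = 2 / (N - 3)" using N by (simp add: field_simps)
      moreover have "U z - S z = ((N - 1) / (N - 3) - 1) * S z + c * remainder n z"
        unfolding U_eq[OF z] by (simp add: algebra_simps)
      ultimately have "U z - S z = 2 / (N - 3) * S z + c * remainder n z" by simp
      then have "\<bar>U z - S z\<bar> \<le> \<bar>2 / (N - 3) * S z\<bar> + \<bar>c * remainder n z\<bar>" by linarith
      moreover have "\<bar>2 / (N - 3) * S z\<bar> \<le> 4 / N * \<bar>S z\<bar>"
        unfolding abs_mult using N by (intro mult_right_mono) (auto simp: field_simps)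
      moreover have "\<bar>c * remainder n z\<bar> = c * \<bar>remainder n z\<bar>" using c0 by (simp add: abs_mult)
      ultimately show "\<bar>U z - S z\<bar> \<le> 4 / N * \<bar>S z\<bar> + c * \<bar>remainder n z\<bar>" by linarith
    qed
    also have "\<dots> = 4 / N * (\<integral>z. \<bar>S z\<bar> \<partial>?P) + c * (\<integral>z. \<bar>remainder n z\<bar> \<partial>?P)"
      using rem_int S_int by simp
    also have "\<dots> \<le> 4 / N * 1 + c * sqrt (32 * N * vw)"
    proof (intro add_mono mult_left_mono)
      show "(\<integral>z. \<bar>remainder n z\<bar> \<partial>?P) \<le> sqrt (32 * N * vw)"
        using P.P.abs_expectation_le_sqrt[OF rem(1,2)] real_sqrt_le_mono[OF rem(3)]
        unfolding N_def by (rule order_trans)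
    qed (use ES N c0 in auto)
    also have "c * sqrt (32 * N * vw) \<le> 8 / sqrt N"
    proof -
      have "sqrt s * sqrt (32 * N * vw) = sqrt (4\<^sup>2 * (N\<^sup>2 * (N - 1))) * \<sigma>"
        unfolding \<sigma>_def real_sqrt_mult[symmetric] by (simp add: s_def power2_eq_square mult_ac)
      also have "\<dots> \<le> sqrt (4\<^sup>2 * (N\<^sup>2 * N)) * \<sigma>"
        using N \<sigma> by (intro mult_right_mono real_sqrt_le_mono mult_left_mono) auto
      also have "sqrt (4\<^sup>2 * (N\<^sup>2 * N)) = 4 * N * sqrt N"
        unfolding real_sqrt_mult real_sqrt_abs using N by simp
      finally have le: "sqrt s * sqrt (32 * N * vw) \<le> 4 * N * sqrt N * \<sigma>" .
      have "c * sqrt (32 * N * vw) = (sqrt s * sqrt (32 * N * vw)) / (N * (N - 3) * \<sigma>)" by (simp add: c_def)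
      also have "\<dots> \<le> (4 * N * sqrt N * \<sigma>) / (N * (N - 3) * \<sigma>)"
        by (rule divide_right_mono[OF le]) (use N \<sigma> in simp)
      also have "\<dots> = 4 * sqrt N / (N - 3)" using N \<sigma> by simp
      also have "\<dots> \<le> 4 * sqrt N / (N / 2)" using N by (intro divide_left_mono) auto
      also have "\<dots> = 8 * (sqrt N / N)" by simp
      also have "sqrt N / N = 1 / sqrt N" using N by (simp add: real_div_sqrt field_simps)
      finally show ?thesis by simp
    qed
    also have "4 / N * 1 + 8 / sqrt N \<le> 12 / sqrt N"
    proof -
      have "1 \<le> sqrt N" using N by simp
      then have "sqrt N \<le> N" using mult_left_mono[of 1 "sqrt N" "sqrt N"] N by simp
      then have "4 / N \<le> 4 / sqrt N" using N by (intro divide_left_mono) auto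
      then show ?thesis by (simp add: add_divide_distrib[symmetric] field_simps)
    qed
    finally show ?thesis by simp
  qed
  have EU: "(\<integral>z. \<bar>U z\<bar> \<partial>?P) \<le> 13"
  proof -
    have "(\<integral>z. \<bar>U z\<bar> \<partial>?P) \<le> (\<integral>z. \<bar>U z - S z\<bar> + \<bar>S z\<bar> \<partial>?P)"
      using U_int S_int by (intro integral_mono) auto
    also have "\<dots> = (\<integral>z. \<bar>U z - S z\<bar> \<partial>?P) + (\<integral>z. \<bar>S z\<bar> \<partial>?P)" using U_int S_int by simp
    also have "\<dots> \<le> 12 / sqrt N + 1" using US ES by (rule add_mono)
    also have "12 / sqrt N \<le> 12 / 1" using N by (intro divide_left_mono) auto
    finally show ?thesis by simp
  qed
  have \<tau>1: "\<tau> \<le> 1" using \<tau> by simp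
  have qX_int: "integrable (iid_space MX {1..n}) qX"
    unfolding qX_def using X.self_law(1)[OF \<tau>(1) \<tau>1 n vX KX_int] by simp
  have qY_int: "integrable (iid_space MY {1..n}) qY"
    unfolding qY_def using Y.self_law(1)[OF \<tau>(1) \<tau>1 n vY KY_int] by simp
  have qX_le: "(\<integral>w. \<bar>qX w - 1\<bar> \<partial>iid_space MX {1..n}) \<le> \<beta>X"
    unfolding qX_def \<beta>X_def \<kappa>X_def using X.self_law(2)[OF \<tau>(1) \<tau>1 n vX KX_int] .
  have qY_le: "(\<integral>w. \<bar>qY w - 1\<bar> \<partial>iid_space MY {1..n}) \<le> \<beta>Y"
    unfolding qY_def \<beta>Y_def \<kappa>Y_def using Y.self_law(2)[OF \<tau>(1) \<tau>1 n vY KY_int] .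
  have q_meas: "q \<in> borel_measurable ?P"
  proof -
    have "(\<lambda>z. qX (fst z)) \<in> borel_measurable ?P" "(\<lambda>z. qY (snd z)) \<in> borel_measurable ?P"
      using measurable_compose[OF measurable_fst borel_measurable_integrable[OF qX_int]]
        measurable_compose[OF measurable_snd borel_measurable_integrable[OF qY_int]] by auto
    then show ?thesis unfolding q_def by simp
  qed
  have q_int: "integrable ?P q" unfolding q_def by (rule sample_mult(1)[OF qX_int qY_int])
  \<comment> \<open>Write \<open>q - 1\<close> as \<open>qX * (qY - 1) + (qX - 1)\<close>; the
    samples are independent, so the mean of the product is a product of means.\<close>
  have q_le: "(\<integral>z. \<bar>q z - 1\<bar> \<partial>?P) \<le> \<beta>"
  proof -
    have 1: "integrable (iid_space MX {1..n}) (\<lambda>w. 1 + \<bar>qX w - 1\<bar>)" and onep: "integrable (iid_space MX {1..n}) (\<lambda>w. \<bar>qX w - 1\<bar>)"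
      using qX_int by auto
    have 2: "integrable (iid_space MY {1..n}) (\<lambda>w. \<bar>qY w - 1\<bar>)" using qY_int by simp
    have 3: "integrable (iid_space MY {1..n}) (\<lambda>w. 1 :: real)" by simp
    note a = sample_mult[OF 1 2] and b = sample_mult[OF onep 3]
    have "(\<integral>z. \<bar>q z - 1\<bar> \<partial>?P) \<le> (\<integral>z. (1 + \<bar>qX (fst z) - 1\<bar>) * \<bar>qY (snd z) - 1\<bar> + \<bar>qX (fst z) - 1\<bar> * 1 \<partial>?P)"
    proof (rule integral_mono)
      show "integrable ?P (\<lambda>z. \<bar>q z - 1\<bar>)" using q_int by simp
      show "integrable ?P (\<lambda>z. (1 + \<bar>qX (fst z) - 1\<bar>) * \<bar>qY (snd z) - 1\<bar> + \<bar>qX (fst z) - 1\<bar> * 1)"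
        using a(1) b(1) by simp
      fix z
      have "q z - 1 = qX (fst z) * (qY (snd z) - 1) + (qX (fst z) - 1)" by (simp add: q_def algebra_simps)
      then have "\<bar>q z - 1\<bar> \<le> \<bar>qX (fst z)\<bar> * \<bar>qY (snd z) - 1\<bar> + \<bar>qX (fst z) - 1\<bar>"
        by (metis abs_mult abs_triangle_ineq)
      also have "\<bar>qX (fst z)\<bar> * \<bar>qY (snd z) - 1\<bar> \<le> (1 + \<bar>qX (fst z) - 1\<bar>) * \<bar>qY (snd z) - 1\<bar>"
        by (intro mult_right_mono) auto
      finally show "\<bar>q z - 1\<bar> \<le> (1 + \<bar>qX (fst z) - 1\<bar>) * \<bar>qY (snd z) - 1\<bar> + \<bar>qX (fst z) - 1\<bar> * 1" by simp
    qed
    also have "\<dots> = (1 + (\<integral>w. \<bar>qX w - 1\<bar> \<partial>iid_space MX {1..n})) * (\<integral>w. \<bar>qY w - 1\<bar> \<partial>iid_space MY {1..n})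
        + (\<integral>w. \<bar>qX w - 1\<bar> \<partial>iid_space MX {1..n}) * 1"
      unfolding Bochner_Integration.integral_add[OF a(1) b(1)] a(2) b(2)
      using qX_int by (simp add: P.M1.prob_space P.M2.prob_space)
    also have "\<dots> \<le> (1 + \<beta>X) * \<beta>Y + \<beta>X * 1"
      using qX_le qY_le order_trans[OF _ qX_le]
      by (intro add_mono mult_mono) (auto intro: add_nonneg_nonneg)
    finally show ?thesis by (simp add: \<beta>_def)
  qed
  have T_eq: "dcor_stat n z = (if 0 < q z then U z / sqrt (q z) else 0)" for z
  proof -
    define vX' where "vX' = V_star n (\<lambda>k l. aX (fst z k) (fst z l)) (\<lambda>k l. aX (fst z k) (fst z l))"
    define vY' where "vY' = V_star n (\<lambda>k l. aY (snd z k) (snd z l)) (\<lambda>k l. aY (snd z k) (snd z l))"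
    have prod: "vX' * vY' = vw * q z" using vX vY by (simp add: q_def qX_def qY_def vX'_def vY'_def)
    then have pos: "vX' * vY' > 0 \<longleftrightarrow> 0 < q z" by (metis vw_pos zero_less_mult_pos mult_pos_pos)
    have "sqrt (vX' * vY') = \<sigma> * sqrt (q z)" by (simp add: prod real_sqrt_mult \<sigma>_def)
    then show ?thesis
      unfolding dcor_stat_def R_star_def vX'_def[symmetric] vY'_def[symmetric] V_def[symmetric] pos
      by (simp add: U_def s_def N_def)
  qed
  have U_meas: "U \<in> borel_measurable ?P" using U_int by simp
  show T_meas: "dcor_stat n \<in> borel_measurable ?P"
  proof -
    have "(\<lambda>z. if 0 < q z then U z / sqrt (q z) else 0) \<in> borel_measurable ?P"
      using q_meas U_meas by measurable
    then show ?thesis unfolding T_eq .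
  qed
  have TU: "(\<integral>z. cmod (iexp (t * dcor_stat n z) - iexp (t * U z)) \<partial>?P) \<le> 2 * sqrt (\<bar>t\<bar> * 13 * \<beta>) + 4 * \<beta>"
  proof -
    have i1: "integrable ?P (\<lambda>z. \<bar>t\<bar> * \<bar>U z\<bar>)" using U_int by simp
    have i2: "integrable ?P (\<lambda>z. \<bar>q z - 1\<bar>)" using q_int by simp
    note sq = P.P.integral_sqrt_mult_le[OF i1 _ i2]
    have "(\<integral>z. cmod (iexp (t * dcor_stat n z) - iexp (t * U z)) \<partial>?P)
      \<le> (\<integral>z. 2 * (sqrt (\<bar>t\<bar> * \<bar>U z\<bar>) * sqrt \<bar>q z - 1\<bar>) + 4 * \<bar>q z - 1\<bar> \<partial>?P)"
    proof (rule integral_mono)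
      show "integrable ?P (\<lambda>z. cmod (iexp (t * dcor_stat n z) - iexp (t * U z)))"
      proof (rule P.P.integrable_const_bound[of _ 2])
        show "AE z in ?P. norm (cmod (iexp (t * dcor_stat n z) - iexp (t * U z))) \<le> 2"
          using norm_iexp_diff_le_2 by (simp del: of_real_mult)
        show "(\<lambda>z. cmod (iexp (t * dcor_stat n z) - iexp (t * U z))) \<in> borel_measurable ?P"
          using T_meas U_meas by simp
      qed
      show "integrable ?P (\<lambda>z. 2 * (sqrt (\<bar>t\<bar> * \<bar>U z\<bar>) * sqrt \<bar>q z - 1\<bar>) + 4 * \<bar>q z - 1\<bar>)"
        using sq(1) i2 by simp
      show "cmod (iexp (t * dcor_stat n z) - iexp (t * U z)) \<le> 2 * (sqrt (\<bar>t\<bar> * \<bar>U z\<bar>) * sqrt \<bar>q z - 1\<bar>) + 4 * \<bar>q z - 1\<bar>" for z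
        unfolding T_eq by (rule norm_iexp_studentize)
    qed
    also have "\<dots> = 2 * (\<integral>z. sqrt (\<bar>t\<bar> * \<bar>U z\<bar>) * sqrt \<bar>q z - 1\<bar> \<partial>?P) + 4 * (\<integral>z. \<bar>q z - 1\<bar> \<partial>?P)"
      using sq(1) i2 by simp
    also have "\<dots> \<le> 2 * sqrt ((\<bar>t\<bar> * (\<integral>z. \<bar>U z\<bar> \<partial>?P)) * (\<integral>z. \<bar>q z - 1\<bar> \<partial>?P)) + 4 * (\<integral>z. \<bar>q z - 1\<bar> \<partial>?P)"
      using sq(2) by simp
    also have "\<dots> \<le> 2 * sqrt ((\<bar>t\<bar> * 13) * \<beta>) + 4 * \<beta>"
      using EU q_le by (intro add_mono mult_left_mono real_sqrt_le_mono mult_mono) auto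
    finally show ?thesis by simp
  qed
  have i_int: "integrable ?P (\<lambda>z. iexp (t * f z))" if "f \<in> borel_measurable ?P" for f
    using that by (intro P.P.integrable_const_bound[of _ 1]) auto
  have 1: "cmod ((\<integral>z. iexp (t * dcor_stat n z) \<partial>?P) - (\<integral>z. iexp (t * U z) \<partial>?P)) \<le> 2 * sqrt (\<bar>t\<bar> * 13 * \<beta>) + 4 * \<beta>"
    unfolding Bochner_Integration.integral_diff[OF i_int[OF T_meas] i_int[OF U_meas], symmetric]
    using integral_norm_bound TU by (rule order_trans)
  have 2: "cmod ((\<integral>z. iexp (t * U z) \<partial>?P) - (\<integral>z. iexp (t * S z) \<partial>?P)) \<le> \<bar>t\<bar> * (12 / sqrt N)"
  proof -
    have "cmod ((\<integral>z. iexp (t * U z) \<partial>?P) - (\<integral>z. iexp (t * S z) \<partial>?P)) \<le> (\<integral>z. cmod (iexp (t * U z) - iexp (t * S z)) \<partial>?P)"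
      unfolding Bochner_Integration.integral_diff[OF i_int[OF U_meas] i_int[OF S_meas], symmetric]
      by (rule integral_norm_bound)
    also have "\<dots> \<le> (\<integral>z. \<bar>t\<bar> * \<bar>U z - S z\<bar> \<partial>?P)"
    proof (rule integral_mono)
      show "integrable ?P (\<lambda>z. cmod (iexp (t * U z) - iexp (t * S z)))"
        by (intro integrable_norm Bochner_Integration.integrable_diff i_int U_meas S_meas)
      show "integrable ?P (\<lambda>z. \<bar>t\<bar> * \<bar>U z - S z\<bar>)" using U_int S_int by simp
      show "cmod (iexp (t * U z) - iexp (t * S z)) \<le> \<bar>t\<bar> * \<bar>U z - S z\<bar>" for z
        using norm_iexp_diff_le[of "t * U z" "t * S z"]
        unfolding right_diff_distrib[symmetric] abs_mult .
    qed
    also have "\<dots> = \<bar>t\<bar> * (\<integral>z. \<bar>U z - S z\<bar> \<partial>?P)" by simp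
    also have "\<dots> \<le> \<bar>t\<bar> * (12 / sqrt N)" using US by (intro mult_left_mono) auto
    finally show ?thesis .
  qed
  have 3: "cmod ((\<integral>z. iexp (t * S z) \<partial>?P) - exp (- (t\<^sup>2) / 2))
    \<le> (2 + t\<^sup>2 * exp (t\<^sup>2)) * (2 * y + 4 * sqrt y + 4 * sqrt (2 * \<rho>))
        + 2 * exp (t\<^sup>2) * \<bar>t\<bar> powr (2 + 2 * \<tau>) * (1152 * y)"
  proof -
    have m: "(\<lambda>w. iexp (t * H.ustat n w)) \<in> borel_measurable ?Q" using ustat_meas by simp
    have "(\<integral>z. iexp (t * S z) \<partial>?P) = (\<integral>w. iexp (t * H.ustat n w) \<partial>?Q)"
      unfolding S_def using integral_distr[OF Z_meas m, unfolded Z_distr] by simp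
    moreover have "real n powr (- \<tau>) * H.moment_K (2 + 2 * \<tau>) = y"
    proof -
      have "vw powr ((2 + 2 * \<tau>) / 2) = X.variance_K powr (1 + \<tau>) * Y.variance_K powr (1 + \<tau>)"
        using vX vY by (simp add: powr_mult add_divide_distrib)
      then show ?thesis by (simp add: moment_H[OF KX_int KY_int] y_def \<kappa>X_def \<kappa>Y_def)
    qed
    moreover have "H.variance_KK = \<rho>" by (simp add: variance_HH \<rho>_def power_mult_distrib)
    ultimately show ?thesis
      using H.ustat_char_bound[OF \<tau> _ variance_H H_powr_integrable[OF KX_int KY_int], of n t] n by simp
  qed
  have triangle: "cmod (a - d) \<le> cmod (a - b) + cmod (b - c) + cmod (c - d)" for a b c d
    using norm_triangle_ineq[of "a - b" "b - d"] norm_triangle_ineq[of "b - c" "c - d"] by simp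
  show "cmod ((\<integral>z. iexp (t * dcor_stat n z) \<partial>sample_space n) - exp (- (t\<^sup>2) / 2))
    \<le> (2 * sqrt (\<bar>t\<bar> * 13 * \<beta>) + 4 * \<beta>) + \<bar>t\<bar> * (12 / sqrt (real n))
      + ((2 + t\<^sup>2 * exp (t\<^sup>2)) * (2 * y + 4 * sqrt y + 4 * sqrt (2 * \<rho>))
        + 2 * exp (t\<^sup>2) * \<bar>t\<bar> powr (2 + 2 * \<tau>) * (1152 * y))"
    using triangle add_mono[OF add_mono[OF 1 2] 3] unfolding N_def by (rule order_trans)
qed

end

section \<open>The Euclidean distance kernel\<close>

lemma vnorm_nonneg [simp]: "0 \<le> vnorm d x"
  by (simp add: vnorm_def)

lemma vdist_nonneg [simp]: "0 \<le> vdist d x y"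
  by (simp add: vdist_def)

lemma vnorm_square: "(vnorm d x)\<^sup>2 = (\<Sum>i<d. (x i)\<^sup>2)"
  by (simp add: vnorm_def L2_set_def sum_nonneg)

lemma vinner_commute: "vinner d x y = vinner d y x"
  by (simp add: vinner_def mult.commute)

lemma abs_vinner_le: "\<bar>vinner d x y\<bar> \<le> vnorm d x * vnorm d y"
proof -
  have "\<bar>vinner d x y\<bar> \<le> (\<Sum>i<d. \<bar>x i\<bar> * \<bar>y i\<bar>)"
    unfolding vinner_def abs_mult[symmetric] by (rule sum_abs)
  also have "\<dots> \<le> vnorm d x * vnorm d y" unfolding vnorm_def by (rule L2_set_mult_ineq)
  finally show ?thesis .
qed

lemma vdist_square: "(vdist d x y)\<^sup>2 = (vnorm d x)\<^sup>2 + (vnorm d y)\<^sup>2 - 2 * vinner d x y"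
  unfolding vdist_def vnorm_square vinner_def power2_diff
  by (simp add: sum.distrib sum_subtractf sum_distrib_left mult.assoc)

lemma vdist_commute: "vdist d x y = vdist d y x"
proof -
  have "(vdist d x y)\<^sup>2 = (vdist d y x)\<^sup>2" by (simp add: vdist_square vinner_commute)
  then show ?thesis by (simp add: power2_eq_iff_nonneg)
qed

lemma vdist_self [simp]: "vdist d x x = 0"
  by (simp add: vdist_def vnorm_def L2_set_def)

lemma vdist_le: "vdist d x y \<le> vnorm d x + vnorm d y"
proof (rule power2_le_imp_le)
  show "(vdist d x y)\<^sup>2 \<le> (vnorm d x + vnorm d y)\<^sup>2"
    using abs_vinner_le[of d x y] unfolding vdist_square power2_sum by linarith
qed simp

lemma two_abs_vinner_le: "2 * \<bar>vinner d x y\<bar> \<le> (vnorm d x)\<^sup>2 + (vnorm d y)\<^sup>2"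
  using abs_vinner_le[of d x y] sum_squares_bound[of "vnorm d x" "vnorm d y"] by linarith

lemma abs_coord_le_vnorm: "i < d \<Longrightarrow> \<bar>x i\<bar> \<le> vnorm d x"
proof (rule power2_le_imp_le)
  assume "i < d"
  then show "\<bar>x i\<bar>\<^sup>2 \<le> (vnorm d x)\<^sup>2"
    unfolding vnorm_square using member_le_sum[of i "{..<d}" "\<lambda>i. (x i)\<^sup>2"] by simp
qed simp

text \<open>The distance as an average of Gaussian kernels: by scaling, the integral over all
  \<open>u\<close> is proportional to \<open>z \<ge> 0\<close>, with constant twice the square root
  of pi. At \<open>u = 0\<close> division by zero gives the value 0, which concerns a null set
  only.\<close>

definition norm_kernel :: "real \<Rightarrow> real \<Rightarrow> real" where
  "norm_kernel z u = (1 - exp (- (u\<^sup>2 * z\<^sup>2))) / u\<^sup>2"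

definition norm_const :: real where
  "norm_const = (\<integral>u. norm_kernel 1 u \<partial>lborel)"

lemma norm_kernel_nonneg: "0 \<le> norm_kernel z u"
  by (simp add: norm_kernel_def)

lemma norm_kernel_meas [measurable]: "(\<lambda>(z, u). norm_kernel z u) \<in> borel_measurable (borel \<Otimes>\<^sub>M borel)"
  unfolding norm_kernel_def by measurable

text \<open>The numerator is at most \<open>u^2 * z^2\<close> and at most 1; adding suitable
  multiples of the two bounds compares the kernel with \<open>1 / (1 + u^2)\<close>.\<close>

lemma integrable_norm_kernel: "integrable lborel (norm_kernel z)"
proof (rule Bochner_Integration.integrable_bound)
  have "integrable lborel (\<lambda>x::real. inverse (1 + x\<^sup>2))"
    using integrable_inverse_1_plus_square by (simp add: set_integrable_def)
  then show "integrable lborel (\<lambda>u::real. (1 + z\<^sup>2) * inverse (1 + u\<^sup>2))" by simp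
  have "norm_kernel z u \<le> (1 + z\<^sup>2) * inverse (1 + u\<^sup>2)" for u
  proof (cases "u = 0")
    case False
    define x where "x = 1 - exp (- (u\<^sup>2 * z\<^sup>2))"
    have "x \<le> u\<^sup>2 * z\<^sup>2" "x \<le> 1"
      using exp_ge_add_one_self[of "- (u\<^sup>2 * z\<^sup>2)"] by (auto simp: x_def)
    then have "x * (1 + u\<^sup>2) \<le> u\<^sup>2 * z\<^sup>2 + 1 * u\<^sup>2"
      unfolding distrib_left by (intro add_mono mult_right_mono) auto
    then have "x * (1 + u\<^sup>2) \<le> (1 + z\<^sup>2) * u\<^sup>2" by (simp add: algebra_simps)
    then show ?thesis
      using False add_pos_nonneg[of 1 "u\<^sup>2"] by (simp add: norm_kernel_def x_def[symmetric] field_simps)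
  qed (simp add: norm_kernel_def)
  then show "AE u in lborel. norm (norm_kernel z u) \<le> norm ((1 + z\<^sup>2) * inverse (1 + u\<^sup>2))"
    using norm_kernel_nonneg by (intro AE_I2) (simp add: abs_of_nonneg)
qed simp

lemma integral_norm_kernel:
  assumes "0 \<le> z"
  shows "(\<integral>u. norm_kernel z u \<partial>lborel) = norm_const * z"
proof (cases "z = 0")
  case False
  then have z: "0 < z" using assms by simp
  have "norm_const = z * (\<integral>u. norm_kernel 1 (z * u) \<partial>lborel)"
    unfolding norm_const_def using lborel_integral_real_affine[of z "norm_kernel 1" 0] z by simp
  also have "(\<lambda>u. norm_kernel 1 (z * u)) = (\<lambda>u. norm_kernel z u / z\<^sup>2)"
    by (simp add: norm_kernel_def power_mult_distrib mult.commute fun_eq_iff)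
  finally show ?thesis using z by (simp add: power2_eq_square field_simps)
qed (simp add: norm_kernel_def)

lemma norm_const_nonneg: "0 \<le> norm_const"
  unfolding norm_const_def by (intro Bochner_Integration.integral_nonneg norm_kernel_nonneg)

section \<open>Laws on Euclidean space and the correlation of distance with inner product\<close>

locale random_vector = prob_space M for M :: "(nat \<Rightarrow> real) measure" +
  fixes d :: nat and \<tau> :: real
  assumes sets_M: "sets M = sets (euclid d)"
    and \<tau>: "0 < \<tau>" "\<tau> \<le> 1 / 2"
    and mean_zero: "\<And>i. i < d \<Longrightarrow> (\<integral>x. x i \<partial>M) = 0"
    and moment: "integrable M (\<lambda>x. vnorm d x powr (4 + 4 * \<tau>))"
begin

lemma coord_meas [measurable]: "i < d \<Longrightarrow> (\<lambda>x. x i) \<in> borel_measurable M"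
  by (subst measurable_cong_sets[OF sets_M refl]) (rule measurable_component_singleton, simp)

lemma coord_meas_comp:
  "i < d \<Longrightarrow> f \<in> N \<rightarrow>\<^sub>M M \<Longrightarrow> (\<lambda>x. f x i) \<in> borel_measurable N"
  by (rule measurable_compose[OF _ coord_meas])

lemma vinner_meas_comp:
  "f \<in> N \<rightarrow>\<^sub>M M \<Longrightarrow> g \<in> N \<rightarrow>\<^sub>M M \<Longrightarrow> (\<lambda>x. vinner d (f x) (g x)) \<in> borel_measurable N"
  unfolding vinner_def by (intro borel_measurable_sum borel_measurable_times coord_meas_comp) auto

lemma vnorm_meas: "vnorm d \<in> borel_measurable M"
proof -
  have "(\<lambda>x. sqrt (\<Sum>i<d. (x i)\<^sup>2)) \<in> borel_measurable M"
    by measurable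
  then show ?thesis unfolding vnorm_def[abs_def] L2_set_def .
qed

lemma vnorm_meas_comp: "f \<in> N \<rightarrow>\<^sub>M M \<Longrightarrow> (\<lambda>x. vnorm d (f x)) \<in> borel_measurable N"
  by (rule measurable_compose[OF _ vnorm_meas])

lemma vdist_meas_comp:
  assumes "f \<in> N \<rightarrow>\<^sub>M M" "g \<in> N \<rightarrow>\<^sub>M M"
  shows "(\<lambda>x. vdist d (f x) (g x)) \<in> borel_measurable N"
proof -
  have "vdist d x y = sqrt ((vnorm d x)\<^sup>2 + (vnorm d y)\<^sup>2 - 2 * vinner d x y)" for x y
    using vdist_square[of d x y] by (metis real_sqrt_unique vdist_nonneg)
  then show ?thesis using vnorm_meas_comp[OF assms(1)] vnorm_meas_comp[OF assms(2)] vinner_meas_comp[OF assms]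
    by simp
qed

lemma vinner_meas: "(\<lambda>(x, y). vinner d x y) \<in> borel_measurable M2"
  using vinner_meas_comp[OF measurable_fst measurable_snd] by (simp add: split_beta')

lemma vdist_meas: "(\<lambda>(x, y). vdist d x y) \<in> borel_measurable M2"
  using vdist_meas_comp[OF measurable_fst measurable_snd] by (simp add: split_beta')

lemma vnorm_powr_integrable: "0 \<le> s \<Longrightarrow> s \<le> 4 + 4 * \<tau> \<Longrightarrow> integrable M (\<lambda>x. vnorm d x powr s)"
  using integrable_powr_le[of s "4 + 4 * \<tau>" "vnorm d"] vnorm_meas moment by simp

lemma vnorm_power_integrable: "k \<le> 4 \<Longrightarrow> integrable M (\<lambda>x. vnorm d x ^ k)"
proof (cases "k = 0")
  case False
  assume "k \<le> 4"
  then have "integrable M (\<lambda>x. vnorm d x powr real k)"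
    using \<tau> by (intro vnorm_powr_integrable) auto
  then show ?thesis using False by (simp add: powr_realpow')
qed simp

lemma coord_integrable: "i < d \<Longrightarrow> integrable M (\<lambda>x. x i)"
proof (rule Bochner_Integration.integrable_bound)
  show "integrable M (vnorm d)" using vnorm_power_integrable[of 1] by simp
  show "AE x in M. norm (x i) \<le> norm (vnorm d x)" if "i < d"
    using abs_coord_le_vnorm[OF that] by (intro AE_I2) simp
qed measurable

lemma pair_bound_integrable:
  assumes "f \<in> borel_measurable M2" "integrable M g" "integrable M g'"
    and "\<And>x y. \<bar>f (x, y)\<bar> \<le> g x * g' y"
  shows "integrable M2 (f :: _ \<Rightarrow> real)"
proof (rule Bochner_Integration.integrable_bound)
  show "integrable M2 (\<lambda>(x, y). g x * g' y)"
    by (rule integrable_pair_mult[OF pair_sigma_finite_self assms(2,3)])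
  show "AE p in M2. norm (f p) \<le> norm (case p of (x, y) \<Rightarrow> g x * g' y)"
    using assms(4) by (intro AE_I2) (auto intro: order_trans[OF _ abs_ge_self])
qed (rule assms)

lemma vinner_powr_integrable: "integrable M2 (\<lambda>(x, y). \<bar>vinner d x y\<bar> powr (2 + 2 * \<tau>))"
proof (rule pair_bound_integrable)
  show "(\<lambda>(x, y). \<bar>vinner d x y\<bar> powr (2 + 2 * \<tau>)) \<in> borel_measurable M2"
    using vinner_meas by (simp add: split_beta')
  show "integrable M (\<lambda>x. vnorm d x powr (2 + 2 * \<tau>))" "integrable M (\<lambda>x. vnorm d x powr (2 + 2 * \<tau>))"
    using \<tau> by (auto intro: vnorm_powr_integrable)
  show "\<bar>case (x, y) of (x, y) \<Rightarrow> \<bar>vinner d x y\<bar> powr (2 + 2 * \<tau>)\<bar> \<le> vnorm d x powr (2 + 2 * \<tau>) * vnorm d y powr (2 + 2 * \<tau>)" for x y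
    using powr_mono2[OF _ _ abs_vinner_le[of d x y], of "2 + 2 * \<tau>"] \<tau> by (simp add: powr_mult)
qed

lemma vinner_square_integrable: "integrable M2 (\<lambda>(x, y). (vinner d x y)\<^sup>2)"
proof -
  interpret MM: prob_space "M2" by (rule prob_space_pair_self)
  show ?thesis
    using MM.integrable_square_of_powr[of "2 + 2 * \<tau>" "\<lambda>(x, y). vinner d x y"] vinner_meas vinner_powr_integrable \<tau>
    by (simp add: split_beta')
qed

lemma vinner_integrable: "integrable M2 (\<lambda>(x, y). vinner d x y)"
proof -
  interpret MM: prob_space "M2" by (rule prob_space_pair_self)
  show ?thesis
    using MM.integrable_of_square[OF vinner_meas] vinner_square_integrable by (simp add: split_beta')
qed

lemma integral_vinner: "(\<integral>y. vinner d x y \<partial>M) = 0"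
proof -
  have "(\<integral>y. vinner d x y \<partial>M) = (\<Sum>i<d. \<integral>y. x i * y i \<partial>M)"
    unfolding vinner_def using coord_integrable by (intro Bochner_Integration.integral_sum) auto
  then show ?thesis by (simp add: mean_zero)
qed

lemma integral_pair_vinner: "(\<integral>(x, y). vinner d x y \<partial>M2) = 0"
  using pair_sigma_finite.integral_fst'[OF pair_sigma_finite_self vinner_integrable] by (simp add: integral_vinner)

text \<open>Expanding one factor over the coordinates moves \<open>x i\<close> and
  \<open>y i\<close> into the weight, which is why the induction generalises \<open>g\<close>. At
  exponent 0 the integral is the square of the mean of \<open>g\<close>.\<close>

lemma vinner_power_psd:
  assumes "g \<in> borel_measurable M" "\<And>m. integrable M (\<lambda>x. g x * vnorm d x ^ m)"
  shows "0 \<le> (\<integral>(x, y). g x * g y * vinner d x y ^ k \<partial>M2)"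
  using assms
proof (induction k arbitrary: g)
  case 0
  have "integrable M g" using 0(2)[of 0] by simp
  then show ?case using integral_pair_mult[OF pair_sigma_finite_self, of g g] by simp
next
  case (Suc k)
  define G where "G i x = g x * x i" for i and x :: "nat \<Rightarrow> real"
  have G_meas: "G i \<in> borel_measurable M" if "i < d" for i
    unfolding G_def using Suc.prems(1) that by measurable
  have G_int: "integrable M (\<lambda>x. G i x * vnorm d x ^ m)" if "i < d" for i m
  proof (rule Bochner_Integration.integrable_bound[OF Suc.prems(2)[of "Suc m"]])
    show "(\<lambda>x. G i x * vnorm d x ^ m) \<in> borel_measurable M" using G_meas[OF that] vnorm_meas by simp
    have "\<bar>x i\<bar> * (\<bar>g x\<bar> * vnorm d x ^ m) \<le> vnorm d x * (\<bar>g x\<bar> * vnorm d x ^ m)" for x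
      using abs_coord_le_vnorm[OF that] by (intro mult_right_mono) auto
    then show "AE x in M. norm (G i x * vnorm d x ^ m) \<le> norm (g x * vnorm d x ^ Suc m)"
      by (intro AE_I2) (simp add: G_def abs_mult mult_ac)
  qed
  have int: "integrable M2 (\<lambda>p. G i (fst p) * G i (snd p) * vinner d (fst p) (snd p) ^ k)" if "i < d" for i
  proof (rule pair_bound_integrable[where g = "\<lambda>x. \<bar>G i x * vnorm d x ^ k\<bar>" and g' = "\<lambda>x. \<bar>G i x * vnorm d x ^ k\<bar>"])
    show "(\<lambda>p. G i (fst p) * G i (snd p) * vinner d (fst p) (snd p) ^ k) \<in> borel_measurable M2"
      by (intro borel_measurable_times borel_measurable_power vinner_meas_comp measurable_fst measurable_snd
          measurable_compose[OF measurable_fst G_meas[OF that]] measurable_compose[OF measurable_snd G_meas[OF that]])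
    show "integrable M (\<lambda>x. \<bar>G i x * vnorm d x ^ k\<bar>)" "integrable M (\<lambda>x. \<bar>G i x * vnorm d x ^ k\<bar>)"
      using G_int[OF that] by (auto intro!: integrable_abs)
    fix x y
    have "\<bar>vinner d x y\<bar> ^ k \<le> (vnorm d x * vnorm d y) ^ k" by (intro power_mono abs_vinner_le) simp
    then have "\<bar>G i x\<bar> * \<bar>G i y\<bar> * \<bar>vinner d x y\<bar> ^ k \<le> \<bar>G i x\<bar> * \<bar>G i y\<bar> * (vnorm d x * vnorm d y) ^ k"
      by (intro mult_left_mono) auto
    then show "\<bar>G i (fst (x, y)) * G i (snd (x, y)) * vinner d (fst (x, y)) (snd (x, y)) ^ k\<bar>
      \<le> \<bar>G i x * vnorm d x ^ k\<bar> * \<bar>G i y * vnorm d y ^ k\<bar>"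
      by (simp add: abs_mult power_abs power_mult_distrib mult_ac)
  qed
  have "(\<integral>(x, y). g x * g y * vinner d x y ^ Suc k \<partial>M2)
    = (\<integral>p. (\<Sum>i<d. G i (fst p) * G i (snd p) * vinner d (fst p) (snd p) ^ k) \<partial>M2)"
  proof (intro Bochner_Integration.integral_cong refl)
    fix p :: "(nat \<Rightarrow> real) \<times> (nat \<Rightarrow> real)"
    have "g (fst p) * g (snd p) * vinner d (fst p) (snd p) ^ Suc k
      = (\<Sum>i<d. fst p i * snd p i) * (g (fst p) * g (snd p) * vinner d (fst p) (snd p) ^ k)"
      unfolding power_Suc by (subst (1) vinner_def) (simp add: mult_ac)
    also have "\<dots> = (\<Sum>i<d. G i (fst p) * G i (snd p) * vinner d (fst p) (snd p) ^ k)"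
      unfolding sum_distrib_right by (intro sum.cong refl) (simp add: G_def mult_ac)
    finally show "(case p of (x, y) \<Rightarrow> g x * g y * vinner d x y ^ Suc k)
      = (\<Sum>i<d. G i (fst p) * G i (snd p) * vinner d (fst p) (snd p) ^ k)" by (simp add: split_beta')
  qed
  also have "\<dots> = (\<Sum>i<d. \<integral>p. G i (fst p) * G i (snd p) * vinner d (fst p) (snd p) ^ k \<partial>M2)"
    using int by (intro Bochner_Integration.integral_sum) auto
  also have "0 \<le> \<dots>"
    using Suc.IH[OF G_meas G_int] by (intro sum_nonneg) (simp add: split_beta')
  finally show ?case by simp
qed

text \<open>The law is assumed to have moments only up to order \<open>4 + 4 * \<tau>\<close>; the
  Gaussian weight makes every power integrable, as the full exponential series requires.\<close>

lemma gauss_moment_integrable: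
  assumes "0 < l"
  shows "integrable M (\<lambda>x. exp (- l * (vnorm d x)\<^sup>2) * vnorm d x ^ m)"
proof (rule integrable_const_bound)
  show "(\<lambda>x. exp (- l * (vnorm d x)\<^sup>2) * vnorm d x ^ m) \<in> borel_measurable M" using vnorm_meas by simp
  have "exp (- l * z\<^sup>2) * z ^ m \<le> 1 + fact m / l ^ m" if "0 \<le> z" for z :: real
  proof -
    define y where "y = l * z\<^sup>2"
    have y: "0 \<le> y" using assms by (simp add: y_def)
    have "y ^ m / fact m \<le> exp y"
    proof -
      have "summable (\<lambda>n. y ^ n / fact n)" using summable_exp_generic[of y] by (simp add: divide_inverse mult.commute)
      then have "(\<Sum>n\<in>{m}. y ^ n / fact n) \<le> (\<Sum>n. y ^ n / fact n)" using y by (intro sum_le_suminf) auto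
      then show ?thesis by (simp add: exp_def divide_inverse mult.commute)
    qed
    then have "exp (- y) * (y ^ m / fact m) \<le> exp (- y) * exp y" by (intro mult_left_mono) auto
    then have "exp (- y) * y ^ m \<le> fact m" by (simp add: exp_minus field_simps)
    then have "exp (- y) * (z ^ m)\<^sup>2 \<le> fact m / l ^ m"
      using assms by (simp add: y_def power_mult_distrib field_simps flip: power_mult)
    moreover have "z ^ m \<le> 1 + (z ^ m)\<^sup>2"
      using sum_squares_bound[of "z ^ m" 1] that by simp (smt (verit) zero_le_power)
    then have "exp (- y) * z ^ m \<le> exp (- y) * (1 + (z ^ m)\<^sup>2)" by (intro mult_left_mono) auto
    moreover have "exp (- y) \<le> 1" using y by simp
    ultimately have "exp (- y) * z ^ m \<le> 1 + fact m / l ^ m" unfolding distrib_left by linarith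
    then show ?thesis by (simp add: y_def)
  qed
  then show "AE x in M. norm (exp (- l * (vnorm d x)\<^sup>2) * vnorm d x ^ m) \<le> 1 + fact m / l ^ m"
    by (intro AE_I2) (simp add: abs_mult)
qed

text \<open>The Gaussian kernel of the distance factors into weights of \<open>x\<close> and of
  \<open>y\<close> times \<open>exp (2 * l * vinner d x y)\<close>. In the series of the last factor
  every term has nonnegative mean, and only the one with \<open>j = 1\<close> is kept.\<close>

lemma gauss_vinner_le:
  assumes l: "0 < l"
  shows "2 * l * (\<integral>(x, y). exp (- l * ((vnorm d x)\<^sup>2 + (vnorm d y)\<^sup>2)) * (vinner d x y)\<^sup>2 \<partial>M2)
    \<le> (\<integral>(x, y). exp (- l * (vdist d x y)\<^sup>2) * vinner d x y \<partial>M2)"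
proof -
  let ?MM = "M2"
  interpret MM: prob_space "?MM" by (rule prob_space_pair_self)
  define w where "w x = exp (- l * (vnorm d x)\<^sup>2)" for x
  define h where "h p = vinner d (fst p) (snd p)" for p
  define W where "W p = w (fst p) * w (snd p)" for p
  have w_meas: "w \<in> borel_measurable M" unfolding w_def using vnorm_meas by simp
  have h_meas: "h \<in> borel_measurable ?MM" unfolding h_def by (rule vinner_meas_comp[OF measurable_fst measurable_snd])
  have W_meas: "W \<in> borel_measurable ?MM"
    unfolding W_def
    by (intro borel_measurable_times measurable_compose[OF measurable_fst w_meas] measurable_compose[OF measurable_snd w_meas])
  have W_le: "0 \<le> W p" "W p * exp (2 * l * \<bar>h p\<bar>) \<le> 1" for p
  proof -
    show "0 \<le> W p" by (simp add: W_def w_def)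
    have "W p * exp (2 * l * \<bar>h p\<bar>) = exp (l * (2 * \<bar>h p\<bar> - ((vnorm d (fst p))\<^sup>2 + (vnorm d (snd p))\<^sup>2)))"
      by (simp add: W_def w_def algebra_simps flip: exp_add)
    also have "\<dots> \<le> exp 0"
      using two_abs_vinner_le[of d "fst p" "snd p"] l
      by (subst exp_le_cancel_iff) (simp add: h_def mult_nonneg_nonpos)
    finally show "W p * exp (2 * l * \<bar>h p\<bar>) \<le> 1" by simp
  qed
  have exp_partial: "(\<Sum>j<n. (2 * l * \<bar>h p\<bar>) ^ j / fact j) \<le> exp (2 * l * \<bar>h p\<bar>)" for n p
  proof -
    have "summable (\<lambda>j. (2 * l * \<bar>h p\<bar>) ^ j / fact j)"
      using summable_exp_generic[of "2 * l * \<bar>h p\<bar>"] by (simp add: divide_inverse mult.commute)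
    then have "(\<Sum>j<n. (2 * l * \<bar>h p\<bar>) ^ j / fact j) \<le> (\<Sum>j. (2 * l * \<bar>h p\<bar>) ^ j / fact j)"
      using l by (intro sum_le_suminf) auto
    then show ?thesis by (simp add: exp_def divide_inverse mult.commute)
  qed
  have "h = (\<lambda>(x, y). vinner d x y)" by (simp add: h_def fun_eq_iff)
  then have h_int: "integrable ?MM h" using vinner_integrable by simp
  define s where "s n p = W p * h p * (\<Sum>j<n. (2 * l * h p) ^ j / fact j)" for n p
  define f where "f p = W p * h p * exp (2 * l * h p)" for p
  have s_meas: "s n \<in> borel_measurable ?MM" for n unfolding s_def using W_meas h_meas by simp
  have s_bound: "norm (s n p) \<le> norm (h p)" for n p
  proof -
    have "\<bar>\<Sum>j<n. (2 * l * h p) ^ j / fact j\<bar> \<le> (\<Sum>j<n. (2 * l * \<bar>h p\<bar>) ^ j / fact j)"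
      using l by (intro order_trans[OF sum_abs]) (simp add: abs_mult power_abs power_mult_distrib)
    also have "\<dots> \<le> exp (2 * l * \<bar>h p\<bar>)" by (rule exp_partial)
    finally have "\<bar>h p\<bar> * (W p * \<bar>\<Sum>j<n. (2 * l * h p) ^ j / fact j\<bar>) \<le> \<bar>h p\<bar> * (W p * exp (2 * l * \<bar>h p\<bar>))"
      using W_le(1) by (intro mult_left_mono) auto
    also have "\<dots> \<le> \<bar>h p\<bar> * 1" using W_le(2) by (intro mult_left_mono) auto
    finally show ?thesis using W_le(1)[of p] by (simp add: s_def abs_mult mult_ac)
  qed
  \<comment> \<open>Dominated by \<open>\<bar>h p\<bar>\<close>: the partial sums stay below
    \<open>exp (2 * l * \<bar>h p\<bar>)\<close>, and the weight \<open>W p\<close> brings this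
    below 1, because twice the inner product is at most the sum of the squared norms.\<close>
  have lim: "(\<lambda>n. \<integral>p. s n p \<partial>?MM) \<longlonglongrightarrow> (\<integral>p. f p \<partial>?MM)"
  proof (rule integral_dominated_convergence[where w = "\<lambda>p. norm (h p)"])
    show "f \<in> borel_measurable ?MM" unfolding f_def using W_meas h_meas by simp
    have "(\<lambda>n. \<Sum>j<n. (2 * l * h p) ^ j / fact j) \<longlonglongrightarrow> exp (2 * l * h p)" for p
      using exp_converges[of "2 * l * h p"] unfolding sums_def by (simp add: divide_inverse mult.commute)
    then show "AE p in ?MM. (\<lambda>n. s n p) \<longlonglongrightarrow> f p"
      unfolding s_def f_def by (intro AE_I2 tendsto_mult_left)
  qed (use h_int s_bound s_meas in auto)
  define c where "c j = (\<integral>p. W p * h p ^ Suc j \<partial>?MM)" for j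
  have term_int: "integrable ?MM (\<lambda>p. W p * h p ^ Suc j)" for j
  proof (rule Bochner_Integration.integrable_bound[OF h_int[THEN integrable_mult_right, of "fact j / (2 * l) ^ j"]])
    show "(\<lambda>p. W p * h p ^ Suc j) \<in> borel_measurable ?MM" using W_meas h_meas by simp
    show "AE p in ?MM. norm (W p * h p ^ Suc j) \<le> norm (fact j / (2 * l) ^ j * h p)"
    proof (rule AE_I2)
      fix p
      have "(2 * l * \<bar>h p\<bar>) ^ j / fact j \<le> (\<Sum>i<Suc j. (2 * l * \<bar>h p\<bar>) ^ i / fact i)"
        using l by (simp add: sum_nonneg)
      also have "\<dots> \<le> exp (2 * l * \<bar>h p\<bar>)" by (rule exp_partial)
      finally have "W p * ((2 * l * \<bar>h p\<bar>) ^ j / fact j) \<le> W p * exp (2 * l * \<bar>h p\<bar>)"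
        using W_le(1) by (intro mult_left_mono)
      also have "\<dots> \<le> 1" by (rule W_le)
      finally have "W p * \<bar>h p\<bar> ^ j \<le> fact j / (2 * l) ^ j"
        using l by (simp add: power_mult_distrib field_simps)
      then have "(W p * \<bar>h p\<bar> ^ j) * \<bar>h p\<bar> \<le> fact j / (2 * l) ^ j * \<bar>h p\<bar>" by (intro mult_right_mono) auto
      then show "norm (W p * h p ^ Suc j) \<le> norm (fact j / (2 * l) ^ j * h p)"
        using W_le(1)[of p] l by (simp add: abs_mult power_abs mult_ac)
    qed
  qed
  have c_nonneg: "0 \<le> c j" for j
    using vinner_power_psd[OF w_meas, of "Suc j"] gauss_moment_integrable[OF l]
    by (simp add: c_def W_def h_def w_def split_beta')
  have s_eq: "s n p = (\<Sum>j<n. (2 * l) ^ j / fact j * (W p * h p ^ Suc j))" for n p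
    unfolding s_def sum_distrib_left by (intro sum.cong refl) (simp add: power_mult_distrib)
  have int_s: "(\<integral>p. s n p \<partial>?MM) = (\<Sum>j<n. (2 * l) ^ j / fact j * c j)" for n
    unfolding s_eq c_def using term_int by (simp add: Bochner_Integration.integral_sum)
  have "2 * l * c 1 \<le> (\<integral>p. s n p \<partial>?MM)" if "2 \<le> n" for n
  proof -
    have "(\<Sum>j\<in>{1}. (2 * l) ^ j / fact j * c j) \<le> (\<Sum>j<n. (2 * l) ^ j / fact j * c j)"
      using that l c_nonneg by (intro sum_mono2) auto
    then show ?thesis unfolding int_s by simp
  qed
  then have "2 * l * c 1 \<le> (\<integral>p. f p \<partial>?MM)"
    by (intro LIMSEQ_le_const[OF lim]) auto
  moreover have "f p = exp (- l * (vdist d (fst p) (snd p))\<^sup>2) * vinner d (fst p) (snd p)" for p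
  proof -
    have "W p * exp (2 * l * h p) = exp (- l * (vdist d (fst p) (snd p))\<^sup>2)"
      by (simp add: W_def w_def h_def vdist_square algebra_simps flip: exp_add)
    then show ?thesis by (simp add: f_def h_def mult_ac)
  qed
  moreover have "W p * h p ^ Suc 1 = exp (- l * ((vnorm d (fst p))\<^sup>2 + (vnorm d (snd p))\<^sup>2)) * (vinner d (fst p) (snd p))\<^sup>2" for p
    by (simp add: W_def w_def h_def power2_eq_square algebra_simps flip: exp_add)
  ultimately show ?thesis by (simp add: c_def split_beta' del: power_Suc)
qed

lemma dist_vinner_integrable: "integrable M2 (\<lambda>(x, y). vdist d x y * vinner d x y)"
proof (rule pair_bound_integrable)
  show "(\<lambda>(x, y). vdist d x y * vinner d x y) \<in> borel_measurable M2"
    using vdist_meas vinner_meas by (simp add: split_beta')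
  show "integrable M (\<lambda>x. vnorm d x + (vnorm d x)\<^sup>2)" "integrable M (\<lambda>x. vnorm d x + (vnorm d x)\<^sup>2)"
    using vnorm_power_integrable[of 1] vnorm_power_integrable[of 2] by auto
  fix x y
  define X Y where "X = vnorm d x" and "Y = vnorm d y"
  have XY: "0 \<le> X" "0 \<le> Y" by (auto simp: X_def Y_def)
  have "vdist d x y * \<bar>vinner d x y\<bar> \<le> (X + Y) * (X * Y)"
    unfolding X_def Y_def by (intro mult_mono vdist_le abs_vinner_le) auto
  also have "\<dots> \<le> (X + X\<^sup>2) * (Y + Y\<^sup>2)"
    using XY by (simp add: algebra_simps power2_eq_square)
  finally show "\<bar>case (x, y) of (x, y) \<Rightarrow> vdist d x y * vinner d x y\<bar> \<le> (vnorm d x + (vnorm d x)\<^sup>2) * (vnorm d y + (vnorm d y)\<^sup>2)"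
    by (simp add: X_def Y_def abs_mult)
qed

text \<open>The Gaussian bound with \<open>l = u^2\<close> is integrated over \<open>u\<close>. The
  inner product has mean zero, so the constant 1 in the norm kernel drops out. Every
  \<open>u\<close> contributes with the right sign; those with \<open>0 < u \<le> 1 / R\<close> are
  kept, since there the Gaussian weight is at least \<open>exp (- 1) \<ge> 1 / 4\<close> on the
  truncated set.\<close>

lemma neg_dist_vinner_ge:
  assumes R: "0 < R"
  shows "(\<integral>(x, y). (vinner d x y)\<^sup>2 * of_bool ((vnorm d x)\<^sup>2 + (vnorm d y)\<^sup>2 \<le> R\<^sup>2) \<partial>M2) / (2 * R)
    \<le> norm_const * - (\<integral>(x, y). vdist d x y * vinner d x y \<partial>M2)"
proof -
  let ?MM = "M2"
  interpret MM: prob_space "?MM" by (rule prob_space_pair_self)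
  interpret PL: pair_sigma_finite "?MM" lborel ..
  define h where "h p = vinner d (fst p) (snd p)" for p
  define a where "a p = vdist d (fst p) (snd p)" for p
  define s2 where "s2 p = (vnorm d (fst p))\<^sup>2 + (vnorm d (snd p))\<^sup>2" for p
  have h_meas: "h \<in> borel_measurable ?MM" unfolding h_def by (rule vinner_meas_comp[OF measurable_fst measurable_snd])
  have a_meas: "a \<in> borel_measurable ?MM" unfolding a_def by (rule vdist_meas_comp[OF measurable_fst measurable_snd])
  have s_meas: "s2 \<in> borel_measurable ?MM"
    unfolding s2_def by (intro borel_measurable_add borel_measurable_power vnorm_meas_comp measurable_fst measurable_snd)
  have a_nonneg: "0 \<le> a p" for p by (simp add: a_def)
  have ah_int: "integrable ?MM (\<lambda>p. a p * h p)"
    using dist_vinner_integrable by (simp add: a_def h_def split_beta')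
  have h_int: "integrable ?MM (\<lambda>p. h p)"
    using vinner_integrable by (simp add: h_def split_beta')
  have h2_int: "integrable ?MM (\<lambda>p. (h p)\<^sup>2)"
    using vinner_square_integrable by (simp add: h_def split_beta')
  define F where "F p u = norm_kernel (a p) u * h p" for p u
  have F_meas: "(\<lambda>(p, u). F p u) \<in> borel_measurable (?MM \<Otimes>\<^sub>M lborel)"
  proof -
    have "(\<lambda>q. (a (fst q), snd q)) \<in> ?MM \<Otimes>\<^sub>M lborel \<rightarrow>\<^sub>M borel \<Otimes>\<^sub>M borel"
      using measurable_compose[OF measurable_fst a_meas] by measurable
    from measurable_compose[OF this norm_kernel_meas]
    have 1: "(\<lambda>q. norm_kernel (a (fst q)) (snd q)) \<in> borel_measurable (?MM \<Otimes>\<^sub>M lborel)" by simp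
    have "(\<lambda>q. norm_kernel (a (fst q)) (snd q) * h (fst q)) \<in> borel_measurable (?MM \<Otimes>\<^sub>M lborel)"
      by (intro borel_measurable_times 1 measurable_compose[OF measurable_fst h_meas])
    then show ?thesis by (simp add: F_def split_beta')
  qed
  have F_int: "integrable (?MM \<Otimes>\<^sub>M lborel) (\<lambda>(p, u). F p u)"
  proof (rule PL.Fubini_integrable[OF F_meas])
    have "(\<integral>u. norm (F p u) \<partial>lborel) = norm_const * (a p * \<bar>h p\<bar>)" for p
      using integral_norm_kernel[OF a_nonneg] norm_kernel_nonneg by (simp add: F_def abs_mult)
    then show "integrable ?MM (\<lambda>p. \<integral>u. norm (case (p, u) of (p, u) \<Rightarrow> F p u) \<partial>lborel)"
      using integrable_abs[OF ah_int] a_nonneg by (simp add: abs_mult)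
    show "AE p in ?MM. integrable lborel (\<lambda>u. case (p, u) of (p, u) \<Rightarrow> F p u)"
      using integrable_norm_kernel by (intro AE_I2) (simp add: F_def)
  qed
  define Q where "Q = (\<integral>p. (h p)\<^sup>2 * of_bool (s2 p \<le> R\<^sup>2) \<partial>?MM)"
  have Q0: "0 \<le> Q" unfolding Q_def by (intro Bochner_Integration.integral_nonneg) simp
  have Q_int: "integrable ?MM (\<lambda>p. (h p)\<^sup>2 * of_bool (s2 p \<le> R\<^sup>2))"
  proof (rule Bochner_Integration.integrable_bound[OF h2_int])
    show "(\<lambda>p. (h p)\<^sup>2 * of_bool (s2 p \<le> R\<^sup>2)) \<in> borel_measurable ?MM"
      using h_meas s_meas by measurable
  qed (auto intro!: AE_I2)
  have slice: "(\<integral>p. F p u \<partial>?MM) \<le> indicator {0<..1 / R} u * - (Q / 2)" for u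
  proof (cases "u = 0")
    case True
    then show ?thesis by (simp add: F_def norm_kernel_def)
  next
    case False
    define E where "E p = exp (- u\<^sup>2 * (a p)\<^sup>2) * h p" for p
    have E_int: "integrable ?MM E"
    proof (rule Bochner_Integration.integrable_bound[OF h_int])
      show "E \<in> borel_measurable ?MM" unfolding E_def using a_meas h_meas by measurable
      have "exp (- u\<^sup>2 * (a p)\<^sup>2) * \<bar>h p\<bar> \<le> 1 * \<bar>h p\<bar>" for p by (intro mult_right_mono) auto
      then show "AE p in ?MM. norm (E p) \<le> norm (h p)" by (intro AE_I2) (simp add: E_def abs_mult)
    qed
    have "F p u = (h p - E p) / u\<^sup>2" for p
      by (simp add: F_def norm_kernel_def E_def algebra_simps diff_divide_distrib)
    then have "(\<integral>p. F p u \<partial>?MM) = (\<integral>p. (h p - E p) / u\<^sup>2 \<partial>?MM)" by presburger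
    also have "\<dots> = ((\<integral>p. h p \<partial>?MM) - (\<integral>p. E p \<partial>?MM)) / u\<^sup>2" using h_int E_int by simp
    also have "(\<integral>p. h p \<partial>?MM) = 0" using integral_pair_vinner by (simp add: h_def split_beta')
    finally have Fu: "(\<integral>p. F p u \<partial>?MM) = - (\<integral>p. E p \<partial>?MM) / u\<^sup>2" by simp
    have gauss: "2 * u\<^sup>2 * (\<integral>p. exp (- u\<^sup>2 * s2 p) * (h p)\<^sup>2 \<partial>?MM) \<le> (\<integral>p. E p \<partial>?MM)"
      using gauss_vinner_le[of "u\<^sup>2"] False by (simp add: E_def a_def h_def s2_def split_beta')
    have s2_nonneg: "0 \<le> s2 p" for p by (simp add: s2_def)
    have G_nonneg: "0 \<le> (\<integral>p. exp (- u\<^sup>2 * s2 p) * (h p)\<^sup>2 \<partial>?MM)"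
      by (intro Bochner_Integration.integral_nonneg) simp
    show ?thesis
    proof (cases "u \<in> {0<..1 / R}")
      case True
      have "Q / 4 \<le> (\<integral>p. exp (- u\<^sup>2 * s2 p) * (h p)\<^sup>2 \<partial>?MM)"
      proof -
        have "(\<integral>p. (h p)\<^sup>2 * of_bool (s2 p \<le> R\<^sup>2) / 4 \<partial>?MM) \<le> (\<integral>p. exp (- u\<^sup>2 * s2 p) * (h p)\<^sup>2 \<partial>?MM)"
        proof (rule integral_mono)
          show "integrable ?MM (\<lambda>p. (h p)\<^sup>2 * of_bool (s2 p \<le> R\<^sup>2) / 4)" using Q_int by simp
          show "integrable ?MM (\<lambda>p. exp (- u\<^sup>2 * s2 p) * (h p)\<^sup>2)"
          proof (rule Bochner_Integration.integrable_bound[OF h2_int])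
            show "(\<lambda>p. exp (- u\<^sup>2 * s2 p) * (h p)\<^sup>2) \<in> borel_measurable ?MM" using s_meas h_meas by measurable
            have "exp (- u\<^sup>2 * s2 p) * (h p)\<^sup>2 \<le> 1 * (h p)\<^sup>2" for p
              using s2_nonneg by (intro mult_right_mono) auto
            then show "AE p in ?MM. norm (exp (- u\<^sup>2 * s2 p) * (h p)\<^sup>2) \<le> norm ((h p)\<^sup>2)"
              by (intro AE_I2) (simp add: abs_mult)
          qed
          fix p
          have "1 / 4 \<le> exp (- u\<^sup>2 * s2 p)" if "s2 p \<le> R\<^sup>2"
          proof -
            have "u\<^sup>2 \<le> (1 / R)\<^sup>2" using True by (intro power_mono) auto
            then have "u\<^sup>2 * s2 p \<le> (1 / R)\<^sup>2 * R\<^sup>2" using that s2_nonneg by (intro mult_mono) auto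
            also have "\<dots> = 1" using R by (simp add: power_divide)
            finally have "exp (- 1) \<le> exp (- u\<^sup>2 * s2 p)" by simp
            moreover have "1 / 4 \<le> exp (- 1 :: real)"
              using exp_le by (simp add: exp_minus field_simps)
            ultimately show ?thesis by linarith
          qed
          then show "(h p)\<^sup>2 * of_bool (s2 p \<le> R\<^sup>2) / 4 \<le> exp (- u\<^sup>2 * s2 p) * (h p)\<^sup>2"
            using mult_right_mono[of "1 / 4" "exp (- u\<^sup>2 * s2 p)" "(h p)\<^sup>2"] by (cases "s2 p \<le> R\<^sup>2") auto
        qed
        then show ?thesis by (simp add: Q_def)
      qed
      then have "2 * u\<^sup>2 * (Q / 4) \<le> 2 * u\<^sup>2 * (\<integral>p. exp (- u\<^sup>2 * s2 p) * (h p)\<^sup>2 \<partial>?MM)"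
        by (intro mult_left_mono) auto
      also note gauss
      finally have "Q / 2 \<le> (\<integral>p. E p \<partial>?MM) / u\<^sup>2" using False by (simp add: field_simps)
      then show ?thesis using True unfolding Fu by simp
    next
      case nin: False
      have "0 \<le> (\<integral>p. E p \<partial>?MM)"
        using gauss G_nonneg by (meson mult_nonneg_nonneg order_trans zero_le_numeral zero_le_power2)
      then show ?thesis using nin unfolding Fu by simp
    qed
  qed
  have "norm_const * (\<integral>p. a p * h p \<partial>?MM) = (\<integral>p. (\<integral>u. F p u \<partial>lborel) \<partial>?MM)"
    using integral_norm_kernel[OF a_nonneg] by (simp add: F_def mult.assoc)
  also have "\<dots> = (\<integral>u. (\<integral>p. F p u \<partial>?MM) \<partial>lborel)"
    using PL.Fubini_integral[OF F_int] by simp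
  also have "\<dots> \<le> (\<integral>u. indicator {0<..1 / R} u * - (Q / 2) \<partial>lborel)"
  proof (rule integral_mono[OF _ _ slice])
    show "integrable lborel (\<lambda>u. \<integral>p. F p u \<partial>?MM)"
      using PL.integrable_snd[of "\<lambda>p u. F p u"] F_int by simp
    have "emeasure lborel {0<..1 / R} < \<infinity>" using R by simp
    then have "integrable lborel (\<lambda>u. indicator {0<..1 / R} u :: real)" by simp
    then show "integrable lborel (\<lambda>u. indicator {0<..1 / R} u * - (Q / 2))" by (rule integrable_mult_left)
  qed
  also have "\<dots> = - (Q / (2 * R))" using R by simp
  finally show ?thesis by (simp add: Q_def a_def h_def s2_def split_beta')
qed

end

lemma abs_sum4_powr_le:
  fixes a b c e r :: real
  assumes "0 \<le> r"
  shows "\<bar>a - b - c + e\<bar> powr r \<le> 4 powr r * (\<bar>a\<bar> powr r + \<bar>b\<bar> powr r + \<bar>c\<bar> powr r + \<bar>e\<bar> powr r)"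
proof -
  define m where "m = max (max \<bar>a\<bar> \<bar>b\<bar>) (max \<bar>c\<bar> \<bar>e\<bar>)"
  have "\<bar>a - b - c + e\<bar> powr r \<le> (4 * m) powr r"
    using assms by (intro powr_mono2) (auto simp: m_def)
  also have "\<dots> = 4 powr r * m powr r" by (rule powr_mult)
  also have "m powr r \<le> \<bar>a\<bar> powr r + \<bar>b\<bar> powr r + \<bar>c\<bar> powr r + \<bar>e\<bar> powr r"
  proof -
    have "m = \<bar>a\<bar> \<or> m = \<bar>b\<bar> \<or> m = \<bar>c\<bar> \<or> m = \<bar>e\<bar>" by (auto simp: m_def max_def)
    moreover have "0 \<le> \<bar>a\<bar> powr r" "0 \<le> \<bar>b\<bar> powr r" "0 \<le> \<bar>c\<bar> powr r" "0 \<le> \<bar>e\<bar> powr r" by auto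
    ultimately show ?thesis by (elim disjE; simp only:; linarith)
  qed
  finally show ?thesis by simp
qed

section \<open>Double centring\<close>

context prob_space
begin

definition double_center :: "('a \<Rightarrow> 'a \<Rightarrow> real) \<Rightarrow> 'a \<Rightarrow> 'a \<Rightarrow> real" where
  "double_center f x y = f x y - (\<integral>z. f x z \<partial>M) - (\<integral>z. f z y \<partial>M) + (\<integral>(x, y). f x y \<partial>M2)"

lemma abs_expectation_powr_le:
  fixes f :: "'a \<Rightarrow> real"
  assumes "1 \<le> r" "f \<in> borel_measurable M" "integrable M (\<lambda>x. \<bar>f x\<bar> powr r)"
  shows "\<bar>\<integral>x. f x \<partial>M\<bar> powr r \<le> (\<integral>x. \<bar>f x\<bar> powr r \<partial>M)"
proof -
  have "integrable M (\<lambda>x. \<bar>f x\<bar> powr 1)" using assms by (intro integrable_powr_le[of 1 r]) auto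
  then have int: "integrable M (\<lambda>x. \<bar>f x\<bar>)" by simp
  have "\<bar>\<integral>x. f x \<partial>M\<bar> \<le> (\<integral>x. \<bar>f x\<bar> \<partial>M)" by (rule integral_abs_bound)
  then have "\<bar>\<integral>x. f x \<partial>M\<bar> powr r \<le> (\<integral>x. \<bar>f x\<bar> \<partial>M) powr r"
    using assms by (intro powr_mono2) auto
  also have "\<dots> \<le> (\<integral>x. \<bar>f x\<bar> powr r \<partial>M)"
    using assms int by (intro powr_expectation_le) auto
  finally show ?thesis .
qed

lemma double_center_meas:
  assumes [measurable]: "(\<lambda>(x, y). f x y) \<in> borel_measurable M2"
  shows "(\<lambda>(x, y). double_center f x y) \<in> borel_measurable M2"
proof -
  have swap: "(\<lambda>(y, z). f z y) \<in> borel_measurable M2"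
    using measurable_compose[OF measurable_pair_swap' assms] by (simp add: split_beta')
  have 1: "(\<lambda>x. \<integral>z. f x z \<partial>M) \<in> borel_measurable M" by (rule borel_measurable_lebesgue_integral[OF assms])
  have 2: "(\<lambda>y. \<integral>z. f z y \<partial>M) \<in> borel_measurable M" by (rule borel_measurable_lebesgue_integral[OF swap])
  have 3: "(\<lambda>p. f (fst p) (snd p)) \<in> borel_measurable M2" using assms by (simp add: split_beta')
  show ?thesis
    unfolding double_center_def split_beta'
    by (intro borel_measurable_add borel_measurable_diff borel_measurable_const 3
        measurable_compose[OF measurable_fst 1] measurable_compose[OF measurable_snd 2])
qed

text \<open>By Jensen's inequality the two marginals and the grand mean have moments no larger than
  \<open>f\<close> itself; adding four terms costs the factor \<open>4 powr r\<close>.\<close>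

lemma
  fixes f :: "'a \<Rightarrow> 'a \<Rightarrow> real"
  assumes r: "1 \<le> r" and f: "(\<lambda>(x, y). f x y) \<in> borel_measurable M2"
    and int: "integrable M2 (\<lambda>(x, y). \<bar>f x y\<bar> powr r)"
  shows double_center_powr_integrable: "integrable M2 (\<lambda>(x, y). \<bar>double_center f x y\<bar> powr r)"
    and double_center_powr_le: "(\<integral>(x, y). \<bar>double_center f x y\<bar> powr r \<partial>M2)
      \<le> 4 powr r * (4 * (\<integral>(x, y). \<bar>f x y\<bar> powr r \<partial>M2))"
proof -
  interpret MM: prob_space "M2" by (rule prob_space_pair_self)
  interpret PP: pair_sigma_finite M M by (rule pair_sigma_finite_self)
  define F where "F = (\<integral>(x, y). \<bar>f x y\<bar> powr r \<partial>M2)"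
  have marginal: "integrable M (\<lambda>x. \<bar>\<integral>z. g x z \<partial>M\<bar> powr r) \<and> (\<integral>x. \<bar>\<integral>z. g x z \<partial>M\<bar> powr r \<partial>M) \<le> G"
    if g: "(\<lambda>(x, y). g x y) \<in> borel_measurable M2"
      and gi: "integrable M2 (\<lambda>(x, y). \<bar>g x y\<bar> powr r)"
      and G: "(\<integral>(x, y). \<bar>g x y\<bar> powr r \<partial>M2) = G" for g G
  proof -
    have A: "integrable M (\<lambda>x. \<integral>z. \<bar>g x z\<bar> powr r \<partial>M)" using PP.integrable_fst'[OF gi] by simp
    have le: "AE x in M. \<bar>\<integral>z. g x z \<partial>M\<bar> powr r \<le> (\<integral>z. \<bar>g x z\<bar> powr r \<partial>M)"
      using PP.AE_integrable_fst'[OF gi]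
    proof (rule AE_mp, intro AE_I2 impI)
      fix x assume "x \<in> space M" "integrable M (\<lambda>y. case (x, y) of (x, y) \<Rightarrow> \<bar>g x y\<bar> powr r)"
      then show "\<bar>\<integral>z. g x z \<partial>M\<bar> powr r \<le> (\<integral>z. \<bar>g x z\<bar> powr r \<partial>M)"
        using section_meas(1)[OF g] by (intro abs_expectation_powr_le r) auto
    qed
    have i: "integrable M (\<lambda>x. \<bar>\<integral>z. g x z \<partial>M\<bar> powr r)"
    proof (rule Bochner_Integration.integrable_bound[OF A])
      show "(\<lambda>x. \<bar>\<integral>z. g x z \<partial>M\<bar> powr r) \<in> borel_measurable M"
        using borel_measurable_lebesgue_integral[OF g] by simp
      show "AE x in M. norm (\<bar>\<integral>z. g x z \<partial>M\<bar> powr r) \<le> norm (\<integral>z. \<bar>g x z\<bar> powr r \<partial>M)"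
        using le by eventually_elim (simp add: abs_of_nonneg)
    qed
    have "(\<integral>x. \<bar>\<integral>z. g x z \<partial>M\<bar> powr r \<partial>M) \<le> (\<integral>x. (\<integral>z. \<bar>g x z\<bar> powr r \<partial>M) \<partial>M)"
      by (rule integral_mono_AE[OF i A le])
    then show ?thesis using i PP.integral_fst'[OF gi] G by simp
  qed
  have m1: "integrable M (\<lambda>x. \<bar>\<integral>z. f x z \<partial>M\<bar> powr r)" "(\<integral>x. \<bar>\<integral>z. f x z \<partial>M\<bar> powr r \<partial>M) \<le> F"
    using marginal[OF f int] by (auto simp: F_def)
  have m2: "integrable M (\<lambda>y. \<bar>\<integral>z. f z y \<partial>M\<bar> powr r)" "(\<integral>y. \<bar>\<integral>z. f z y \<partial>M\<bar> powr r \<partial>M) \<le> F"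
  proof -
    have "(\<lambda>(y, z). f z y) \<in> borel_measurable M2"
      using measurable_compose[OF measurable_pair_swap' f] by (simp add: split_beta')
    moreover have "integrable M2 (\<lambda>(y, z). \<bar>f z y\<bar> powr r)"
      using PP.integrable_product_swap[OF int] by (simp add: split_beta')
    moreover have "(\<integral>(y, z). \<bar>f z y\<bar> powr r \<partial>M2) = F"
      using PP.integral_product_swap[OF borel_measurable_integrable[OF int]] by (simp add: split_beta' F_def)
    ultimately show "integrable M (\<lambda>y. \<bar>\<integral>z. f z y \<partial>M\<bar> powr r)" "(\<integral>y. \<bar>\<integral>z. f z y \<partial>M\<bar> powr r \<partial>M) \<le> F"
      using marginal[of "\<lambda>y z. f z y" F] by auto
  qed
  have m0: "\<bar>\<integral>(x, y). f x y \<partial>M2\<bar> powr r \<le> F"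
    unfolding F_def using MM.abs_expectation_powr_le[OF r f] int by (simp add: split_beta')
  have one: "integrable M (\<lambda>_. 1 :: real)" by simp
  note p1 = integrable_pair_mult[OF PP.pair_sigma_finite_axioms m1(1) one]
    integral_pair_mult[OF PP.pair_sigma_finite_axioms m1(1) one]
  note p2 = integrable_pair_mult[OF PP.pair_sigma_finite_axioms one m2(1)]
    integral_pair_mult[OF PP.pair_sigma_finite_axioms one m2(1)]
  define U where "U p = 4 powr r * (\<bar>f (fst p) (snd p)\<bar> powr r + \<bar>\<integral>z. f (fst p) z \<partial>M\<bar> powr r
      + \<bar>\<integral>z. f z (snd p) \<partial>M\<bar> powr r + \<bar>\<integral>(x, y). f x y \<partial>M2\<bar> powr r)" for p
  have i1: "integrable M2 (\<lambda>p. \<bar>f (fst p) (snd p)\<bar> powr r)" using int by (simp add: split_beta')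
  have i2: "integrable M2 (\<lambda>p. \<bar>\<integral>z. f (fst p) z \<partial>M\<bar> powr r)" using p1(1) by (simp add: split_beta')
  have i3: "integrable M2 (\<lambda>p. \<bar>\<integral>z. f z (snd p) \<partial>M\<bar> powr r)" using p2(1) by (simp add: split_beta')
  have i4: "integrable M2 (\<lambda>p. \<bar>\<integral>(x, y). f x y \<partial>M2\<bar> powr r)" by (rule MM.integrable_const)
  have U_int: "integrable M2 U"
    unfolding U_def by (intro integrable_mult_right Bochner_Integration.integrable_add i1 i2 i3 i4)
  have U_le: "\<bar>double_center f (fst p) (snd p)\<bar> powr r \<le> U p" for p
    unfolding U_def double_center_def using r by (intro abs_sum4_powr_le) simp
  have dc_meas: "(\<lambda>p. double_center f (fst p) (snd p)) \<in> borel_measurable M2"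
    using double_center_meas[OF f] by (simp add: split_beta')
  have dc_int: "integrable M2 (\<lambda>p. \<bar>double_center f (fst p) (snd p)\<bar> powr r)"
  proof (rule Bochner_Integration.integrable_bound[OF U_int])
    show "(\<lambda>p. \<bar>double_center f (fst p) (snd p)\<bar> powr r) \<in> borel_measurable M2"
      using dc_meas by simp
    show "AE p in M2. norm (\<bar>double_center f (fst p) (snd p)\<bar> powr r) \<le> norm (U p)"
      using U_le by (intro AE_I2) (auto intro: order_trans[OF _ abs_ge_self])
  qed
  then show "integrable M2 (\<lambda>(x, y). \<bar>double_center f x y\<bar> powr r)" by (simp add: split_beta')
  have "(\<integral>p. \<bar>double_center f (fst p) (snd p)\<bar> powr r \<partial>M2) \<le> (\<integral>p. U p \<partial>M2)"
    by (rule integral_mono[OF dc_int U_int U_le])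
  also have "\<dots> = 4 powr r * ((\<integral>p. \<bar>f (fst p) (snd p)\<bar> powr r \<partial>M2) + (\<integral>p. \<bar>\<integral>z. f (fst p) z \<partial>M\<bar> powr r \<partial>M2)
      + (\<integral>p. \<bar>\<integral>z. f z (snd p) \<partial>M\<bar> powr r \<partial>M2) + \<bar>\<integral>(x, y). f x y \<partial>M2\<bar> powr r)"
    unfolding U_def using i1 i2 i3 i4 by (simp add: MM.prob_space)
  also have "\<dots> \<le> 4 powr r * (F + F + F + F)"
  proof (intro mult_left_mono add_mono m0)
    show "(\<integral>p. \<bar>f (fst p) (snd p)\<bar> powr r \<partial>M2) \<le> F" by (simp add: F_def split_beta')
    show "(\<integral>p. \<bar>\<integral>z. f (fst p) z \<partial>M\<bar> powr r \<partial>M2) \<le> F"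
      using p1(2) m1(2) by (simp add: split_beta' prob_space)
    show "(\<integral>p. \<bar>\<integral>z. f z (snd p) \<partial>M\<bar> powr r \<partial>M2) \<le> F"
      using p2(2) m2(2) by (simp add: split_beta' prob_space)
  qed simp
  finally show "(\<integral>(x, y). \<bar>double_center f x y\<bar> powr r \<partial>M2)
      \<le> 4 powr r * (4 * (\<integral>(x, y). \<bar>f x y\<bar> powr r \<partial>M2))"
    by (simp add: F_def split_beta')
qed

end

section \<open>The doubly centred distance as a degenerate kernel\<close>

context random_vector
begin

definition "avgdist x = (\<integral>z. vdist d x z \<partial>M)"
definition "avgdist0 = (\<integral>(x, y). vdist d x y \<partial>M2)"

abbreviation "DK \<equiv> double_center (vdist d)"

lemma vnorm_integrable: "integrable M (vnorm d)"
  using vnorm_power_integrable[of 1] by simp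

lemma vnorm_square_integrable: "integrable M (\<lambda>x. (vnorm d x)\<^sup>2)"
  using vnorm_power_integrable[of 2] by simp

lemma vdist_section_integrable:
  assumes "x \<in> space M"
  shows "integrable M (\<lambda>z. vdist d x z)"
proof (rule Bochner_Integration.integrable_bound)
  show "integrable M (\<lambda>z. vnorm d x + vnorm d z)" using vnorm_integrable by simp
  show "(\<lambda>z. vdist d x z) \<in> borel_measurable M" by (rule section_meas(1)[OF vdist_meas assms])
  show "AE z in M. norm (vdist d x z) \<le> norm (vnorm d x + vnorm d z)" using vdist_le by (intro AE_I2) simp
qed

lemma vdist_integrable: "integrable M2 (\<lambda>(x, y). vdist d x y)"
proof (rule pair_bound_integrable[OF vdist_meas])
  show "integrable M (\<lambda>x. 1 + vnorm d x)" "integrable M (\<lambda>x. 1 + vnorm d x)" using vnorm_integrable by auto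
  fix x y
  have "vdist d x y \<le> (1 + vnorm d x) * (1 + vnorm d y)"
    using vdist_le[of d x y] mult_nonneg_nonneg[OF vnorm_nonneg[of d x] vnorm_nonneg[of d y]]
    unfolding ring_distribs by linarith
  then show "\<bar>case (x, y) of (x, y) \<Rightarrow> vdist d x y\<bar> \<le> (1 + vnorm d x) * (1 + vnorm d y)" by simp
qed

lemma avgdist_integrable: "integrable M avgdist"
  using pair_sigma_finite.integrable_fst'[OF pair_sigma_finite_self vdist_integrable] unfolding avgdist_def[abs_def] by simp

lemma integral_avgdist: "(\<integral>x. avgdist x \<partial>M) = avgdist0"
  using pair_sigma_finite.integral_fst'[OF pair_sigma_finite_self vdist_integrable] by (simp add: avgdist_def avgdist0_def)

lemma DK_eq: "DK x y = vdist d x y - avgdist x - avgdist y + avgdist0"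
  unfolding double_center_def avgdist_def avgdist0_def by (simp add: vdist_commute[of d _ y])

lemma avgdist_bounds:
  assumes "x \<in> space M"
  shows "0 \<le> avgdist x" "avgdist x \<le> vnorm d x + (\<integral>z. vnorm d z \<partial>M)"
proof -
  show "0 \<le> avgdist x" unfolding avgdist_def by (intro Bochner_Integration.integral_nonneg) simp
  have "avgdist x \<le> (\<integral>z. vnorm d x + vnorm d z \<partial>M)"
    unfolding avgdist_def using vnorm_integrable
    by (intro integral_mono vdist_section_integrable assms vdist_le) simp
  then show "avgdist x \<le> vnorm d x + (\<integral>z. vnorm d z \<partial>M)" using vnorm_integrable by (simp add: prob_space)
qed

lemma vdist_powr_integrable: "integrable M2 (\<lambda>(x, y). \<bar>vdist d x y - c\<bar> powr (2 + 2 * \<tau>))"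
proof (rule pair_bound_integrable)
  let ?r = "2 + 2 * \<tau>"
  show "(\<lambda>(x, y). \<bar>vdist d x y - c\<bar> powr ?r) \<in> borel_measurable M2"
    using vdist_meas by (simp add: split_beta')
  show "integrable M (\<lambda>x. 4 powr ?r * (1 + (\<bar>c\<bar> powr ?r + vnorm d x powr ?r)))"
    "integrable M (\<lambda>x. 1 + vnorm d x powr ?r)"
    using vnorm_powr_integrable[of ?r] \<tau> by auto
  fix x y
  define X Y C where "X = vnorm d x powr ?r" and "Y = vnorm d y powr ?r" and "C = \<bar>c\<bar> powr ?r"
  have nn: "0 \<le> X" "0 \<le> Y" "0 \<le> C" by (auto simp: X_def Y_def C_def)
  have "\<bar>vdist d x y - c\<bar> \<le> \<bar>vnorm d x - - vnorm d y - - \<bar>c\<bar> + 0\<bar>"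
  proof -
    have "\<bar>vdist d x y - c\<bar> \<le> vnorm d x + vnorm d y + \<bar>c\<bar>"
      using vdist_le[of d x y] vdist_nonneg[of d x y] by linarith
    then show ?thesis by simp
  qed
  then have "\<bar>vdist d x y - c\<bar> powr ?r \<le> \<bar>vnorm d x - - vnorm d y - - \<bar>c\<bar> + 0\<bar> powr ?r"
    using \<tau> by (intro powr_mono2) auto
  also have "\<dots> \<le> 4 powr ?r * (X + Y + C + 0)"
    using abs_sum4_powr_le[of ?r "vnorm d x" "- vnorm d y" "- \<bar>c\<bar>" 0] \<tau> by (simp add: X_def Y_def C_def)
  also have "\<dots> \<le> 4 powr ?r * ((1 + (C + X)) * (1 + Y))"
    using nn by (intro mult_left_mono) (auto simp: algebra_simps)
  finally show "\<bar>case (x, y) of (x, y) \<Rightarrow> \<bar>vdist d x y - c\<bar> powr ?r\<bar> \<le> 4 powr ?r * (1 + (\<bar>c\<bar> powr ?r + vnorm d x powr ?r)) * (1 + vnorm d y powr ?r)"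
    by (simp add: X_def Y_def C_def)
qed

text \<open>Double centring removes constants, so distances may be measured from any reference
  value. The square root of \<open>B\<close> is used in high dimension, where distances concentrate
  there, and 0 in bounded dimension.\<close>

lemma DK_minus_const:
  assumes "x \<in> space M" "y \<in> space M"
  shows "DK x y = double_center (\<lambda>x y. vdist d x y - c) x y"
proof -
  interpret MM: prob_space "M2" by (rule prob_space_pair_self)
  have "integrable M (\<lambda>z. vdist d z y)"
    using vdist_section_integrable[OF assms(2)] by (simp add: vdist_commute[of d _ y])
  then show ?thesis
    unfolding double_center_def using vdist_section_integrable[OF assms(1)] vdist_integrable
    by (simp add: prob_space MM.prob_space split_beta')
qed

lemma DK_meas: "(\<lambda>(x, y). DK x y) \<in> borel_measurable M2"
  by (rule double_center_meas[OF vdist_meas])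

lemma four_powr_le: "4 powr (2 + 2 * \<tau>) * (4 * z) \<le> 256 * z" if "0 \<le> z" for z :: real
proof -
  have "4 powr (2 + 2 * \<tau>) \<le> (4::real) powr 3" using \<tau> by (intro powr_mono) auto
  then have "4 powr (2 + 2 * \<tau>) \<le> (64::real)" by simp
  then have "4 powr (2 + 2 * \<tau>) * (4 * z) \<le> 64 * (4 * z)" using that by (intro mult_right_mono) auto
  then show ?thesis by simp
qed

lemma
  shows DK_powr_integrable: "integrable M2 (\<lambda>(x, y). \<bar>DK x y\<bar> powr (2 + 2 * \<tau>))"
    and DK_powr_le: "(\<integral>(x, y). \<bar>DK x y\<bar> powr (2 + 2 * \<tau>) \<partial>M2)
      \<le> 256 * (\<integral>(x, y). \<bar>vdist d x y - c\<bar> powr (2 + 2 * \<tau>) \<partial>M2)"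
proof -
  let ?r = "2 + 2 * \<tau>"
  have r: "1 \<le> ?r" using \<tau> by simp
  show "integrable M2 (\<lambda>(x, y). \<bar>DK x y\<bar> powr ?r)"
    using double_center_powr_integrable[OF r vdist_meas] vdist_powr_integrable[of 0] by simp
  have m: "(\<lambda>(x, y). vdist d x y - c) \<in> borel_measurable M2" using vdist_meas by (simp add: split_beta')
  have "(\<integral>(x, y). \<bar>DK x y\<bar> powr ?r \<partial>M2)
    = (\<integral>(x, y). \<bar>double_center (\<lambda>x y. vdist d x y - c) x y\<bar> powr ?r \<partial>M2)"
    by (intro Bochner_Integration.integral_cong refl) (auto simp: space_pair_measure DK_minus_const[of _ _ c])
  also have "\<dots> \<le> 4 powr ?r * (4 * (\<integral>(x, y). \<bar>vdist d x y - c\<bar> powr ?r \<partial>M2))"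
    by (rule double_center_powr_le[OF r m vdist_powr_integrable])
  also have "\<dots> \<le> 256 * (\<integral>(x, y). \<bar>vdist d x y - c\<bar> powr ?r \<partial>M2)"
    by (intro four_powr_le Bochner_Integration.integral_nonneg) auto
  finally show "(\<integral>(x, y). \<bar>DK x y\<bar> powr ?r \<partial>M2)
      \<le> 256 * (\<integral>(x, y). \<bar>vdist d x y - c\<bar> powr ?r \<partial>M2)" .
qed

lemma DK_section: 
  assumes x: "x \<in> space M"
  shows "integrable M (\<lambda>y. (DK x y)\<^sup>2)"
proof (rule Bochner_Integration.integrable_bound)
  define c where "c = 2 * vnorm d x + 2 * (\<integral>z. vnorm d z \<partial>M) + avgdist0"
  have m0: "0 \<le> avgdist0" unfolding avgdist0_def by (intro Bochner_Integration.integral_nonneg) auto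
  have E0: "0 \<le> (\<integral>z. vnorm d z \<partial>M)" by (intro Bochner_Integration.integral_nonneg) simp
  show "integrable M (\<lambda>y. 2 * c\<^sup>2 + 8 * (vnorm d y)\<^sup>2)" using vnorm_square_integrable by simp
  show "(\<lambda>y. (DK x y)\<^sup>2) \<in> borel_measurable M" using section_meas(1)[OF DK_meas x] by simp
  show "AE y in M. norm ((DK x y)\<^sup>2) \<le> norm (2 * c\<^sup>2 + 8 * (vnorm d y)\<^sup>2)"
  proof (rule AE_I2)
    fix y assume y: "y \<in> space M"
    have "\<bar>DK x y\<bar> \<le> c + 2 * vnorm d y"
      unfolding DK_eq c_def using avgdist_bounds[OF x] avgdist_bounds[OF y] m0 E0 vdist_le[of d x y] vdist_nonneg[of d x y]
        vnorm_nonneg[of d x] vnorm_nonneg[of d y] unfolding abs_le_iff by linarith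
    then have "\<bar>DK x y\<bar>\<^sup>2 \<le> (c + 2 * vnorm d y)\<^sup>2" by (intro power_mono) auto
    also have "\<dots> \<le> 2 * c\<^sup>2 + 8 * (vnorm d y)\<^sup>2"
      using sum_squares_bound[of c "2 * vnorm d y"] by (simp add: power2_sum)
    finally show "norm ((DK x y)\<^sup>2) \<le> norm (2 * c\<^sup>2 + 8 * (vnorm d y)\<^sup>2)" by simp
  qed
qed

text \<open>The grand mean is divided evenly between the two variables.\<close>

sublocale D: centered_kernel M DK "vdist d" "\<lambda>x. avgdist x - avgdist0 / 2"
proof
  interpret MM: prob_space "M2" by (rule prob_space_pair_self)
  show "(\<lambda>(x, y). DK x y) \<in> borel_measurable M2" by (rule DK_meas)
  show "integrable M2 (\<lambda>(x, y). (DK x y)\<^sup>2)"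
    using MM.integrable_square_of_powr[of "2 + 2 * \<tau>" "\<lambda>(x, y). DK x y"] DK_meas DK_powr_integrable \<tau>
    by (simp add: split_beta')
  fix x assume x: "x \<in> space M"
  show "integrable M (\<lambda>y. (DK x y)\<^sup>2)" by (rule DK_section[OF x])
  show "(\<integral>y. DK x y \<partial>M) = 0"
    unfolding DK_eq using vdist_section_integrable[OF x] avgdist_integrable
    by (simp add: prob_space integral_avgdist) (simp add: avgdist_def)
  fix y
  show "DK x y = DK y x" by (simp add: DK_eq vdist_commute[of d x y])
  show "vdist d x y = DK x y + (avgdist x - avgdist0 / 2) + (avgdist y - avgdist0 / 2)" by (simp add: DK_eq)
qed simp

end

text \<open>Of the four factors \<open>\<bar>a - b\<bar>\<close>, a power
  \<open>2 - 2 * \<tau>\<close> is enlarged to \<open>a + b\<close>. A power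
  \<open>2 + 2 * \<tau>\<close> of \<open>a + b\<close> then combines with the remaining factors to
  the difference of squares, which leaves \<open>a + b\<close> to the power
  \<open>- 4 * \<tau>\<close>.\<close>

lemma abs_diff_power4_le:
  fixes a b \<tau> :: real
  assumes "0 \<le> a" "0 < b" "0 < \<tau>" "\<tau> \<le> 1"
  shows "(a - b) ^ 4 \<le> \<bar>a\<^sup>2 - b\<^sup>2\<bar> powr (2 + 2 * \<tau>) * b powr (- 4 * \<tau>)"
proof (cases "a = b")
  case False
  have pos: "0 < a + b" "0 < \<bar>a - b\<bar>" using assms False by auto
  have "(a - b) ^ 4 = \<bar>a - b\<bar> ^ 4" by simp
  also have "\<dots> = \<bar>a - b\<bar> powr ((2 + 2 * \<tau>) + (2 - 2 * \<tau>))"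
    using pos powr_realpow[of "\<bar>a - b\<bar>" 4] by simp
  also have "\<dots> = \<bar>a - b\<bar> powr (2 + 2 * \<tau>) * \<bar>a - b\<bar> powr (2 - 2 * \<tau>)" by (rule powr_add)
  also have "\<dots> \<le> \<bar>a - b\<bar> powr (2 + 2 * \<tau>) * (a + b) powr (2 - 2 * \<tau>)"
    using assms by (intro mult_left_mono powr_mono2) auto
  also have "(a + b) powr (2 - 2 * \<tau>) = (a + b) powr (2 + 2 * \<tau>) * (a + b) powr (- 4 * \<tau>)"
    by (simp flip: powr_add)
  also have "\<bar>a - b\<bar> powr (2 + 2 * \<tau>) * ((a + b) powr (2 + 2 * \<tau>) * (a + b) powr (- 4 * \<tau>))
    = (\<bar>a - b\<bar> * (a + b)) powr (2 + 2 * \<tau>) * (a + b) powr (- 4 * \<tau>)"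
    using pos by (simp add: powr_mult)
  also have "\<bar>a - b\<bar> * (a + b) = \<bar>a\<^sup>2 - b\<^sup>2\<bar>"
  proof -
    have "a\<^sup>2 - b\<^sup>2 = (a - b) * (a + b)" by (simp add: power2_eq_square algebra_simps)
    then show ?thesis using pos by (simp add: abs_mult)
  qed
  also have "\<bar>a\<^sup>2 - b\<^sup>2\<bar> powr (2 + 2 * \<tau>) * (a + b) powr (- 4 * \<tau>) \<le> \<bar>a\<^sup>2 - b\<^sup>2\<bar> powr (2 + 2 * \<tau>) * b powr (- 4 * \<tau>)"
    using assms by (intro mult_left_mono powr_mono2') auto
  finally show ?thesis .
qed simp

section \<open>High dimension: comparison with the inner product kernel\<close>

locale nondegenerate_vector = random_vector +
  assumes nondegenerate: "0 < (\<integral>(x, y). (vinner d x y)\<^sup>2 \<partial>M2)"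
begin

text \<open>The population quantities as integrals over the law and its product with itself, so that
  they depend on the law alone; \<open>population_transfer\<close> identifies them with the
  quantities defined from independent copies.\<close>

definition "msq = (\<integral>x. (vnorm d x)\<^sup>2 \<partial>M)"
definition "hsq = (\<integral>(x, y). (vinner d x y)\<^sup>2 \<partial>M2)"
definition "LA = (\<integral>x. \<bar>(vnorm d x)\<^sup>2 - msq\<bar> powr (2 + 2 * \<tau>) \<partial>M)"
definition "LH = (\<integral>(x, y). \<bar>vinner d x y\<bar> powr (2 + 2 * \<tau>) \<partial>M2)"
definition "L = LA + LH"
definition "B = 2 * msq"

lemma hsq_pos: "0 < hsq" using nondegenerate by (simp add: hsq_def)

lemma msq_nonneg: "0 \<le> msq" unfolding msq_def by (intro Bochner_Integration.integral_nonneg) simp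

lemma hsq_le: "hsq \<le> msq\<^sup>2"
proof -
  have i: "integrable M2 (\<lambda>(x, y). (vnorm d x)\<^sup>2 * (vnorm d y)\<^sup>2)"
    by (rule integrable_pair_mult[OF pair_sigma_finite_self vnorm_square_integrable vnorm_square_integrable])
  have "(vinner d x y)\<^sup>2 \<le> (vnorm d x)\<^sup>2 * (vnorm d y)\<^sup>2" for x y
    using power_mono[OF abs_vinner_le[of d x y], of 2] by (simp add: power_mult_distrib)
  then have "hsq \<le> (\<integral>(x, y). (vnorm d x)\<^sup>2 * (vnorm d y)\<^sup>2 \<partial>M2)"
    unfolding hsq_def using i vinner_square_integrable by (intro integral_mono) auto
  also have "\<dots> = msq\<^sup>2"
    using integral_pair_mult[OF pair_sigma_finite_self vnorm_square_integrable vnorm_square_integrable]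
    by (simp add: msq_def power2_eq_square)
  finally show ?thesis .
qed

lemma msq_pos: "0 < msq"
proof -
  have "0 < msq\<^sup>2" using hsq_pos hsq_le by (rule less_le_trans)
  then show ?thesis using msq_nonneg by (simp add: zero_less_power2)
qed

lemma B_pos: "0 < B" using msq_pos by (simp add: B_def)

lemma LA_integrable: "integrable M (\<lambda>x. \<bar>(vnorm d x)\<^sup>2 - msq\<bar> powr (2 + 2 * \<tau>))"
proof -
  have "\<bar>(vnorm d x)\<^sup>2\<bar> powr (2 + 2 * \<tau>) = vnorm d x powr (4 + 4 * \<tau>)" for x
    by (simp add: powr_power2_eq algebra_simps)
  then have "integrable M (\<lambda>x. \<bar>(vnorm d x)\<^sup>2\<bar> powr (2 + 2 * \<tau>))" using moment by simp
  then have "integrable M (\<lambda>x. \<bar>(vnorm d x)\<^sup>2 + - msq\<bar> powr (2 + 2 * \<tau>))"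
    using \<tau> vnorm_meas by (intro integrable_powr_add) auto
  then show ?thesis by simp
qed

lemma LA_nonneg: "0 \<le> LA" and LH_nonneg: "0 \<le> LH"
  unfolding LA_def LH_def by (auto intro!: Bochner_Integration.integral_nonneg)

lemma L_ge: "hsq powr (1 + \<tau>) \<le> L"
proof -
  interpret MM: prob_space "M2" by (rule prob_space_pair_self)
  have "((vinner d x y)\<^sup>2) powr (1 + \<tau>) = \<bar>vinner d x y\<bar> powr (2 + 2 * \<tau>)" for x y
    by (simp add: powr_power2_eq)
  then have "hsq powr (1 + \<tau>) \<le> LH"
    unfolding hsq_def LH_def
    using MM.powr_expectation_le[of "1 + \<tau>" "\<lambda>(x, y). (vinner d x y)\<^sup>2"] vinner_square_integrable vinner_powr_integrable \<tau>
    by (simp add: split_beta')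
  then show ?thesis using LA_nonneg by (simp add: L_def)
qed

lemma L_pos: "0 < L"
proof -
  have "0 < hsq powr (1 + \<tau>)" using hsq_pos by simp
  then show ?thesis using L_ge by (rule less_le_trans)
qed

lemma sqdist_eq: "(vdist d x y)\<^sup>2 - B = ((vnorm d x)\<^sup>2 - msq) + (((vnorm d y)\<^sup>2 - msq) + - 2 * vinner d x y)"
  by (simp add: vdist_square B_def)

text \<open>The squared distance deviates from its mean \<open>B\<close> by two norm deviations and
  twice the inner product. Splitting off one term at a time costs a factor 8 each, so the norms
  receive \<open>8 + 64\<close> and the inner product \<open>512\<close>.\<close>

lemma
  shows sqdist_powr_integrable: "integrable M2 (\<lambda>(x, y). \<bar>(vdist d x y)\<^sup>2 - B\<bar> powr (2 + 2 * \<tau>))"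
    and sqdist_powr_le: "(\<integral>(x, y). \<bar>(vdist d x y)\<^sup>2 - B\<bar> powr (2 + 2 * \<tau>) \<partial>M2) \<le> 600 * L"
proof -
  let ?r = "2 + 2 * \<tau>"
  have r2: "2 powr ?r \<le> 8" using \<tau> powr_mono[of ?r 3 "2::real"] by simp
  define U where "U p = 8 * \<bar>(vnorm d (fst p))\<^sup>2 - msq\<bar> powr ?r + (64 * \<bar>(vnorm d (snd p))\<^sup>2 - msq\<bar> powr ?r
    + 512 * \<bar>vinner d (fst p) (snd p)\<bar> powr ?r)" for p
  have one: "integrable M (\<lambda>_. 1 :: real)" by simp
  note p1 = integrable_pair_mult[OF pair_sigma_finite_self LA_integrable one]
    integral_pair_mult[OF pair_sigma_finite_self LA_integrable one]
  note p2 = integrable_pair_mult[OF pair_sigma_finite_self one LA_integrable]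
    integral_pair_mult[OF pair_sigma_finite_self one LA_integrable]
  have i1: "integrable M2 (\<lambda>p. \<bar>(vnorm d (fst p))\<^sup>2 - msq\<bar> powr ?r)" "(\<integral>p. \<bar>(vnorm d (fst p))\<^sup>2 - msq\<bar> powr ?r \<partial>M2) = LA"
    using p1 by (simp_all add: split_beta' LA_def prob_space)
  have i2: "integrable M2 (\<lambda>p. \<bar>(vnorm d (snd p))\<^sup>2 - msq\<bar> powr ?r)" "(\<integral>p. \<bar>(vnorm d (snd p))\<^sup>2 - msq\<bar> powr ?r \<partial>M2) = LA"
    using p2 by (simp_all add: split_beta' LA_def prob_space)
  have i3: "integrable M2 (\<lambda>p. \<bar>vinner d (fst p) (snd p)\<bar> powr ?r)" "(\<integral>p. \<bar>vinner d (fst p) (snd p)\<bar> powr ?r \<partial>M2) = LH"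
    using vinner_powr_integrable by (simp_all add: split_beta' LH_def)
  have U_int: "integrable M2 U" unfolding U_def using i1 i2 i3 by simp
  have add2: "\<bar>u + v\<bar> powr ?r \<le> 8 * (\<bar>u\<bar> powr ?r + \<bar>v\<bar> powr ?r)" for u v :: real
    using abs_add_powr_le_sum[of ?r u v] \<tau> mult_right_mono[OF r2, of "\<bar>u\<bar> powr ?r + \<bar>v\<bar> powr ?r"] by simp
  have le: "\<bar>(vdist d (fst p) (snd p))\<^sup>2 - B\<bar> powr ?r \<le> U p" for p
  proof -
    define u v h where "u = (vnorm d (fst p))\<^sup>2 - msq" and "v = (vnorm d (snd p))\<^sup>2 - msq" and "h = vinner d (fst p) (snd p)"
    have "\<bar>- 2 * h\<bar> powr ?r = 2 powr ?r * \<bar>h\<bar> powr ?r" by (simp add: abs_mult powr_mult)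
    also have "\<dots> \<le> 8 * \<bar>h\<bar> powr ?r" using r2 by (intro mult_right_mono) auto
    finally have 1: "\<bar>- 2 * h\<bar> powr ?r \<le> 8 * \<bar>h\<bar> powr ?r" .
    have "\<bar>u + (v + - 2 * h)\<bar> powr ?r \<le> 8 * (\<bar>u\<bar> powr ?r + \<bar>v + - 2 * h\<bar> powr ?r)" by (rule add2)
    also have "\<dots> \<le> 8 * (\<bar>u\<bar> powr ?r + 8 * (\<bar>v\<bar> powr ?r + \<bar>- 2 * h\<bar> powr ?r))"
      by (intro mult_left_mono add_left_mono add2) auto
    also have "\<dots> \<le> 8 * (\<bar>u\<bar> powr ?r + 8 * (\<bar>v\<bar> powr ?r + 8 * \<bar>h\<bar> powr ?r))"
      by (intro mult_left_mono add_left_mono 1) auto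
    finally have "\<bar>u + (v + - 2 * h)\<bar> powr ?r \<le> 8 * (\<bar>u\<bar> powr ?r + 8 * (\<bar>v\<bar> powr ?r + 8 * \<bar>h\<bar> powr ?r))" .
    then show ?thesis unfolding sqdist_eq U_def u_def v_def h_def by simp
  qed
  have meas: "(\<lambda>p. \<bar>(vdist d (fst p) (snd p))\<^sup>2 - B\<bar> powr ?r) \<in> borel_measurable M2"
    using vdist_meas by (simp add: split_beta')
  have int: "integrable M2 (\<lambda>p. \<bar>(vdist d (fst p) (snd p))\<^sup>2 - B\<bar> powr ?r)"
    by (rule Bochner_Integration.integrable_bound[OF U_int meas])
       (use le in \<open>auto intro!: AE_I2 intro: order_trans[OF _ abs_ge_self]\<close>)
  then show "integrable M2 (\<lambda>(x, y). \<bar>(vdist d x y)\<^sup>2 - B\<bar> powr ?r)" by (simp add: split_beta')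
  have "(\<integral>p. \<bar>(vdist d (fst p) (snd p))\<^sup>2 - B\<bar> powr ?r \<partial>M2) \<le> (\<integral>p. U p \<partial>M2)"
    by (rule integral_mono[OF int U_int le])
  also have "\<dots> = 72 * LA + 512 * LH" unfolding U_def using i1 i2 i3 by simp
  also have "\<dots> \<le> 600 * L" using LA_nonneg LH_nonneg by (simp add: L_def)
  finally show "(\<integral>(x, y). \<bar>(vdist d x y)\<^sup>2 - B\<bar> powr ?r \<partial>M2) \<le> 600 * L" by (simp add: split_beta')
qed

text \<open>Around \<open>b = sqrt B\<close> one has
  \<open>\<bar>a - b\<bar> * b \<le> \<bar>a^2 - b^2\<bar>\<close>, because
  \<open>a + b \<ge> b\<close>. The constant is \<open>256 * 600\<close>.\<close>

lemma DK_moment_le: "D.moment_K (2 + 2 * \<tau>) \<le> 153600 * B powr (- (1 + \<tau>)) * L"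
proof -
  let ?r = "2 + 2 * \<tau>"
  define b where "b = sqrt B"
  have b: "0 < b" "b\<^sup>2 = B" using B_pos by (auto simp: b_def)
  have b_pow: "b powr (- ?r) = B powr (- (1 + \<tau>))"
    using powr_power2_eq[of b "- (1 + \<tau>)"] b by (simp add: algebra_simps)
  have pw: "\<bar>vdist d x y - b\<bar> powr ?r \<le> b powr (- ?r) * \<bar>(vdist d x y)\<^sup>2 - B\<bar> powr ?r" for x y
  proof -
    define a where "a = vdist d x y"
    have a: "0 \<le> a" by (simp add: a_def)
    have "a\<^sup>2 - B = (a - b) * (a + b)" unfolding b(2)[symmetric] by (simp add: power2_eq_square algebra_simps)
    then have "\<bar>a\<^sup>2 - B\<bar> = \<bar>a - b\<bar> * (a + b)" using a b by (simp add: abs_mult)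
    moreover have "\<bar>a - b\<bar> * b \<le> \<bar>a - b\<bar> * (a + b)" using a by (intro mult_left_mono) auto
    ultimately have "(\<bar>a - b\<bar> * b) powr ?r \<le> \<bar>a\<^sup>2 - B\<bar> powr ?r" using b \<tau> by (intro powr_mono2) auto
    then have "b powr (- ?r) * (\<bar>a - b\<bar> powr ?r * b powr ?r) \<le> b powr (- ?r) * \<bar>a\<^sup>2 - B\<bar> powr ?r"
      using b by (intro mult_left_mono) (auto simp: powr_mult)
    moreover have "b powr (- ?r) * b powr ?r = 1" using b by (simp flip: powr_add)
    ultimately show ?thesis by (simp add: a_def mult.left_commute[of "b powr _"])
  qed
  have "D.moment_K ?r \<le> 256 * (\<integral>(x, y). \<bar>vdist d x y - b\<bar> powr ?r \<partial>M2)"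
    unfolding D.moment_K_def by (rule DK_powr_le)
  also have "\<dots> \<le> 256 * (\<integral>(x, y). b powr (- ?r) * \<bar>(vdist d x y)\<^sup>2 - B\<bar> powr ?r \<partial>M2)"
    using pw vdist_powr_integrable[of b] sqdist_powr_integrable
    by (intro mult_left_mono integral_mono) (auto simp: split_beta')
  also have "\<dots> = 256 * (B powr (- (1 + \<tau>)) * (\<integral>(x, y). \<bar>(vdist d x y)\<^sup>2 - B\<bar> powr ?r \<partial>M2))"
    unfolding b_pow by (simp add: split_beta')
  also have "\<dots> \<le> 256 * (B powr (- (1 + \<tau>)) * (600 * L))"
    using sqdist_powr_le by (intro mult_left_mono) auto
  finally show ?thesis by (simp add: mult_ac)
qed

text \<open>The exact error in \<open>a = b / 2 + a^2 / (2 * b) + rest\<close> with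
  \<open>b = sqrt B\<close>, that is, of linearising the square root at the mean squared
  distance.\<close>

definition "rest x y = - ((vdist d x y - sqrt B)\<^sup>2) / (2 * sqrt B)"

lemma rest_meas: "(\<lambda>(x, y). rest x y) \<in> borel_measurable M2"
  unfolding rest_def using vdist_meas by (simp add: split_beta')

text \<open>The square of \<open>rest\<close> is a fourth power of the deviation of the distance,
  whereas only moments of order \<open>2 + 2 * \<tau>\<close> of the squared distance are at hand.
  \<open>abs_diff_power4_le\<close> bridges the gap and produces the factor
  \<open>B powr (- 2 * \<tau>)\<close> that enters \<open>E\<close>.\<close>

lemma
  shows rest_square_integrable: "integrable M2 (\<lambda>(x, y). (rest x y)\<^sup>2)"
    and rest_square_le: "(\<integral>(x, y). (rest x y)\<^sup>2 \<partial>M2) \<le> 150 * (B powr (- 2 * \<tau>) / B * L)"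
proof -
  let ?r = "2 + 2 * \<tau>"
  define b where "b = sqrt B"
  have b: "0 < b" "b\<^sup>2 = B" using B_pos by (auto simp: b_def)
  have b_pow: "b powr (- 4 * \<tau>) = B powr (- 2 * \<tau>)"
    using powr_power2_eq[of b "- 2 * \<tau>"] b by (simp add: algebra_simps)
  define c where "c = B powr (- 2 * \<tau>) / (4 * B)"
  have c: "0 \<le> c" using B_pos by (simp add: c_def)
  have pw: "(rest x y)\<^sup>2 \<le> c * \<bar>(vdist d x y)\<^sup>2 - B\<bar> powr ?r" for x y
  proof -
    have "(rest x y)\<^sup>2 = (vdist d x y - b) ^ 4 / (4 * B)"
      using b B_pos by (simp add: rest_def b_def[symmetric] power_divide power_mult_distrib flip: power_mult)
    also have "\<dots> \<le> (\<bar>(vdist d x y)\<^sup>2 - b\<^sup>2\<bar> powr ?r * b powr (- 4 * \<tau>)) / (4 * B)"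
      using \<tau> b B_pos by (intro divide_right_mono abs_diff_power4_le) auto
    also have "\<dots> = c * \<bar>(vdist d x y)\<^sup>2 - B\<bar> powr ?r"
      unfolding b(2) b_pow by (simp add: c_def)
    finally show ?thesis .
  qed
  have U: "integrable M2 (\<lambda>(x, y). c * \<bar>(vdist d x y)\<^sup>2 - B\<bar> powr ?r)"
    using sqdist_powr_integrable by (simp add: split_beta')
  show int: "integrable M2 (\<lambda>(x, y). (rest x y)\<^sup>2)"
  proof (rule Bochner_Integration.integrable_bound[OF U])
    show "(\<lambda>(x, y). (rest x y)\<^sup>2) \<in> borel_measurable M2" using rest_meas by (simp add: split_beta')
    show "AE p in M2. norm (case p of (x, y) \<Rightarrow> (rest x y)\<^sup>2) \<le> norm (case p of (x, y) \<Rightarrow> c * \<bar>(vdist d x y)\<^sup>2 - B\<bar> powr ?r)"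
      using pw c by (intro AE_I2) (auto simp: split_beta' abs_mult)
  qed
  have "(\<integral>(x, y). (rest x y)\<^sup>2 \<partial>M2) \<le> (\<integral>(x, y). c * \<bar>(vdist d x y)\<^sup>2 - B\<bar> powr ?r \<partial>M2)"
    using pw by (intro integral_mono int U) auto
  also have "\<dots> = c * (\<integral>(x, y). \<bar>(vdist d x y)\<^sup>2 - B\<bar> powr ?r \<partial>M2)" by (simp add: split_beta')
  also have "\<dots> \<le> c * (600 * L)" using sqdist_powr_le c by (intro mult_left_mono)
  finally show "(\<integral>(x, y). (rest x y)\<^sup>2 \<partial>M2) \<le> 150 * (B powr (- 2 * \<tau>) / B * L)"
    by (simp add: c_def mult_ac)
qed

lemma vdist_square_section:
  assumes "x \<in> space M"
  shows "integrable M (\<lambda>y. (vdist d x y)\<^sup>2)" "(\<integral>y. (vdist d x y)\<^sup>2 \<partial>M) = (vnorm d x)\<^sup>2 + msq"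
proof -
  have h: "integrable M (\<lambda>y. vinner d x y)"
    unfolding vinner_def using coord_integrable by (intro Bochner_Integration.integrable_sum) auto
  show "integrable M (\<lambda>y. (vdist d x y)\<^sup>2)" "(\<integral>y. (vdist d x y)\<^sup>2 \<partial>M) = (vnorm d x)\<^sup>2 + msq"
    unfolding vdist_square using h vnorm_square_integrable
    by (simp_all add: integral_vinner msq_def prob_space)
qed

text \<open>Double centring removes constants and functions of one variable, so the squared distance
  over \<open>2 * sqrt B\<close> keeps its cross term only.\<close>

lemma DK_decomp:
  assumes xy: "x \<in> space M" "y \<in> space M"
  shows "DK x y = - vinner d x y / sqrt B + double_center rest x y"
proof -
  interpret MM: prob_space "M2" by (rule prob_space_pair_self)
  define b where "b = sqrt B"
  have b: "0 < b" "b\<^sup>2 = B" using B_pos by (auto simp: b_def)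
  have rest_eq: "rest u v = vdist d u v - b / 2 - (vdist d u v)\<^sup>2 / (2 * b)" for u v
    using b(1) by (simp add: rest_def b_def[symmetric] field_simps power2_eq_square)
  have sec: "(\<integral>v. rest u v \<partial>M) = avgdist u - b / 2 - ((vnorm d u)\<^sup>2 + msq) / (2 * b)" if "u \<in> space M" for u
    unfolding rest_eq using vdist_section_integrable[OF that] vdist_square_section[OF that]
    by (simp add: prob_space avgdist_def)
  have sec': "(\<integral>v. rest v u \<partial>M) = avgdist u - b / 2 - ((vnorm d u)\<^sup>2 + msq) / (2 * b)" if "u \<in> space M" for u
    using sec[OF that] by (simp add: rest_def vdist_commute[of d _ u])
  have rest_int: "integrable M2 (\<lambda>(x, y). rest x y)"
    using MM.integrable_of_square[OF rest_meas] rest_square_integrable by (simp add: split_beta')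
  have "(\<integral>(x, y). rest x y \<partial>M2) = (\<integral>u. (\<integral>v. rest u v \<partial>M) \<partial>M)"
    using pair_sigma_finite.integral_fst'[OF pair_sigma_finite_self rest_int] by simp
  also have "\<dots> = (\<integral>u. avgdist u - b / 2 - ((vnorm d u)\<^sup>2 + msq) / (2 * b) \<partial>M)"
    by (intro Bochner_Integration.integral_cong refl sec)
  also have "\<dots> = avgdist0 - b / 2 - (msq + msq) / (2 * b)"
    using avgdist_integrable vnorm_square_integrable by (simp add: prob_space integral_avgdist) (simp add: msq_def)
  finally have all: "(\<integral>(x, y). rest x y \<partial>M2) = avgdist0 - b / 2 - (msq + msq) / (2 * b)" .
  have "vdist d x y - b / 2 - ((vnorm d x)\<^sup>2 + (vnorm d y)\<^sup>2 - 2 * vinner d x y) / (2 * b)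
      - (avgdist x - b / 2 - ((vnorm d x)\<^sup>2 + msq) / (2 * b)) - (avgdist y - b / 2 - ((vnorm d y)\<^sup>2 + msq) / (2 * b))
      + (avgdist0 - b / 2 - (msq + msq) / (2 * b))
    = vdist d x y - avgdist x - avgdist y + avgdist0 + vinner d x y / b"
    using b(1) by (simp add: field_simps)
  moreover have "double_center rest x y = rest x y - (avgdist x - b / 2 - ((vnorm d x)\<^sup>2 + msq) / (2 * b))
      - (avgdist y - b / 2 - ((vnorm d y)\<^sup>2 + msq) / (2 * b)) + (avgdist0 - b / 2 - (msq + msq) / (2 * b))"
    unfolding double_center_def[of rest] sec[OF xy(1)] sec'[OF xy(2)] all ..
  ultimately show ?thesis
    unfolding rest_eq vdist_square DK_eq b_def[symmetric] by simp
qed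

text \<open>As the vectors are centred, a function of one variable integrates to zero against the
  inner product. So distance and centred kernel correlate equally with it, and Cauchy-Schwarz turns
  the Gaussian lower bound into one for the variance of the kernel.\<close>

lemma variance_ge:
  assumes R: "0 < R"
  shows "(\<integral>(x, y). (vinner d x y)\<^sup>2 * of_bool ((vnorm d x)\<^sup>2 + (vnorm d y)\<^sup>2 \<le> R\<^sup>2) \<partial>M2)
    \<le> 2 * norm_const * R * (sqrt D.variance_K * sqrt hsq)"
proof -
  interpret MM: prob_space "M2" by (rule prob_space_pair_self)
  interpret PP: pair_sigma_finite M M by (rule pair_sigma_finite_self)
  define h where "h p = vinner d (fst p) (snd p)" for p
  have h_meas: "h \<in> borel_measurable M2" unfolding h_def by (rule vinner_meas_comp[OF measurable_fst measurable_snd])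
  have K_meas: "(\<lambda>p. DK (fst p) (snd p)) \<in> borel_measurable M2" using DK_meas by (simp add: split_beta')
  have h2: "integrable M2 (\<lambda>p. (h p)\<^sup>2)" using vinner_square_integrable by (simp add: h_def split_beta')
  have K2: "integrable M2 (\<lambda>p. (DK (fst p) (snd p))\<^sup>2)" using D.K_square by (simp add: split_beta')
  define \<alpha> where "\<alpha> x = avgdist x - avgdist0 / 2" for x
  have \<alpha>_meas: "\<alpha> \<in> borel_measurable M" unfolding \<alpha>_def using avgdist_integrable by simp
  define c where "c = (\<integral>z. vnorm d z \<partial>M) + \<bar>avgdist0\<bar>"
  have \<alpha>_le: "\<bar>\<alpha> x\<bar> \<le> vnorm d x + c" if "x \<in> space M" for x
    using avgdist_bounds[OF that] by (simp add: \<alpha>_def c_def)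
  have zero: "(\<integral>p. \<alpha> (fst p) * h p \<partial>M2) = 0" and i: "integrable M2 (\<lambda>p. \<alpha> (fst p) * h p)"
  proof -
    have \<alpha>X: "integrable M (\<lambda>x. \<bar>\<alpha> x\<bar> * vnorm d x)"
    proof (rule Bochner_Integration.integrable_bound)
      show "integrable M (\<lambda>x. (vnorm d x)\<^sup>2 + c * vnorm d x)" using vnorm_square_integrable vnorm_integrable by simp
      show "(\<lambda>x. \<bar>\<alpha> x\<bar> * vnorm d x) \<in> borel_measurable M" using \<alpha>_meas vnorm_meas by simp
      show "AE x in M. norm (\<bar>\<alpha> x\<bar> * vnorm d x) \<le> norm ((vnorm d x)\<^sup>2 + c * vnorm d x)"
      proof (rule AE_I2)
        fix x assume "x \<in> space M"
        from mult_right_mono[OF \<alpha>_le[OF this] vnorm_nonneg[of d x]]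
        have "\<bar>\<alpha> x\<bar> * vnorm d x \<le> (vnorm d x)\<^sup>2 + c * vnorm d x" by (simp add: power2_eq_square distrib_right)
        then show "norm (\<bar>\<alpha> x\<bar> * vnorm d x) \<le> norm ((vnorm d x)\<^sup>2 + c * vnorm d x)" by (simp add: abs_mult)
      qed
    qed
    have *: "integrable M2 (\<lambda>(x, y). \<alpha> x * vinner d x y)"
    proof (rule pair_bound_integrable[OF _ \<alpha>X vnorm_integrable])
      show "(\<lambda>(x, y). \<alpha> x * vinner d x y) \<in> borel_measurable M2"
        unfolding split_beta' by (intro borel_measurable_times measurable_compose[OF measurable_fst \<alpha>_meas] vinner_meas_comp measurable_fst measurable_snd)
      show "\<bar>case (x, y) of (x, y) \<Rightarrow> \<alpha> x * vinner d x y\<bar> \<le> \<bar>\<alpha> x\<bar> * vnorm d x * vnorm d y" for x y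
        using mult_left_mono[OF abs_vinner_le[of d x y], of "\<bar>\<alpha> x\<bar>"] by (simp add: abs_mult mult.assoc)
    qed
    then show "integrable M2 (\<lambda>p. \<alpha> (fst p) * h p)" by (simp add: h_def split_beta')
    show "(\<integral>p. \<alpha> (fst p) * h p \<partial>M2) = 0"
      using PP.integral_fst'[OF *] by (simp add: integral_vinner h_def split_beta')
  qed
  have i': "integrable M2 (\<lambda>p. \<alpha> (snd p) * h p)"
    using PP.integrable_product_swap[OF i] by (simp add: h_def vinner_commute split_beta')
  have zero': "(\<integral>p. \<alpha> (snd p) * h p \<partial>M2) = 0"
    using PP.integral_product_swap[OF borel_measurable_integrable[OF i]] zero
    by (simp add: h_def vinner_commute split_beta')
  have Kh: "integrable M2 (\<lambda>p. DK (fst p) (snd p) * h p)"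
    by (rule integrable_mult_of_squares[OF K_meas h_meas K2 h2])
  have "(\<integral>p. vdist d (fst p) (snd p) * h p \<partial>M2)
    = (\<integral>p. DK (fst p) (snd p) * h p + \<alpha> (fst p) * h p + \<alpha> (snd p) * h p \<partial>M2)"
    by (intro Bochner_Integration.integral_cong refl) (simp add: DK_eq \<alpha>_def algebra_simps)
  also have "\<dots> = (\<integral>p. DK (fst p) (snd p) * h p \<partial>M2)"
    using Kh i i' zero zero' by simp
  finally have eq: "(\<integral>p. vdist d (fst p) (snd p) * h p \<partial>M2) = (\<integral>p. DK (fst p) (snd p) * h p \<partial>M2)" .
  have "(\<integral>p. DK (fst p) (snd p) * h p \<partial>M2)\<^sup>2 \<le> D.variance_K * hsq"
    using integral_Cauchy_Schwarz[OF K_meas h_meas K2 h2] by (simp add: D.variance_K_def hsq_def h_def split_beta')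
  then have "\<bar>\<integral>p. DK (fst p) (snd p) * h p \<partial>M2\<bar> \<le> sqrt D.variance_K * sqrt hsq"
    unfolding real_sqrt_mult[symmetric] by (intro real_le_rsqrt) simp
  then have "- (\<integral>p. vdist d (fst p) (snd p) * h p \<partial>M2) \<le> sqrt D.variance_K * sqrt hsq" unfolding eq by linarith
  then have "norm_const * - (\<integral>p. vdist d (fst p) (snd p) * h p \<partial>M2) \<le> norm_const * (sqrt D.variance_K * sqrt hsq)"
    using norm_const_nonneg by (intro mult_left_mono)
  with neg_dist_vinner_ge[OF R] have "(\<integral>(x, y). (vinner d x y)\<^sup>2 * of_bool ((vnorm d x)\<^sup>2 + (vnorm d y)\<^sup>2 \<le> R\<^sup>2) \<partial>M2) / (2 * R)
    \<le> norm_const * (sqrt D.variance_K * sqrt hsq)"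
    by (simp add: h_def split_beta')
  then show ?thesis using R by (simp add: field_simps)
qed

lemma variance_ge':
  assumes R: "0 < R"
    and half: "hsq / 2 \<le> (\<integral>(x, y). (vinner d x y)\<^sup>2 * of_bool ((vnorm d x)\<^sup>2 + (vnorm d y)\<^sup>2 \<le> R\<^sup>2) \<partial>M2)"
  shows "hsq \<le> 16 * norm_const\<^sup>2 * R\<^sup>2 * D.variance_K"
proof -
  have v: "0 \<le> D.variance_K" unfolding D.variance_K_def by (intro Bochner_Integration.integral_nonneg) auto
  have hh: "hsq = sqrt hsq * sqrt hsq" using hsq_pos by simp
  have "sqrt hsq * sqrt hsq \<le> (4 * norm_const * R * sqrt D.variance_K) * sqrt hsq"
    using order_trans[OF half variance_ge[OF R]] hh by (simp add: mult_ac)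
  then have "sqrt hsq \<le> 4 * norm_const * R * sqrt D.variance_K"
    by (rule mult_right_le_imp_le) (use hsq_pos in simp)
  then have "(sqrt hsq)\<^sup>2 \<le> (4 * norm_const * R * sqrt D.variance_K)\<^sup>2" using hsq_pos by (intro power_mono) auto
  then show ?thesis using hsq_pos v by (simp add: power_mult_distrib)
qed

lemma D_variance_nonneg: "0 \<le> D.variance_K"
  unfolding D.variance_K_def by (intro Bochner_Integration.integral_nonneg) auto

text \<open>\<open>U\<close> majorises the squared inner product outside the truncated set, so at
  least half of \<open>hsq\<close> is left inside. The two regimes of the dimension differ in the
  choice of \<open>R\<close> and \<open>U\<close> only.\<close>

lemma variance_ge_of_tail:
  assumes R: "0 < R" and U: "integrable M2 U" "(\<integral>p. U p \<partial>M2) \<le> hsq / 2"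
    and pw: "\<And>x y. (vinner d x y)\<^sup>2 \<le> (vinner d x y)\<^sup>2 * of_bool ((vnorm d x)\<^sup>2 + (vnorm d y)\<^sup>2 \<le> R\<^sup>2) + U (x, y)"
  shows "hsq \<le> 16 * norm_const\<^sup>2 * R\<^sup>2 * D.variance_K"
proof (rule variance_ge'[OF R])
  let ?I = "\<lambda>p. (vinner d (fst p) (snd p))\<^sup>2 * of_bool ((vnorm d (fst p))\<^sup>2 + (vnorm d (snd p))\<^sup>2 \<le> R\<^sup>2)"
  have h2: "integrable M2 (\<lambda>p. (vinner d (fst p) (snd p))\<^sup>2)"
    using vinner_square_integrable by (simp add: split_beta')
  have n: "(\<lambda>p. (vnorm d (fst p))\<^sup>2 + (vnorm d (snd p))\<^sup>2) \<in> borel_measurable M2"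
    by (intro borel_measurable_add borel_measurable_power vnorm_meas_comp measurable_fst measurable_snd)
  have "of_bool (z \<le> R\<^sup>2) = (indicator {..R\<^sup>2} z :: real)" for z by (simp add: indicator_def)
  then have "(\<lambda>p. of_bool ((vnorm d (fst p))\<^sup>2 + (vnorm d (snd p))\<^sup>2 \<le> R\<^sup>2) :: real) \<in> borel_measurable M2"
    using measurable_compose[OF n borel_measurable_indicator[of "{..R\<^sup>2}"]] by simp
  then have I_meas: "?I \<in> borel_measurable M2"
    using borel_measurable_integrable[OF h2] by (intro borel_measurable_times)
  have I: "integrable M2 ?I"
    by (rule Bochner_Integration.integrable_bound[OF h2 I_meas]) (auto intro!: AE_I2)
  have "hsq \<le> (\<integral>p. ?I p + U p \<partial>M2)"
    unfolding hsq_def split_beta'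
  proof (intro integral_mono h2 Bochner_Integration.integrable_add I U(1))
    show "(vinner d (fst p) (snd p))\<^sup>2 \<le> ?I p + U p" for p using pw[of "fst p" "snd p"] by simp
  qed
  also have "\<dots> = (\<integral>p. ?I p \<partial>M2) + (\<integral>p. U p \<partial>M2)"
    by (rule Bochner_Integration.integral_add[OF I U(1)])
  finally show "hsq / 2 \<le> (\<integral>(x, y). (vinner d x y)\<^sup>2 * of_bool ((vnorm d x)\<^sup>2 + (vnorm d y)\<^sup>2 \<le> R\<^sup>2) \<partial>M2)"
    unfolding split_beta' using U(2) by linarith
qed

text \<open>The truncation is at \<open>R = 2 * sqrt B\<close>. Beyond it some squared norm deviates
  from \<open>msq\<close> by at least \<open>B\<close>. An inner product of size at most
  \<open>B\<close> is then bounded by the moment of this deviation, a larger one by its own moment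
  of order \<open>2 + 2 * \<tau>\<close>; both conversions cost
  \<open>B powr (- 2 * \<tau>)\<close>.\<close>

lemma variance_ge_B:
  assumes small: "4 * (B powr (- 2 * \<tau>) * L) \<le> hsq"
  shows "hsq \<le> 64 * norm_const\<^sup>2 * B * D.variance_K"
proof -
  let ?r = "2 + 2 * \<tau>"
  define b where "b = B powr (- 2 * \<tau>)"
  have b: "0 \<le> b" by (simp add: b_def)
  define U where "U p = b * (\<bar>vinner d (fst p) (snd p)\<bar> powr ?r + \<bar>(vnorm d (fst p))\<^sup>2 - msq\<bar> powr ?r * 1
    + 1 * \<bar>(vnorm d (snd p))\<^sup>2 - msq\<bar> powr ?r)" for p
  have one: "integrable M (\<lambda>_. 1 :: real)" by simp
  note p1 = integrable_pair_mult[OF pair_sigma_finite_self LA_integrable one]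
    integral_pair_mult[OF pair_sigma_finite_self LA_integrable one]
  note p2 = integrable_pair_mult[OF pair_sigma_finite_self one LA_integrable]
    integral_pair_mult[OF pair_sigma_finite_self one LA_integrable]
  have U_int: "integrable M2 U" and U_eq: "(\<integral>p. U p \<partial>M2) = b * (LH + LA + LA)"
    unfolding U_def using p1 p2 vinner_powr_integrable by (simp_all add: split_beta' LA_def LH_def prob_space)
  have Bb: "B\<^sup>2 = b * B powr ?r"
  proof -
    have "b * B powr ?r = B powr 2" unfolding b_def by (simp flip: powr_add)
    then show ?thesis using B_pos by (simp add: powr_numeral)
  qed
  have "hsq \<le> 16 * norm_const\<^sup>2 * (2 * sqrt B)\<^sup>2 * D.variance_K"
  proof (rule variance_ge_of_tail[OF _ U_int])
    show "0 < 2 * sqrt B" using B_pos by simp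
    have "b * (LH + LA + LA) \<le> b * (2 * L)"
      using b LA_nonneg LH_nonneg by (intro mult_left_mono) (auto simp: L_def)
    then show "(\<integral>p. U p \<partial>M2) \<le> hsq / 2" using small unfolding U_eq by (simp add: b_def)
    fix x y
    define h u v where "h = \<bar>vinner d x y\<bar>" and "u = (vnorm d x)\<^sup>2" and "v = (vnorm d y)\<^sup>2"
    have Uxy: "U (x, y) = b * (h powr ?r + \<bar>u - msq\<bar> powr ?r + \<bar>v - msq\<bar> powr ?r)"
      by (simp add: U_def h_def u_def v_def)
    have U_nonneg: "0 \<le> U (x, y)" unfolding Uxy using b by simp
    have "h\<^sup>2 \<le> U (x, y)" if "\<not> u + v \<le> 4 * B"
    proof (cases "h \<le> B")
      case True
      \<comment> \<open>Otherwise \<open>u + v < 2 * (msq + B) = 3 * B\<close>.\<close>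
      have "B \<le> \<bar>u - msq\<bar> \<or> B \<le> \<bar>v - msq\<bar>" using that B_pos unfolding B_def by linarith
      then have "B powr ?r \<le> \<bar>u - msq\<bar> powr ?r \<or> B powr ?r \<le> \<bar>v - msq\<bar> powr ?r"
        using B_pos \<tau> by (meson less_imp_le powr_mono2 add_nonneg_nonneg mult_nonneg_nonneg zero_le_numeral)
      then have "B powr ?r \<le> h powr ?r + \<bar>u - msq\<bar> powr ?r + \<bar>v - msq\<bar> powr ?r"
        using powr_ge_zero[of h ?r] powr_ge_zero[of "\<bar>u - msq\<bar>" ?r] powr_ge_zero[of "\<bar>v - msq\<bar>" ?r] by linarith
      then have "B\<^sup>2 \<le> U (x, y)" unfolding Bb Uxy using b by (intro mult_left_mono)
      moreover have "h\<^sup>2 \<le> B\<^sup>2" using True by (intro power_mono) (auto simp: h_def)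
      ultimately show ?thesis by linarith
    next
      case False
      have "h\<^sup>2 = h powr (- 2 * \<tau>) * h powr ?r"
        using False B_pos by (simp add: powr_numeral flip: powr_add)
      also have "\<dots> \<le> b * h powr ?r"
        unfolding b_def using False B_pos \<tau> by (intro mult_right_mono powr_mono2') auto
      also have "\<dots> \<le> U (x, y)" unfolding Uxy using b by (intro mult_left_mono) auto
      finally show ?thesis .
    qed
    moreover have "(vinner d x y)\<^sup>2 = h\<^sup>2" by (simp add: h_def)
    moreover have "(2 * sqrt B)\<^sup>2 = 4 * B" using B_pos by (simp add: power_mult_distrib)
    ultimately show "(vinner d x y)\<^sup>2 \<le> (vinner d x y)\<^sup>2 * of_bool ((vnorm d x)\<^sup>2 + (vnorm d y)\<^sup>2 \<le> (2 * sqrt B)\<^sup>2) + U (x, y)"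
      using U_nonneg by (cases "u + v \<le> 4 * B") (auto simp: u_def v_def)
  qed
  then show ?thesis using B_pos by (simp add: power_mult_distrib mult.assoc)
qed

lemma variance_pos_of_ge:
  assumes "hsq \<le> c * D.variance_K"
  shows "0 < D.variance_K"
proof (rule ccontr)
  assume "\<not> 0 < D.variance_K"
  then have "D.variance_K = 0" using D_variance_nonneg by simp
  then show False using assms hsq_pos by simp
qed

lemma moment_ratio_le_of_ge:
  assumes ge: "hsq \<le> c * D.variance_K" and c: "0 \<le> c" and A: "D.moment_K (2 + 2 * \<tau>) * c powr (1 + \<tau>) \<le> A"
  shows "D.moment_K (2 + 2 * \<tau>) / D.variance_K powr (1 + \<tau>) \<le> A / hsq powr (1 + \<tau>)"
proof -
  have V: "0 < D.variance_K powr (1 + \<tau>)" using variance_pos_of_ge[OF ge] by simp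
  have H: "0 < hsq powr (1 + \<tau>)" using hsq_pos by simp
  have "hsq powr (1 + \<tau>) \<le> (c * D.variance_K) powr (1 + \<tau>)" using ge hsq_pos \<tau> by (intro powr_mono2) auto
  also have "\<dots> = c powr (1 + \<tau>) * D.variance_K powr (1 + \<tau>)" by (rule powr_mult)
  finally have "D.moment_K (2 + 2 * \<tau>) * hsq powr (1 + \<tau>) \<le> D.moment_K (2 + 2 * \<tau>) * (c powr (1 + \<tau>) * D.variance_K powr (1 + \<tau>))"
    using D.moment_K_nonneg by (intro mult_left_mono)
  also have "\<dots> \<le> A * D.variance_K powr (1 + \<tau>)"
    using mult_right_mono[OF A less_imp_le[OF V]] by (simp add: mult.assoc)
  finally show ?thesis using V H by (simp add: field_simps)
qed

lemma moment_ratio_le_large: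
  assumes small: "4 * (B powr (- 2 * \<tau>) * L) \<le> hsq"
  shows "D.moment_K (2 + 2 * \<tau>) / D.variance_K powr (1 + \<tau>)
    \<le> 153600 * (64 * norm_const\<^sup>2) powr (1 + \<tau>) * (L / hsq powr (1 + \<tau>))"
proof -
  have Bp: "B powr (- (1 + \<tau>)) * B powr (1 + \<tau>) = 1" using B_pos by (simp flip: powr_add)
  have "D.moment_K (2 + 2 * \<tau>) * (64 * norm_const\<^sup>2 * B) powr (1 + \<tau>)
    \<le> (153600 * B powr (- (1 + \<tau>)) * L) * ((64 * norm_const\<^sup>2) powr (1 + \<tau>) * B powr (1 + \<tau>))"
    unfolding powr_mult[of "64 * norm_const\<^sup>2" B] by (intro mult_right_mono DK_moment_le) auto
  also have "\<dots> = 153600 * (64 * norm_const\<^sup>2) powr (1 + \<tau>) * L * (B powr (- (1 + \<tau>)) * B powr (1 + \<tau>))"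
    by (simp only: mult_ac)
  finally have A: "D.moment_K (2 + 2 * \<tau>) * (64 * norm_const\<^sup>2 * B) powr (1 + \<tau>)
    \<le> 153600 * (64 * norm_const\<^sup>2) powr (1 + \<tau>) * L" unfolding Bp by simp
  show ?thesis using moment_ratio_le_of_ge[OF variance_ge_B[OF small] _ A] B_pos by simp
qed

lemma moment_ratio_ge: "D.variance_K powr (1 + \<tau>) \<le> D.moment_K (2 + 2 * \<tau>)"
proof -
  interpret MM: prob_space "M2" by (rule prob_space_pair_self)
  have "((DK x y)\<^sup>2) powr (1 + \<tau>) = \<bar>DK x y\<bar> powr (2 + 2 * \<tau>)" for x y
    by (simp add: powr_power2_eq)
  then show ?thesis
    unfolding D.variance_K_def D.moment_K_def
    using MM.powr_expectation_le[of "1 + \<tau>" "\<lambda>(x, y). (DK x y)\<^sup>2"] D.K_square DK_powr_integrable \<tau>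
    by (simp add: split_beta')
qed

definition "cov i j = (\<integral>x. x i * x j \<partial>M)"
definition "S4 = (\<integral>(x, y). (\<Sum>i<d. \<Sum>j<d. x i * cov i j * y j)\<^sup>2 \<partial>M2)"

lemma coord_mult_integrable: "i < d \<Longrightarrow> j < d \<Longrightarrow> integrable M (\<lambda>x. x i * x j)"
proof (rule Bochner_Integration.integrable_bound[OF vnorm_square_integrable])
  assume ij: "i < d" "j < d"
  show "(\<lambda>x. x i * x j) \<in> borel_measurable M" using ij by simp
  show "AE x in M. norm (x i * x j) \<le> norm ((vnorm d x)\<^sup>2)"
    using abs_coord_le_vnorm[OF ij(1)] abs_coord_le_vnorm[OF ij(2)]
    by (intro AE_I2) (simp add: abs_mult power2_eq_square mult_mono)
qed

text \<open>The origin of the covariance term in \<open>E\<close>: composing the inner product with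
  itself averages the products \<open>z i * z j\<close>.\<close>

lemma comp_vinner: "comp_kernel (vinner d) (vinner d) x y = (\<Sum>i<d. \<Sum>j<d. x i * cov i j * y j)"
proof -
  have "comp_kernel (vinner d) (vinner d) x y = (\<integral>z. (\<Sum>i<d. \<Sum>j<d. (x i * y j) * (z i * z j)) \<partial>M)"
    unfolding comp_kernel_def vinner_def sum_product by (simp add: mult_ac)
  also have "\<dots> = (\<Sum>i<d. \<Sum>j<d. (x i * y j) * cov i j)"
  proof -
    have "(\<integral>z. (\<Sum>i<d. \<Sum>j<d. (x i * y j) * (z i * z j)) \<partial>M) = (\<Sum>i<d. \<integral>z. (\<Sum>j<d. (x i * y j) * (z i * z j)) \<partial>M)"
      using coord_mult_integrable by (intro Bochner_Integration.integral_sum Bochner_Integration.integrable_sum) simp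
    also have "\<dots> = (\<Sum>i<d. \<Sum>j<d. \<integral>z. (x i * y j) * (z i * z j) \<partial>M)"
      using coord_mult_integrable by (intro sum.cong refl Bochner_Integration.integral_sum) simp
    finally show ?thesis by (simp add: cov_def)
  qed
  finally show ?thesis by (simp add: mult_ac)
qed

lemma vinner_section:
  "x \<in> space M \<Longrightarrow> integrable M (\<lambda>y. (vinner d x y)\<^sup>2)" "x \<in> space M \<Longrightarrow> integrable M (\<lambda>y. (vinner d y x)\<^sup>2)"
proof -
  have *: "integrable M (\<lambda>y. (vinner d x y)\<^sup>2)" if "x \<in> space M" for x
  proof (rule Bochner_Integration.integrable_bound)
    show "integrable M (\<lambda>y. (vnorm d x)\<^sup>2 * (vnorm d y)\<^sup>2)" using vnorm_square_integrable by simp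
    show "(\<lambda>y. (vinner d x y)\<^sup>2) \<in> borel_measurable M" using section_meas(1)[OF vinner_meas that] by simp
    show "AE y in M. norm ((vinner d x y)\<^sup>2) \<le> norm ((vnorm d x)\<^sup>2 * (vnorm d y)\<^sup>2)"
      using power_mono[OF abs_vinner_le[of d x] abs_ge_zero, of _ 2] by (intro AE_I2) (simp add: power_mult_distrib)
  qed
  then show "x \<in> space M \<Longrightarrow> integrable M (\<lambda>y. (vinner d x y)\<^sup>2)" "x \<in> space M \<Longrightarrow> integrable M (\<lambda>y. (vinner d y x)\<^sup>2)"
    by (simp_all add: vinner_commute[of d _ x])
qed

lemma square_add4_le: "(a + b + c + e)\<^sup>2 \<le> 4 * (a\<^sup>2 + b\<^sup>2 + c\<^sup>2 + e\<^sup>2)" for a b c e :: real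
proof -
  have "4 * (a\<^sup>2 + b\<^sup>2 + c\<^sup>2 + e\<^sup>2) - (a + b + c + e)\<^sup>2
    = (a - b)\<^sup>2 + (a - c)\<^sup>2 + (a - e)\<^sup>2 + (b - c)\<^sup>2 + (b - e)\<^sup>2 + (c - e)\<^sup>2"
    by (simp add: power2_eq_square algebra_simps)
  moreover have "0 \<le> (a - b)\<^sup>2 + (a - c)\<^sup>2 + (a - e)\<^sup>2 + (b - c)\<^sup>2 + (b - e)\<^sup>2 + (c - e)\<^sup>2" by simp
  ultimately show ?thesis by linarith
qed

text \<open>The kernel is \<open>u + v\<close> with \<open>u\<close> the scaled inner product and
  \<open>v\<close> the doubly centred \<open>rest\<close>. Composing \<open>u\<close> with itself
  gives the covariance term exactly; the other three compositions are bounded by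
  submultiplicativity. \<open>w\<close> bounds the square integral of \<open>v\<close>, with
  \<open>9600 = 16 * 4 * 150\<close>.\<close>

lemma variance_KK_upper:
  defines "w \<equiv> 9600 * (B powr (- 2 * \<tau>) / B * L)"
  shows "D.variance_KK \<le> 4 * (S4 / B\<^sup>2 + 2 * (hsq / B * w) + w\<^sup>2)"
proof -
  interpret MM: prob_space "M2" by (rule prob_space_pair_self)
  define b where "b = sqrt B"
  have b: "0 < b" "b\<^sup>2 = B" using B_pos by (auto simp: b_def)
  define u where "u x y = - vinner d x y / b" for x y
  define v where "v x y = DK x y + vinner d x y / b" for x y
  have uv: "DK x y = u x y + v x y" for x y by (simp add: u_def v_def)
  have u_meas: "(\<lambda>(x, y). u x y) \<in> borel_measurable M2"
    unfolding u_def using vinner_meas by (simp add: split_beta')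
  have v_meas: "(\<lambda>(x, y). v x y) \<in> borel_measurable M2"
    unfolding v_def using vinner_meas DK_meas by (simp add: split_beta')
  have u2: "(u x y)\<^sup>2 = (vinner d x y)\<^sup>2 / B" for x y by (simp add: u_def power_divide b)
  have v2: "(v x y)\<^sup>2 \<le> 2 * (DK x y)\<^sup>2 + 2 * ((vinner d x y)\<^sup>2 / B)" for x y
  proof -
    have "(v x y)\<^sup>2 + (DK x y - vinner d x y / b)\<^sup>2 = 2 * (DK x y)\<^sup>2 + 2 * (vinner d x y / b)\<^sup>2"
      by (simp add: v_def power2_eq_square algebra_simps)
    then have "(v x y)\<^sup>2 \<le> 2 * (DK x y)\<^sup>2 + 2 * (vinner d x y / b)\<^sup>2"
      using zero_le_power2[of "DK x y - vinner d x y / b"] by linarith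
    then show ?thesis by (simp add: power_divide b)
  qed
  have u_sec: "integrable M (\<lambda>y. (u x y)\<^sup>2)" "integrable M (\<lambda>y. (u y x)\<^sup>2)" if "x \<in> space M" for x
    unfolding u2 using vinner_section[OF that] by simp_all
  have v_sec: "integrable M (\<lambda>y. (v x y)\<^sup>2)" "integrable M (\<lambda>y. (v y x)\<^sup>2)" if x: "x \<in> space M" for x
  proof -
    show "integrable M (\<lambda>y. (v x y)\<^sup>2)"
    proof (rule Bochner_Integration.integrable_bound)
      show "integrable M (\<lambda>y. 2 * (DK x y)\<^sup>2 + 2 * ((vinner d x y)\<^sup>2 / B))"
        using D.K_section[OF x] vinner_section[OF x] by simp
    qed (use section_meas(1)[OF v_meas x] v2 B_pos in \<open>auto intro!: AE_I2\<close>)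
    show "integrable M (\<lambda>y. (v y x)\<^sup>2)"
    proof (rule Bochner_Integration.integrable_bound)
      show "integrable M (\<lambda>y. 2 * (DK y x)\<^sup>2 + 2 * ((vinner d y x)\<^sup>2 / B))"
        using D.K_section'[OF x] vinner_section[OF x] by simp
    qed (use section_meas(2)[OF v_meas x] v2 B_pos in \<open>auto intro!: AE_I2\<close>)
  qed
  have u_sq: "integrable M2 (\<lambda>(x, y). (u x y)\<^sup>2)"
    unfolding u2 using vinner_square_integrable by (simp add: split_beta')
  have u_val: "(\<integral>(x, y). (u x y)\<^sup>2 \<partial>M2) = hsq / B"
    unfolding u2 hsq_def by (simp add: split_beta')
  have rest2: "integrable M2 (\<lambda>(x, y). \<bar>rest x y\<bar> powr 2)"
    "(\<integral>(x, y). \<bar>rest x y\<bar> powr 2 \<partial>M2) = (\<integral>(x, y). (rest x y)\<^sup>2 \<partial>M2)"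
    using rest_square_integrable by (simp_all add: powr_numeral)
  note dc = double_center_powr_integrable[OF _ rest_meas rest2(1)] double_center_powr_le[OF _ rest_meas rest2(1)]
  have v_dc: "(case p of (x, y) \<Rightarrow> (v x y)\<^sup>2) = (case p of (x, y) \<Rightarrow> \<bar>double_center rest x y\<bar> powr 2)"
    if "p \<in> space M2" for p
    using that DK_decomp by (auto simp: space_pair_measure v_def b_def)
  have v_sq: "integrable M2 (\<lambda>(x, y). (v x y)\<^sup>2)"
    using dc(1) by (subst Bochner_Integration.integrable_cong[OF refl v_dc]) auto
  have "(\<integral>(x, y). (v x y)\<^sup>2 \<partial>M2) = (\<integral>(x, y). \<bar>double_center rest x y\<bar> powr 2 \<partial>M2)"
    by (rule Bochner_Integration.integral_cong[OF refl v_dc])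
  also have "\<dots> \<le> 4 powr 2 * (4 * (\<integral>(x, y). (rest x y)\<^sup>2 \<partial>M2))" using dc(2) unfolding rest2(2) by simp
  also have "\<dots> \<le> 4 powr 2 * (4 * (150 * (B powr (- 2 * \<tau>) / B * L)))"
    using rest_square_le by (intro mult_left_mono) auto
  also have "\<dots> = w" by (simp add: w_def)
  finally have v_val: "(\<integral>(x, y). (v x y)\<^sup>2 \<partial>M2) \<le> w" .
  have v_nonneg: "0 \<le> (\<integral>(x, y). (v x y)\<^sup>2 \<partial>M2)" by (intro Bochner_Integration.integral_nonneg) auto
  have w_nonneg: "0 \<le> w" using v_nonneg v_val by simp
  have split: "D.KK x y = comp_kernel u u x y + comp_kernel u v x y + comp_kernel v u x y + comp_kernel v v x y"
    if xy: "x \<in> space M" "y \<in> space M" for x y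
  proof -
    note mx = section_meas(1)[OF u_meas xy(1)] section_meas(1)[OF v_meas xy(1)]
    note my = section_meas(2)[OF u_meas xy(2)] section_meas(2)[OF v_meas xy(2)]
    note i = integrable_mult_of_squares[OF mx(1) my(1) u_sec(1)[OF xy(1)] u_sec(2)[OF xy(2)]]
      integrable_mult_of_squares[OF mx(1) my(2) u_sec(1)[OF xy(1)] v_sec(2)[OF xy(2)]]
      integrable_mult_of_squares[OF mx(2) my(1) v_sec(1)[OF xy(1)] u_sec(2)[OF xy(2)]]
      integrable_mult_of_squares[OF mx(2) my(2) v_sec(1)[OF xy(1)] v_sec(2)[OF xy(2)]]
    have "D.KK x y = (\<integral>z. u x z * u z y + u x z * v z y + v x z * u z y + v x z * v z y \<partial>M)"
      unfolding comp_kernel_def uv by (simp add: algebra_simps)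
    then show ?thesis unfolding comp_kernel_def using i by simp
  qed
  note c = comp_kernel_square_integrable[OF u_meas u_meas u_sec(1) u_sec(2) u_sq u_sq]
    comp_kernel_square_integrable[OF u_meas v_meas u_sec(1) v_sec(2) u_sq v_sq]
    comp_kernel_square_integrable[OF v_meas u_meas v_sec(1) u_sec(2) v_sq u_sq]
    comp_kernel_square_integrable[OF v_meas v_meas v_sec(1) v_sec(2) v_sq v_sq]
  have KK2: "integrable M2 (\<lambda>(x, y). (D.KK x y)\<^sup>2)"
    by (rule comp_kernel_square_integrable[OF D.K_meas D.K_meas D.K_section D.K_section' D.K_square D.K_square])
  have cuu: "(\<integral>(x, y). (comp_kernel u u x y)\<^sup>2 \<partial>M2) = S4 / B\<^sup>2"
  proof -
    have "comp_kernel u u x y = comp_kernel (vinner d) (vinner d) x y / B" for x y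
      unfolding comp_kernel_def u_def b(2)[symmetric] by (simp add: power2_eq_square)
    then show ?thesis unfolding S4_def by (simp add: comp_vinner power_divide split_beta')
  qed
  have cuv: "(\<integral>(x, y). (comp_kernel u v x y)\<^sup>2 \<partial>M2) \<le> hsq / B * w"
    using integral_comp_kernel_square[OF u_meas v_meas u_sec(1) v_sec(2) u_sq v_sq]
      mult_left_mono[OF v_val, of "hsq / B"] hsq_pos B_pos unfolding u_val by fastforce
  have cvu: "(\<integral>(x, y). (comp_kernel v u x y)\<^sup>2 \<partial>M2) \<le> w * (hsq / B)"
    using integral_comp_kernel_square[OF v_meas u_meas v_sec(1) u_sec(2) v_sq u_sq]
      mult_right_mono[OF v_val, of "hsq / B"] hsq_pos B_pos unfolding u_val by fastforce
  have cvv: "(\<integral>(x, y). (comp_kernel v v x y)\<^sup>2 \<partial>M2) \<le> w\<^sup>2"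
    using integral_comp_kernel_square[OF v_meas v_meas v_sec(1) v_sec(2) v_sq v_sq]
      mult_mono[OF v_val v_val w_nonneg v_nonneg] unfolding power2_eq_square by fastforce
  have "D.variance_KK \<le> (\<integral>p. 4 * ((case p of (x, y) \<Rightarrow> (comp_kernel u u x y)\<^sup>2) + (case p of (x, y) \<Rightarrow> (comp_kernel u v x y)\<^sup>2)
      + (case p of (x, y) \<Rightarrow> (comp_kernel v u x y)\<^sup>2) + (case p of (x, y) \<Rightarrow> (comp_kernel v v x y)\<^sup>2)) \<partial>M2)"
    unfolding D.variance_KK_def
  proof (rule integral_mono[OF KK2])
    show "integrable M2 (\<lambda>p. 4 * ((case p of (x, y) \<Rightarrow> (comp_kernel u u x y)\<^sup>2) + (case p of (x, y) \<Rightarrow> (comp_kernel u v x y)\<^sup>2)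
      + (case p of (x, y) \<Rightarrow> (comp_kernel v u x y)\<^sup>2) + (case p of (x, y) \<Rightarrow> (comp_kernel v v x y)\<^sup>2)))"
      using c by (intro integrable_mult_right Bochner_Integration.integrable_add) auto
  qed (use split square_add4_le in \<open>auto simp: space_pair_measure\<close>)
  also have "\<dots> = 4 * ((\<integral>(x, y). (comp_kernel u u x y)\<^sup>2 \<partial>M2) + (\<integral>(x, y). (comp_kernel u v x y)\<^sup>2 \<partial>M2)
      + (\<integral>(x, y). (comp_kernel v u x y)\<^sup>2 \<partial>M2) + (\<integral>(x, y). (comp_kernel v v x y)\<^sup>2 \<partial>M2))"
    using c by simp
  also have "\<dots> \<le> 4 * (S4 / B\<^sup>2 + hsq / B * w + w * (hsq / B) + w\<^sup>2)"
    using cuu cuv cvu cvv by (intro mult_left_mono add_mono) auto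
  finally show ?thesis by (simp add: mult.commute)
qed

definition "E = (S4 + B powr (- 2 * \<tau>) * L powr ((2 + \<tau>) / (1 + \<tau>))) / hsq\<^sup>2"

lemma S4_nonneg: "0 \<le> S4"
  unfolding S4_def by (intro Bochner_Integration.integral_nonneg) auto

lemma E_nonneg: "0 \<le> E"
  unfolding E_def using S4_nonneg by simp

lemma S4_le_E: "S4 \<le> E * hsq\<^sup>2"
  unfolding E_def using hsq_pos by simp

text \<open>The exponent in \<open>E\<close> is \<open>1 + 1 / (1 + \<tau>)\<close>, and
  \<open>L powr (1 / (1 + \<tau>)) \<ge> hsq\<close> by Jensen's inequality, so one factor
  \<open>hsq\<close> of the denominator cancels.\<close>

lemma L_le_E: "B powr (- 2 * \<tau>) * L \<le> E * hsq"
proof -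
  have \<tau>1: "1 + \<tau> \<noteq> 0" using \<tau> by simp
  have "(2 + \<tau>) / (1 + \<tau>) = 1 + 1 / (1 + \<tau>)" using \<tau>1 by (simp add: field_simps)
  then have "L powr ((2 + \<tau>) / (1 + \<tau>)) = L * L powr (1 / (1 + \<tau>))"
    using L_pos by (simp add: powr_add)
  moreover have "hsq \<le> L powr (1 / (1 + \<tau>))"
  proof -
    have "hsq = (hsq powr (1 + \<tau>)) powr (1 / (1 + \<tau>))" using hsq_pos \<tau>1 by (simp add: powr_powr)
    also have "\<dots> \<le> L powr (1 / (1 + \<tau>))" using L_ge \<tau> by (intro powr_mono2) auto
    finally show ?thesis .
  qed
  ultimately have "B powr (- 2 * \<tau>) * (L * hsq) \<le> B powr (- 2 * \<tau>) * L powr ((2 + \<tau>) / (1 + \<tau>))"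
    using L_pos by (simp add: mult_left_mono)
  also have "\<dots> \<le> E * hsq\<^sup>2" unfolding E_def using S4_nonneg hsq_pos by simp
  finally have "(B powr (- 2 * \<tau>) * L) * hsq \<le> (E * hsq) * hsq" by (simp add: power2_eq_square mult.assoc)
  then show ?thesis by (rule mult_right_le_imp_le[OF _ hsq_pos])
qed

lemma small_of_E: "E \<le> 1 / 4 \<Longrightarrow> 4 * (B powr (- 2 * \<tau>) * L) \<le> hsq"
  using L_le_E mult_right_mono[of E "1 / 4" hsq] hsq_pos by linarith

text \<open>With \<open>g = hsq / B\<close>, all terms of the upper bound are at most multiples of
  \<open>E * g^2\<close>, and \<open>g\<close> is at most a constant times the variance of the
  kernel. The threshold \<open>1 / 4\<close> makes that lower bound on the variance available and
  also turns the square of \<open>E\<close> into \<open>E\<close>.\<close>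

lemma variance_KK_ratio_le:
  assumes E: "E \<le> 1 / 4"
  shows "D.variance_KK / D.variance_K\<^sup>2 \<le> (400000000 * (64 * norm_const\<^sup>2)\<^sup>2) * E"
proof -
  define c where "c = 64 * norm_const\<^sup>2"
  have c: "hsq \<le> c * B * D.variance_K" using variance_ge_B[OF small_of_E[OF E]] by (simp add: c_def)
  have V: "0 < D.variance_K" by (rule variance_pos_of_ge[OF c])
  define g where "g = hsq / B"
  have g: "0 < g" using hsq_pos B_pos by (simp add: g_def)
  define w where "w = 9600 * (B powr (- 2 * \<tau>) / B * L)"
  have "w = 9600 * (B powr (- 2 * \<tau>) * L) / B" by (simp add: w_def)
  also have "\<dots> \<le> 9600 * (E * hsq) / B" using L_le_E B_pos by (intro divide_right_mono mult_left_mono) auto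
  finally have w: "w \<le> 9600 * (E * g)" by (simp add: g_def)
  have w0: "0 \<le> w" using B_pos L_pos by (simp add: w_def)
  have "w\<^sup>2 \<le> (9600 * (E * g))\<^sup>2" using w w0 by (intro power_mono)
  also have "\<dots> = 92160000 * ((E * E) * g\<^sup>2)" by (simp add: power_mult_distrib power2_eq_square)
  also have "\<dots> \<le> 92160000 * ((E * 1) * g\<^sup>2)"
    using E E_nonneg by (intro mult_left_mono mult_right_mono) auto
  finally have w2: "w\<^sup>2 \<le> 92160000 * (E * g\<^sup>2)" by simp
  have gw: "g * w \<le> 9600 * (E * g\<^sup>2)"
    using mult_left_mono[OF w less_imp_le[OF g]] by (simp add: power2_eq_square mult_ac)
  have S: "S4 / B\<^sup>2 \<le> E * g\<^sup>2"
    using divide_right_mono[OF S4_le_E, of "B\<^sup>2"] by (simp add: g_def power_divide)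
  have Eg: "0 \<le> E * g\<^sup>2" using E_nonneg by simp
  have arith: "4 * (a + 2 * b + e) \<le> 400000000 * z"
    if "a \<le> z" "b \<le> 9600 * z" "e \<le> 92160000 * z" "0 \<le> z" for a b e z :: real
  proof -
    have "a + 2 * b + e \<le> z + 2 * (9600 * z) + 92160000 * z" using that by (intro add_mono mult_left_mono) auto
    also have "\<dots> = 92179201 * z" by simp
    also have "\<dots> \<le> 100000000 * z" using that(4) by (intro mult_right_mono) auto
    finally show ?thesis by simp
  qed
  have "D.variance_KK \<le> 4 * (S4 / B\<^sup>2 + 2 * (g * w) + w\<^sup>2)"
    using variance_KK_upper by (simp add: w_def g_def)
  also have "\<dots> \<le> 400000000 * (E * g\<^sup>2)" by (rule arith[OF S gw w2 Eg])
  finally have 1: "D.variance_KK \<le> 400000000 * (E * g\<^sup>2)" .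
  have "g \<le> c * D.variance_K" using c B_pos by (simp add: g_def field_simps)
  then have "g\<^sup>2 \<le> (c * D.variance_K)\<^sup>2" using g by (intro power_mono) auto
  then have "400000000 * (E * g\<^sup>2) \<le> 400000000 * (E * (c * D.variance_K)\<^sup>2)"
    using E_nonneg by (intro mult_left_mono) auto
  with 1 have "D.variance_KK \<le> (400000000 * c\<^sup>2 * E) * D.variance_K\<^sup>2" by (simp add: power_mult_distrib mult_ac)
  then have "D.variance_KK / D.variance_K\<^sup>2 \<le> 400000000 * c\<^sup>2 * E" using V by (simp add: divide_le_eq)
  then show ?thesis unfolding c_def .
qed

lemma variance_KK_ratio_le_1: "D.variance_KK / D.variance_K\<^sup>2 \<le> 1"
  using D.variance_KK_le D.variance_KK_nonneg by (simp add: divide_le_eq_1)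

end

section \<open>Bounded dimension\<close>

definition dim_const :: "real \<Rightarrow> nat \<Rightarrow> real" where
  "dim_const \<tau> d = 4096 * (32 * norm_const\<^sup>2) powr (1 + \<tau>) * ((4 * real d + 1) * (8 * (1 + real d powr (1 + \<tau>))))"

lemma dim_const_mono: "0 \<le> \<tau> \<Longrightarrow> d \<le> e \<Longrightarrow> dim_const \<tau> d \<le> dim_const \<tau> e"
  unfolding dim_const_def by (intro mult_left_mono mult_mono add_mono powr_mono2) auto

context nondegenerate_vector
begin

definition "moment4 = (\<integral>x. vnorm d x powr (4 + 4 * \<tau>) \<partial>M)"

lemma dim_pos: "0 < d"
proof (rule ccontr)
  assume "\<not> 0 < d"
  then have "vinner d x y = 0" for x y by (simp add: vinner_def)
  then have "hsq = 0" unfolding hsq_def by (simp add: split_beta')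
  then show False using hsq_pos by simp
qed

text \<open>\<open>msq\<close> is the trace of the covariance matrix and \<open>hsq\<close> the sum
  of its squared entries, so this is Cauchy-Schwarz on the diagonal.\<close>

lemma msq_square_le: "msq\<^sup>2 \<le> real d * hsq"
proof -
  note coordp = integrable_pair_mult[OF pair_sigma_finite_self coord_mult_integrable coord_mult_integrable]
    integral_pair_mult[OF pair_sigma_finite_self coord_mult_integrable coord_mult_integrable]
  have "hsq = (\<integral>p. (\<Sum>i<d. \<Sum>j<d. (fst p i * fst p j) * (snd p i * snd p j)) \<partial>M2)"
    unfolding hsq_def vinner_def split_beta' power2_eq_square sum_product by (simp add: mult_ac)
  also have "\<dots> = (\<Sum>i<d. \<integral>p. (\<Sum>j<d. (fst p i * fst p j) * (snd p i * snd p j)) \<partial>M2)"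
    using coordp(1) by (intro Bochner_Integration.integral_sum Bochner_Integration.integrable_sum) (simp add: split_beta')
  also have "\<dots> = (\<Sum>i<d. \<Sum>j<d. \<integral>p. (fst p i * fst p j) * (snd p i * snd p j) \<partial>M2)"
    using coordp(1) by (intro sum.cong refl Bochner_Integration.integral_sum) (simp add: split_beta')
  also have "\<dots> = (\<Sum>i<d. \<Sum>j<d. (cov i j)\<^sup>2)"
    using coordp(2) by (intro sum.cong refl) (simp add: split_beta' cov_def power2_eq_square)
  finally have hsq_cov: "hsq = (\<Sum>i<d. \<Sum>j<d. (cov i j)\<^sup>2)" .
  have "msq = (\<integral>x. (\<Sum>i<d. x i * x i) \<partial>M)" unfolding msq_def vnorm_square by (simp add: power2_eq_square)
  also have "\<dots> = (\<Sum>i<d. cov i i)"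
    unfolding cov_def using coord_mult_integrable by (intro Bochner_Integration.integral_sum) auto
  finally have "msq\<^sup>2 = (\<Sum>i<d. cov i i)\<^sup>2" by simp
  also have "\<dots> \<le> (\<Sum>i<d. (cov i i)\<^sup>2) * real d"
    using sum_squared_le_sum_of_squares[of "\<lambda>i. cov i i" "{..<d}"] by simp
  also have "\<dots> \<le> hsq * real d"
    unfolding hsq_cov by (intro mult_right_mono sum_mono member_le_sum) auto
  finally show ?thesis by (simp add: mult.commute)
qed

lemma moment4_ge: "msq powr (2 + 2 * \<tau>) \<le> moment4"
proof -
  have eq: "((vnorm d x)\<^sup>2) powr (2 + 2 * \<tau>) = vnorm d x powr (4 + 4 * \<tau>)" for x
    by (simp add: powr_power2_eq algebra_simps)
  show ?thesis
    unfolding msq_def moment4_def eq[symmetric]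
    using moment \<tau> by (intro powr_expectation_le vnorm_square_integrable) (auto simp: eq)
qed

lemma moment4_pos: "0 < moment4"
proof -
  have "0 < msq powr (2 + 2 * \<tau>)" using msq_pos by simp
  then show ?thesis using moment4_ge by (rule less_le_trans)
qed

text \<open>A level for the squared norm, chosen so that cutting both squared norms there removes at
  most half of \<open>hsq\<close>: the majorant of the tail has mean \<open>2 * moment4 * msq /
  radius powr (1 + 2 * \<tau>) = msq^2 / (2 * d)\<close>, which is at most
  \<open>hsq / 2\<close>.\<close>

definition "radius = (4 * real d * moment4 / msq) powr (1 / (1 + 2 * \<tau>))"

lemma radius_pos: "0 < radius"
  unfolding radius_def using moment4_pos msq_pos dim_pos by simp

lemma radius_powr: "radius powr (1 + 2 * \<tau>) = 4 * real d * moment4 / msq"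
proof -
  define z where "z = 4 * real d * moment4 / msq"
  have "0 < z" unfolding z_def using moment4_pos msq_pos dim_pos by simp
  then show ?thesis unfolding radius_def z_def[symmetric] using \<tau> by (simp add: powr_powr)
qed

text \<open>If the squared norms add up to more than \<open>2 * radius\<close>, one of them exceeds
  \<open>radius\<close> and is dominated there by a multiple of its power
  \<open>2 + 2 * \<tau>\<close>. Independence gives the mean of the resulting majorant of the
  squared inner product.\<close>

lemma variance_ge_radius: "hsq \<le> (32 * norm_const\<^sup>2 * radius) * D.variance_K"
proof -
  define a where "a x = vnorm d x powr (4 + 4 * \<tau>)" for x
  have a_eq: "a x = ((vnorm d x)\<^sup>2) powr (2 + 2 * \<tau>)" for x by (simp add: a_def powr_power2_eq algebra_simps)
  have a: "integrable M a" "(\<integral>x. a x \<partial>M) = moment4" using moment by (simp_all add: a_def[abs_def] moment4_def)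
  note p1 = integrable_pair_mult[OF pair_sigma_finite_self a(1) vnorm_square_integrable]
    integral_pair_mult[OF pair_sigma_finite_self a(1) vnorm_square_integrable]
  note p2 = integrable_pair_mult[OF pair_sigma_finite_self vnorm_square_integrable a(1)]
    integral_pair_mult[OF pair_sigma_finite_self vnorm_square_integrable a(1)]
  define c where "c = radius powr (- (1 + 2 * \<tau>))"
  have c: "0 \<le> c" "c = msq / (4 * real d * moment4)"
    unfolding c_def powr_minus_divide radius_powr using moment4_pos msq_pos by auto
  define U where "U p = c * (a (fst p) * (vnorm d (snd p))\<^sup>2 + (vnorm d (fst p))\<^sup>2 * a (snd p))" for p
  have U_int: "integrable M2 U" unfolding U_def using p1 p2 by (simp add: split_beta')
  have "(\<integral>p. U p \<partial>M2) = c * (moment4 * msq + msq * moment4)"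
    unfolding U_def using p1 p2 a(2) by (simp add: split_beta' msq_def)
  also have "\<dots> = msq\<^sup>2 / real d / 2" unfolding c(2) using moment4_pos dim_pos by (simp add: field_simps power2_eq_square)
  also have "\<dots> \<le> hsq / 2" using msq_square_le dim_pos by (simp add: divide_le_eq mult.commute)
  finally have U_le: "(\<integral>p. U p \<partial>M2) \<le> hsq / 2" .
  have tail: "u \<le> c * u powr (2 + 2 * \<tau>)" if "radius < u" for u
  proof -
    have u: "0 < u" using that radius_pos by simp
    have "u = u powr (- (1 + 2 * \<tau>)) * u powr (2 + 2 * \<tau>)" using u by (simp flip: powr_add)
    also have "\<dots> \<le> c * u powr (2 + 2 * \<tau>)"
      unfolding c_def using that radius_pos \<tau> by (intro mult_right_mono powr_mono2') auto
    finally show ?thesis .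
  qed
  have R2: "(sqrt (2 * radius))\<^sup>2 = 2 * radius" using radius_pos by simp
  have "hsq \<le> 16 * norm_const\<^sup>2 * (sqrt (2 * radius))\<^sup>2 * D.variance_K"
  proof (rule variance_ge_of_tail[OF _ U_int U_le])
    show "0 < sqrt (2 * radius)" using radius_pos by simp
    fix x y
    define u v where "u = (vnorm d x)\<^sup>2" and "v = (vnorm d y)\<^sup>2"
    have uv: "0 \<le> u" "0 \<le> v" by (auto simp: u_def v_def)
    have Uxy: "U (x, y) = (c * u powr (2 + 2 * \<tau>)) * v + u * (c * v powr (2 + 2 * \<tau>))"
      unfolding U_def a_eq u_def v_def by (simp add: algebra_simps)
    have nonneg: "0 \<le> (c * u powr (2 + 2 * \<tau>)) * v" "0 \<le> u * (c * v powr (2 + 2 * \<tau>))"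
      by (intro mult_nonneg_nonneg c(1) uv powr_ge_zero)+
    have h: "(vinner d x y)\<^sup>2 \<le> u * v"
      using power_mono[OF abs_vinner_le[of d x y] abs_ge_zero, of 2] by (simp add: u_def v_def power_mult_distrib)
    have "u * v \<le> U (x, y)" if "\<not> u + v \<le> 2 * radius"
    proof (cases "radius < u")
      case True
      from mult_right_mono[OF tail[OF this] uv(2)] nonneg show ?thesis unfolding Uxy by linarith
    next
      case False
      then have "radius < v" using that by linarith
      from mult_left_mono[OF tail[OF this] uv(1)] nonneg show ?thesis unfolding Uxy by linarith
    qed
    then show "(vinner d x y)\<^sup>2 \<le> (vinner d x y)\<^sup>2 * of_bool ((vnorm d x)\<^sup>2 + (vnorm d y)\<^sup>2 \<le> (sqrt (2 * radius))\<^sup>2) + U (x, y)"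
      unfolding R2 using h nonneg Uxy by (cases "u + v \<le> 2 * radius") (auto simp: u_def v_def)
  qed
  then show ?thesis unfolding R2 by (simp add: mult_ac)
qed

lemma variance_pos: "0 < D.variance_K"
  by (rule variance_pos_of_ge[OF variance_ge_radius])

lemma DK_moment_le_norm: "D.moment_K (2 + 2 * \<tau>) \<le> 4096 * (\<integral>x. vnorm d x powr (2 + 2 * \<tau>) \<partial>M)"
proof -
  let ?r = "2 + 2 * \<tau>"
  have r2: "2 powr ?r \<le> 8" using \<tau> powr_mono[of ?r 3 "2::real"] by simp
  have i: "integrable M (\<lambda>x. vnorm d x powr ?r)" using \<tau> by (intro vnorm_powr_integrable) auto
  have one: "integrable M (\<lambda>_. 1 :: real)" by simp
  note p1 = integrable_pair_mult[OF pair_sigma_finite_self i one] integral_pair_mult[OF pair_sigma_finite_self i one]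
  note p2 = integrable_pair_mult[OF pair_sigma_finite_self one i] integral_pair_mult[OF pair_sigma_finite_self one i]
  have le: "\<bar>vdist d x y - 0\<bar> powr ?r \<le> 8 * (vnorm d x powr ?r * 1 + 1 * vnorm d y powr ?r)" for x y
  proof -
    have "\<bar>vdist d x y - 0\<bar> powr ?r \<le> \<bar>vnorm d x + vnorm d y\<bar> powr ?r" using vdist_le[of d x y] \<tau> by (intro powr_mono2) auto
    also have "\<dots> \<le> 2 powr ?r * (\<bar>vnorm d x\<bar> powr ?r + \<bar>vnorm d y\<bar> powr ?r)" using \<tau> by (intro abs_add_powr_le_sum) auto
    also have "\<dots> \<le> 8 * (\<bar>vnorm d x\<bar> powr ?r + \<bar>vnorm d y\<bar> powr ?r)" using r2 by (intro mult_right_mono) auto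
    finally show ?thesis by simp
  qed
  have "D.moment_K ?r \<le> 256 * (\<integral>(x, y). \<bar>vdist d x y - 0\<bar> powr ?r \<partial>M2)"
    unfolding D.moment_K_def by (rule DK_powr_le)
  also have "(\<integral>(x, y). \<bar>vdist d x y - 0\<bar> powr ?r \<partial>M2)
    \<le> (\<integral>p. 8 * ((case p of (x, y) \<Rightarrow> vnorm d x powr ?r * 1) + (case p of (x, y) \<Rightarrow> 1 * vnorm d y powr ?r)) \<partial>M2)"
  proof (rule integral_mono[OF vdist_powr_integrable])
    show "integrable M2 (\<lambda>p. 8 * ((case p of (x, y) \<Rightarrow> vnorm d x powr ?r * 1) + (case p of (x, y) \<Rightarrow> 1 * vnorm d y powr ?r)))"
      using p1(1) p2(1) by (intro integrable_mult_right Bochner_Integration.integrable_add)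
    show "(case p of (x, y) \<Rightarrow> \<bar>vdist d x y - 0\<bar> powr ?r)
      \<le> 8 * ((case p of (x, y) \<Rightarrow> vnorm d x powr ?r * 1) + (case p of (x, y) \<Rightarrow> 1 * vnorm d y powr ?r))" for p
      using le[of "fst p" "snd p"] by (simp only: split_beta')
  qed
  also have "\<dots> = 8 * ((\<integral>x. vnorm d x powr ?r \<partial>M) + (\<integral>x. vnorm d x powr ?r \<partial>M))"
    using p1 p2 by (simp add: prob_space)
  finally show ?thesis by simp
qed

text \<open>The squared norm is recentred at \<open>msq\<close>: the moment of the deviation is part
  of \<open>L\<close>, and \<open>msq powr (2 + 2 * \<tau>)\<close> is reached through
  \<open>msq^2 \<le> d * hsq\<close>.\<close>

lemma moment4_le: "moment4 \<le> 8 * (1 + real d powr (1 + \<tau>)) * L"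
proof -
  let ?r = "2 + 2 * \<tau>"
  have r2: "2 powr ?r \<le> 8" using \<tau> powr_mono[of ?r 3 "2::real"] by simp
  have le: "vnorm d x powr (4 + 4 * \<tau>) \<le> 8 * (\<bar>(vnorm d x)\<^sup>2 - msq\<bar> powr ?r + msq powr ?r)" for x
  proof -
    have "vnorm d x powr (4 + 4 * \<tau>) = \<bar>((vnorm d x)\<^sup>2 - msq) + msq\<bar> powr ?r"
      by (simp add: powr_power2_eq algebra_simps)
    also have "\<dots> \<le> 2 powr ?r * (\<bar>(vnorm d x)\<^sup>2 - msq\<bar> powr ?r + \<bar>msq\<bar> powr ?r)"
      using \<tau> by (intro abs_add_powr_le_sum) auto
    also have "\<dots> \<le> 8 * (\<bar>(vnorm d x)\<^sup>2 - msq\<bar> powr ?r + \<bar>msq\<bar> powr ?r)"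
      using r2 by (intro mult_right_mono) auto
    finally show ?thesis using msq_pos by simp
  qed
  have "moment4 \<le> (\<integral>x. 8 * (\<bar>(vnorm d x)\<^sup>2 - msq\<bar> powr ?r + msq powr ?r) \<partial>M)"
    unfolding moment4_def using moment LA_integrable le by (intro integral_mono) auto
  also have "\<dots> = 8 * (LA + msq powr ?r)" using LA_integrable by (simp add: LA_def prob_space)
  also have "msq powr ?r = (msq\<^sup>2) powr (1 + \<tau>)" using msq_pos by (simp add: powr_power2_eq)
  also have "\<dots> \<le> (real d * hsq) powr (1 + \<tau>)" using msq_square_le \<tau> by (intro powr_mono2) auto
  also have "\<dots> = real d powr (1 + \<tau>) * hsq powr (1 + \<tau>)" by (rule powr_mult)
  also have "\<dots> \<le> real d powr (1 + \<tau>) * L" using L_ge by (intro mult_left_mono) auto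
  finally have "moment4 \<le> 8 * (LA + real d powr (1 + \<tau>) * L)" by simp
  also have "\<dots> \<le> 8 * (L + real d powr (1 + \<tau>) * L)" using LH_nonneg by (simp add: L_def)
  finally show ?thesis by (simp add: algebra_simps)
qed

text \<open>The radius from the lower bound on the variance has to disappear. Multiplied by
  \<open>radius powr (1 + \<tau>)\<close>, the moment of order \<open>2 + 2 * \<tau>\<close> is
  bounded by \<open>radius powr (1 + 2 * \<tau>) * msq + moment4\<close>, and the choice of the
  radius makes the first term \<open>4 * d * moment4\<close>.\<close>

lemma moment_ratio_le_dim:
  "D.moment_K (2 + 2 * \<tau>) / D.variance_K powr (1 + \<tau>) \<le> dim_const \<tau> d * (L / hsq powr (1 + \<tau>))"
proof -
  let ?r = "2 + 2 * \<tau>" and ?\<rho> = radius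
  have i: "integrable M (\<lambda>x. vnorm d x powr ?r)" using \<tau> by (intro vnorm_powr_integrable) auto
  \<comment> \<open>For \<open>u\<close> up to the radius the first term on the right dominates,
    beyond it the second.\<close>
  have split: "?\<rho> powr (1 + \<tau>) * u powr (1 + \<tau>) \<le> ?\<rho> powr (1 + 2 * \<tau>) * u + u powr ?r" if u: "0 \<le> u" for u
  proof (cases "u = 0")
    case False
    then have u: "0 < u" using u by simp
    show ?thesis
    proof (cases "u \<le> ?\<rho>")
      case True
      have "?\<rho> powr (1 + \<tau>) * u powr (1 + \<tau>) = ?\<rho> powr (1 + \<tau>) * (u powr \<tau> * u)" using u by (simp add: powr_add)
      also have "\<dots> \<le> ?\<rho> powr (1 + \<tau>) * (?\<rho> powr \<tau> * u)"
        using True u \<tau> by (intro mult_left_mono mult_right_mono powr_mono2) auto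
      also have "\<dots> = ?\<rho> powr (1 + 2 * \<tau>) * u" by (simp add: algebra_simps flip: powr_add)
      finally show ?thesis using powr_ge_zero[of u ?r] by linarith
    next
      case False
      have "?\<rho> powr (1 + \<tau>) * u powr (1 + \<tau>) \<le> u powr (1 + \<tau>) * u powr (1 + \<tau>)"
        using False radius_pos \<tau> by (intro mult_right_mono powr_mono2) auto
      also have "\<dots> = u powr ?r" by (simp flip: powr_add)
      finally show ?thesis using mult_nonneg_nonneg[OF powr_ge_zero[of ?\<rho> "1 + 2 * \<tau>"] less_imp_le[OF u]] by linarith
    qed
  qed simp
  have e: "((vnorm d x)\<^sup>2) powr (1 + \<tau>) = vnorm d x powr ?r" "((vnorm d x)\<^sup>2) powr ?r = vnorm d x powr (4 + 4 * \<tau>)" for x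
    by (simp_all add: powr_power2_eq algebra_simps)
  have "?\<rho> powr (1 + \<tau>) * (\<integral>x. vnorm d x powr ?r \<partial>M) = (\<integral>x. ?\<rho> powr (1 + \<tau>) * vnorm d x powr ?r \<partial>M)" by simp
  also have "\<dots> \<le> (\<integral>x. ?\<rho> powr (1 + 2 * \<tau>) * (vnorm d x)\<^sup>2 + vnorm d x powr (4 + 4 * \<tau>) \<partial>M)"
    using split[OF zero_le_power2[of "vnorm d _"]] i moment vnorm_square_integrable
    unfolding e by (intro integral_mono) auto
  also have "\<dots> = ?\<rho> powr (1 + 2 * \<tau>) * msq + moment4"
    using moment vnorm_square_integrable by (simp add: msq_def moment4_def)
  also have "\<dots> = (4 * real d + 1) * moment4"
    unfolding radius_powr using msq_pos by (simp add: distrib_right)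
  also have "\<dots> \<le> (4 * real d + 1) * (8 * (1 + real d powr (1 + \<tau>)) * L)"
    by (intro mult_left_mono moment4_le) auto
  finally have m: "?\<rho> powr (1 + \<tau>) * (\<integral>x. vnorm d x powr ?r \<partial>M) \<le> (4 * real d + 1) * (8 * (1 + real d powr (1 + \<tau>)) * L)" .
  let ?c = "(32 * norm_const\<^sup>2) powr (1 + \<tau>)"
  have "D.moment_K ?r * (32 * norm_const\<^sup>2 * ?\<rho>) powr (1 + \<tau>)
    \<le> (4096 * (\<integral>x. vnorm d x powr ?r \<partial>M)) * (?c * ?\<rho> powr (1 + \<tau>))"
    unfolding powr_mult[of "32 * norm_const\<^sup>2" ?\<rho>] by (intro mult_right_mono DK_moment_le_norm) auto
  also have "\<dots> = 4096 * ?c * (?\<rho> powr (1 + \<tau>) * (\<integral>x. vnorm d x powr ?r \<partial>M))" by (simp only: mult_ac)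
  also have "\<dots> \<le> 4096 * ?c * ((4 * real d + 1) * (8 * (1 + real d powr (1 + \<tau>)) * L))"
    by (intro mult_left_mono m) auto
  also have "\<dots> = dim_const \<tau> d * L" unfolding dim_const_def by (simp only: mult_ac)
  finally have A: "D.moment_K ?r * (32 * norm_const\<^sup>2 * ?\<rho>) powr (1 + \<tau>) \<le> dim_const \<tau> d * L" .
  show ?thesis using moment_ratio_le_of_ge[OF variance_ge_radius _ A] radius_pos by simp
qed

text \<open>This ratio and \<open>rho\<close> are invariant under scaling of the vector; the error
  bound depends on the law through these two alone.\<close>

definition "kappa = D.moment_K (2 + 2 * \<tau>) / D.variance_K powr (1 + \<tau>)"
definition "rho = D.variance_KK / D.variance_K\<^sup>2"

lemma kappa_ge_1: "1 \<le> kappa"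
  unfolding kappa_def using moment_ratio_ge variance_pos by (simp add: le_divide_eq)

lemma rho_nonneg: "0 \<le> rho" and rho_le_1: "rho \<le> 1"
  unfolding rho_def using variance_KK_ratio_le_1 D.variance_KK_nonneg by simp_all

end

section \<open>Convergence of the statistic\<close>

lemma U_center_cong:
  assumes "\<And>k l. k \<in> {1..n} \<Longrightarrow> l \<in> {1..n} \<Longrightarrow> a k l = a' k l" "k \<in> {1..n}" "l \<in> {1..n}"
  shows "U_center n a k l = U_center n a' k l"
proof -
  have "(\<Sum>i=1..n. a i l) = (\<Sum>i=1..n. a' i l)" "(\<Sum>j=1..n. a k j) = (\<Sum>j=1..n. a' k j)"
    "(\<Sum>i=1..n. \<Sum>j=1..n. a i j) = (\<Sum>i=1..n. \<Sum>j=1..n. a' i j)"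
    using assms by (auto intro!: sum.cong)
  then show ?thesis unfolding U_center_def using assms by simp
qed

lemma V_star_cong:
  assumes "\<And>k l. k \<in> {1..n} \<Longrightarrow> l \<in> {1..n} \<Longrightarrow> a k l = a' k l"
    and "\<And>k l. k \<in> {1..n} \<Longrightarrow> l \<in> {1..n} \<Longrightarrow> b k l = b' k l"
  shows "V_star n a b = V_star n a' b'"
proof -
  have "(\<Sum>k=1..n. \<Sum>l\<in>{1..n} - {k}. U_center n a k l * U_center n b k l)
    = (\<Sum>k=1..n. \<Sum>l\<in>{1..n} - {k}. U_center n a' k l * U_center n b' k l)"
    using U_center_cong[OF assms(1)] U_center_cong[OF assms(2)] by (intro sum.cong refl) auto
  then show ?thesis by (simp add: V_star_def)
qed

lemma T_stat_cong:
  assumes "\<And>i. i \<in> {1..n} \<Longrightarrow> x i = x' i" "\<And>i. i \<in> {1..n} \<Longrightarrow> y i = y' i"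
  shows "T_stat n p q x y = T_stat n p q x' y'"
proof -
  let ?a = "\<lambda>k l. vdist p (x k) (x l)" and ?a' = "\<lambda>k l. vdist p (x' k) (x' l)"
  let ?b = "\<lambda>k l. vdist q (y k) (y l)" and ?b' = "\<lambda>k l. vdist q (y' k) (y' l)"
  have "V_star n ?a ?a = V_star n ?a' ?a'" "V_star n ?b ?b = V_star n ?b' ?b'" "V_star n ?a ?b = V_star n ?a' ?b'"
    using assms by (auto intro!: V_star_cong)
  then show ?thesis by (simp add: T_stat_def R_star_def)
qed

definition char_error :: "real \<Rightarrow> real \<Rightarrow> nat \<Rightarrow> real \<Rightarrow> real \<Rightarrow> real \<Rightarrow> real" where
  "char_error \<tau> t n \<kappa>X \<kappa>Y \<rho> =
    (let y = real n powr (- \<tau>) * (\<kappa>X * \<kappa>Y);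
      \<beta>X = 4 * (real n powr (- \<tau>) * \<kappa>X) + 6 * sqrt (real n powr (- \<tau>) * \<kappa>X) + 12 / real n;
      \<beta>Y = 4 * (real n powr (- \<tau>) * \<kappa>Y) + 6 * sqrt (real n powr (- \<tau>) * \<kappa>Y) + 12 / real n;
      \<beta> = (1 + \<beta>X) * \<beta>Y + \<beta>X
    in (2 * sqrt (\<bar>t\<bar> * 13 * \<beta>) + 4 * \<beta>) + \<bar>t\<bar> * (12 / sqrt (real n))
      + ((2 + t\<^sup>2 * exp (t\<^sup>2)) * (2 * y + 4 * sqrt y + 4 * sqrt (2 * \<rho>))
        + 2 * exp (t\<^sup>2) * \<bar>t\<bar> powr (2 + 2 * \<tau>) * (1152 * y)))"

text \<open>The hypothesis controls the product of the two moment ratios. Each ratio is at least 1,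
  so each of them separately, times \<open>n powr (- \<tau>)\<close>, lies below the product term
  and vanishes with it.\<close>

lemma char_error_tendsto_0:
  assumes \<tau>: "0 < \<tau>" and n: "filterlim n at_top sequentially"
    and \<kappa>: "\<And>m. 1 \<le> \<kappa>X m" "\<And>m. 1 \<le> \<kappa>Y m"
    and y: "(\<lambda>m. real (n m) powr (- \<tau>) * (\<kappa>X m * \<kappa>Y m)) \<longlonglongrightarrow> 0" and \<rho>: "\<rho> \<longlonglongrightarrow> 0"
  shows "(\<lambda>m. char_error \<tau> t (n m) (\<kappa>X m) (\<kappa>Y m) (\<rho> m)) \<longlonglongrightarrow> 0"
proof -
  have N: "filterlim (\<lambda>m. real (n m)) at_top sequentially"
    by (rule filterlim_compose[OF filterlim_real_sequentially n])
  have inv: "(\<lambda>m. c / real (n m)) \<longlonglongrightarrow> 0" for c by (rule real_tendsto_divide_at_top[OF tendsto_const N])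
  have inv_sqrt: "(\<lambda>m. c / sqrt (real (n m))) \<longlonglongrightarrow> 0" for c
    by (rule real_tendsto_divide_at_top[OF tendsto_const filterlim_compose[OF sqrt_at_top N]])
  have x: "(\<lambda>m. real (n m) powr (- \<tau>) * \<kappa>X m) \<longlonglongrightarrow> 0"
  proof (rule tendsto_sandwich[OF _ _ tendsto_const y])
    show "\<forall>\<^sub>F m in sequentially. 0 \<le> real (n m) powr (- \<tau>) * \<kappa>X m"
      using order_trans[OF zero_le_one \<kappa>(1)] by simp
    have "\<kappa>X m * 1 \<le> \<kappa>X m * \<kappa>Y m" for m using \<kappa>[of m] by (intro mult_left_mono) auto
    then show "\<forall>\<^sub>F m in sequentially. real (n m) powr (- \<tau>) * \<kappa>X m \<le> real (n m) powr (- \<tau>) * (\<kappa>X m * \<kappa>Y m)"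
      by (intro always_eventually allI mult_left_mono) auto
  qed
  have x': "(\<lambda>m. real (n m) powr (- \<tau>) * \<kappa>Y m) \<longlonglongrightarrow> 0"
  proof (rule tendsto_sandwich[OF _ _ tendsto_const y])
    show "\<forall>\<^sub>F m in sequentially. 0 \<le> real (n m) powr (- \<tau>) * \<kappa>Y m"
      using order_trans[OF zero_le_one \<kappa>(2)] by simp
    have "1 * \<kappa>Y m \<le> \<kappa>X m * \<kappa>Y m" for m using \<kappa>[of m] by (intro mult_right_mono) auto
    then show "\<forall>\<^sub>F m in sequentially. real (n m) powr (- \<tau>) * \<kappa>Y m \<le> real (n m) powr (- \<tau>) * (\<kappa>X m * \<kappa>Y m)"
      by (intro always_eventually allI mult_left_mono) auto
  qed
  show ?thesis
    unfolding char_error_def Let_def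
    by (rule tendsto_eq_rhs, (rule tendsto_intros x x' y \<rho> inv inv_sqrt)+) simp
qed

lemma T_stat_char_bound:
  assumes X: "nondegenerate_vector P p \<tau>" and Y: "nondegenerate_vector Q q \<tau>" and n: "6 \<le> n"
  defines "S \<equiv> iid_space P {1..n} \<Otimes>\<^sub>M iid_space Q {1..n}"
  shows "(\<lambda>z. T_stat n p q (fst z) (snd z)) \<in> borel_measurable S"
    and "cmod ((\<integral>z. iexp (t * T_stat n p q (fst z) (snd z)) \<partial>S) - exp (- (t\<^sup>2) / 2))
      \<le> char_error \<tau> t n (nondegenerate_vector.kappa P p \<tau>) (nondegenerate_vector.kappa Q q \<tau>)
          (nondegenerate_vector.rho P p * nondegenerate_vector.rho Q q)"
proof -
  interpret X: nondegenerate_vector P p \<tau> by fact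
  interpret Y: nondegenerate_vector Q q \<tau> by fact
  interpret XY: kernel_pair P X.DK "vdist p" "\<lambda>x. X.avgdist x - X.avgdist0 / 2" Q Y.DK "vdist q" "\<lambda>x. Y.avgdist x - Y.avgdist0 / 2"
    by unfold_locales (rule X.variance_pos Y.variance_pos)+
  have T: "(\<lambda>z. T_stat n p q (fst z) (snd z)) = XY.dcor_stat n"
    by (simp add: fun_eq_iff T_stat_def XY.dcor_stat_def)
  note b = XY.dcor_stat_char_bound[OF X.\<tau> n X.DK_powr_integrable Y.DK_powr_integrable]
  show "(\<lambda>z. T_stat n p q (fst z) (snd z)) \<in> borel_measurable S" unfolding T S_def by (rule b(1))
  show "cmod ((\<integral>z. iexp (t * T_stat n p q (fst z) (snd z)) \<partial>S) - exp (- (t\<^sup>2) / 2))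
      \<le> char_error \<tau> t n X.kappa Y.kappa (X.rho * Y.rho)"
    using b(2)[of t] unfolding fun_cong[OF T] S_def char_error_def Let_def X.kappa_def Y.kappa_def X.rho_def Y.rho_def .
qed

section \<open>From random variables to product laws\<close>

lemma sample_law:
  fixes P :: "'b measure" and Q :: "'c measure" and I :: "nat set"
  assumes M: "prob_space M" and P: "prob_space P" "prob_space Q" and I: "finite I" "I \<noteq> {}"
    and indep: "prob_space.indep_vars M (\<lambda>_. P \<Otimes>\<^sub>M Q) (\<lambda>i \<omega>. (Xs i \<omega>, Ys i \<omega>)) I"
    and law: "\<And>i. i \<in> I \<Longrightarrow> distr M (P \<Otimes>\<^sub>M Q) (\<lambda>\<omega>. (Xs i \<omega>, Ys i \<omega>)) = P \<Otimes>\<^sub>M Q"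
  defines "S \<equiv> iid_space P I \<Otimes>\<^sub>M iid_space Q I"
  defines "V \<equiv> \<lambda>\<omega>. (\<lambda>i\<in>I. Xs i \<omega>, \<lambda>i\<in>I. Ys i \<omega>)"
  shows "V \<in> M \<rightarrow>\<^sub>M S" "distr M S V = S"
proof -
  interpret M: prob_space M by fact
  let ?Z = "\<lambda>\<omega>. \<lambda>i\<in>I. (Xs i \<omega>, Ys i \<omega>)" and ?Q = "iid_space (P \<Otimes>\<^sub>M Q) I"
  define zip where "zip z = (\<lambda>i\<in>I. (fst z i, snd z i))" for z :: "(nat \<Rightarrow> 'b) \<times> (nat \<Rightarrow> 'c)"
  define unzip where "unzip w = (\<lambda>i\<in>I. fst (w i), \<lambda>i\<in>I. snd (w i))" for w :: "nat \<Rightarrow> 'b \<times> 'c"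
  have rv: "(\<lambda>\<omega>. (Xs i \<omega>, Ys i \<omega>)) \<in> M \<rightarrow>\<^sub>M P \<Otimes>\<^sub>M Q" if "i \<in> I" for i
    using indep that by (simp add: M.indep_vars_def2)
  have Z: "?Z \<in> M \<rightarrow>\<^sub>M ?Q" by (intro measurable_restrict rv)
  have zip: "zip \<in> S \<rightarrow>\<^sub>M ?Q" unfolding zip_def S_def by measurable
  have unzip: "unzip \<in> ?Q \<rightarrow>\<^sub>M S" unfolding unzip_def S_def by measurable
  have V_eq: "V = unzip \<circ> ?Z" by (auto simp: V_def unzip_def fun_eq_iff restrict_def)
  show "V \<in> M \<rightarrow>\<^sub>M S" unfolding V_eq by (rule measurable_comp[OF Z unzip])
  have "distr M ?Q ?Z = PiM I (\<lambda>i. distr M (P \<Otimes>\<^sub>M Q) (\<lambda>\<omega>. (Xs i \<omega>, Ys i \<omega>)))"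
    using M.indep_vars_iff_distr_eq_PiM'[OF I(2) rv, of "\<lambda>i. i"] indep by simp
  also have "\<dots> = ?Q" by (intro PiM_cong refl law)
  also have "?Q = distr S ?Q zip" unfolding zip_def S_def by (rule distr_zip[OF P I(1), symmetric])
  finally have law_Z: "distr M ?Q ?Z = distr S ?Q zip" .
  \<comment> \<open>The zipped sample and the zipped product law agree, and unzipping undoes zipping
    on the space of \<open>S\<close>.\<close>
  have "distr M S V = distr (distr M ?Q ?Z) S unzip" unfolding V_eq by (rule distr_distr[OF unzip Z, symmetric])
  also have "\<dots> = distr S S (unzip \<circ> zip)" unfolding law_Z by (rule distr_distr[OF unzip zip])
  also have "\<dots> = distr S S (\<lambda>z. z)"
  proof (rule distr_cong[OF refl refl])
    fix z assume "z \<in> space S"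
    then have "fst z \<in> extensional I" "snd z \<in> extensional I"
      by (auto simp: S_def space_pair_measure space_PiM PiE_def)
    then show "(unzip \<circ> zip) z = z"
      by (auto simp: unzip_def zip_def prod_eq_iff fun_eq_iff restrict_def extensional_def)
  qed
  finally show "distr M S V = S" by (simp add: distr_id2)
qed

lemma integral_law:
  fixes f :: "_ \<Rightarrow> real"
  assumes "V \<in> M \<rightarrow>\<^sub>M N" "distr M N V = P" "f \<in> borel_measurable P"
  shows "(\<integral>\<omega>. f (V \<omega>) \<partial>M) = (\<integral>x. f x \<partial>P)"
  using assms by (auto simp: integral_distr)

lemma (in prob_space) indep_var_of_indep_vars:
  assumes "indep_vars (\<lambda>_. N) Z I" "i \<in> I" "j \<in> I" "i \<noteq> j"
  shows "indep_var N (Z i) N (Z j)"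
proof -
  have "indep_var N ((\<lambda>f. f i) \<circ> (\<lambda>\<omega>. restrict (\<lambda>i. Z i \<omega>) {i})) N ((\<lambda>f. f j) \<circ> (\<lambda>\<omega>. restrict (\<lambda>i. Z i \<omega>) {j}))"
    using assms by (intro indep_var_compose[OF indep_var_restrict[OF assms(1)]] measurable_component_singleton) auto
  then show ?thesis by (simp add: comp_def)
qed

context random_vector
begin

lemma Sigma_transfer:
  assumes X: "X \<in> N \<rightarrow>\<^sub>M M" "distr N M X = M" and "i < d" "j < d"
  shows "Sigma_mat N X i j = (\<integral>x. x i * x j \<partial>M)"
  unfolding Sigma_mat_def using assms by (intro integral_law[OF X, of "\<lambda>x. x i * x j"]) simp

end

context nondegenerate_vector
begin

lemma population_transfer:
  assumes X: "X \<in> N \<rightarrow>\<^sub>M M" "distr N M X = M"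
    and X12: "(\<lambda>\<omega>. (X1 \<omega>, X2 \<omega>)) \<in> N \<rightarrow>\<^sub>M M2" "distr N M2 (\<lambda>\<omega>. (X1 \<omega>, X2 \<omega>)) = M2"
  shows "inner_sq_moment N d X1 X2 = hsq" "L_moment N d \<tau> X X1 X2 = L" "E_ratio N d \<tau> X X1 X2 = E"
proof -
  have pair: "(\<integral>\<omega>. f (X1 \<omega>) (X2 \<omega>) \<partial>N) = (\<integral>(x, y). f x y \<partial>M2)"
    if "(\<lambda>(x, y). f x y) \<in> borel_measurable M2" for f :: "_ \<Rightarrow> _ \<Rightarrow> real"
    using integral_law[OF X12 that] by simp
  show h: "inner_sq_moment N d X1 X2 = hsq"
    unfolding inner_sq_moment_def hsq_def by (intro pair borel_measurable_integrable vinner_square_integrable)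
  have "(\<integral>\<omega>. (vnorm d (X \<omega>))\<^sup>2 \<partial>N) = msq"
    unfolding msq_def using vnorm_meas by (intro integral_law[OF X]) simp
  then show L: "L_moment N d \<tau> X X1 X2 = L"
    unfolding L_moment_def L_def LA_def LH_def
    using integral_law[OF X borel_measurable_integrable[OF LA_integrable]]
      pair[OF borel_measurable_integrable[OF vinner_powr_integrable]] by simp
  have "B_dist N d X1 X2 = (\<integral>(x, y). (vdist d x y)\<^sup>2 \<partial>M2)"
    unfolding B_dist_def using vdist_meas by (intro pair) (simp add: split_beta')
  also have "\<dots> = B"
  proof -
    have one: "integrable M (\<lambda>_. 1 :: real)" by simp
    note p1 = integrable_pair_mult[OF pair_sigma_finite_self vnorm_square_integrable one]
      integral_pair_mult[OF pair_sigma_finite_self vnorm_square_integrable one]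
    note p2 = integrable_pair_mult[OF pair_sigma_finite_self one vnorm_square_integrable]
      integral_pair_mult[OF pair_sigma_finite_self one vnorm_square_integrable]
    show ?thesis
      unfolding vdist_square using p1 p2 vinner_integrable integral_pair_vinner
      by (simp add: split_beta' B_def msq_def prob_space)
  qed
  finally have B: "B_dist N d X1 X2 = B" .
  have "Sigma_sq_moment N d X X1 X2 = (\<integral>\<omega>. (\<Sum>i<d. \<Sum>j<d. X1 \<omega> i * cov i j * X2 \<omega> j)\<^sup>2 \<partial>N)"
    unfolding Sigma_sq_moment_def cov_def using Sigma_transfer[OF X] by simp
  also have "\<dots> = S4"
    unfolding S4_def
  proof (rule pair)
    show "(\<lambda>(x, y). (\<Sum>i<d. \<Sum>j<d. x i * cov i j * y j)\<^sup>2) \<in> borel_measurable M2"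
      unfolding split_beta'
      by (intro borel_measurable_power borel_measurable_sum borel_measurable_times coord_meas_comp
          measurable_fst measurable_snd borel_measurable_const) auto
  qed
  finally have S: "Sigma_sq_moment N d X X1 X2 = S4" .
  show "E_ratio N d \<tau> X X1 X2 = E" unfolding E_ratio_def E_def h L B S ..
qed

end

text \<open>In high dimension \<open>E\<close> eventually falls below the threshold
  \<open>1 / 4\<close>, so the bounds with absolute constants apply. In bounded dimension the
  constant of the largest dimension serves for all \<open>m\<close>, and \<open>rho\<close> is
  merely at most 1, so its limit is claimed in the first case only.\<close>

lemma vector_asymptotics:
  fixes \<mu> :: "nat \<Rightarrow> (nat \<Rightarrow> real) measure" and d :: "nat \<Rightarrow> nat"
  assumes nd: "\<And>m. nondegenerate_vector (\<mu> m) (d m) \<tau>"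
    and dich: "filterlim d at_top sequentially \<or> (\<exists>D. \<forall>m. d m \<le> D)"
    and E: "filterlim d at_top sequentially \<Longrightarrow> (\<lambda>m. nondegenerate_vector.E (\<mu> m) (d m) \<tau>) \<longlonglongrightarrow> 0"
  shows "\<exists>C. \<forall>\<^sub>F m in sequentially. nondegenerate_vector.kappa (\<mu> m) (d m) \<tau>
      \<le> C * (nondegenerate_vector.L (\<mu> m) (d m) \<tau> / nondegenerate_vector.hsq (\<mu> m) (d m) powr (1 + \<tau>))"
    and "filterlim d at_top sequentially \<Longrightarrow> (\<lambda>m. nondegenerate_vector.rho (\<mu> m) (d m)) \<longlonglongrightarrow> 0"
proof -
  have small: "\<forall>\<^sub>F m in sequentially. nondegenerate_vector.E (\<mu> m) (d m) \<tau> \<le> 1 / 4"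
    if "filterlim d at_top sequentially"
    using order_tendstoD(2)[OF E[OF that], of "1 / 4"] by (auto elim: eventually_mono)
  have \<tau>: "0 < \<tau>" using nd[of 0] by (simp add: nondegenerate_vector_def random_vector_def random_vector_axioms_def)
  from dich show "\<exists>C. \<forall>\<^sub>F m in sequentially. nondegenerate_vector.kappa (\<mu> m) (d m) \<tau>
      \<le> C * (nondegenerate_vector.L (\<mu> m) (d m) \<tau> / nondegenerate_vector.hsq (\<mu> m) (d m) powr (1 + \<tau>))"
  proof
    assume "filterlim d at_top sequentially"
    from small[OF this] have "\<forall>\<^sub>F m in sequentially. nondegenerate_vector.kappa (\<mu> m) (d m) \<tau>
      \<le> 153600 * (64 * norm_const\<^sup>2) powr (1 + \<tau>) * (nondegenerate_vector.L (\<mu> m) (d m) \<tau> / nondegenerate_vector.hsq (\<mu> m) (d m) powr (1 + \<tau>))"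
    proof eventually_elim
      case (elim m)
      interpret nondegenerate_vector "\<mu> m" "d m" \<tau> by (rule nd)
      show ?case unfolding kappa_def by (rule moment_ratio_le_large[OF small_of_E[OF elim]])
    qed
    then show ?thesis ..
  next
    assume "\<exists>D. \<forall>m. d m \<le> D"
    then obtain D where D: "d m \<le> D" for m by auto
    have "nondegenerate_vector.kappa (\<mu> m) (d m) \<tau>
      \<le> dim_const \<tau> D * (nondegenerate_vector.L (\<mu> m) (d m) \<tau> / nondegenerate_vector.hsq (\<mu> m) (d m) powr (1 + \<tau>))" for m
    proof -
      interpret nondegenerate_vector "\<mu> m" "d m" \<tau> by (rule nd)
      have "kappa \<le> dim_const \<tau> (d m) * (L / hsq powr (1 + \<tau>))" unfolding kappa_def by (rule moment_ratio_le_dim)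
      also have "\<dots> \<le> dim_const \<tau> D * (L / hsq powr (1 + \<tau>))"
        using \<tau> D L_pos by (intro mult_right_mono dim_const_mono) auto
      finally show ?thesis .
    qed
    then show ?thesis by (intro exI always_eventually allI)
  qed
  assume inf: "filterlim d at_top sequentially"
  show "(\<lambda>m. nondegenerate_vector.rho (\<mu> m) (d m)) \<longlonglongrightarrow> 0"
  proof (rule tendsto_sandwich[OF _ _ tendsto_const tendsto_mult_right_zero[OF E[OF inf]]])
    show "\<forall>\<^sub>F m in sequentially. 0 \<le> nondegenerate_vector.rho (\<mu> m) (d m)"
      using nondegenerate_vector.rho_nonneg[OF nd] by simp
    from small[OF inf] show "\<forall>\<^sub>F m in sequentially. nondegenerate_vector.rho (\<mu> m) (d m)
      \<le> (400000000 * (64 * norm_const\<^sup>2)\<^sup>2) * nondegenerate_vector.E (\<mu> m) (d m) \<tau>"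
    proof eventually_elim
      case (elim m)
      interpret nondegenerate_vector "\<mu> m" "d m" \<tau> by (rule nd)
      show ?case unfolding rho_def by (rule variance_KK_ratio_le[OF elim])
    qed
  qed
qed

section \<open>Reduction to subsequences\<close>

lemma tendsto_of_subsequences:
  fixes Z :: "nat \<Rightarrow> real"
  assumes "\<And>r :: nat \<Rightarrow> nat. strict_mono r \<Longrightarrow> \<exists>s :: nat \<Rightarrow> nat. strict_mono s \<and> (\<lambda>m. Z (r (s m))) \<longlonglongrightarrow> l"
  shows "Z \<longlonglongrightarrow> l"
proof (rule ccontr)
  assume "\<not> Z \<longlonglongrightarrow> l"
  then obtain e where e: "0 < e" and inf: "\<forall>N. \<exists>m\<ge>N. e \<le> dist (Z m) l"
    unfolding LIMSEQ_def by (auto simp: not_less)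
  then have "\<exists>m>N. e \<le> dist (Z m) l" for N using inf[rule_format, of "Suc N"] by (auto simp: Suc_le_eq)
  then have "\<exists>m'. e \<le> dist (Z m') l \<and> m < m'" for m by blast
  then obtain r where r: "\<And>k. e \<le> dist (Z (r k)) l" "\<And>k. r k < r (Suc k)"
    using dependent_nat_choice[of "\<lambda>_ m. e \<le> dist (Z m) l" "\<lambda>_ m m'. m < m'"] by blast
  from assms[of r] r(2) obtain s where "(\<lambda>m. Z (r (s m))) \<longlonglongrightarrow> l" by (auto simp: strict_mono_Suc_iff)
  then obtain m where "dist (Z (r (s m))) l < e" using e unfolding LIMSEQ_def by blast
  then show False using r(1)[of "s m"] by simp
qed

lemma subsequence_at_top_or_bounded:
  fixes f :: "nat \<Rightarrow> nat"
  shows "\<exists>s. strict_mono s \<and> (filterlim (\<lambda>m. f (s m)) at_top sequentially \<or> (\<exists>D. \<forall>m. f (s m) \<le> D))"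
proof (cases "\<exists>D. \<forall>m. f m \<le> D")
  case True
  then show ?thesis by (intro exI[of _ "\<lambda>m. m"]) (auto simp: strict_mono_def)
next
  case False
  have large: "\<exists>m'. k \<le> f m' \<and> m < m'" for k m
  proof -
    obtain m' where m': "Max (f ` {..m}) + k < f m'" using False by (meson not_le)
    have "\<not> m' \<le> m"
    proof
      assume "m' \<le> m"
      then have "f m' \<le> Max (f ` {..m})" by (intro Max_ge) auto
      then show False using m' by simp
    qed
    then show ?thesis using m' by (intro exI[of _ m']) auto
  qed
  then obtain s where s: "\<And>k. k \<le> f (s k)" "\<And>k. s k < s (Suc k)"
    using dependent_nat_choice[of "\<lambda>k m. k \<le> f m" "\<lambda>_ m m'. m < m'"] by blast
  have "filterlim (\<lambda>m. f (s m)) at_top sequentially"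
    using s(1) by (intro filterlim_at_top_mono[OF filterlim_ident]) simp
  then show ?thesis using s(2) by (intro exI[of _ s]) (auto simp: strict_mono_Suc_iff)
qed

text \<open>Proved for every \<open>n\<close>: weak convergence refers to the laws of all members of
  the sequence, while the error bound starts at \<open>n = 6\<close>.\<close>

lemma T_stat_meas:
  fixes M :: "'a measure"
  assumes P: "random_vector P p \<tau>" and Q: "random_vector Q q \<tau>"
    and Xs: "\<And>i. i \<in> {1..n} \<Longrightarrow> Xs i \<in> M \<rightarrow>\<^sub>M P" and Ys: "\<And>i. i \<in> {1..n} \<Longrightarrow> Ys i \<in> M \<rightarrow>\<^sub>M Q"
  shows "(\<lambda>\<omega>. T_stat n p q (\<lambda>i. Xs i \<omega>) (\<lambda>i. Ys i \<omega>)) \<in> borel_measurable M"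
proof -
  interpret P: random_vector P p \<tau> by fact
  interpret Q: random_vector Q q \<tau> by fact
  have U: "(\<lambda>\<omega>. U_center n (\<lambda>k l. a k l \<omega>) k l) \<in> borel_measurable M"
    if "\<And>k l. k \<in> {1..n} \<Longrightarrow> l \<in> {1..n} \<Longrightarrow> a k l \<in> borel_measurable M" "k \<in> {1..n}" "l \<in> {1..n}"
    for a :: "nat \<Rightarrow> nat \<Rightarrow> 'a \<Rightarrow> real" and k l
    unfolding U_center_def using that
    by (intro borel_measurable_add borel_measurable_diff borel_measurable_divide borel_measurable_sum borel_measurable_const) auto
  have V: "(\<lambda>\<omega>. V_star n (\<lambda>k l. a k l \<omega>) (\<lambda>k l. b k l \<omega>)) \<in> borel_measurable M"
    if "\<And>k l. k \<in> {1..n} \<Longrightarrow> l \<in> {1..n} \<Longrightarrow> a k l \<in> borel_measurable M" "\<And>k l. k \<in> {1..n} \<Longrightarrow> l \<in> {1..n} \<Longrightarrow> b k l \<in> borel_measurable M"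
    for a b :: "nat \<Rightarrow> nat \<Rightarrow> 'a \<Rightarrow> real"
    unfolding V_star_def
    by (intro borel_measurable_divide borel_measurable_sum borel_measurable_times borel_measurable_const U that) auto
  have dX: "(\<lambda>\<omega>. vdist p (Xs k \<omega>) (Xs l \<omega>)) \<in> borel_measurable M" if "k \<in> {1..n}" "l \<in> {1..n}" for k l
    by (rule P.vdist_meas_comp[OF Xs[OF that(1)] Xs[OF that(2)]])
  have dY: "(\<lambda>\<omega>. vdist q (Ys k \<omega>) (Ys l \<omega>)) \<in> borel_measurable M" if "k \<in> {1..n}" "l \<in> {1..n}" for k l
    by (rule Q.vdist_meas_comp[OF Ys[OF that(1)] Ys[OF that(2)]])
  note [measurable] = V[of "\<lambda>k l \<omega>. vdist p (Xs k \<omega>) (Xs l \<omega>)" "\<lambda>k l \<omega>. vdist p (Xs k \<omega>) (Xs l \<omega>)", OF dX dX]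
    V[of "\<lambda>k l \<omega>. vdist q (Ys k \<omega>) (Ys l \<omega>)" "\<lambda>k l \<omega>. vdist q (Ys k \<omega>) (Ys l \<omega>)", OF dY dY]
    V[of "\<lambda>k l \<omega>. vdist p (Xs k \<omega>) (Xs l \<omega>)" "\<lambda>k l \<omega>. vdist q (Ys k \<omega>) (Ys l \<omega>)", OF dX dY]
  show ?thesis unfolding T_stat_def R_star_def by measurable
qed

text \<open>The laws have the same measurable sets as the Euclidean spaces, so the copies may be
  regarded as taking values in the laws themselves. Independence of the two vectors makes the joint
  law a product, and independence of the copies does the same for the first two samples.\<close>

lemma copies_laws:
  fixes X :: "'a \<Rightarrow> nat \<Rightarrow> real" and Y :: "'a \<Rightarrow> nat \<Rightarrow> real"
  assumes M: "prob_space M" and X: "X \<in> M \<rightarrow>\<^sub>M euclid p" and Y: "Y \<in> M \<rightarrow>\<^sub>M euclid q"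
    and copies: "iid_copies M (euclid p \<Otimes>\<^sub>M euclid q) (\<lambda>\<omega>. (X \<omega>, Y \<omega>)) (\<lambda>i \<omega>. (Xs i \<omega>, Ys i \<omega>))"
    and indep: "prob_space.indep_var M (euclid p) X (euclid q) Y"
  defines "\<mu> \<equiv> distr M (euclid p) X" and "\<nu> \<equiv> distr M (euclid q) Y"
  shows "prob_space.indep_vars M (\<lambda>_. \<mu> \<Otimes>\<^sub>M \<nu>) (\<lambda>i \<omega>. (Xs i \<omega>, Ys i \<omega>)) {1..}"
    and "\<And>i. 1 \<le> i \<Longrightarrow> distr M (\<mu> \<Otimes>\<^sub>M \<nu>) (\<lambda>\<omega>. (Xs i \<omega>, Ys i \<omega>)) = \<mu> \<Otimes>\<^sub>M \<nu>"
    and "\<And>i. 1 \<le> i \<Longrightarrow> Xs i \<in> M \<rightarrow>\<^sub>M \<mu>" "\<And>i. 1 \<le> i \<Longrightarrow> Ys i \<in> M \<rightarrow>\<^sub>M \<nu>"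
    and "distr M (\<mu> \<Otimes>\<^sub>M \<mu>) (\<lambda>\<omega>. (Xs 1 \<omega>, Xs 2 \<omega>)) = \<mu> \<Otimes>\<^sub>M \<mu>"
    and "distr M (\<nu> \<Otimes>\<^sub>M \<nu>) (\<lambda>\<omega>. (Ys 1 \<omega>, Ys 2 \<omega>)) = \<nu> \<Otimes>\<^sub>M \<nu>"
proof -
  interpret M: prob_space M by fact
  let ?N = "euclid p \<Otimes>\<^sub>M euclid q" and ?Z = "\<lambda>i \<omega>. (Xs i \<omega>, Ys i \<omega>)"
  have s: "sets \<mu> = sets (euclid p)" "sets \<nu> = sets (euclid q)" by (simp_all add: \<mu>_def \<nu>_def)
  have sN: "sets (\<mu> \<Otimes>\<^sub>M \<nu>) = sets ?N" by (rule sets_pair_measure_cong[OF s])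
  have ind: "M.indep_vars (\<lambda>_. ?N) ?Z {1..}" and same: "distr M ?N (?Z i) = distr M ?N (\<lambda>\<omega>. (X \<omega>, Y \<omega>))" if "1 \<le> i" for i
    using copies that by (auto simp: iid_copies_def)
  have ind: "M.indep_vars (\<lambda>_. ?N) ?Z {1..}" using copies by (auto simp: iid_copies_def)
  have rv: "?Z i \<in> M \<rightarrow>\<^sub>M ?N" if "1 \<le> i" for i using ind that by (auto simp: M.indep_vars_def2)
  have joint: "distr M ?N (\<lambda>\<omega>. (X \<omega>, Y \<omega>)) = \<mu> \<Otimes>\<^sub>M \<nu>"
    using indep by (simp add: M.indep_var_distribution_eq \<mu>_def \<nu>_def)
  show "M.indep_vars (\<lambda>_. \<mu> \<Otimes>\<^sub>M \<nu>) ?Z {1..}"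
    using ind unfolding M.indep_vars_def2 sN measurable_cong_sets[OF refl sN] .
  show "distr M (\<mu> \<Otimes>\<^sub>M \<nu>) (?Z i) = \<mu> \<Otimes>\<^sub>M \<nu>" if "1 \<le> i" for i
    using same[OF that] joint distr_cong[OF refl sN, of M "?Z i" "?Z i"] by simp
  have XY_rv: "(\<lambda>\<omega>. (X \<omega>, Y \<omega>)) \<in> M \<rightarrow>\<^sub>M ?N" using X Y by simp
  have Xs: "Xs i \<in> M \<rightarrow>\<^sub>M euclid p" and Ys: "Ys i \<in> M \<rightarrow>\<^sub>M euclid q" if "1 \<le> i" for i
    using measurable_compose[OF rv[OF that] measurable_fst] measurable_compose[OF rv[OF that] measurable_snd] by simp_all
  show "Xs i \<in> M \<rightarrow>\<^sub>M \<mu>" "Ys i \<in> M \<rightarrow>\<^sub>M \<nu>" if "1 \<le> i" for i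
    using Xs[OF that] Ys[OF that] by (simp_all add: \<mu>_def \<nu>_def)
  have lawX: "distr M (euclid p) (Xs i) = \<mu>" and lawY: "distr M (euclid q) (Ys i) = \<nu>" if "1 \<le> i" for i
  proof -
    have "distr M (euclid p) (Xs i) = distr (distr M ?N (?Z i)) (euclid p) fst"
      using distr_distr[OF measurable_fst rv[OF that]] by (simp add: comp_def)
    also have "\<dots> = \<mu>" unfolding same[OF that] \<mu>_def using distr_distr[OF measurable_fst XY_rv] by (simp add: comp_def)
    finally show "distr M (euclid p) (Xs i) = \<mu>" .
    have "distr M (euclid q) (Ys i) = distr (distr M ?N (?Z i)) (euclid q) snd"
      using distr_distr[OF measurable_snd rv[OF that]] by (simp add: comp_def)
    also have "\<dots> = \<nu>" unfolding same[OF that] \<nu>_def using distr_distr[OF measurable_snd XY_rv] by (simp add: comp_def)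
    finally show "distr M (euclid q) (Ys i) = \<nu>" .
  qed
  have Z12: "M.indep_var ?N (?Z 1) ?N (?Z 2)" by (rule M.indep_var_of_indep_vars[OF ind]) auto
  have "M.indep_var (euclid p) (fst \<circ> ?Z 1) (euclid p) (fst \<circ> ?Z 2)"
    by (rule M.indep_var_compose[OF Z12 measurable_fst measurable_fst])
  then have "M.indep_var (euclid p) (Xs 1) (euclid p) (Xs 2)" by (simp add: comp_def)
  then have "distr M (euclid p \<Otimes>\<^sub>M euclid p) (\<lambda>\<omega>. (Xs 1 \<omega>, Xs 2 \<omega>)) = \<mu> \<Otimes>\<^sub>M \<mu>"
    using lawX[of 1] lawX[of 2] by (simp add: M.indep_var_distribution_eq)
  then show "distr M (\<mu> \<Otimes>\<^sub>M \<mu>) (\<lambda>\<omega>. (Xs 1 \<omega>, Xs 2 \<omega>)) = \<mu> \<Otimes>\<^sub>M \<mu>"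
    using distr_cong[OF refl sets_pair_measure_cong[OF s(1) s(1)], of M "\<lambda>\<omega>. (Xs 1 \<omega>, Xs 2 \<omega>)" "\<lambda>\<omega>. (Xs 1 \<omega>, Xs 2 \<omega>)"] by simp
  have "M.indep_var (euclid q) (snd \<circ> ?Z 1) (euclid q) (snd \<circ> ?Z 2)"
    by (rule M.indep_var_compose[OF Z12 measurable_snd measurable_snd])
  then have "M.indep_var (euclid q) (Ys 1) (euclid q) (Ys 2)" by (simp add: comp_def)
  then have "distr M (euclid q \<Otimes>\<^sub>M euclid q) (\<lambda>\<omega>. (Ys 1 \<omega>, Ys 2 \<omega>)) = \<nu> \<Otimes>\<^sub>M \<nu>"
    using lawY[of 1] lawY[of 2] by (simp add: M.indep_var_distribution_eq)
  then show "distr M (\<nu> \<Otimes>\<^sub>M \<nu>) (\<lambda>\<omega>. (Ys 1 \<omega>, Ys 2 \<omega>)) = \<nu> \<Otimes>\<^sub>M \<nu>"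
    using distr_cong[OF refl sets_pair_measure_cong[OF s(2) s(2)], of M "\<lambda>\<omega>. (Ys 1 \<omega>, Ys 2 \<omega>)" "\<lambda>\<omega>. (Ys 1 \<omega>, Ys 2 \<omega>)"] by simp
qed

lemma nondegenerate_vector_distr:
  fixes X :: "'a \<Rightarrow> nat \<Rightarrow> real"
  assumes M: "prob_space M" and X: "X \<in> M \<rightarrow>\<^sub>M euclid d" and \<tau>: "0 < \<tau>" "\<tau> \<le> 1 / 2"
    and mean: "\<And>i. i < d \<Longrightarrow> (\<integral>\<omega>. X \<omega> i \<partial>M) = 0"
    and moment: "integrable M (\<lambda>\<omega>. vnorm d (X \<omega>) powr (4 + 4 * \<tau>))"
  defines "\<mu> \<equiv> distr M (euclid d) X"
  assumes X12: "X1 \<in> M \<rightarrow>\<^sub>M \<mu>" "X2 \<in> M \<rightarrow>\<^sub>M \<mu>" "distr M (\<mu> \<Otimes>\<^sub>M \<mu>) (\<lambda>\<omega>. (X1 \<omega>, X2 \<omega>)) = \<mu> \<Otimes>\<^sub>M \<mu>"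
    and nondeg: "0 < inner_sq_moment M d X1 X2"
  shows "nondegenerate_vector \<mu> d \<tau>"
    and "inner_sq_moment M d X1 X2 = nondegenerate_vector.hsq \<mu> d"
    and "L_moment M d \<tau> X X1 X2 = nondegenerate_vector.L \<mu> d \<tau>"
    and "E_ratio M d \<tau> X X1 X2 = nondegenerate_vector.E \<mu> d \<tau>"
proof -
  interpret M: prob_space M by fact
  have X': "X \<in> M \<rightarrow>\<^sub>M \<mu>" "distr M \<mu> X = \<mu>"
    using X by (auto simp: \<mu>_def intro!: distr_cong)
  have coord: "(\<lambda>x. x i) \<in> borel_measurable (euclid d)" if "i < d" for i
    using that by (intro measurable_component_singleton) simp
  have norm: "vnorm d \<in> borel_measurable (euclid d)"
    unfolding vnorm_def[abs_def] L2_set_def using coord by simp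
  have "random_vector \<mu> d \<tau>"
  proof (intro random_vector.intro random_vector_axioms.intro)
    show "prob_space \<mu>" unfolding \<mu>_def by (rule M.prob_space_distr[OF X])
    show "sets \<mu> = sets (euclid d)" by (simp add: \<mu>_def)
    show "(\<integral>x. x i \<partial>\<mu>) = 0" if "i < d" for i
      using mean[OF that] integral_distr[OF X coord[OF that]] by (simp add: \<mu>_def)
    show "integrable \<mu> (\<lambda>x. vnorm d x powr (4 + 4 * \<tau>))"
      unfolding \<mu>_def using integrable_distr_eq[OF X, of "\<lambda>x. vnorm d x powr (4 + 4 * \<tau>)"] norm moment by simp
  qed fact+
  then interpret R: random_vector \<mu> d \<tau> .
  have pair: "(\<lambda>\<omega>. (X1 \<omega>, X2 \<omega>)) \<in> M \<rightarrow>\<^sub>M \<mu> \<Otimes>\<^sub>M \<mu>" using X12 by simp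
  have "inner_sq_moment M d X1 X2 = (\<integral>(x, y). (vinner d x y)\<^sup>2 \<partial>(\<mu> \<Otimes>\<^sub>M \<mu>))"
    unfolding inner_sq_moment_def
    using integral_law[OF pair X12(3) borel_measurable_integrable[OF R.vinner_square_integrable]] by simp
  then show nd: "nondegenerate_vector \<mu> d \<tau>"
    using nondeg by unfold_locales simp
  interpret nondegenerate_vector \<mu> d \<tau> by (rule nd)
  show "inner_sq_moment M d X1 X2 = hsq" "L_moment M d \<tau> X X1 X2 = L" "E_ratio M d \<tau> X X1 X2 = E"
    using population_transfer[OF X' pair X12(3)] by auto
qed

lemma char_T_stat:
  assumes M: "prob_space M" and X: "nondegenerate_vector P p \<tau>" and Y: "nondegenerate_vector Q q \<tau>" and n: "6 \<le> n"
    and indep: "prob_space.indep_vars M (\<lambda>_. P \<Otimes>\<^sub>M Q) (\<lambda>i \<omega>. (Xs i \<omega>, Ys i \<omega>)) {1..}"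
    and law: "\<And>i. 1 \<le> i \<Longrightarrow> distr M (P \<Otimes>\<^sub>M Q) (\<lambda>\<omega>. (Xs i \<omega>, Ys i \<omega>)) = P \<Otimes>\<^sub>M Q"
    and meas: "(\<lambda>\<omega>. T_stat n p q (\<lambda>i. Xs i \<omega>) (\<lambda>i. Ys i \<omega>)) \<in> borel_measurable M"
  shows "cmod (char (distr M borel (\<lambda>\<omega>. T_stat n p q (\<lambda>i. Xs i \<omega>) (\<lambda>i. Ys i \<omega>))) t - exp (- (t\<^sup>2) / 2))
    \<le> char_error \<tau> t n (nondegenerate_vector.kappa P p \<tau>) (nondegenerate_vector.kappa Q q \<tau>)
        (nondegenerate_vector.rho P p * nondegenerate_vector.rho Q q)"
proof -
  interpret M: prob_space M by fact
  interpret X: nondegenerate_vector P p \<tau> by fact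
  interpret Y: nondegenerate_vector Q q \<tau> by fact
  define S where "S = iid_space P {1..n} \<Otimes>\<^sub>M iid_space Q {1..n}"
  define V where "V \<omega> = (\<lambda>i\<in>{1..n}. Xs i \<omega>, \<lambda>i\<in>{1..n}. Ys i \<omega>)" for \<omega>
  let ?G = "\<lambda>z. T_stat n p q (fst z) (snd z)" and ?T = "\<lambda>\<omega>. T_stat n p q (\<lambda>i. Xs i \<omega>) (\<lambda>i. Ys i \<omega>)"
  note b = T_stat_char_bound[OF X Y n, folded S_def]
  have V: "V \<in> M \<rightarrow>\<^sub>M S" "distr M S V = S"
    unfolding V_def[abs_def] S_def
    using n by (intro sample_law[OF M X.prob_space_axioms Y.prob_space_axioms] M.indep_vars_subset[OF indep] law; auto)+
  have T_eq: "?T \<omega> = ?G (V \<omega>)" for \<omega>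
    unfolding V_def by (intro T_stat_cong) auto
  have "char (distr M borel ?T) t = (CLINT \<omega>|M. iexp (t * ?T \<omega>))"
    unfolding char_def by (rule integral_distr[OF meas]) measurable
  also have "\<dots> = (CLINT \<omega>|M. iexp (t * ?G (V \<omega>)))" unfolding T_eq ..
  also have "\<dots> = (CLINT z|distr M S V. iexp (t * ?G z))"
  proof (rule integral_distr[OF V(1), symmetric])
    show "(\<lambda>z. iexp (t * ?G z)) \<in> borel_measurable S" using b(1) by measurable
  qed
  finally have "char (distr M borel ?T) t = (CLINT z|S. iexp (t * ?G z))" unfolding V(2) .
  then show ?thesis using b(2)[of t] by simp
qed

text \<open>The regime is a triangular array indexed by \<open>m\<close>. The dimensions may
  oscillate, so "if p tends to infinity" is read along every subsequence on which p diverges, and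
  likewise for q.\<close>

theorem theorem2:
  fixes M :: "nat \<Rightarrow> 'a measure"
    and n p q :: "nat \<Rightarrow> nat"
    and X Y :: "nat \<Rightarrow> 'a \<Rightarrow> nat \<Rightarrow> real"
    and Xs Ys :: "nat \<Rightarrow> nat \<Rightarrow> 'a \<Rightarrow> nat \<Rightarrow> real"
    and \<tau> :: real
  assumes prob: "\<And>m. prob_space (M m)"
    and X_rv: "\<And>m. X m \<in> M m \<rightarrow>\<^sub>M euclid (p m)"
    and Y_rv: "\<And>m. Y m \<in> M m \<rightarrow>\<^sub>M euclid (q m)"
    and copies: "\<And>m. iid_copies (M m) (euclid (p m) \<Otimes>\<^sub>M euclid (q m))
                   (\<lambda>\<omega>. (X m \<omega>, Y m \<omega>)) (\<lambda>i \<omega>. (Xs m i \<omega>, Ys m i \<omega>))"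
    and X_mean: "\<And>m i. i < p m \<Longrightarrow> (\<integral>\<omega>. X m \<omega> i \<partial>M m) = 0"
    and Y_mean: "\<And>m i. i < q m \<Longrightarrow> (\<integral>\<omega>. Y m \<omega> i \<partial>M m) = 0"
    and tau: "0 < \<tau>" "\<tau> \<le> 1 / 2"
    and X_moment: "\<And>m. integrable (M m) (\<lambda>\<omega>. vnorm (p m) (X m \<omega>) powr (4 + 4 * \<tau>))"
    and Y_moment: "\<And>m. integrable (M m) (\<lambda>\<omega>. vnorm (q m) (Y m \<omega>) powr (4 + 4 * \<tau>))"
    and X_nondeg: "\<And>m. inner_sq_moment (M m) (p m) (Xs m 1) (Xs m 2) > 0"
    and Y_nondeg: "\<And>m. inner_sq_moment (M m) (q m) (Ys m 1) (Ys m 2) > 0"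
    and n_lim: "filterlim n at_top sequentially"
    and pq_lim: "filterlim (\<lambda>m. p m + q m) at_top sequentially"
    and L_lim: "(\<lambda>m. real (n m) powr (- \<tau>)
                   * L_moment (M m) (p m) \<tau> (X m) (Xs m 1) (Xs m 2)
                   * L_moment (M m) (q m) \<tau> (Y m) (Ys m 1) (Ys m 2)
                 / (inner_sq_moment (M m) (p m) (Xs m 1) (Xs m 2)
                    * inner_sq_moment (M m) (q m) (Ys m 1) (Ys m 2)) powr (1 + \<tau>))
                \<longlonglongrightarrow> 0"
    and Ex_lim: "\<And>r :: nat \<Rightarrow> nat. strict_mono r \<Longrightarrow>
                   filterlim (\<lambda>m. p (r m)) at_top sequentially \<Longrightarrow>
                   (\<lambda>m. E_ratio (M (r m)) (p (r m)) \<tau> (X (r m)) (Xs (r m) 1) (Xs (r m) 2))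
                     \<longlonglongrightarrow> 0"
    and Ey_lim: "\<And>r :: nat \<Rightarrow> nat. strict_mono r \<Longrightarrow>
                   filterlim (\<lambda>m. q (r m)) at_top sequentially \<Longrightarrow>
                   (\<lambda>m. E_ratio (M (r m)) (q (r m)) \<tau> (Y (r m)) (Ys (r m) 1) (Ys (r m) 2))
                     \<longlonglongrightarrow> 0"
    and indep: "\<And>m. prob_space.indep_var (M m) (euclid (p m)) (X m) (euclid (q m)) (Y m)"
  shows "weak_conv_m
           (\<lambda>m. distr (M m) borel
             (\<lambda>\<omega>. T_stat (n m) (p m) (q m) (\<lambda>i. Xs m i \<omega>) (\<lambda>i. Ys m i \<omega>)))
           std_normal_distribution"
proof -
  define \<mu> where "\<mu> m = distr (M m) (euclid (p m)) (X m)" for m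
  define \<nu> where "\<nu> m = distr (M m) (euclid (q m)) (Y m)" for m
  note laws = copies_laws[OF prob X_rv Y_rv copies indep, folded \<mu>_def \<nu>_def]
  have X12: "Xs m 1 \<in> M m \<rightarrow>\<^sub>M \<mu> m" "Xs m 2 \<in> M m \<rightarrow>\<^sub>M \<mu> m"
    "distr (M m) (\<mu> m \<Otimes>\<^sub>M \<mu> m) (\<lambda>\<omega>. (Xs m 1 \<omega>, Xs m 2 \<omega>)) = \<mu> m \<Otimes>\<^sub>M \<mu> m" for m
    using laws(3)[of 1 m] laws(3)[of 2 m] laws(5)[of m] by auto
  have Y12: "Ys m 1 \<in> M m \<rightarrow>\<^sub>M \<nu> m" "Ys m 2 \<in> M m \<rightarrow>\<^sub>M \<nu> m"
    "distr (M m) (\<nu> m \<Otimes>\<^sub>M \<nu> m) (\<lambda>\<omega>. (Ys m 1 \<omega>, Ys m 2 \<omega>)) = \<nu> m \<Otimes>\<^sub>M \<nu> m" for m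
    using laws(4)[of 1 m] laws(4)[of 2 m] laws(6)[of m] by auto
  have nX: "nondegenerate_vector (\<mu> m) (p m) \<tau>"
    and hX: "inner_sq_moment (M m) (p m) (Xs m 1) (Xs m 2) = nondegenerate_vector.hsq (\<mu> m) (p m)"
    and LX: "L_moment (M m) (p m) \<tau> (X m) (Xs m 1) (Xs m 2) = nondegenerate_vector.L (\<mu> m) (p m) \<tau>"
    and EX: "E_ratio (M m) (p m) \<tau> (X m) (Xs m 1) (Xs m 2) = nondegenerate_vector.E (\<mu> m) (p m) \<tau>" for m
    unfolding \<mu>_def
    by (rule nondegenerate_vector_distr[OF prob X_rv tau X_mean X_moment X12[unfolded \<mu>_def] X_nondeg]; assumption)+
  have nY: "nondegenerate_vector (\<nu> m) (q m) \<tau>"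
    and hY: "inner_sq_moment (M m) (q m) (Ys m 1) (Ys m 2) = nondegenerate_vector.hsq (\<nu> m) (q m)"
    and LY: "L_moment (M m) (q m) \<tau> (Y m) (Ys m 1) (Ys m 2) = nondegenerate_vector.L (\<nu> m) (q m) \<tau>"
    and EY: "E_ratio (M m) (q m) \<tau> (Y m) (Ys m 1) (Ys m 2) = nondegenerate_vector.E (\<nu> m) (q m) \<tau>" for m
    unfolding \<nu>_def
    by (rule nondegenerate_vector_distr[OF prob Y_rv tau Y_mean Y_moment Y12[unfolded \<nu>_def] Y_nondeg]; assumption)+
  define \<kappa>X where "\<kappa>X m = nondegenerate_vector.kappa (\<mu> m) (p m) \<tau>" for m
  define \<kappa>Y where "\<kappa>Y m = nondegenerate_vector.kappa (\<nu> m) (q m) \<tau>" for m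
  define \<rho>X where "\<rho>X m = nondegenerate_vector.rho (\<mu> m) (p m)" for m
  define \<rho>Y where "\<rho>Y m = nondegenerate_vector.rho (\<nu> m) (q m)" for m
  define lX where "lX m = nondegenerate_vector.L (\<mu> m) (p m) \<tau> / nondegenerate_vector.hsq (\<mu> m) (p m) powr (1 + \<tau>)" for m
  define lY where "lY m = nondegenerate_vector.L (\<nu> m) (q m) \<tau> / nondegenerate_vector.hsq (\<nu> m) (q m) powr (1 + \<tau>)" for m
  have \<kappa>: "1 \<le> \<kappa>X m" "1 \<le> \<kappa>Y m" for m
    unfolding \<kappa>X_def \<kappa>Y_def by (rule nondegenerate_vector.kappa_ge_1[OF nX] nondegenerate_vector.kappa_ge_1[OF nY])+
  have \<rho>: "0 \<le> \<rho>X m" "\<rho>X m \<le> 1" "0 \<le> \<rho>Y m" "\<rho>Y m \<le> 1" for m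
    unfolding \<rho>X_def \<rho>Y_def
    using nondegenerate_vector.rho_nonneg[OF nX] nondegenerate_vector.rho_nonneg[OF nY]
      nondegenerate_vector.rho_le_1[OF nX] nondegenerate_vector.rho_le_1[OF nY] by auto
  have L_lim': "(\<lambda>m. real (n m) powr (- \<tau>) * (lX m * lY m)) \<longlonglongrightarrow> 0"
    using L_lim unfolding LX LY hX hY powr_mult by (simp add: lX_def lY_def mult_ac)
  \<comment> \<open>Along a suitable further subsequence each dimension either diverges or stays
    bounded, so for each vector one of the two sets of estimates applies.\<close>
  have sub: "\<exists>s. strict_mono s \<and> (\<lambda>m. real (n (r (s m))) powr (- \<tau>) * (\<kappa>X (r (s m)) * \<kappa>Y (r (s m)))) \<longlonglongrightarrow> 0
      \<and> (\<lambda>m. \<rho>X (r (s m)) * \<rho>Y (r (s m))) \<longlonglongrightarrow> 0" if r: "strict_mono r" for r :: "nat \<Rightarrow> nat"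
  proof -
    obtain s\<^sub>1 where s\<^sub>1: "strict_mono s\<^sub>1"
      "filterlim (\<lambda>m. p (r (s\<^sub>1 m))) at_top sequentially \<or> (\<exists>D. \<forall>m. p (r (s\<^sub>1 m)) \<le> D)"
      using subsequence_at_top_or_bounded[of "\<lambda>m. p (r m)"] by auto
    obtain s\<^sub>2 where s\<^sub>2: "strict_mono s\<^sub>2"
      "filterlim (\<lambda>m. q (r (s\<^sub>1 (s\<^sub>2 m)))) at_top sequentially \<or> (\<exists>D. \<forall>m. q (r (s\<^sub>1 (s\<^sub>2 m))) \<le> D)"
      using subsequence_at_top_or_bounded[of "\<lambda>m. q (r (s\<^sub>1 m))"] by auto
    define s where "s m = s\<^sub>1 (s\<^sub>2 m)" for m
    define u where "u m = r (s m)" for m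
    have s: "strict_mono s" using s\<^sub>1(1) s\<^sub>2(1) by (auto simp: s_def strict_mono_def)
    have u: "strict_mono u" using r s by (auto simp: u_def strict_mono_def)
    note u_lim = filterlim_subseq[OF u]
    have dp: "filterlim (\<lambda>m. p (u m)) at_top sequentially \<or> (\<exists>D. \<forall>m. p (u m) \<le> D)"
      using s\<^sub>1(2) filterlim_compose[OF _ filterlim_subseq[OF s\<^sub>2(1)], of "\<lambda>m. p (r (s\<^sub>1 m))" at_top]
      by (auto simp: u_def s_def)
    have dq: "filterlim (\<lambda>m. q (u m)) at_top sequentially \<or> (\<exists>D. \<forall>m. q (u m) \<le> D)"
      using s\<^sub>2(2) by (auto simp: u_def s_def)
    \<comment> \<open>This is where the divergence of p + q enters: both dimensions cannot stay
      bounded, so one of the two ratios tends to zero and carries the product with it.\<close>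
    have one_inf: "filterlim (\<lambda>m. p (u m)) at_top sequentially \<or> filterlim (\<lambda>m. q (u m)) at_top sequentially"
    proof (rule ccontr)
      assume "\<not> ?thesis"
      with dp dq obtain D D' where D: "\<And>m. p (u m) \<le> D" "\<And>m. q (u m) \<le> D'" by auto
      have "filterlim (\<lambda>m. p (u m) + q (u m)) at_top sequentially" by (rule filterlim_compose[OF pq_lim u_lim])
      then have "\<forall>\<^sub>F m in sequentially. D + D' + 1 \<le> p (u m) + q (u m)" by (simp add: filterlim_at_top)
      then obtain m where "D + D' + 1 \<le> p (u m) + q (u m)" by (auto simp: eventually_sequentially)
      then show False using D[of m] by simp
    qed
    note aX = vector_asymptotics[of "\<lambda>m. \<mu> (u m)" "\<lambda>m. p (u m)" \<tau>, OF nX dp Ex_lim[OF u, unfolded EX]]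
    note aY = vector_asymptotics[of "\<lambda>m. \<nu> (u m)" "\<lambda>m. q (u m)" \<tau>, OF nY dq Ey_lim[OF u, unfolded EY]]
    obtain CX where CX: "\<forall>\<^sub>F m in sequentially. \<kappa>X (u m) \<le> CX * lX (u m)"
      using aX(1) by (auto simp: \<kappa>X_def lX_def)
    obtain CY where CY: "\<forall>\<^sub>F m in sequentially. \<kappa>Y (u m) \<le> CY * lY (u m)"
      using aY(1) by (auto simp: \<kappa>Y_def lY_def)
    have lim: "(\<lambda>m. (CX * CY) * (real (n (u m)) powr (- \<tau>) * (lX (u m) * lY (u m)))) \<longlonglongrightarrow> 0"
      using tendsto_mult_right_zero[OF filterlim_compose[OF L_lim' u_lim]] by simp
    have y: "(\<lambda>m. real (n (u m)) powr (- \<tau>) * (\<kappa>X (u m) * \<kappa>Y (u m))) \<longlonglongrightarrow> 0"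
    proof (rule tendsto_sandwich[OF _ _ tendsto_const lim])
      show "\<forall>\<^sub>F m in sequentially. 0 \<le> real (n (u m)) powr (- \<tau>) * (\<kappa>X (u m) * \<kappa>Y (u m))"
        using order_trans[OF zero_le_one \<kappa>(1)] order_trans[OF zero_le_one \<kappa>(2)] by simp
      from CX CY show "\<forall>\<^sub>F m in sequentially. real (n (u m)) powr (- \<tau>) * (\<kappa>X (u m) * \<kappa>Y (u m))
        \<le> (CX * CY) * (real (n (u m)) powr (- \<tau>) * (lX (u m) * lY (u m)))"
      proof eventually_elim
        case (elim m)
        have nonneg: "0 \<le> \<kappa>X (u m)" "0 \<le> \<kappa>Y (u m)" using \<kappa>[of "u m"] by auto
        have "\<kappa>X (u m) * \<kappa>Y (u m) \<le> (CX * lX (u m)) * (CY * lY (u m))"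
          by (rule mult_mono[OF elim order_trans[OF nonneg(1) elim(1)] nonneg(2)])
        then have "real (n (u m)) powr (- \<tau>) * (\<kappa>X (u m) * \<kappa>Y (u m))
          \<le> real (n (u m)) powr (- \<tau>) * ((CX * lX (u m)) * (CY * lY (u m)))" by (rule mult_left_mono) simp
        then show ?case by (simp only: mult_ac)
      qed
    qed
    have "(\<lambda>m. \<rho>X (u m) * \<rho>Y (u m)) \<longlonglongrightarrow> 0"
      using one_inf
    proof
      assume "filterlim (\<lambda>m. p (u m)) at_top sequentially"
      with aX(2) have z: "(\<lambda>m. \<rho>X (u m)) \<longlonglongrightarrow> 0" by (simp add: \<rho>X_def)
      show ?thesis
        by (rule tendsto_sandwich[OF _ _ tendsto_const z]) (use \<rho> in \<open>auto intro!: always_eventually mult_left_le\<close>)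
    next
      assume "filterlim (\<lambda>m. q (u m)) at_top sequentially"
      with aY(2) have z: "(\<lambda>m. \<rho>Y (u m)) \<longlonglongrightarrow> 0" by (simp add: \<rho>Y_def)
      show ?thesis
        by (rule tendsto_sandwich[OF _ _ tendsto_const z]) (use \<rho> in \<open>auto intro!: always_eventually mult_left_le_one_le\<close>)
    qed
    then show ?thesis using s y by (intro exI[of _ s]) (simp add: u_def)
  qed
  have y_lim: "(\<lambda>m. real (n m) powr (- \<tau>) * (\<kappa>X m * \<kappa>Y m)) \<longlonglongrightarrow> 0"
  proof (rule tendsto_of_subsequences)
    fix r :: "nat \<Rightarrow> nat" assume "strict_mono r"
    from sub[OF this] show "\<exists>s. strict_mono s \<and> (\<lambda>m. real (n (r (s m))) powr (- \<tau>) * (\<kappa>X (r (s m)) * \<kappa>Y (r (s m)))) \<longlonglongrightarrow> 0"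
      by auto
  qed
  have \<rho>_lim: "(\<lambda>m. \<rho>X m * \<rho>Y m) \<longlonglongrightarrow> 0"
  proof (rule tendsto_of_subsequences)
    fix r :: "nat \<Rightarrow> nat" assume "strict_mono r"
    from sub[OF this] show "\<exists>s. strict_mono s \<and> (\<lambda>m. \<rho>X (r (s m)) * \<rho>Y (r (s m))) \<longlonglongrightarrow> 0" by auto
  qed
  let ?T = "\<lambda>m \<omega>. T_stat (n m) (p m) (q m) (\<lambda>i. Xs m i \<omega>) (\<lambda>i. Ys m i \<omega>)"
  have rX: "random_vector (\<mu> m) (p m) \<tau>" and rY: "random_vector (\<nu> m) (q m) \<tau>" for m
    using nX nY by (simp_all add: nondegenerate_vector_def)
  have T_meas: "?T m \<in> borel_measurable (M m)" for m
    using laws(3,4) by (intro T_stat_meas[OF rX rY]) auto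
  show ?thesis
  proof (rule levy_continuity)
    show "real_distribution (distr (M m) borel (?T m))" for m
      by (rule prob_space.real_distribution_distr[OF prob T_meas])
    show "real_distribution std_normal_distribution" by (rule real_dist_normal_dist)
    fix t
    have err: "(\<lambda>m. char_error \<tau> t (n m) (\<kappa>X m) (\<kappa>Y m) (\<rho>X m * \<rho>Y m)) \<longlonglongrightarrow> 0"
      by (rule char_error_tendsto_0[OF tau(1) n_lim \<kappa> y_lim \<rho>_lim])
    have "\<forall>\<^sub>F m in sequentially. 6 \<le> n m" using n_lim by (simp add: filterlim_at_top)
    then have "\<forall>\<^sub>F m in sequentially. cmod (char (distr (M m) borel (?T m)) t - char std_normal_distribution t)
      \<le> char_error \<tau> t (n m) (\<kappa>X m) (\<kappa>Y m) (\<rho>X m * \<rho>Y m)"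
    proof eventually_elim
      case (elim m)
      show ?case
        using char_T_stat[OF prob nX nY elim laws(1,2) T_meas]
        unfolding \<kappa>X_def \<kappa>Y_def \<rho>X_def \<rho>Y_def char_std_normal_distribution by simp
    qed
    then have "(\<lambda>m. char (distr (M m) borel (?T m)) t - char std_normal_distribution t) \<longlonglongrightarrow> 0"
      by (rule Lim_null_comparison[OF _ err])
    then show "(\<lambda>m. char (distr (M m) borel (?T m)) t) \<longlonglongrightarrow> char std_normal_distribution t"
      by (rule LIM_zero_cancel)
  qed
qed

end
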